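(* Let $\mathcal{N}$ be a network in $\mathbb{S}^2$ with partition $\{\mathcal{N}_i\}_{i=1,\dots,l}$. Then $$\mathrm{Ind}(\mathcal{N})+\mathrm{Nul}(\mathcal{N})=\sum_{i=1}^l\left(\mathrm{Ind}(\mathcal{N}_i)+\mathrm{Nul}(\mathcal{N}_i)\right)+\mathrm{Ind}(\overline{T})+\mathrm{Nul}(\overline{T}),$$ where $\overline{T}$ is the Dirichlet-to-Neumann map with respect to the partition.
   Context: Curves. A curve is a smooth map $\gamma:[0,1]\to\mathbb{S}^2$ with $\gamma'\neq0$, of constant speed, without self-intersection. $s$ is arc length, $\nu$ a chosen unit normal field along $\gamma$ (tangent to $\mathbb{S}^2$). The exterior unit tangent is $\tau=-\gamma'/|\gamma'|$ at $\gamma(0)$ and $\tau=\gamma'/|\gamma'|$ at $\gamma(1)$. $\Delta f=d^2f/ds^2$, $\nabla f$ is the arc length gradient, and $\partial f/\partial\tau$ at an endpoint is the derivative in direction $\tau$. Networks. A network is a finite collection of curves $\{\gamma^1,\dots,\gamma^n\}$ in $\mathbb{S}^2$ with disjoint finite sets $\mathcal{P}$ (interior endpoints) and $\mathcal{Q}$ (boundary endpoints) whose union is the set of all endpoints. Networks are assumed embedded (curves meet only at endpoints), and the exterior unit tangents at a common endpoint point in distinct directions. For $P\in\mathcal{P}$, $\gamma_P^j$ ($1\le j\le j_P$) are the curves ending at $P$, with exterior unit tangents $\tau_P^j$ and normals $\nu_P^j$; for $q\in\mathcal{Q}$, $k_q$ is the number of curves ending at $q$. Functions. A function on $\mathcal{N}$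 is a tuple $\phi=(\phi^i)$, $\phi^i$ a function on $\gamma^i$; regularity ($C^\infty$, $W^{1,2}$) is meant on each $\gamma^i$. For $P\in\mathcal{P}$: $V(P)=\mathbb{R}^{j_P}$, $V_1(P)=\{(X\cdot\nu_P^j)_j:X\in T_P\mathbb{S}^2\}$, $V_2(P)=V_1(P)^\perp$ (Euclidean inner product). For a set of interior endpoints, $V,V_1,V_2$ are the direct sums over its points. For $A\subset\mathcal{Q}$, $V(A)=\bigoplus_{q\in A}\mathbb{R}^{k_q}$. Restrictions of $\phi$ and of $\partial\phi/\partial\tau$ to point sets are elements of these spaces, one value per curve end. $C_1^\infty(\mathcal{N})$, $W_1^{1,2}(\mathcal{N})$: functions with $\phi|_{\mathcal{P}}\in V_1(\mathcal{P})$; $C_{0,1}^\infty(\mathcal{N})$, $W^{1,2}_{0,1}(\mathcal{N})$: in addition $\phi=0$ on $\mathcal{Q}$. Compatibility condition: $\partial\phi/\partial\tau\in V_2(\mathcal{P})$ on $\mathcal{P}$. Operator. Fix $d\in C^\infty(\mathcal{N})$, $L=\Delta+d$ (for the stability operator $d\equiv1$), with form $\mathcal{L}(u,v)=\int_{\mathcal{N}}(\nabla u\cdot\nabla v-duv)$; subnetworks use the restriction of $d$ and of the normals. $\lambda$ is an eigenvalue with eigenfunction $\phi\ne0$ if $\phi\in C_{0,1}^\infty(\mathcal{N})$ satisfies the compatibility condition and $-L\phi=\lambda\phi$; $\mathcal{J}_\lambda$ is the eigenspace. $\mathcal{J}_0^-(\mathcal{N})=\bigoplus_{\lambda<0}\mathcal{J}_\lambda$,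 $\mathcal{J}_0^0(\mathcal{N})=\mathcal{J}_0$. $\mathrm{Ind}(\mathcal{N})=\dim\mathcal{J}_0^-$ (the maximal dimension of a subspace of $W^{1,2}_{0,1}(\mathcal{N})$ on which $\mathcal{L}$ is negative definite) and $\mathrm{Nul}(\mathcal{N})=\dim\mathcal{J}_0^0$. Partition. Networks $\mathcal{N}_i$ with interior/boundary endpoint sets $\mathcal{P}_i,\mathcal{Q}_i$ ($i=1,\dots,l$) form a partition of $\mathcal{N}$ if $\mathcal{N}$ is the disjoint union of the $\mathcal{N}_i$ (as collections of curves), and there are disjoint decompositions $\mathcal{P}=\mathring{\mathcal{P}}\sqcup\overline{\mathcal{P}}$, $\mathcal{Q}_i=\tilde{\mathcal{Q}}_i\sqcup\overline{\mathcal{Q}}_i$ with $\mathring{\mathcal{P}}=\bigsqcup_i\mathcal{P}_i$, $\overline{\mathcal{P}}=\bigcup_i\tilde{\mathcal{Q}}_i$, $\mathcal{Q}=\bigcup_i\overline{\mathcal{Q}}_i$. Then $V(\overline{\mathcal{P}})\cong\bigoplus_iV(\tilde{\mathcal{Q}}_i)$. Dirichlet-to-Neumann maps. $D_\tau\mathcal{J}_0^0(\tilde{\mathcal{Q}}_i)=\{\partial u/\partial\tau|_{\tilde{\mathcal{Q}}_i}:u\in\mathcal{J}_0^0(\mathcal{N}_i)\}\subset V(\tilde{\mathcal{Q}}_i)$, and $\perp$ is the orthogonal complement in $V(\tilde{\mathcal{Q}}_i)$. $\mathcal{I}_0(\tilde{\mathcal{Q}}_i)=\{v\in\mathcal{J}_0^0(\mathcal{N}_i):\partial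 v/\partial\tau=0\text{ on }\tilde{\mathcal{Q}}_i\}$. For $g\in(D_\tau\mathcal{J}_0^0(\tilde{\mathcal{Q}}_i))^\perp$ the $L$-extension $u_g\in C_1^\infty(\mathcal{N}_i)$ is the unique function, $L^2$-orthogonal to $\mathcal{I}_0(\tilde{\mathcal{Q}}_i)$, with $Lu_g=0$ on $\mathcal{N}_i$, $u_g=g$ on $\tilde{\mathcal{Q}}_i$, $u_g=0$ on $\mathcal{Q}_i\setminus\tilde{\mathcal{Q}}_i$, $\partial u_g/\partial\tau\in V_2(\mathcal{P}_i)$ on $\mathcal{P}_i$, and $\partial u_g/\partial\tau|_{\tilde{\mathcal{Q}}_i}\in(D_\tau\mathcal{J}_0^0(\tilde{\mathcal{Q}}_i))^\perp$. The Dirichlet-to-Neumann map of $\mathcal{N}_i$ with respect to $\tilde{\mathcal{Q}}_i$ is $T_i(g)=\partial u_g/\partial\tau|_{\tilde{\mathcal{Q}}_i}$, a self-map of $(D_\tau\mathcal{J}_0^0(\tilde{\mathcal{Q}}_i))^\perp$. Put $\hat T(g_1,\dots,g_l)=(T_1g_1,\dots,T_lg_l)$ on $\bigoplus_i(D_\tau\mathcal{J}_0^0(\tilde{\mathcal{Q}}_i))^\perp$, and $\overline{V}_1(\overline{\mathcal{P}})=\bigoplus_i(D_\tau\mathcal{J}_0^0(\tilde{\mathcal{Q}}_i))^\perp\cap V_1(\overline{\mathcal{P}})$. Let $\mathrm{Proj}_1:\bigoplus_i(D_\tau\mathcal{J}_0^0(\tilde{\mathcal{Q}}_i))^\perp\to\overline{V}_1(\overline{\mathcal{P}})$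 be the orthogonal projection (in the paper, the restriction of the orthogonal projection $V(\overline{\mathcal{P}})\to V_1(\overline{\mathcal{P}})$). The Dirichlet-to-Neumann map with respect to the partition is the self-adjoint map $\overline{T}:\overline{V}_1(\overline{\mathcal{P}})\to\overline{V}_1(\overline{\mathcal{P}})$, $\overline{T}(g)=\mathrm{Proj}_1(\hat T(g))$. $\mathrm{Ind}(\overline{T})$ is the number of negative eigenvalues of $\overline{T}$ with multiplicity, $\mathrm{Nul}(\overline{T})=\dim\ker\overline{T}$. *)

theory Defs
  imports "HOL-Analysis.Analysis" "HOL-Library.Function_Algebras"
begin

text \<open>
  Pointwise real vector space structure on functions, so that the library's
  \<open>span\<close> and \<open>dim\<close> apply to tuples of functions on curves and to vectors indexed
  by curve ends.
\<close>

instantiation "fun" :: (type, real_vector) real_vector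
begin

definition scaleR_fun :: "real \<Rightarrow> ('a \<Rightarrow> 'b) \<Rightarrow> 'a \<Rightarrow> 'b"
  where "scaleR_fun c f = (\<lambda>x. c *\<^sub>R f x)"

instance
  by standard (auto simp: scaleR_fun_def fun_eq_iff algebra_simps)

end

text \<open>
  All derivatives are taken within \<open>[0,1]\<close>; hence they are one-sided at the end
  points and depend only on the values on \<open>[0,1]\<close>.
\<close>

abbreviation deriv01 :: "(real \<Rightarrow> 'a::real_normed_vector) \<Rightarrow> real \<Rightarrow> 'a"
  where "deriv01 f t \<equiv> vector_derivative f (at t within {0..1})"

definition smooth01 :: "(real \<Rightarrow> 'a::real_normed_vector) \<Rightarrow> bool"
  where "smooth01 f \<longleftrightarrow>
    (\<exists>D. D 0 = f \<and>
      (\<forall>k. \<forall>t\<in>{0..1}. (D k has_vector_derivative D (Suc k) t) (at t within {0..1})))"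

text \<open>
  \<open>simple_path\<close> excludes all self-intersections except that the two ends of a curve
  may coincide; such a curve has two ends at the same vertex.
\<close>

definition is_curve :: "(real \<Rightarrow> real^3) \<Rightarrow> bool"
  where "is_curve \<gamma> \<longleftrightarrow>
    smooth01 \<gamma> \<and> (\<forall>t\<in>{0..1}. \<gamma> t \<in> sphere 0 1) \<and>
    (\<forall>t\<in>{0..1}. deriv01 \<gamma> t \<noteq> 0) \<and>
    (\<exists>c. \<forall>t\<in>{0..1}. norm (deriv01 \<gamma> t) = c) \<and>
    simple_path \<gamma>"

definition is_unit_normal :: "(real \<Rightarrow> real^3) \<Rightarrow> (real \<Rightarrow> real^3) \<Rightarrow> bool"
  where "is_unit_normal \<gamma> \<nu> \<longleftrightarrow>
    smooth01 \<nu> \<and>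
    (\<forall>t\<in>{0..1}. norm (\<nu> t) = 1 \<and> \<nu> t \<bullet> \<gamma> t = 0 \<and> \<nu> t \<bullet> deriv01 \<gamma> t = 0)"

record 'i network =
  idx :: "'i set"
  crv :: "'i \<Rightarrow> real \<Rightarrow> real^3"
  nrm :: "'i \<Rightarrow> real \<Rightarrow> real^3"
  intp :: "(real^3) set"
  bdp :: "(real^3) set"

text \<open>
  A curve end is a pair \<open>(i, t)\<close> of a curve index and a parameter \<open>t \<in> {0, 1}\<close>.
\<close>

definition ends :: "'i network \<Rightarrow> ('i \<times> real) set"
  where "ends N = idx N \<times> {0, 1}"

definition endpt :: "'i network \<Rightarrow> 'i \<times> real \<Rightarrow> real^3"
  where "endpt N e = crv N (fst e) (snd e)"

definition ends_at :: "'i network \<Rightarrow> (real^3) set \<Rightarrow> ('i \<times> real) set"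
  where "ends_at N A = {e \<in> ends N. endpt N e \<in> A}"

definition ext_sign :: "real \<Rightarrow> real"
  where "ext_sign t = (if t = 0 then -1 else 1)"

definition ext_tangent :: "'i network \<Rightarrow> 'i \<times> real \<Rightarrow> real^3"
  where "ext_tangent N e = ext_sign (snd e) *\<^sub>R sgn (deriv01 (crv N (fst e)) (snd e))"

definition is_network :: "'i network \<Rightarrow> bool"
  where "is_network N \<longleftrightarrow>
    finite (idx N) \<and>
    (\<forall>i\<in>idx N. is_curve (crv N i) \<and> is_unit_normal (crv N i) (nrm N i)) \<and>
    intp N \<inter> bdp N = {} \<and>
    intp N \<union> bdp N = endpt N ` ends N \<and>
    (\<forall>i\<in>idx N. \<forall>j\<in>idx N. i \<noteq> j \<longrightarrow>
      (\<forall>s\<in>{0..1}. \<forall>t\<in>{0..1}. crv N i s = crv N j t \<longrightarrow> s \<in> {0, 1} \<and> t \<in> {0, 1})) \<and>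
    (\<forall>e\<in>ends N. \<forall>e'\<in>ends N. e \<noteq> e' \<and> endpt N e = endpt N e' \<longrightarrow>
      ext_tangent N e \<noteq> ext_tangent N e')"

text \<open>
  \<open>V(A)\<close> is realised as the space of functions on curve ends vanishing off the ends
  at \<open>A\<close>; direct sums over disjoint sets of ends are then internal direct sums.
\<close>

definition restr :: "'i network \<Rightarrow> (real^3) set \<Rightarrow> ('i \<times> real \<Rightarrow> real) \<Rightarrow> 'i \<times> real \<Rightarrow> real"
  where "restr N A x = (\<lambda>e. if e \<in> ends_at N A then x e else 0)"

definition Vsp :: "'i network \<Rightarrow> (real^3) set \<Rightarrow> ('i \<times> real \<Rightarrow> real) set"
  where "Vsp N A = {x. \<forall>e. e \<notin> ends_at N A \<longrightarrow> x e = 0}"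

definition ip :: "'i network \<Rightarrow> ('i \<times> real \<Rightarrow> real) \<Rightarrow> ('i \<times> real \<Rightarrow> real) \<Rightarrow> real"
  where "ip N x y = (\<Sum>e\<in>ends N. x e * y e)"

definition perp_in :: "'i network \<Rightarrow> ('i \<times> real \<Rightarrow> real) set \<Rightarrow> ('i \<times> real \<Rightarrow> real) set
    \<Rightarrow> ('i \<times> real \<Rightarrow> real) set"
  where "perp_in N U S = {y \<in> U. \<forall>x\<in>S. ip N x y = 0}"

definition V1_at :: "'i network \<Rightarrow> real^3 \<Rightarrow> ('i \<times> real \<Rightarrow> real) set"
  where "V1_at N p = {restr N {p} (\<lambda>(i, t). X \<bullet> nrm N i t) |X. X \<bullet> p = 0}"

definition V2_at :: "'i network \<Rightarrow> real^3 \<Rightarrow> ('i \<times> real \<Rightarrow> real) set"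
  where "V2_at N p = perp_in N (Vsp N {p}) (V1_at N p)"

definition V1 :: "'i network \<Rightarrow> (real^3) set \<Rightarrow> ('i \<times> real \<Rightarrow> real) set"
  where "V1 N A = {x \<in> Vsp N A. \<forall>p\<in>A. restr N {p} x \<in> V1_at N p}"

definition V2 :: "'i network \<Rightarrow> (real^3) set \<Rightarrow> ('i \<times> real \<Rightarrow> real) set"
  where "V2 N A = {x \<in> Vsp N A. \<forall>p\<in>A. restr N {p} x \<in> V2_at N p}"

text \<open>
  A function on a network is a tuple of functions of the curve parameter.  It is
  normalised to vanish off the curves of the network, so that two functions
  agreeing on the network are equal and dimensions are meaningful.
\<close>

definition C_inf :: "'i network \<Rightarrow> ('i \<Rightarrow> real \<Rightarrow> real) set"
  where "C_inf N = {\<phi>. (\<forall>i\<in>idx N. smooth01 (\<phi> i)) \<and>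
    (\<forall>i t. \<not> (i \<in> idx N \<and> t \<in> {0..1}) \<longrightarrow> \<phi> i t = 0)}"

text \<open>
  Derivative with respect to arc length \<open>s\<close>, where \<open>ds = |\<gamma>'| dt\<close>.
\<close>

definition ds_deriv :: "'i network \<Rightarrow> 'i \<Rightarrow> (real \<Rightarrow> real) \<Rightarrow> real \<Rightarrow> real"
  where "ds_deriv N i f t = deriv01 f t / norm (deriv01 (crv N i) t)"

definition L2_ip :: "'i network \<Rightarrow> ('i \<Rightarrow> real \<Rightarrow> real) \<Rightarrow> ('i \<Rightarrow> real \<Rightarrow> real) \<Rightarrow> real"
  where "L2_ip N u v =
    (\<Sum>i\<in>idx N. integral {0..1} (\<lambda>t. u i t * v i t * norm (deriv01 (crv N i) t)))"

definition bdval :: "'i network \<Rightarrow> (real^3) set \<Rightarrow> ('i \<Rightarrow> real \<Rightarrow> real) \<Rightarrow> 'i \<times> real \<Rightarrow> real"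
  where "bdval N A \<phi> = restr N A (\<lambda>(i, t). \<phi> i t)"

definition dtau :: "'i network \<Rightarrow> (real^3) set \<Rightarrow> ('i \<Rightarrow> real \<Rightarrow> real) \<Rightarrow> 'i \<times> real \<Rightarrow> real"
  where "dtau N A \<phi> = restr N A (\<lambda>(i, t). ext_sign t * ds_deriv N i (\<phi> i) t)"

definition C1_inf :: "'i network \<Rightarrow> ('i \<Rightarrow> real \<Rightarrow> real) set"
  where "C1_inf N = {\<phi> \<in> C_inf N. bdval N (intp N) \<phi> \<in> V1 N (intp N)}"

definition C01_inf :: "'i network \<Rightarrow> ('i \<Rightarrow> real \<Rightarrow> real) set"
  where "C01_inf N = {\<phi> \<in> C1_inf N. bdval N (bdp N) \<phi> = 0}"

definition compatible :: "'i network \<Rightarrow> ('i \<Rightarrow> real \<Rightarrow> real) \<Rightarrow> bool"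
  where "compatible N \<phi> \<longleftrightarrow> dtau N (intp N) \<phi> \<in> V2 N (intp N)"

definition Lop :: "('i \<Rightarrow> real \<Rightarrow> real) \<Rightarrow> 'i network \<Rightarrow> ('i \<Rightarrow> real \<Rightarrow> real) \<Rightarrow> 'i \<Rightarrow> real \<Rightarrow> real"
  where "Lop d N \<phi> i t = ds_deriv N i (ds_deriv N i (\<phi> i)) t + d i t * \<phi> i t"

definition Jsp :: "('i \<Rightarrow> real \<Rightarrow> real) \<Rightarrow> 'i network \<Rightarrow> real \<Rightarrow> ('i \<Rightarrow> real \<Rightarrow> real) set"
  where "Jsp d N \<mu> = {\<phi> \<in> C01_inf N. compatible N \<phi> \<and>
    (\<forall>i\<in>idx N. \<forall>t\<in>{0..1}. - Lop d N \<phi> i t = \<mu> * \<phi> i t)}"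

definition J_neg :: "('i \<Rightarrow> real \<Rightarrow> real) \<Rightarrow> 'i network \<Rightarrow> ('i \<Rightarrow> real \<Rightarrow> real) set"
  where "J_neg d N = span (\<Union>\<mu>\<in>{..<0}. Jsp d N \<mu>)"

definition Ind :: "('i \<Rightarrow> real \<Rightarrow> real) \<Rightarrow> 'i network \<Rightarrow> nat"
  where "Ind d N = dim (J_neg d N)"

definition Nul :: "('i \<Rightarrow> real \<Rightarrow> real) \<Rightarrow> 'i network \<Rightarrow> nat"
  where "Nul d N = dim (Jsp d N 0)"

text \<open>
  \<open>Po\<close>, \<open>Pb\<close> are the two parts of the interior endpoints of \<open>N\<close>; \<open>Qt k\<close>, \<open>Qb k\<close> are
  the two parts of the boundary endpoints of \<open>Ns k\<close>, with \<open>Qt k\<close> interior in \<open>N\<close>.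
\<close>

definition is_partition :: "'i network \<Rightarrow> nat \<Rightarrow> (nat \<Rightarrow> 'i network) \<Rightarrow>
    (real^3) set \<Rightarrow> (real^3) set \<Rightarrow> (nat \<Rightarrow> (real^3) set) \<Rightarrow> (nat \<Rightarrow> (real^3) set) \<Rightarrow> bool"
  where "is_partition N l Ns Po Pb Qt Qb \<longleftrightarrow>
    (\<forall>k\<in>{1..l}. is_network (Ns k)) \<and>
    idx N = (\<Union>k\<in>{1..l}. idx (Ns k)) \<and>
    disjoint_family_on (\<lambda>k. idx (Ns k)) {1..l} \<and>
    (\<forall>k\<in>{1..l}. \<forall>i\<in>idx (Ns k). \<forall>t\<in>{0..1}.
      crv (Ns k) i t = crv N i t \<and> nrm (Ns k) i t = nrm N i t) \<and>
    intp N = Po \<union> Pb \<and> Po \<inter> Pb = {} \<and>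
    (\<forall>k\<in>{1..l}. bdp (Ns k) = Qt k \<union> Qb k \<and> Qt k \<inter> Qb k = {}) \<and>
    Po = (\<Union>k\<in>{1..l}. intp (Ns k)) \<and>
    disjoint_family_on (\<lambda>k. intp (Ns k)) {1..l} \<and>
    Pb = (\<Union>k\<in>{1..l}. Qt k) \<and>
    bdp N = (\<Union>k\<in>{1..l}. Qb k)"

definition D_tau_J :: "('i \<Rightarrow> real \<Rightarrow> real) \<Rightarrow> 'i network \<Rightarrow> (real^3) set \<Rightarrow> ('i \<times> real \<Rightarrow> real) set"
  where "D_tau_J d M A = dtau M A ` Jsp d M 0"

definition DJ_perp :: "('i \<Rightarrow> real \<Rightarrow> real) \<Rightarrow> 'i network \<Rightarrow> (real^3) set \<Rightarrow> ('i \<times> real \<Rightarrow> real) set"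
  where "DJ_perp d M A = perp_in M (Vsp M A) (D_tau_J d M A)"

definition I0 :: "('i \<Rightarrow> real \<Rightarrow> real) \<Rightarrow> 'i network \<Rightarrow> (real^3) set \<Rightarrow> ('i \<Rightarrow> real \<Rightarrow> real) set"
  where "I0 d M A = {v \<in> Jsp d M 0. dtau M A v = 0}"

definition is_L_ext :: "('i \<Rightarrow> real \<Rightarrow> real) \<Rightarrow> 'i network \<Rightarrow> (real^3) set \<Rightarrow>
    ('i \<times> real \<Rightarrow> real) \<Rightarrow> ('i \<Rightarrow> real \<Rightarrow> real) \<Rightarrow> bool"
  where "is_L_ext d M A g u \<longleftrightarrow>
    u \<in> C1_inf M \<and>
    (\<forall>v\<in>I0 d M A. L2_ip M u v = 0) \<and>
    (\<forall>i\<in>idx M. \<forall>t\<in>{0..1}. Lop d M u i t = 0) \<and>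
    bdval M A u = g \<and>
    bdval M (bdp M - A) u = 0 \<and>
    compatible M u \<and>
    dtau M A u \<in> DJ_perp d M A"

definition L_ext :: "('i \<Rightarrow> real \<Rightarrow> real) \<Rightarrow> 'i network \<Rightarrow> (real^3) set \<Rightarrow>
    ('i \<times> real \<Rightarrow> real) \<Rightarrow> 'i \<Rightarrow> real \<Rightarrow> real"
  where "L_ext d M A g = (THE u. is_L_ext d M A g u)"

definition DN :: "('i \<Rightarrow> real \<Rightarrow> real) \<Rightarrow> 'i network \<Rightarrow> (real^3) set \<Rightarrow>
    ('i \<times> real \<Rightarrow> real) \<Rightarrow> 'i \<times> real \<Rightarrow> real"
  where "DN d M A g = dtau M A (L_ext d M A g)"

text \<open>
  Since the ends of \<open>N\<close> at \<open>Pb\<close> are the disjoint union of the ends of \<open>Ns k\<close> at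
  \<open>Qt k\<close>, the direct sum of the spaces \<open>Vsp (Ns k) (Qt k)\<close> is identified with \<open>Vsp N Pb\<close>;
  the \<open>k\<close>-th component of \<open>g\<close> is \<open>restr (Ns k) (Qt k) g\<close>.
\<close>

definition DJ_perp_sum :: "('i \<Rightarrow> real \<Rightarrow> real) \<Rightarrow> 'i network \<Rightarrow> nat \<Rightarrow> (nat \<Rightarrow> 'i network) \<Rightarrow>
    (real^3) set \<Rightarrow> (nat \<Rightarrow> (real^3) set) \<Rightarrow> ('i \<times> real \<Rightarrow> real) set"
  where "DJ_perp_sum d N l Ns Pb Qt =
    {g \<in> Vsp N Pb. \<forall>k\<in>{1..l}. restr (Ns k) (Qt k) g \<in> DJ_perp d (Ns k) (Qt k)}"

definition T_hat :: "('i \<Rightarrow> real \<Rightarrow> real) \<Rightarrow> nat \<Rightarrow> (nat \<Rightarrow> 'i network) \<Rightarrow>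
    (nat \<Rightarrow> (real^3) set) \<Rightarrow> ('i \<times> real \<Rightarrow> real) \<Rightarrow> 'i \<times> real \<Rightarrow> real"
  where "T_hat d l Ns Qt g = (\<Sum>k\<in>{1..l}. DN d (Ns k) (Qt k) (restr (Ns k) (Qt k) g))"

definition V1_bar :: "('i \<Rightarrow> real \<Rightarrow> real) \<Rightarrow> 'i network \<Rightarrow> nat \<Rightarrow> (nat \<Rightarrow> 'i network) \<Rightarrow>
    (real^3) set \<Rightarrow> (nat \<Rightarrow> (real^3) set) \<Rightarrow> ('i \<times> real \<Rightarrow> real) set"
  where "V1_bar d N l Ns Pb Qt = DJ_perp_sum d N l Ns Pb Qt \<inter> V1 N Pb"

definition orth_proj :: "'i network \<Rightarrow> ('i \<times> real \<Rightarrow> real) set \<Rightarrow>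
    ('i \<times> real \<Rightarrow> real) \<Rightarrow> 'i \<times> real \<Rightarrow> real"
  where "orth_proj N U g = (THE h. h \<in> U \<and> (\<forall>v\<in>U. ip N (g - h) v = 0))"

definition T_bar :: "('i \<Rightarrow> real \<Rightarrow> real) \<Rightarrow> 'i network \<Rightarrow> nat \<Rightarrow> (nat \<Rightarrow> 'i network) \<Rightarrow>
    (real^3) set \<Rightarrow> (nat \<Rightarrow> (real^3) set) \<Rightarrow> ('i \<times> real \<Rightarrow> real) \<Rightarrow> 'i \<times> real \<Rightarrow> real"
  where "T_bar d N l Ns Pb Qt g =
    orth_proj N (V1_bar d N l Ns Pb Qt) (T_hat d l Ns Qt g)"

text \<open>
  Index and nullity of a self-adjoint linear self-map \<open>T\<close> of a finite-dimensional
  space \<open>U\<close>; the multiplicity of an eigenvalue is the dimension of its eigenspace.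
\<close>

definition eigenspace_on :: "'v::real_vector set \<Rightarrow> ('v \<Rightarrow> 'v) \<Rightarrow> real \<Rightarrow> 'v set"
  where "eigenspace_on U T \<mu> = {g \<in> U. T g = \<mu> *\<^sub>R g}"

definition map_Ind :: "'v::real_vector set \<Rightarrow> ('v \<Rightarrow> 'v) \<Rightarrow> nat"
  where "map_Ind U T =
    (\<Sum>\<mu> | \<mu> < 0 \<and> (\<exists>g\<in>eigenspace_on U T \<mu>. g \<noteq> 0). dim (eigenspace_on U T \<mu>))"

definition map_Nul :: "'v::real_vector set \<Rightarrow> ('v \<Rightarrow> 'v) \<Rightarrow> nat"
  where "map_Nul U T = dim {g \<in> U. T g = 0}"

end

theory Submission
  imports Defs
begin

text \<open>
  The proof rests on a variational description: for every network, index plus nullity is the largest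
  dimension of a subspace of \<open>C01_inf\<close> on which the energy form is nonpositive
  (\<open>index_network\<close>). Once this is known, the theorem is linear algebra. Let
  \<open>J0\<close> be the sum of the kernels \<open>Jsp d (Ns k) 0\<close> of the parts. A solution
  on one part pairs with a function on the whole network only through its normal derivatives at the
  cut points (\<open>pairing\<close>), and the elements of \<open>J0\<close> vanish there, so the
  energy vanishes on \<open>J0\<close>. Passing to the orthogonal complement of a finite-dimensional
  isotropic subspace does not change the largest nonpositive dimension
  (\<open>max_nonpos_dim_isotropic_complement\<close>). A function \<open>w\<close> lies in the
  complement of \<open>J0\<close> iff its values at the cut points are orthogonal to the normal
  derivatives of all kernel functions, which is the condition for an \<open>L\<close>-extension of
  these values to exist. Hence the complement is the direct sum of the functions vanishing at the
  cut points, that is, of the spaces \<open>C01_inf (Ns k)\<close>, and of the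
  \<open>L\<close>-extensions of \<open>V1_bar\<close> (\<open>J0_perp\<close>). The summands are
  orthogonal, and on extensions the energy is the form \<open>\<langle>T_bar g, h\<rangle>\<close>;
  so the largest nonpositive dimensions add up, and those of the summands are given by the
  variational description of the parts and of the self-adjoint map \<open>T_bar\<close>.

  The analytic core is the variational description, proved here for vertex conditions given by an
  arbitrary subspace of boundary values, by a reduction to finite dimension. Each curve is divided
  into pieces so short that the energy is positive on functions vanishing at the nodes
  (\<open>dirichlet_positive\<close>). For each spectral parameter \<open>l \<le> 1\<close>,
  minimising the energy shifted by \<open>l\<close> over the functions with prescribed node values
  leaves a form \<open>Q l\<close> on node values, and the radical of \<open>Q l\<close> consists of
  the node values of the eigenfunctions for \<open>l\<close> (\<open>radical_eigenfunction\<close>).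
  A subspace on which the energy is nonpositive is mapped injectively to node values, and
  \<open>Q 0\<close> is nonpositive on its image. Now let \<open>l\<close> decrease from
  \<open>0\<close>: the form \<open>Q l\<close> depends continuously on \<open>l\<close> and is
  positive for very negative \<open>l\<close>, so every dimension of nonpositivity has to be lost on
  the way, and at a given \<open>l\<close> at most the dimension of the radical can be lost
  (\<open>nonpos_dim_le_radical_dims\<close>). So the dimension of a nonpositive subspace is at most
  the sum of the dimensions of the eigenspaces with \<open>l \<le> 0\<close>; conversely the energy
  is nonpositive on the span of these eigenspaces.

  The \<open>L\<close>-extensions come from a Fredholm alternative (\<open>fredholm\<close>). It is
  a statement about the finite-dimensional space of boundary data, because by the Wronskian identity
  the data of the solutions of a linear second-order equation form a Lagrangian subspace
  (\<open>lagrangian\<close>).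
\<close>

section \<open>Finite-dimensional subspaces\<close>

text \<open>
  In a function space, \<open>dim\<close> is the true dimension only on these subspaces; elsewhere
  it is the cardinality \<open>0\<close> of an infinite basis.
\<close>

definition findim :: "'v::real_vector set \<Rightarrow> bool"
  where "findim U \<longleftrightarrow> subspace U \<and> (\<exists>S. finite S \<and> U \<subseteq> span S)"

lemma findim_subspace: "findim U \<Longrightarrow> subspace U"
  by (simp add: findim_def)

lemma findim_span: "finite S \<Longrightarrow> findim (span S)"
  unfolding findim_def by (auto intro: subspace_span)

lemma findim_subset:
  assumes "findim U" "subspace W" "W \<subseteq> U"
  shows "findim W"
  using assms unfolding findim_def by blast

lemma span_finite_sum:
  assumes "finite B" "x \<in> span B"
  obtains r where "x = (\<Sum>b\<in>B. r b *\<^sub>R b)"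
  using assms by (auto simp: real_vector.span_finite)

lemma independent_sum_zero:
  assumes "finite B" "independent B" "(\<Sum>b\<in>B. r b *\<^sub>R b) = 0" "b \<in> B"
  shows "r b = 0"
  using assms(2-4) unfolding real_vector.dependent_finite[OF assms(1)] by blast

lemma findim_basis:
  fixes U :: "'v::real_vector set"
  assumes "findim U"
  obtains B where "finite B" "independent B" "span B = U" "card B = dim U"
proof -
  obtain S where S: "finite S" "U \<subseteq> span S" and U: "subspace U"
    using assms unfolding findim_def by blast
  obtain B where B: "B \<subseteq> U" "independent B" "U \<subseteq> span B" "card B = dim U"
    using real_vector.basis_exists[of U] by blast
  have "finite B"
    using real_vector.independent_span_bound[OF S(1) B(2)] B(1) S(2) by blast
  moreover have "span B = U"
    using B U by (simp add: real_vector.span_minimal subset_antisym)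
  ultimately show ?thesis
    using B that by blast
qed

lemma independent_findim:
  fixes U :: "'v::real_vector set"
  assumes "findim U" "independent B" "B \<subseteq> U"
  shows "finite B" "card B \<le> dim U"
proof -
  obtain C where C: "finite C" "independent C" "span C = U" "card C = dim U"
    using findim_basis[OF assms(1)] by blast
  show "finite B" "card B \<le> dim U"
    using real_vector.independent_span_bound[OF C(1) assms(2)] assms(3) C by auto
qed

lemma findim_dim_mono:
  assumes "findim U" "subspace W" "W \<subseteq> U"
  shows "dim W \<le> dim U"
proof -
  obtain B where B: "finite B" "independent B" "span B = W" "card B = dim W"
    using findim_basis[OF findim_subset[OF assms]] by blast
  have "B \<subseteq> U" using B(3) assms(3) real_vector.span_superset[of B] by auto
  then show ?thesis using independent_findim(2)[OF assms(1) B(2)] B(4) by simp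
qed

lemma findim_span_Un:
  assumes "findim A" "findim B"
  shows "findim (span (A \<union> B))"
proof -
  obtain S T where "finite S" "A \<subseteq> span S" "finite T" "B \<subseteq> span T"
    using assms unfolding findim_def by blast
  then have "A \<union> B \<subseteq> span (S \<union> T)" "finite (S \<union> T)"
    using real_vector.span_mono[of S "S \<union> T"] real_vector.span_mono[of T "S \<union> T"] by auto
  then show ?thesis
    unfolding findim_def
    using real_vector.span_minimal[OF _ real_vector.subspace_span] real_vector.subspace_span by blast
qed

lemma span_Un_subspaces:
  assumes "subspace A" "subspace B"
  shows "span (A \<union> B) = {a + b | a b. a \<in> A \<and> b \<in> B}"
  unfolding real_vector.span_Un real_vector.span_eq_iff[THEN iffD2, OF assms(1)]
    real_vector.span_eq_iff[THEN iffD2, OF assms(2)] by (rule refl)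

lemma span_Un_E:
  assumes "subspace A" "subspace B" "x \<in> span (A \<union> B)"
  obtains a b where "a \<in> A" "b \<in> B" "x = a + b"
  using assms(3) unfolding span_Un_subspaces[OF assms(1,2)] by blast

lemma span_Un_spans:
  fixes A B :: "'v::real_vector set"
  shows "span (span A \<union> span B) = span (A \<union> B)"
  unfolding real_vector.span_Un real_vector.span_span ..

lemma independent_Un_direct:
  fixes S T :: "'v::real_vector set"
  assumes S: "finite S" "independent S" and T: "finite T" "independent T"
    and int: "span S \<inter> span T \<subseteq> {0}"
  shows "independent (S \<union> T)" "S \<inter> T = {}"
proof -
  have 0: "0 \<notin> S" using S(2) real_vector.dependent_zero by blast
  show disj: "S \<inter> T = {}"
    using int 0 real_vector.span_superset[of S] real_vector.span_superset[of T] by auto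
  show "independent (S \<union> T)"
    unfolding real_vector.independent_explicit_finite_subsets
  proof (intro allI impI ballI)
    fix R u v assume R: "R \<subseteq> S \<union> T" "finite R" "(\<Sum>v\<in>R. u v *\<^sub>R v) = 0" and v: "v \<in> R"
    define u' where "u' x = (if x \<in> R then u x else 0)" for x
    have "(\<Sum>v\<in>S \<union> T. u' v *\<^sub>R v) = (\<Sum>v\<in>R. u v *\<^sub>R v)"
      using R S(1) T(1) by (intro sum.mono_neutral_cong_right) (auto simp: u'_def)
    then have eq: "(\<Sum>v\<in>S. u' v *\<^sub>R v) + (\<Sum>v\<in>T. u' v *\<^sub>R v) = 0"
      using R S(1) T(1) disj by (simp add: sum.union_disjoint)
    have a: "(\<Sum>v\<in>S. u' v *\<^sub>R v) \<in> span S"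
      by (auto intro!: real_vector.span_sum real_vector.span_scale intro: real_vector.span_base)
    have b: "(\<Sum>v\<in>T. u' v *\<^sub>R v) \<in> span T"
      by (auto intro!: real_vector.span_sum real_vector.span_scale intro: real_vector.span_base)
    have "(\<Sum>v\<in>S. u' v *\<^sub>R v) = - (\<Sum>v\<in>T. u' v *\<^sub>R v)" using eq by (simp add: eq_neg_iff_add_eq_0)
    then have "(\<Sum>v\<in>S. u' v *\<^sub>R v) \<in> span T"
      using b by (simp add: real_vector.span_neg)
    then have z1: "(\<Sum>v\<in>S. u' v *\<^sub>R v) = 0" using a int by blast
    then have z2: "(\<Sum>v\<in>T. u' v *\<^sub>R v) = 0" using eq by simp
    have "u' v = 0"
      using v R(1) independent_sum_zero[OF S z1] independent_sum_zero[OF T z2] by blast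
    then show "u v = 0" using v by (simp add: u'_def)
  qed
qed

lemma dim_direct_sum:
  fixes A B :: "'v::real_vector set"
  assumes A: "findim A" and B: "findim B" and AB: "A \<inter> B \<subseteq> {0}"
  shows "dim (span (A \<union> B)) = dim A + dim B"
proof -
  obtain S where S: "finite S" "independent S" "span S = A" "card S = dim A"
    using findim_basis[OF A] by blast
  obtain T where T: "finite T" "independent T" "span T = B" "card T = dim B"
    using findim_basis[OF B] by blast
  have "span S \<inter> span T \<subseteq> {0}" using AB S(3) T(3) by simp
  note ind = independent_Un_direct[OF S(1,2) T(1,2) this]
  have "span (S \<union> T) = span (A \<union> B)"
    unfolding S(3)[symmetric] T(3)[symmetric] by (rule span_Un_spans[symmetric])
  then show ?thesis
    using real_vector.dim_span_eq_card_independent[OF ind(1)] S(1,4) T(1,4) ind(2)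
    by (simp add: card_Un_disjoint)
qed

lemma subspaces_meet:
  assumes "findim U" "subspace W" "subspace P" "W \<subseteq> U" "P \<subseteq> U" "dim U < dim W + dim P"
  obtains x where "x \<in> W" "x \<in> P" "x \<noteq> 0"
proof -
  have "\<not> W \<inter> P \<subseteq> {0}"
  proof
    assume 0: "W \<inter> P \<subseteq> {0}"
    have "dim (span (W \<union> P)) = dim W + dim P"
      by (rule dim_direct_sum) (use 0 assms findim_subset in blast)+
    moreover have "span (W \<union> P) \<subseteq> U"
      using assms by (intro real_vector.span_minimal) (auto simp: findim_subspace)
    ultimately show False
      using findim_dim_mono[OF assms(1), of "span (W \<union> P)"] assms(6) by simp
  qed
  then show ?thesis using that by blast
qed

lemma dim_pos_nonzero:
  assumes "0 < dim (W :: 'v::real_vector set)"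
  obtains x where "x \<in> W" "x \<noteq> 0"
proof -
  have "\<not> W \<subseteq> {0}"
  proof
    assume "W \<subseteq> {0}"
    then have "W \<subseteq> span {}" by simp
    then have "dim W \<le> card ({} :: 'v set)" by (rule real_vector.dim_le_card) simp
    then show False using assms by simp
  qed
  then show ?thesis using that by blast
qed

lemma findim_complement:
  assumes "findim U" "subspace W" "W \<subseteq> U"
  obtains C where "findim C" "C \<subseteq> U" "W \<inter> C \<subseteq> {0}" "dim W + dim C = dim U" "span (W \<union> C) = U"
proof -
  obtain B where B: "finite B" "independent B" "span B = W" "card B = dim W"
    using findim_basis[OF findim_subset[OF assms]] by blast
  have BU: "B \<subseteq> U" using B(3) assms(3) real_vector.span_superset[of B] by auto
  obtain B' where B': "B \<subseteq> B'" "B' \<subseteq> U" "independent B'" "U \<subseteq> span B'"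
    using real_vector.maximal_independent_subset_extend[OF BU B(2)] by blast
  have fin: "finite B'" using independent_findim[OF assms(1) B'(3,2)] by blast
  have spanB': "span B' = U"
    using B' assms(1) by (simp add: findim_subspace real_vector.span_minimal subset_antisym)
  define C where "C = span (B' - B)"
  have C: "findim C" unfolding C_def using fin by (simp add: findim_span)
  have CU: "C \<subseteq> U" unfolding C_def
    using B'(2) assms(1) by (intro real_vector.span_minimal) (auto simp: findim_subspace)
  have int: "W \<inter> C \<subseteq> {0}"
  proof
    fix x assume "x \<in> W \<inter> C"
    then have "x \<in> span B" "x \<in> span (B' - B)" using B(3) by (auto simp: C_def)
    then obtain u w where u: "x = (\<Sum>v\<in>B. u v *\<^sub>R v)" and w: "x = (\<Sum>v\<in>B'-B. w v *\<^sub>R v)"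
      using span_finite_sum[OF B(1)] span_finite_sum[of "B' - B"] fin by (metis finite_Diff)
    define z where "z v = (if v \<in> B then u v else - w v)" for v
    have "(\<Sum>v\<in>B'. z v *\<^sub>R v) = (\<Sum>v\<in>B. z v *\<^sub>R v) + (\<Sum>v\<in>B'-B. z v *\<^sub>R v)"
      using B'(1) fin by (metis (no_types, lifting) add.commute sum.subset_diff)
    also have "\<dots> = x - x"
    proof -
      have "(\<Sum>v\<in>B. z v *\<^sub>R v) = x" unfolding u by (rule sum.cong) (auto simp: z_def)
      moreover have "(\<Sum>v\<in>B'-B. z v *\<^sub>R v) = - (\<Sum>v\<in>B'-B. w v *\<^sub>R v)"
        unfolding sum_negf[symmetric] by (rule sum.cong) (auto simp: z_def)
      ultimately show ?thesis using w by simp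
    qed
    finally have "\<forall>v\<in>B'. z v = 0"
      using independent_sum_zero[OF fin B'(3), of z] by simp
    then have "\<forall>v\<in>B. u v = 0" using B'(1) unfolding z_def by fastforce
    then show "x \<in> {0}" using u by simp
  qed
  have un: "span (W \<union> C) = U"
  proof -
    have "B \<union> (B' - B) = B'" using B'(1) by blast
    then have "U = span (B \<union> (B' - B))" using spanB' by metis
    also have "\<dots> = span (W \<union> C)"
      unfolding C_def B(3)[symmetric] by (rule span_Un_spans[symmetric])
    finally show ?thesis ..
  qed
  have "findim W" using findim_subset[OF assms] .
  then have "dim W + dim C = dim U" using dim_direct_sum[OF _ C int] un by metis
  then show ?thesis using that C CU int un by blast
qed

lemma dim_linear_image:
  fixes f :: "'v::real_vector \<Rightarrow> 'w::real_vector"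
  assumes U: "findim U" and add: "\<And>x y. x \<in> U \<Longrightarrow> y \<in> U \<Longrightarrow> f (x + y) = f x + f y"
    and scale: "\<And>c x. x \<in> U \<Longrightarrow> f (c *\<^sub>R x) = c *\<^sub>R f x"
    and inj: "\<And>x. x \<in> U \<Longrightarrow> f x = 0 \<Longrightarrow> x = 0"
  shows "findim (f ` U)" "dim (f ` U) = dim U"
proof -
  have sU: "subspace U" using U findim_subspace by blast
  obtain B where B: "finite B" "independent B" "span B = U" "card B = dim U"
    using findim_basis[OF U] by blast
  have BU: "B \<subseteq> U" using B(3) real_vector.span_superset[of B] by auto
  have f0: "f 0 = 0" using scale[of 0 0] sU by (simp add: real_vector.subspace_0)
  have sum: "f (\<Sum>b\<in>A. r b *\<^sub>R b) = (\<Sum>b\<in>A. r b *\<^sub>R f b)" if "A \<subseteq> B" for r A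
  proof -
    have "finite A" using that B(1) finite_subset by blast
    then show ?thesis using that
    proof induction
      case empty then show ?case by (simp add: f0)
    next
      case (insert b A)
      have "(\<Sum>b\<in>A. r b *\<^sub>R b) \<in> U"
        using insert.prems BU by (intro real_vector.subspace_sum[OF sU] real_vector.subspace_scale[OF sU]) auto
      moreover have "b \<in> U" using insert.prems BU by auto
      moreover have "r b *\<^sub>R b \<in> U" using \<open>b \<in> U\<close> sU by (simp add: real_vector.subspace_scale)
      ultimately show ?case using insert by (simp add: add scale)
    qed
  qed
  have injB: "inj_on f B"
  proof
    fix x y assume "x \<in> B" "y \<in> B" and e: "f x = f y"
    then have xy: "x \<in> U" "y \<in> U" using BU by auto
    have "f (x + (-1) *\<^sub>R y) = f x + (-1) *\<^sub>R f y"
      using xy sU by (simp only: add scale real_vector.subspace_scale)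
    then have "x + (-1) *\<^sub>R y = 0"
      using e xy sU by (intro inj) (auto simp: real_vector.subspace_add real_vector.subspace_diff)
    then show "x = y" by simp
  qed
  have img: "f ` U = span (f ` B)"
  proof
    show "f ` U \<subseteq> span (f ` B)"
    proof
      fix y assume "y \<in> f ` U"
      then obtain x where x: "x \<in> U" "y = f x" by blast
      then obtain r where "x = (\<Sum>b\<in>B. r b *\<^sub>R b)" using span_finite_sum[OF B(1)] B(3) by metis
      then have "y = (\<Sum>b\<in>B. r b *\<^sub>R f b)" using sum[of B r] x by simp
      then show "y \<in> span (f ` B)"
        by (simp add: real_vector.span_sum real_vector.span_scale real_vector.span_base)
    qed
    have "subspace (f ` U)"
    proof (unfold real_vector.subspace_def, intro conjI ballI allI)
      show "0 \<in> f ` U" using f0 sU by (metis imageI real_vector.subspace_0)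
      fix x y assume "x \<in> f ` U" "y \<in> f ` U"
      then obtain x' y' where "x' \<in> U" "y' \<in> U" "x = f x'" "y = f y'" by blast
      then show "x + y \<in> f ` U"
        using add[of x' y'] real_vector.subspace_add[OF sU, of x' y'] by (auto intro: rev_image_eqI)
    next
      fix c x assume "x \<in> f ` U"
      then obtain x' where "x' \<in> U" "x = f x'" by blast
      then show "c *\<^sub>R x \<in> f ` U"
        using scale[of x' c] real_vector.subspace_scale[OF sU, of x' c] by (auto intro: rev_image_eqI)
    qed
    then show "span (f ` B) \<subseteq> f ` U" using BU by (intro real_vector.span_minimal) auto
  qed
  then show "findim (f ` U)" using B(1) by (simp add: findim_span)
  have "independent (f ` B)"
    unfolding real_vector.independent_explicit_finite_subsets
  proof (intro allI impI ballI)
    fix R u v assume R: "R \<subseteq> f ` B" "finite R" "(\<Sum>v\<in>R. u v *\<^sub>R v) = 0" and v: "v \<in> R"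
    obtain A where A: "A \<subseteq> B" "R = f ` A" using R(1) by (meson subset_imageE)
    have injA: "inj_on f A" using injB A inj_on_subset by blast
    have finA: "finite A" using A B finite_subset by blast
    have "f (\<Sum>b\<in>A. u (f b) *\<^sub>R b) = 0"
      using R(3) A injA by (simp add: sum sum.reindex)
    moreover have "(\<Sum>b\<in>A. u (f b) *\<^sub>R b) \<in> U"
      using A BU by (intro real_vector.subspace_sum[OF sU] real_vector.subspace_scale[OF sU]) auto
    ultimately have "(\<Sum>b\<in>A. u (f b) *\<^sub>R b) = 0" using inj by blast
    moreover have "independent A" using A B(2) real_vector.independent_mono by blast
    ultimately have "\<forall>b\<in>A. u (f b) = 0"
      using independent_sum_zero[OF finA, of "\<lambda>b. u (f b)"] by blast
    then show "u v = 0" using v A by blast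
  qed
  then have "dim (f ` U) = card (f ` B)"
    using img real_vector.dim_span_eq_card_independent by metis
  then show "dim (f ` U) = dim U" using injB B(4) by (simp add: card_image)
qed

lemma findim_injective_preimage:
  fixes f :: "'v::real_vector \<Rightarrow> 'w::real_vector"
  assumes U: "subspace U" and add: "\<And>x y. x \<in> U \<Longrightarrow> y \<in> U \<Longrightarrow> f (x + y) = f x + f y"
    and scale: "\<And>k x. x \<in> U \<Longrightarrow> f (k *\<^sub>R x) = k *\<^sub>R f x"
    and inj: "\<And>x. x \<in> U \<Longrightarrow> f x = 0 \<Longrightarrow> x = 0"
    and Y: "findim Y" "f ` U \<subseteq> Y"
  shows "findim U" "subspace (f ` U)" "dim (f ` U) = dim U"
proof -
  have f0: "f 0 = 0" using scale[of 0 0] U by (simp add: real_vector.subspace_0)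
  show sfU: "subspace (f ` U)"
    unfolding real_vector.subspace_def
  proof (intro conjI ballI allI)
    show "0 \<in> f ` U" using f0 U by (metis imageI real_vector.subspace_0)
    fix x y assume "x \<in> f ` U" "y \<in> f ` U"
    then obtain x' y' where m: "x' \<in> U" "y' \<in> U" "x = f x'" "y = f y'" by blast
    then have "x + y = f (x' + y')" using add by simp
    then show "x + y \<in> f ` U" using real_vector.subspace_add[OF U m(1,2)] by blast
  next
    fix k x assume "x \<in> f ` U"
    then obtain x' where m: "x' \<in> U" "x = f x'" by blast
    then have "k *\<^sub>R x = f (k *\<^sub>R x')" using scale by simp
    then show "k *\<^sub>R x \<in> f ` U" using real_vector.subspace_scale[OF U m(1)] by blast
  qed
  have ffU: "findim (f ` U)" using findim_subset[OF Y(1) sfU Y(2)] .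
  have injU: "x = y" if "x \<in> U" "y \<in> U" "f x = f y" for x y
  proof -
    have m: "(-1) *\<^sub>R y \<in> U" using that U real_vector.subspace_scale by blast
    have "f (x + (-1) *\<^sub>R y) = 0" using add[OF that(1) m] scale[OF that(2), of "-1"] that(3) by simp
    moreover have "x + (-1) *\<^sub>R y \<in> U" using that(1) m U real_vector.subspace_add by blast
    ultimately have "x + (-1) *\<^sub>R y = 0" using inj by blast
    then show ?thesis by simp
  qed
  define v where "v = inv_into U f"
  have v: "v y \<in> U" "f (v y) = y" if "y \<in> f ` U" for y
    using that unfolding v_def by (auto intro: inv_into_into f_inv_into_f)
  have vf: "v (f x) = x" if "x \<in> U" for x
    using injU[OF v(1)[of "f x"] that] v(2)[of "f x"] that by blast
  have vfU: "v ` (f ` U) = U"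
  proof
    show "v ` (f ` U) \<subseteq> U" using v(1) by blast
    show "U \<subseteq> v ` (f ` U)" using vf by (metis image_eqI subsetI)
  qed
  have vadd: "v (x + y) = v x + v y" if "x \<in> f ` U" "y \<in> f ` U" for x y
    using v[OF that(1)] v[OF that(2)] v[OF real_vector.subspace_add[OF sfU that]] add
      real_vector.subspace_add[OF U] by (intro injU) auto
  have vscale: "v (k *\<^sub>R x) = k *\<^sub>R v x" if "x \<in> f ` U" for k x
    using v[OF that] v[OF real_vector.subspace_scale[OF sfU that, of k]] scale
      real_vector.subspace_scale[OF U] by (intro injU) auto
  have vinj: "x = 0" if "x \<in> f ` U" "v x = 0" for x
    using v(2)[OF that(1)] that(2) f0 by simp
  have "findim (v ` (f ` U))"
    by (rule dim_linear_image(1)[OF ffU vadd vscale vinj])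
  then show "findim U" unfolding vfU .
  have "dim (v ` (f ` U)) = dim (f ` U)"
    by (rule dim_linear_image(2)[OF ffU vadd vscale vinj])
  then show "dim (f ` U) = dim U" unfolding vfU by (rule sym)
qed

section \<open>Symmetric forms on subspaces\<close>

definition sym_bilinear_on :: "'v::real_vector set \<Rightarrow> ('v \<Rightarrow> 'v \<Rightarrow> real) \<Rightarrow> bool"
  where "sym_bilinear_on U Q \<longleftrightarrow>
    (\<forall>x\<in>U. \<forall>y\<in>U. Q x y = Q y x) \<and>
    (\<forall>x\<in>U. \<forall>y\<in>U. \<forall>z\<in>U. Q (x + y) z = Q x z + Q y z) \<and>
    (\<forall>c. \<forall>x\<in>U. \<forall>z\<in>U. Q (c *\<^sub>R x) z = c * Q x z)"

lemma sym_bilinear_onI: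
  assumes "\<And>x y. x \<in> U \<Longrightarrow> y \<in> U \<Longrightarrow> Q x y = Q y x"
    and "\<And>x y z. x \<in> U \<Longrightarrow> y \<in> U \<Longrightarrow> z \<in> U \<Longrightarrow> Q (x + y) z = Q x z + Q y z"
    and "\<And>c x z. x \<in> U \<Longrightarrow> z \<in> U \<Longrightarrow> Q (c *\<^sub>R x) z = c * Q x z"
  shows "sym_bilinear_on U Q"
  unfolding sym_bilinear_on_def using assms by (intro conjI ballI allI)

lemma sym_bilinear_onD:
  assumes "sym_bilinear_on U Q"
  shows "\<And>x y. x \<in> U \<Longrightarrow> y \<in> U \<Longrightarrow> Q x y = Q y x"
    and "\<And>x y z. x \<in> U \<Longrightarrow> y \<in> U \<Longrightarrow> z \<in> U \<Longrightarrow> Q (x + y) z = Q x z + Q y z"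
    and "\<And>c x z. x \<in> U \<Longrightarrow> z \<in> U \<Longrightarrow> Q (c *\<^sub>R x) z = c * Q x z"
  using assms unfolding sym_bilinear_on_def by blast+

lemma sym_bilinear_on_subset:
  "sym_bilinear_on U Q \<Longrightarrow> W \<subseteq> U \<Longrightarrow> sym_bilinear_on W Q"
  unfolding sym_bilinear_on_def by (simp add: subset_iff)

lemma sym_bilinear_on_uminus:
  "sym_bilinear_on U Q \<Longrightarrow> sym_bilinear_on U (\<lambda>x y. - Q x y)"
  by (rule sym_bilinear_onI) (auto simp: sym_bilinear_onD)

lemma sym_bilinear_right:
  assumes Q: "sym_bilinear_on U Q" and U: "subspace U"
  shows "\<And>x y z. x \<in> U \<Longrightarrow> y \<in> U \<Longrightarrow> z \<in> U \<Longrightarrow> Q z (x + y) = Q z x + Q z y"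
    and "\<And>c x z. x \<in> U \<Longrightarrow> z \<in> U \<Longrightarrow> Q z (c *\<^sub>R x) = c * Q z x"
    and "\<And>z. z \<in> U \<Longrightarrow> Q 0 z = 0" "\<And>z. z \<in> U \<Longrightarrow> Q z 0 = 0"
proof -
  show "Q z (x + y) = Q z x + Q z y" if "x \<in> U" "y \<in> U" "z \<in> U" for x y z
    using that sym_bilinear_onD(1)[OF Q, of z] sym_bilinear_onD(2)[OF Q] U
    by (simp add: real_vector.subspace_add)
  show "Q z (c *\<^sub>R x) = c * Q z x" if "x \<in> U" "z \<in> U" for c x z
    using that sym_bilinear_onD(1)[OF Q, of z] sym_bilinear_onD(3)[OF Q] U
    by (simp add: real_vector.subspace_scale)
  show z: "Q 0 z = 0" if "z \<in> U" for z
    using sym_bilinear_onD(3)[OF Q that that, of 0] by simp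
  show "Q z 0 = 0" if "z \<in> U" for z
    using z[OF that] sym_bilinear_onD(1)[OF Q _ that, of 0] U by (simp add: real_vector.subspace_0)
qed

lemma sym_bilinear_sum:
  assumes Q: "sym_bilinear_on U Q" and U: "subspace U"
    and A: "finite A" "\<And>a. a \<in> A \<Longrightarrow> f a \<in> U" and y: "y \<in> U"
  shows "Q (\<Sum>a\<in>A. r a *\<^sub>R f a) y = (\<Sum>a\<in>A. r a * Q (f a) y)"
    and "Q y (\<Sum>a\<in>A. r a *\<^sub>R f a) = (\<Sum>a\<in>A. r a * Q y (f a))"
proof -
  have *: "(\<Sum>a\<in>A'. r a *\<^sub>R f a) \<in> U" if "A' \<subseteq> A" for A'
    using that A(2) by (intro real_vector.subspace_sum[OF U] real_vector.subspace_scale[OF U]) auto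
  show 1: "Q (\<Sum>a\<in>A. r a *\<^sub>R f a) y = (\<Sum>a\<in>A. r a * Q (f a) y)"
    using A *
  proof (induction A rule: finite_induct)
    case empty then show ?case using sym_bilinear_right(3)[OF Q U y] by simp
  next
    case (insert a A)
    have m: "(\<Sum>a\<in>A. r a *\<^sub>R f a) \<in> U" "r a *\<^sub>R f a \<in> U" "f a \<in> U"
      using insert.prems(2)[of A] insert.prems(1) U by (auto simp: real_vector.subspace_scale)
    have "Q (\<Sum>a\<in>A. r a *\<^sub>R f a) y = (\<Sum>a\<in>A. r a * Q (f a) y)"
      using insert.prems by (intro insert.IH) (simp_all add: subset_insertI2)
    then show ?case
      using insert.hyps sym_bilinear_onD(2)[OF Q m(2,1) y] sym_bilinear_onD(3)[OF Q m(3) y] by simp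
  qed
  have "Q y (\<Sum>a\<in>A. r a *\<^sub>R f a) = Q (\<Sum>a\<in>A. r a *\<^sub>R f a) y"
    using sym_bilinear_onD(1)[OF Q y *[OF order_refl]] .
  also have "\<dots> = (\<Sum>a\<in>A. r a * Q y (f a))"
    unfolding 1 using A(2) sym_bilinear_onD(1)[OF Q _ y] by simp
  finally show "Q y (\<Sum>a\<in>A. r a *\<^sub>R f a) = (\<Sum>a\<in>A. r a * Q y (f a))" .
qed

lemma sym_bilinear_sum_sum:
  assumes Q: "sym_bilinear_on U Q" and U: "subspace U" and B: "finite B" "B \<subseteq> U"
  shows "Q (\<Sum>b\<in>B. r b *\<^sub>R b) (\<Sum>b\<in>B. s b *\<^sub>R b) = (\<Sum>a\<in>B. \<Sum>b\<in>B. r a * s b * Q a b)"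
proof -
  have "(\<Sum>b\<in>B. s b *\<^sub>R b) \<in> U"
    using B by (intro real_vector.subspace_sum[OF U] real_vector.subspace_scale[OF U]) auto
  then have "Q (\<Sum>b\<in>B. r b *\<^sub>R b) (\<Sum>b\<in>B. s b *\<^sub>R b) = (\<Sum>a\<in>B. r a * Q a (\<Sum>b\<in>B. s b *\<^sub>R b))"
    using sym_bilinear_sum(1)[OF Q U B(1), of "\<lambda>b. b"] B(2) by auto
  also have "\<dots> = (\<Sum>a\<in>B. r a * (\<Sum>b\<in>B. s b * Q a b))"
    using sym_bilinear_sum(2)[OF Q U B(1), of "\<lambda>b. b"] B(2) by (intro sum.cong) auto
  finally show ?thesis by (simp add: sum_distrib_left mult_ac)
qed

lemma sym_bilinear_sum_orth:
  assumes Q: "sym_bilinear_on U Q" and U: "subspace U" and B: "finite B" "B \<subseteq> U"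
    and orth: "\<And>a b. a \<in> B \<Longrightarrow> b \<in> B \<Longrightarrow> a \<noteq> b \<Longrightarrow> Q a b = 0"
  shows "Q (\<Sum>b\<in>B. r b *\<^sub>R b) (\<Sum>b\<in>B. r b *\<^sub>R b) = (\<Sum>b\<in>B. (r b)\<^sup>2 * Q b b)"
proof -
  have "(\<Sum>b\<in>B. r a * r b * Q a b) = (r a)\<^sup>2 * Q a a" if "a \<in> B" for a
  proof -
    have "(\<Sum>b\<in>B. r a * r b * Q a b) = (\<Sum>b\<in>B. if b = a then r a * r b * Q a b else 0)"
      using orth that by (intro sum.cong) auto
    then show ?thesis using that B(1) by (simp add: power2_eq_square)
  qed
  then show ?thesis by (simp add: sym_bilinear_sum_sum[OF Q U B] cong: sum.cong)
qed

lemma sym_bilinear_add_sq: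
  assumes Q: "sym_bilinear_on U Q" and U: "subspace U" and "x \<in> U" "y \<in> U"
  shows "Q (x + y) (x + y) = Q x x + 2 * Q x y + Q y y"
proof -
  have "x + y \<in> U" using assms by (simp add: real_vector.subspace_add)
  then have "Q (x + y) (x + y) = Q x (x + y) + Q y (x + y)"
    using sym_bilinear_onD(2)[OF Q] assms by blast
  also have "\<dots> = Q x x + Q x y + (Q y x + Q y y)"
    using sym_bilinear_right(1)[OF Q U] assms by metis
  also have "Q y x = Q x y" using sym_bilinear_onD(1)[OF Q] assms by blast
  finally show ?thesis by simp
qed

lemma sym_bilinear_scale_sq:
  assumes Q: "sym_bilinear_on U Q" and U: "subspace U" and "x \<in> U"
  shows "Q (c *\<^sub>R x) (c *\<^sub>R x) = c\<^sup>2 * Q x x"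
proof -
  have "c *\<^sub>R x \<in> U" using assms by (simp add: real_vector.subspace_scale)
  then show ?thesis
    using sym_bilinear_onD(3)[OF Q, of x "c *\<^sub>R x" c] sym_bilinear_right(2)[OF Q U, of x x c] assms
    by (simp add: power2_eq_square)
qed

text \<open>
  A vector \<open>v\<close> with \<open>Q v v \<noteq> 0\<close> splits off its orthogonal
  complement, which has smaller dimension. If there is no such vector, the form vanishes by
  polarisation and every basis is orthogonal.
\<close>

lemma orthogonal_basis:
  fixes U :: "'v::real_vector set"
  assumes "findim U" "sym_bilinear_on U Q"
  obtains B where "finite B" "independent B" "span B = U"
    "\<And>x y. x \<in> B \<Longrightarrow> y \<in> B \<Longrightarrow> x \<noteq> y \<Longrightarrow> Q x y = 0"
proof -
  have "\<exists>B. finite B \<and> independent B \<and> span B = U \<and> (\<forall>x\<in>B. \<forall>y\<in>B. x \<noteq> y \<longrightarrow> Q x y = 0)"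
    using assms
  proof (induction "dim U" arbitrary: U rule: less_induct)
    case less
    note Q = less.prems(2)
    have U: "subspace U" using less.prems by (simp add: findim_subspace)
    show ?case
    proof (cases "\<exists>v\<in>U. Q v v \<noteq> 0")
      case False
      have "Q x y = 0" if "x \<in> U" "y \<in> U" for x y
        using sym_bilinear_add_sq[OF Q U that] False that real_vector.subspace_add[OF U that] by auto
      moreover obtain B where "finite B" "independent B" "span B = U"
        using findim_basis[OF less.prems(1)] by blast
      ultimately show ?thesis using real_vector.span_superset[of B] by (intro exI[of _ B]) auto
    next
      case True
      then obtain v where v: "v \<in> U" "Q v v \<noteq> 0" by blast
      define U' where "U' = {x \<in> U. Q x v = 0}"
      have sU': "subspace U'"
        unfolding U'_def real_vector.subspace_def
        using U v sym_bilinear_right(3)[OF Q U] sym_bilinear_onD(2,3)[OF Q]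
        by (auto simp: real_vector.subspace_0 real_vector.subspace_add real_vector.subspace_scale)
      have U'U: "U' \<subseteq> U" unfolding U'_def by blast
      have vU': "v \<notin> U'" using v unfolding U'_def by simp
      have fU': "findim U'" using findim_subset[OF less.prems(1) sU' U'U] .
      have dec: "\<exists>c. \<exists>u\<in>U'. x = c *\<^sub>R v + u" if x: "x \<in> U" for x
      proof -
        define c where "c = Q x v / Q v v"
        have m: "(- c) *\<^sub>R v \<in> U" using U v real_vector.subspace_scale by blast
        have "Q (x + (- c) *\<^sub>R v) v = 0"
          using sym_bilinear_onD(2)[OF Q x m v(1)] sym_bilinear_onD(3)[OF Q v(1) v(1), of "- c"] v(2)
          by (simp add: c_def)
        moreover have "x + (- c) *\<^sub>R v \<in> U" using real_vector.subspace_add[OF U x m] .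
        ultimately have "x + (- c) *\<^sub>R v \<in> U'" unfolding U'_def by blast
        moreover have "x = c *\<^sub>R v + (x + (- c) *\<^sub>R v)" by simp
        ultimately show ?thesis by blast
      qed
      have "dim U' < dim U"
      proof -
        obtain B where B: "finite B" "independent B" "span B = U'" "card B = dim U'"
          using findim_basis[OF fU'] by blast
        have i: "independent (insert v B)"
          using B vU' by (simp add: real_vector.independent_insertI)
        have "insert v B \<subseteq> U" using v U'U B(3) real_vector.span_superset[of B] by auto
        then have "card (insert v B) \<le> dim U" using independent_findim(2)[OF less.prems(1) i] by blast
        moreover have "v \<notin> B" using vU' B(3) real_vector.span_superset[of B] by auto
        ultimately show ?thesis using B by simp
      qed
      then obtain B where B: "finite B" "independent B" "span B = U'"
          "\<forall>x\<in>B. \<forall>y\<in>B. x \<noteq> y \<longrightarrow> Q x y = 0"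
        using less.hyps[OF _ fU' sym_bilinear_on_subset[OF Q U'U]] by blast
      have BU': "B \<subseteq> U'" using B(3) real_vector.span_superset[of B] by auto
      have "span (insert v B) = U"
      proof
        show "span (insert v B) \<subseteq> U" using v BU' U'U by (intro real_vector.span_minimal[OF _ U]) auto
        show "U \<subseteq> span (insert v B)"
        proof
          fix x assume "x \<in> U"
          then obtain c u where "u \<in> U'" "x = c *\<^sub>R v + u" using dec by blast
          then show "x \<in> span (insert v B)"
            using B(3) by (auto simp: real_vector.span_insert intro!: exI[of _ c])
        qed
      qed
      moreover have "independent (insert v B)"
        using B vU' by (simp add: real_vector.independent_insertI)
      moreover have "\<forall>x\<in>insert v B. \<forall>y\<in>insert v B. x \<noteq> y \<longrightarrow> Q x y = 0"
      proof -
        have "Q x v = 0 \<and> Q v x = 0" if "x \<in> B" for x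
          using that BU' U'U v(1) sym_bilinear_onD(1)[OF Q, of v x] unfolding U'_def by auto
        then show ?thesis using B(4) by auto
      qed
      ultimately show ?thesis using B(1) by (intro exI[of _ "insert v B"]) simp
    qed
  qed
  then show ?thesis using that by blast
qed

text \<open>
  The ambient \<open>U\<close> may have infinite dimension: this gives projections onto
  finite-dimensional spaces of eigenfunctions among all smooth functions, as well as onto spaces of
  boundary data.
\<close>

lemma orthogonal_projection:
  fixes Y :: "'v::real_vector set"
  assumes Y: "findim Y" "Y \<subseteq> U" and U: "subspace U" and B: "sym_bilinear_on U B"
    and pos: "\<And>y. y \<in> Y \<Longrightarrow> y \<noteq> 0 \<Longrightarrow> B y y > 0" and x: "x \<in> U"
  shows "\<exists>y\<in>Y. \<forall>z\<in>Y. B (x - y) z = 0"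
proof -
  obtain T where T: "finite T" "independent T" "span T = Y"
    and orth: "\<And>a b. a \<in> T \<Longrightarrow> b \<in> T \<Longrightarrow> a \<noteq> b \<Longrightarrow> B a b = 0"
    using orthogonal_basis[OF Y(1) sym_bilinear_on_subset[OF B Y(2)]] by blast
  have TY: "T \<subseteq> Y" using T(3) real_vector.span_superset[of T] by auto
  have TU: "T \<subseteq> U" using TY Y(2) by auto
  define y where "y = (\<Sum>t\<in>T. (B x t / B t t) *\<^sub>R t)"
  have y: "y \<in> Y" unfolding y_def T(3)[symmetric]
    by (intro real_vector.span_sum real_vector.span_scale real_vector.span_base)
  then have yU: "y \<in> U" using Y(2) by blast
  have dU: "x - y \<in> U" using x yU U by (simp add: real_vector.subspace_diff)
  have t0: "B (x - y) t = 0" if t: "t \<in> T" for t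
  proof -
    have tU: "t \<in> U" using t TU by blast
    have "t \<noteq> 0" using t T(2) real_vector.dependent_zero by blast
    then have tt: "B t t \<noteq> 0" using pos[of t] t TY by force
    have "B y t = (\<Sum>s\<in>T. (B x s / B s s) * B s t)"
      unfolding y_def using sym_bilinear_sum(1)[OF B U T(1), where f = "\<lambda>b. b" and y = t and r = "\<lambda>s. B x s / B s s"] TU tU
      by blast
    also have "\<dots> = (\<Sum>s\<in>T. if s = t then B x t else 0)"
      using orth t tt by (intro sum.cong) auto
    also have "\<dots> = B x t" using T(1) t by simp
    finally have "B y t = B x t" .
    moreover have "B x t = B (x - y) t + B y t"
      using sym_bilinear_onD(2)[OF B dU yU tU] by simp
    ultimately show ?thesis by simp
  qed
  have "B (x - y) z = 0" if z: "z \<in> Y" for z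
  proof -
    obtain r where r: "z = (\<Sum>t\<in>T. r t *\<^sub>R t)" using span_finite_sum[OF T(1)] z T(3) by blast
    have "B (x - y) z = (\<Sum>t\<in>T. r t * B (x - y) t)"
      unfolding r using sym_bilinear_sum(2)[OF B U T(1), of "\<lambda>b. b"] TU dU by blast
    then show ?thesis using t0 by simp
  qed
  then show ?thesis using y by blast
qed

definition nonpos_on :: "'v set \<Rightarrow> ('v \<Rightarrow> 'v \<Rightarrow> real) \<Rightarrow> bool"
  where "nonpos_on W Q \<longleftrightarrow> (\<forall>x\<in>W. Q x x \<le> 0)"

definition radical :: "'v set \<Rightarrow> ('v \<Rightarrow> 'v \<Rightarrow> real) \<Rightarrow> 'v set"
  where "radical U Q = {x \<in> U. \<forall>y\<in>U. Q x y = 0}"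

lemma subspace_radical:
  assumes "sym_bilinear_on U Q" "subspace U"
  shows "subspace (radical U Q)"
  unfolding real_vector.subspace_def radical_def
  using assms sym_bilinear_right(3)[OF assms] sym_bilinear_onD(2,3)[OF assms(1)]
  by (auto simp: real_vector.subspace_0 real_vector.subspace_add real_vector.subspace_scale)

text \<open>
  A larger \<open>W\<close> would meet the span of the basis vectors with \<open>Q b b > 0\<close>,
  where the form is positive.
\<close>

lemma nonpos_dim_le_card:
  assumes U: "findim U" and Q: "sym_bilinear_on U Q"
    and B: "finite B" "independent B" "span B = U"
    and orth: "\<And>x y. x \<in> B \<Longrightarrow> y \<in> B \<Longrightarrow> x \<noteq> y \<Longrightarrow> Q x y = 0"
    and W: "subspace W" "W \<subseteq> U" "nonpos_on W Q"
  shows "dim W \<le> card {b \<in> B. Q b b \<le> 0}"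
proof (rule ccontr)
  assume neg: "\<not> ?thesis"
  define P where "P = {b \<in> B. Q b b > 0}"
  have "{b \<in> B. Q b b \<le> 0} \<union> P = B" unfolding P_def by auto
  moreover have "card ({b \<in> B. Q b b \<le> 0} \<union> P) = card {b \<in> B. Q b b \<le> 0} + card P"
    using B(1) by (intro card_Un_disjoint) (auto simp: P_def)
  ultimately have "card B = card {b \<in> B. Q b b \<le> 0} + card P" by metis
  moreover have "dim U = card B"
    using real_vector.dim_span_eq_card_independent[OF B(2)] B(3) by simp
  moreover have iP: "independent P" using real_vector.independent_mono[OF B(2), of P] by (auto simp: P_def)
  then have "dim (span P) = card P" by (rule real_vector.dim_span_eq_card_independent)
  ultimately have lt: "dim U < dim W + dim (span P)" using neg by linarith
  have PU: "P \<subseteq> U" using B(3) real_vector.span_superset[of B] unfolding P_def by auto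
  have sU: "subspace U" using U by (rule findim_subspace)
  have "span P \<subseteq> U" using PU sU by (rule real_vector.span_minimal)
  then obtain x where x: "x \<in> W" "x \<in> span P" "x \<noteq> 0"
    using subspaces_meet[OF U W(1) real_vector.subspace_span W(2) _ lt] by blast
  have fP: "finite P" using B(1) unfolding P_def by simp
  obtain r where r: "x = (\<Sum>b\<in>P. r b *\<^sub>R b)" using span_finite_sum[OF fP x(2)] .
  have "Q x x = (\<Sum>b\<in>P. (r b)\<^sup>2 * Q b b)"
    unfolding r by (rule sym_bilinear_sum_orth[OF Q sU fP PU]) (use orth in \<open>auto simp: P_def\<close>)
  moreover have "(\<Sum>b\<in>P. (r b)\<^sup>2 * Q b b) > 0"
  proof -
    obtain b where b: "b \<in> P" "r b \<noteq> 0" using x(3) r by (metis (no_types, lifting) scaleR_eq_0_iff sum.neutral)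
    then show ?thesis
      using fP by (intro sum_pos2[of P b]) (auto simp: P_def)
  qed
  ultimately show False using W(3) x(1) unfolding nonpos_on_def by force
qed

lemma nonpos_on_span_orthogonal:
  assumes Q: "sym_bilinear_on U Q" and U: "subspace U" and B: "finite B" "B \<subseteq> U"
    and orth: "\<And>x y. x \<in> B \<Longrightarrow> y \<in> B \<Longrightarrow> x \<noteq> y \<Longrightarrow> Q x y = 0"
    and "\<And>b. b \<in> B \<Longrightarrow> Q b b \<le> 0"
  shows "nonpos_on (span B) Q"
  unfolding nonpos_on_def
proof
  fix x assume "x \<in> span B"
  then obtain r where r: "x = (\<Sum>b\<in>B. r b *\<^sub>R b)" using span_finite_sum[OF B(1)] by blast
  have "Q x x = (\<Sum>b\<in>B. (r b)\<^sup>2 * Q b b)"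
    unfolding r by (rule sym_bilinear_sum_orth[OF Q U B orth])
  also have "\<dots> \<le> 0" using assms(6) by (intro sum_nonpos) (simp add: mult_nonneg_nonpos)
  finally show "Q x x \<le> 0" .
qed

text \<open>
  The diagonal of the Gram matrix at \<open>m\<close> is at least \<open>\<delta> > 0\<close>. While
  all entries move by less than \<open>\<delta> / (2 * n)\<close>, where \<open>n\<close> is the
  number of basis vectors, the value at a vector with coefficients \<open>r\<close> drops by at most
  half of the lower bound \<open>\<delta> * (\<Sum>b\<in>B. (r b)\<^sup>2)\<close> valid at
  \<open>m\<close>.
\<close>

lemma pos_def_open:
  fixes Q :: "real \<Rightarrow> 'v::real_vector \<Rightarrow> 'v \<Rightarrow> real"
  assumes U: "subspace U" and Q: "\<And>l. l \<in> S \<Longrightarrow> sym_bilinear_on U (Q l)"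
    and B: "finite B" "B \<subseteq> U" and orth: "\<And>x y. x \<in> B \<Longrightarrow> y \<in> B \<Longrightarrow> x \<noteq> y \<Longrightarrow> Q m x y = 0"
    and pos: "\<And>b. b \<in> B \<Longrightarrow> Q m b b > 0"
    and cont: "\<And>x y. x \<in> U \<Longrightarrow> y \<in> U \<Longrightarrow> continuous_on S (\<lambda>l. Q l x y)" and m: "m \<in> S"
  shows "\<exists>e>0. \<forall>l\<in>S. \<bar>l - m\<bar> < e \<longrightarrow> (\<forall>x\<in>span B. x \<noteq> 0 \<longrightarrow> Q l x x > 0)"
proof (cases "B = {}")
  case True
  then show ?thesis by (intro exI[of _ 1]) simp
next
  case False
  define n where "n = real (card B)"
  have n: "n > 0" using False B(1) unfolding n_def by (simp add: card_gt_0_iff)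
  define \<delta> where "\<delta> = Min ((\<lambda>b. Q m b b) ` B)"
  have \<delta>: "\<delta> > 0" unfolding \<delta>_def using False B(1) pos by simp
  have \<delta>le: "\<delta> \<le> Q m b b" if "b \<in> B" for b unfolding \<delta>_def using that B(1) by simp
  have "\<forall>a\<in>B. \<forall>b\<in>B. \<exists>e>0. \<forall>l\<in>S. \<bar>l - m\<bar> < e \<longrightarrow> \<bar>Q l a b - Q m a b\<bar> < \<delta> / (2 * n)"
  proof (intro ballI)
    fix a b assume "a \<in> B" "b \<in> B"
    then have "continuous_on S (\<lambda>l. Q l a b)" using cont B(2) by blast
    moreover have "\<delta> / (2 * n) > 0" using \<delta> n by simp
    ultimately show "\<exists>e>0. \<forall>l\<in>S. \<bar>l - m\<bar> < e \<longrightarrow> \<bar>Q l a b - Q m a b\<bar> < \<delta> / (2 * n)"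
      using m unfolding continuous_on_iff dist_real_def by blast
  qed
  then obtain e where e: "\<And>a b. a \<in> B \<Longrightarrow> b \<in> B \<Longrightarrow> e a b > 0"
    "\<And>a b l. a \<in> B \<Longrightarrow> b \<in> B \<Longrightarrow> l \<in> S \<Longrightarrow> \<bar>l - m\<bar> < e a b \<Longrightarrow> \<bar>Q l a b - Q m a b\<bar> < \<delta> / (2 * n)"
    by metis
  define e0 where "e0 = Min ((\<lambda>(a, b). e a b) ` (B \<times> B))"
  have e0: "e0 > 0" unfolding e0_def using False B(1) e(1) by auto
  have e0le: "e0 \<le> e a b" if "a \<in> B" "b \<in> B" for a b
    unfolding e0_def using that B(1) by (intro Min_le) (auto intro: rev_image_eqI[of "(a, b)"])
  have "Q l x x > 0" if l: "l \<in> S" "\<bar>l - m\<bar> < e0" and x: "x \<in> span B" "x \<noteq> 0" for l x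
  proof -
    obtain r where r: "x = (\<Sum>b\<in>B. r b *\<^sub>R b)" using span_finite_sum[OF B(1) x(1)] .
    obtain b where b: "b \<in> B" "r b \<noteq> 0" using x(2) r by (metis (no_types, lifting) scaleR_eq_0_iff sum.neutral)
    define s where "s = (\<Sum>b\<in>B. (r b)\<^sup>2)"
    have s: "s > 0" unfolding s_def using b B(1) by (intro sum_pos2[of B b]) auto
    have "Q m x x = (\<Sum>b\<in>B. (r b)\<^sup>2 * Q m b b)"
      unfolding r by (rule sym_bilinear_sum_orth[OF Q[OF m] U B orth])
    also have "\<dots> \<ge> (\<Sum>b\<in>B. (r b)\<^sup>2 * \<delta>)"
      using \<delta>le by (intro sum_mono mult_left_mono) auto
    finally have 1: "Q m x x \<ge> s * \<delta>" unfolding s_def by (simp add: sum_distrib_right)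
    have "Q m x x - Q l x x = (\<Sum>a\<in>B. \<Sum>b\<in>B. r a * r b * (Q m a b - Q l a b))"
      unfolding r sym_bilinear_sum_sum[OF Q[OF m] U B] sym_bilinear_sum_sum[OF Q[OF l(1)] U B]
      by (simp add: sum_subtractf right_diff_distrib)
    also have "\<dots> \<le> (\<Sum>a\<in>B. \<Sum>b\<in>B. ((r a)\<^sup>2 + (r b)\<^sup>2) / 2 * (\<delta> / (2 * n)))"
    proof (intro sum_mono)
      fix a b assume ab: "a \<in> B" "b \<in> B"
      have "r a * r b * (Q m a b - Q l a b) \<le> \<bar>r a * r b\<bar> * \<bar>Q m a b - Q l a b\<bar>"
        by (metis abs_ge_self abs_mult)
      also have "\<dots> \<le> ((r a)\<^sup>2 + (r b)\<^sup>2) / 2 * (\<delta> / (2 * n))"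
      proof (rule mult_mono)
        have "0 \<le> (\<bar>r a\<bar> - \<bar>r b\<bar>)\<^sup>2" by simp
        then show "\<bar>r a * r b\<bar> \<le> ((r a)\<^sup>2 + (r b)\<^sup>2) / 2"
          by (simp add: power2_diff abs_mult)
        have "\<bar>l - m\<bar> < e a b" using l(2) e0le[OF ab] by linarith
        then show "\<bar>Q m a b - Q l a b\<bar> \<le> \<delta> / (2 * n)" using e(2)[OF ab l(1)] by linarith
      qed auto
      finally show "r a * r b * (Q m a b - Q l a b) \<le> ((r a)\<^sup>2 + (r b)\<^sup>2) / 2 * (\<delta> / (2 * n))" .
    qed
    also have "\<dots> = (\<Sum>a\<in>B. \<Sum>b\<in>B. (r a)\<^sup>2 + (r b)\<^sup>2) * (\<delta> / (4 * n))"
      by (simp add: sum_distrib_right sum_divide_distrib)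
    also have "(\<Sum>a\<in>B. \<Sum>b\<in>B. (r a)\<^sup>2 + (r b)\<^sup>2) = 2 * n * s"
      by (simp add: sum.distrib n_def s_def sum_distrib_left mult_ac)
    also have "2 * n * s * (\<delta> / (4 * n)) = s * \<delta> / 2" using n by (simp add: field_simps)
    finally have "Q l x x \<ge> s * \<delta> / 2" using 1 by (simp add: field_simps)
    then show ?thesis using s \<delta> by (smt (verit) divide_pos_pos mult_pos_pos)
  qed
  then show ?thesis using e0 by blast
qed

section \<open>Eigenvalue crossing\<close>

text \<open>
  Let \<open>\<mu>\<close> be the infimum of the parameters at which a nonpositive subspace of
  dimension \<open>n\<close> exists. In a basis orthogonal at \<open>\<mu>\<close>, the nonpositive
  vectors number at least \<open>n\<close>, because positivity on the span of the others persists
  near \<open>\<mu>\<close>. The strictly negative ones number less than \<open>n\<close>, because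
  negativity persists as well, and would give a nonpositive subspace of dimension \<open>n\<close>
  to the left of \<open>\<mu>\<close>. So the radical at \<open>\<mu>\<close> accounts for the
  difference, and the induction continues with the span of the strictly negative vectors at a
  parameter slightly to the left of \<open>\<mu>\<close>.
\<close>

lemma nonpos_dim_le_radical_dims:
  fixes Q :: "real \<Rightarrow> 'v::real_vector \<Rightarrow> 'v \<Rightarrow> real"
  assumes U: "findim U" and Q: "\<And>l. l \<le> 0 \<Longrightarrow> sym_bilinear_on U (Q l)"
    and cont: "\<And>x y. x \<in> U \<Longrightarrow> y \<in> U \<Longrightarrow> continuous_on {..0} (\<lambda>l. Q l x y)"
    and pos: "\<And>l x. l \<le> L \<Longrightarrow> x \<in> U \<Longrightarrow> x \<noteq> 0 \<Longrightarrow> Q l x x > 0"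
    and m: "m \<le> 0" and W: "subspace W" "W \<subseteq> U" "nonpos_on W (Q m)"
  shows "\<exists>F. finite F \<and> F \<subseteq> {..m} \<and> dim W \<le> (\<Sum>l\<in>F. dim (radical U (Q l)))"
  using m W
proof (induction "dim W" arbitrary: W m rule: less_induct)
  case less
  have sU: "subspace U" using U by (rule findim_subspace)
  define n where "n = dim W"
  show ?case
  proof (cases "n = 0")
    case True
    then show ?thesis unfolding n_def by (intro exI[of _ "{}"]) simp
  next
    case False
    define S where "S = {l. l \<le> m \<and> (\<exists>W'. subspace W' \<and> W' \<subseteq> U \<and> dim W' = n \<and> nonpos_on W' (Q l))}"
    have mS: "m \<in> S" unfolding S_def n_def using less.prems by auto
    have Sgt: "l > L" if "l \<in> S" for l
    proof (rule ccontr)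
      assume "\<not> l > L"
      obtain W' where W': "W' \<subseteq> U" "dim W' = n" "nonpos_on W' (Q l)"
        using \<open>l \<in> S\<close> unfolding S_def by blast
      have "0 < dim W'" using W'(2) False by simp
      then obtain x where "x \<in> W'" "x \<noteq> 0" using dim_pos_nonzero by blast
      then show False
        using pos[of l x] \<open>\<not> l > L\<close> W' unfolding nonpos_on_def by force
    qed
    have bdd: "bdd_below S" using Sgt by (intro bdd_belowI[of _ L]) force
    define \<mu> where "\<mu> = Inf S"
    have \<mu>m: "\<mu> \<le> m" unfolding \<mu>_def using mS bdd by (rule cInf_lower)
    then have \<mu>0: "\<mu> \<le> 0" "\<mu> \<in> {..0}" using less.prems(1) by auto
    note Q\<mu> = Q[OF \<mu>0(1)]
    obtain B where B: "finite B" "independent B" "span B = U"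
      and orth: "\<And>x y. x \<in> B \<Longrightarrow> y \<in> B \<Longrightarrow> x \<noteq> y \<Longrightarrow> Q \<mu> x y = 0"
      using orthogonal_basis[OF U Q\<mu>] by blast
    have BU: "B \<subseteq> U" using B(3) real_vector.span_superset[of B] by auto
    have dimB: "dim U = card B"
      using real_vector.dim_span_eq_card_independent[OF B(2)] B(3) by simp
    define B1 where "B1 = {b \<in> B. Q \<mu> b b < 0}"
    define B2 where "B2 = {b \<in> B. Q \<mu> b b = 0}"
    define B3 where "B3 = {b \<in> B. Q \<mu> b b > 0}"
    have fin: "finite B1" "finite B2" "finite B3" using B(1) unfolding B1_def B2_def B3_def by auto
    have sub: "B1 \<subseteq> B" "B2 \<subseteq> B" "B3 \<subseteq> B" unfolding B1_def B2_def B3_def by auto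
    have ind: "independent B1" "independent B2" "independent B3"
      using sub real_vector.independent_mono[OF B(2), of B1] real_vector.independent_mono[OF B(2), of B2]
        real_vector.independent_mono[OF B(2), of B3] by simp_all
    have "card (B1 \<union> B2) = card B1 + card B2"
      using fin by (intro card_Un_disjoint) (auto simp: B1_def B2_def)
    moreover have "card ((B1 \<union> B2) \<union> B3) = card (B1 \<union> B2) + card B3"
      using fin by (intro card_Un_disjoint) (auto simp: B1_def B2_def B3_def)
    moreover have "(B1 \<union> B2) \<union> B3 = B" unfolding B1_def B2_def B3_def by auto
    ultimately have cards: "card B = card B1 + card B2 + card B3" by simp
    have Q0: "\<And>l. l \<in> {..0} \<Longrightarrow> sym_bilinear_on U (Q l)" using Q by simp
    have le: "n \<le> card B1 + card B2"
    proof (rule ccontr)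
      assume neg: "\<not> ?thesis"
      have "\<exists>e>0. \<forall>l\<in>{..0}. \<bar>l - \<mu>\<bar> < e \<longrightarrow> (\<forall>x\<in>span B3. x \<noteq> 0 \<longrightarrow> Q l x x > 0)"
      proof (rule pos_def_open[OF sU Q0 fin(3) _ _ _ cont \<mu>0(2)])
        show "Q \<mu> x y = 0" if "x \<in> B3" "y \<in> B3" "x \<noteq> y" for x y using that orth sub by blast
        show "B3 \<subseteq> U" using sub BU by blast
        show "Q \<mu> b b > 0" if "b \<in> B3" for b using that by (simp add: B3_def)
      qed
      then obtain e where e0: "e > 0 \<and> (\<forall>l\<in>{..0}. \<bar>l - \<mu>\<bar> < e \<longrightarrow> (\<forall>x\<in>span B3. x \<noteq> 0 \<longrightarrow> Q l x x > 0))" ..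
      have e: "e > 0" using e0 ..
      have e2: "Q l x x > 0" if "l \<in> {..0}" "\<bar>l - \<mu>\<bar> < e" "x \<in> span B3" "x \<noteq> 0" for l x
        using conjunct2[OF e0, rule_format, OF that] .
      have "Inf S < \<mu> + e" using e \<mu>_def by simp
      then obtain l where l: "l \<in> S" "l < \<mu> + e"
        using cInf_less_iff[of S "\<mu> + e"] mS bdd by blast
      have "\<mu> \<le> l" unfolding \<mu>_def using l(1) bdd by (rule cInf_lower)
      then have le: "\<bar>l - \<mu>\<bar> < e" using l(2) by simp
      obtain W' where W': "subspace W'" "W' \<subseteq> U" "dim W' = n" "nonpos_on W' (Q l)" and lm: "l \<le> m"
        using l(1) unfolding S_def by blast
      have "dim (span B3) = card B3" using ind(3) by (rule real_vector.dim_span_eq_card_independent)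
      then have lt: "dim U < dim W' + dim (span B3)" using neg dimB cards W'(3) by linarith
      have "span B3 \<subseteq> U" using sub BU by (intro real_vector.span_minimal[OF _ sU]) auto
      then obtain x where x: "x \<in> W'" "x \<in> span B3" "x \<noteq> 0"
        using subspaces_meet[OF U W'(1) real_vector.subspace_span W'(2) _ lt] by blast
      have "Q l x x > 0" using e2[OF _ le x(2,3)] lm less.prems(1) by simp
      then show False using W'(4) x(1) unfolding nonpos_on_def by force
    qed
    have left: "\<exists>l<\<mu>. nonpos_on (span A) (Q l)" if A: "A \<subseteq> B1" for A
    proof -
      have fA: "finite A" using A fin(1) finite_subset by blast
      have "\<exists>e>0. \<forall>l\<in>{..0}. \<bar>l - \<mu>\<bar> < e \<longrightarrow> (\<forall>x\<in>span A. x \<noteq> 0 \<longrightarrow> - Q l x x > 0)"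
      proof (rule pos_def_open[where Q = "\<lambda>l x y. - Q l x y", OF sU _ fA _ _ _ _ \<mu>0(2)])
        show "- Q \<mu> x y = 0" if "x \<in> A" "y \<in> A" "x \<noteq> y" for x y using that orth sub A by force
        show "A \<subseteq> U" using sub BU A by blast
        show "sym_bilinear_on U (\<lambda>x y. - Q l x y)" if "l \<in> {..0}" for l
          using sym_bilinear_on_uminus[OF Q0[OF that]] .
        show "- Q \<mu> b b > 0" if "b \<in> A" for b using that A by (auto simp: B1_def)
        show "continuous_on {..0} (\<lambda>l. - Q l x y)" if "x \<in> U" "y \<in> U" for x y
          using cont[OF that] by (rule continuous_on_minus)
      qed
      then obtain e where e0: "e > 0 \<and> (\<forall>l\<in>{..0}. \<bar>l - \<mu>\<bar> < e \<longrightarrow> (\<forall>x\<in>span A. x \<noteq> 0 \<longrightarrow> - Q l x x > 0))" ..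
      have e: "e > 0" using e0 ..
      have e2: "- Q l x x > 0" if "l \<in> {..0}" "\<bar>l - \<mu>\<bar> < e" "x \<in> span A" "x \<noteq> 0" for l x
        using conjunct2[OF e0, rule_format, OF that] .
      define l where "l = \<mu> - e / 2"
      have l: "l < \<mu>" "\<bar>l - \<mu>\<bar> < e" "l \<in> {..0}" unfolding l_def using e \<mu>0 by auto
      have "Q l x x \<le> 0" if "x \<in> span A" for x
      proof (cases "x = 0")
        case True
        then show ?thesis using sym_bilinear_right(3)[OF Q0[OF l(3)] sU, of 0] sU
          by (simp add: real_vector.subspace_0)
      next
        case False
        then show ?thesis using e2[OF l(3,2) that] by simp
      qed
      then show ?thesis using l(1) unfolding nonpos_on_def by blast
    qed
    have lt: "card B1 < n"
    proof (rule ccontr)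
      assume "\<not> ?thesis"
      then obtain A where A: "A \<subseteq> B1" "card A = n" using obtain_subset_with_card_n[of n B1] by auto
      obtain l where l: "l < \<mu>" "nonpos_on (span A) (Q l)" using left[OF A(1)] by blast
      have "independent A" using real_vector.independent_mono[OF ind(1) A(1)] .
      then have "dim (span A) = n" using A(2) real_vector.dim_span_eq_card_independent by blast
      moreover have "span A \<subseteq> U" using A(1) sub BU by (intro real_vector.span_minimal[OF _ sU]) auto
      ultimately have "l \<in> S" using l \<mu>m unfolding S_def
        by (auto intro!: exI[of _ "span A"] real_vector.subspace_span)
      then have "\<mu> \<le> l" unfolding \<mu>_def using bdd by (rule cInf_lower)
      then show False using l(1) by simp
    qed
    obtain l where l: "l < \<mu>" "nonpos_on (span B1) (Q l)" using left[OF order_refl] by blast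
    have d1: "dim (span B1) = card B1" using ind(1) by (rule real_vector.dim_span_eq_card_independent)
    have "\<exists>F. finite F \<and> F \<subseteq> {..l} \<and> dim (span B1) \<le> (\<Sum>l\<in>F. dim (radical U (Q l)))"
    proof (rule less.hyps)
      show "dim (span B1) < dim W" using d1 lt n_def by simp
      show "span B1 \<subseteq> U" using sub BU by (intro real_vector.span_minimal[OF _ sU]) auto
    qed (use l \<mu>0 real_vector.subspace_span in auto)
    then obtain F where F: "finite F" "F \<subseteq> {..l}" "card B1 \<le> (\<Sum>l\<in>F. dim (radical U (Q l)))"
      using d1 by auto
    have "\<mu> \<notin> F" using F(2) l(1) by auto
    have "B2 \<subseteq> radical U (Q \<mu>)"
    proof
      fix b assume b: "b \<in> B2"
      have "Q \<mu> b y = 0" if y: "y \<in> U" for y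
      proof -
        obtain r where r: "y = (\<Sum>b\<in>B. r b *\<^sub>R b)" using span_finite_sum[OF B(1)] y B(3) by blast
        have "b \<in> U" using b sub BU by blast
        then have "Q \<mu> b y = (\<Sum>c\<in>B. r c * Q \<mu> b c)"
          unfolding r using sym_bilinear_sum(2)[OF Q\<mu> sU B(1), of "\<lambda>b. b"] BU by blast
        also have "\<dots> = 0" using b sub orth by (intro sum.neutral) (auto simp: B2_def)
        finally show ?thesis .
      qed
      then show "b \<in> radical U (Q \<mu>)" using b sub BU unfolding radical_def by blast
    qed
    moreover have "findim (radical U (Q \<mu>))"
      using U subspace_radical[OF Q\<mu> sU] by (rule findim_subset) (auto simp: radical_def)
    ultimately have "card B2 \<le> dim (radical U (Q \<mu>))" using independent_findim(2)[OF _ ind(2)] by blast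
    then have "dim W \<le> (\<Sum>l\<in>insert \<mu> F. dim (radical U (Q l)))"
      using F le \<open>\<mu> \<notin> F\<close> unfolding n_def by simp
    moreover have "insert \<mu> F \<subseteq> {..m}" using F(2) l(1) \<mu>m by auto
    ultimately show ?thesis using F(1) by (intro exI[of _ "insert \<mu> F"]) simp
  qed
qed

section \<open>Maximal dimension of a nonpositive subspace\<close>

text \<open>
  A relation, because boundedness of the dimensions is part of what it asserts.
\<close>

definition max_nonpos_dim :: "'v::real_vector set \<Rightarrow> ('v \<Rightarrow> 'v \<Rightarrow> real) \<Rightarrow> nat \<Rightarrow> bool"
  where "max_nonpos_dim H Q n \<longleftrightarrow>
    (\<forall>W. findim W \<longrightarrow> W \<subseteq> H \<longrightarrow> nonpos_on W Q \<longrightarrow> dim W \<le> n) \<and>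
    (\<exists>W. findim W \<and> W \<subseteq> H \<and> nonpos_on W Q \<and> dim W = n)"

lemma max_nonpos_dim_unique:
  "max_nonpos_dim H Q n \<Longrightarrow> max_nonpos_dim H Q n' \<Longrightarrow> n = n'"
  unfolding max_nonpos_dim_def by (meson le_antisym)

lemma max_nonpos_dimD:
  "max_nonpos_dim H Q n \<Longrightarrow> findim W \<Longrightarrow> W \<subseteq> H \<Longrightarrow> nonpos_on W Q \<Longrightarrow> dim W \<le> n"
  unfolding max_nonpos_dim_def by blast

lemma max_nonpos_dim_cong:
  assumes "\<And>x. x \<in> H \<Longrightarrow> Q x x = Q' x x"
  shows "max_nonpos_dim H Q n \<longleftrightarrow> max_nonpos_dim H Q' n"
proof -
  have "nonpos_on W Q \<longleftrightarrow> nonpos_on W Q'" if "W \<subseteq> H" for W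
    unfolding nonpos_on_def by (rule ball_cong[OF refl]) (simp add: assms[OF subsetD[OF that]])
  then show ?thesis unfolding max_nonpos_dim_def by auto
qed

text \<open>
  A nonpositive subspace of the sum is contained in the sum of finite-dimensional subspaces of the
  two summands. Diagonalising the form on each of them gives an orthogonal basis of their sum, so
  the nonpositive basis vectors of the sum are those of the summands.
\<close>

lemma max_nonpos_dim_orthogonal_sum:
  fixes H0 H1 :: "'v::real_vector set"
  assumes Q: "sym_bilinear_on H Q" and H: "subspace H"
    and H0: "subspace H0" "H0 \<subseteq> H" and H1: "subspace H1" "H1 \<subseteq> H"
    and orth: "\<And>x y. x \<in> H0 \<Longrightarrow> y \<in> H1 \<Longrightarrow> Q x y = 0" and int: "H0 \<inter> H1 \<subseteq> {0}"
    and n0: "max_nonpos_dim H0 Q n0" and n1: "max_nonpos_dim H1 Q n1"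
  shows "max_nonpos_dim (span (H0 \<union> H1)) Q (n0 + n1)"
  unfolding max_nonpos_dim_def
proof (intro conjI allI impI)
  obtain W0 where W0: "findim W0" "W0 \<subseteq> H0" "nonpos_on W0 Q" "dim W0 = n0"
    using n0 unfolding max_nonpos_dim_def by blast
  obtain W1 where W1: "findim W1" "W1 \<subseteq> H1" "nonpos_on W1 Q" "dim W1 = n1"
    using n1 unfolding max_nonpos_dim_def by blast
  have "nonpos_on (span (W0 \<union> W1)) Q"
    unfolding nonpos_on_def span_Un_subspaces[OF findim_subspace[OF W0(1)] findim_subspace[OF W1(1)]]
  proof
    fix z assume "z \<in> {a + b |a b. a \<in> W0 \<and> b \<in> W1}"
    then obtain a b where ab: "z = a + b" "a \<in> W0" "b \<in> W1" by blast
    have "a \<in> H" "b \<in> H" using ab W0 W1 H0 H1 by auto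
    then have "Q z z = Q a a + 2 * Q a b + Q b b"
      unfolding ab(1) by (rule sym_bilinear_add_sq[OF Q H])
    moreover have "Q a b = 0" using orth ab W0 W1 by blast
    ultimately show "Q z z \<le> 0" using ab W0(3) W1(3) unfolding nonpos_on_def by force
  qed
  moreover have "dim (span (W0 \<union> W1)) = n0 + n1"
    using dim_direct_sum[OF W0(1) W1(1)] W0 W1 int by blast
  moreover have "span (W0 \<union> W1) \<subseteq> span (H0 \<union> H1)"
    using W0 W1 by (intro real_vector.span_mono) auto
  ultimately show "\<exists>W. findim W \<and> W \<subseteq> span (H0 \<union> H1) \<and> nonpos_on W Q \<and> dim W = n0 + n1"
    using findim_span_Un[OF W0(1) W1(1)] by blast
next
  fix W assume W: "findim W" "W \<subseteq> span (H0 \<union> H1)" "nonpos_on W Q"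
  obtain B where B: "finite B" "independent B" "span B = W" "card B = dim W"
    using findim_basis[OF W(1)] by blast
  have "B \<subseteq> span (H0 \<union> H1)" using B(3) W(2) real_vector.span_superset[of B] by auto
  then have "\<forall>b\<in>B. \<exists>f g. f \<in> H0 \<and> g \<in> H1 \<and> b = f + g"
    unfolding span_Un_subspaces[OF H0(1) H1(1)] by blast
  then obtain f g where fg: "\<And>b. b \<in> B \<Longrightarrow> f b \<in> H0" "\<And>b. b \<in> B \<Longrightarrow> g b \<in> H1"
    "\<And>b. b \<in> B \<Longrightarrow> b = f b + g b" by metis
  define U0 where "U0 = span (f ` B)"
  define U1 where "U1 = span (g ` B)"
  have fU: "findim U0" "findim U1" unfolding U0_def U1_def using B(1) by (auto intro: findim_span)
  have U0: "U0 \<subseteq> H0" unfolding U0_def using fg by (intro real_vector.span_minimal[OF _ H0(1)]) auto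
  have U1: "U1 \<subseteq> H1" unfolding U1_def using fg by (intro real_vector.span_minimal[OF _ H1(1)]) auto
  define U where "U = span (U0 \<union> U1)"
  have U: "findim U" unfolding U_def using fU by (rule findim_span_Un)
  have UH: "U \<subseteq> H" unfolding U_def using U0 U1 H0 H1 by (intro real_vector.span_minimal[OF _ H]) auto
  note QU = sym_bilinear_on_subset[OF Q UH]
  have WU: "W \<subseteq> U" unfolding B(3)[symmetric]
  proof (rule real_vector.span_minimal)
    show "B \<subseteq> U"
    proof
      fix b assume b: "b \<in> B"
      have "f b \<in> U0" "g b \<in> U1" unfolding U0_def U1_def using b by (auto intro: real_vector.span_base)
      then have "f b + g b \<in> U" unfolding U_def
        by (intro real_vector.span_add real_vector.span_base) auto
      then show "b \<in> U" using fg(3)[OF b] by simp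
    qed
  qed (use U in \<open>rule findim_subspace\<close>)
  have Q0: "sym_bilinear_on U0 Q" and Q1: "sym_bilinear_on U1 Q"
    using sym_bilinear_on_subset[OF Q] U0 U1 H0 H1 by blast+
  obtain B0 where B0: "finite B0" "independent B0" "span B0 = U0"
    and o0: "\<And>x y. x \<in> B0 \<Longrightarrow> y \<in> B0 \<Longrightarrow> x \<noteq> y \<Longrightarrow> Q x y = 0"
    using orthogonal_basis[OF fU(1) Q0] by blast
  obtain B1 where B1: "finite B1" "independent B1" "span B1 = U1"
    and o1: "\<And>x y. x \<in> B1 \<Longrightarrow> y \<in> B1 \<Longrightarrow> x \<noteq> y \<Longrightarrow> Q x y = 0"
    using orthogonal_basis[OF fU(2) Q1] by blast
  have B0U: "B0 \<subseteq> U0" using B0(3) real_vector.span_superset[of B0] by auto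
  have B1U: "B1 \<subseteq> U1" using B1(3) real_vector.span_superset[of B1] by auto
  have "span B0 \<inter> span B1 \<subseteq> {0}" using B0(3) B1(3) U0 U1 int by blast
  note ind = independent_Un_direct[OF B0(1,2) B1(1,2) this]
  have sp: "span (B0 \<union> B1) = U"
    unfolding U_def B0(3)[symmetric] B1(3)[symmetric] by (rule span_Un_spans[symmetric])
  have part: "card {b \<in> A. Q b b \<le> 0} \<le> k"
    if A: "finite A" "independent A" "A \<subseteq> H'" "subspace H'" "H' \<subseteq> H" "max_nonpos_dim H' Q k"
      "\<And>x y. x \<in> A \<Longrightarrow> y \<in> A \<Longrightarrow> x \<noteq> y \<Longrightarrow> Q x y = 0" for A H' k
  proof -
    let ?A = "{b \<in> A. Q b b \<le> 0}"
    have "nonpos_on (span ?A) Q"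
      by (rule nonpos_on_span_orthogonal[OF Q H]) (use A in auto)
    moreover have "span ?A \<subseteq> H'" using A by (intro real_vector.span_minimal) auto
    moreover have "findim (span ?A)" using A(1) by (simp add: findim_span)
    ultimately have "dim (span ?A) \<le> k" using A(6) max_nonpos_dimD by blast
    moreover have "independent ?A" using real_vector.independent_mono[OF A(2), of ?A] by auto
    then have "dim (span ?A) = card ?A" by (rule real_vector.dim_span_eq_card_independent)
    ultimately show ?thesis by simp
  qed
  have orth': "Q x y = 0" if "x \<in> B0 \<union> B1" "y \<in> B0 \<union> B1" "x \<noteq> y" for x y
  proof -
    have "Q x y = 0 \<and> Q y x = 0" if "x \<in> B0" "y \<in> B1" for x y
    proof -
      have m: "x \<in> H0" "y \<in> H1" using that B0U B1U U0 U1 by auto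
      then have "y \<in> H" "x \<in> H" using H0 H1 by auto
      then show ?thesis using orth[OF m] sym_bilinear_onD(1)[OF Q, of y x] by simp
    qed
    then show ?thesis using that o0 o1 by blast
  qed
  have "dim W \<le> card {b \<in> B0 \<union> B1. Q b b \<le> 0}"
    by (rule nonpos_dim_le_card[OF U QU _ ind(1) sp orth' findim_subspace[OF W(1)] WU W(3)])
       (use B0 B1 in auto)
  also have "{b \<in> B0 \<union> B1. Q b b \<le> 0} = {b \<in> B0. Q b b \<le> 0} \<union> {b \<in> B1. Q b b \<le> 0}" by auto
  also have "card \<dots> \<le> card {b \<in> B0. Q b b \<le> 0} + card {b \<in> B1. Q b b \<le> 0}" by (rule card_Un_le)
  also have "\<dots> \<le> n0 + n1"
    using part[OF B0(1,2) _ H0 n0 o0] part[OF B1(1,2) _ H1 n1 o1] B0U B1U U0 U1 by (intro add_mono) auto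
  finally show "dim W \<le> n0 + n1" .
qed

text \<open>
  Each of the linear conditions lowers the dimension by at most one.
\<close>

lemma dim_le_kernel:
  fixes W :: "'v::real_vector set"
  assumes Q: "sym_bilinear_on H Q" and H: "subspace H" and W: "findim W" "W \<subseteq> H"
    and T: "finite T" "T \<subseteq> H"
  shows "dim W \<le> dim {w \<in> W. \<forall>t\<in>T. Q w t = 0} + card T"
  using T
proof (induction T rule: finite_induct)
  case empty
  then show ?case by simp
next
  case (insert t T)
  define W1 where "W1 = {w \<in> W. \<forall>t\<in>T. Q w t = 0}"
  define W2 where "W2 = {w \<in> W. \<forall>t\<in>insert t T. Q w t = 0}"
  have sW: "subspace W" using W by (simp add: findim_subspace)
  have sub: "subspace {w \<in> W. \<forall>t\<in>A. Q w t = 0}" if "A \<subseteq> H" for A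
    unfolding real_vector.subspace_def
    using sW W(2) that sym_bilinear_right(3)[OF Q H] sym_bilinear_onD(2,3)[OF Q]
    by (auto simp: real_vector.subspace_0 real_vector.subspace_add real_vector.subspace_scale subset_iff)
  have fW2: "findim W2"
    using findim_subset[OF W(1) sub[of "insert t T"]] insert.prems unfolding W2_def by auto
  obtain B where B: "finite B" "independent B" "span B = W2" "card B = dim W2"
    using findim_basis[OF fW2] by blast
  have "dim W1 \<le> dim W2 + 1"
  proof (cases "W1 \<subseteq> W2")
    case True
    then have "W1 = W2" unfolding W1_def W2_def by auto
    then show ?thesis by simp
  next
    case False
    then obtain v where v: "v \<in> W1" "Q v t \<noteq> 0" unfolding W1_def W2_def by auto
    have t: "t \<in> H" using insert.prems by simp
    have "W1 \<subseteq> span (insert v B)"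
    proof
      fix w assume w: "w \<in> W1"
      define c where "c = Q w t / Q v t"
      have m: "v \<in> H" "w \<in> H" "v \<in> W" "w \<in> W" using v w W(2) unfolding W1_def by auto
      have "Q (w + (- c) *\<^sub>R v) s = Q w s - c * Q v s" if "s \<in> H" for s
        using sym_bilinear_onD(2)[OF Q m(2) _ that, of "(- c) *\<^sub>R v"] m H
          sym_bilinear_onD(3)[OF Q m(1) that, of "- c"] real_vector.subspace_scale[OF H m(1), of "- c"] by simp
      moreover have "w + (- c) *\<^sub>R v \<in> W"
        using m sW real_vector.subspace_add real_vector.subspace_scale by blast
      ultimately have "w + (- c) *\<^sub>R v \<in> W2"
        using v w insert.prems unfolding W1_def W2_def by (auto simp: c_def)
      then show "w \<in> span (insert v B)"
        using B(3) by (auto simp: real_vector.span_insert intro!: exI[of _ c])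
    qed
    then have "dim W1 \<le> card (insert v B)" using B(1) by (intro real_vector.dim_le_card) auto
    also have "\<dots> \<le> dim W2 + 1" using B by (simp add: card_insert_if)
    finally show ?thesis .
  qed
  moreover have "dim W \<le> dim W1 + card T" using insert unfolding W1_def by auto
  ultimately show ?case using insert.hyps unfolding W1_def W2_def by simp
qed

text \<open>
  If \<open>Q x y \<noteq> 0\<close>, the values of the form on the line
  \<open>c *\<^sub>R x + y\<close> would be a nonconstant affine function of \<open>c\<close>, and
  so positive somewhere.
\<close>

lemma nonpos_null_orthogonal:
  assumes Q: "sym_bilinear_on W Q" and W: "subspace W" "nonpos_on W Q"
    and x: "x \<in> W" "Q x x = 0" and y: "y \<in> W"
  shows "Q x y = 0"
proof (rule ccontr)
  assume neg: "Q x y \<noteq> 0"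
  \<comment> \<open>the solution of \<open>2 * c * Q x y + Q y y = 1\<close>\<close>
  define c where "c = (1 - Q y y) / (2 * Q x y)"
  have m: "c *\<^sub>R x \<in> W" using x W real_vector.subspace_scale by blast
  have "Q (c *\<^sub>R x + y) (c *\<^sub>R x + y) = c\<^sup>2 * Q x x + 2 * (c * Q x y) + Q y y"
    using sym_bilinear_add_sq[OF Q W(1) m y] sym_bilinear_scale_sq[OF Q W(1) x(1), of c]
      sym_bilinear_onD(3)[OF Q x(1) y] by simp
  also have "\<dots> = 1" using neg x(2) by (simp add: c_def field_simps)
  finally have "Q (c *\<^sub>R x + y) (c *\<^sub>R x + y) = 1" .
  moreover have "c *\<^sub>R x + y \<in> W" using m y W(1) real_vector.subspace_add by blast
  ultimately show False using W(2) unfolding nonpos_on_def by force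
qed

text \<open>
  Let \<open>W\<close> be nonpositive and \<open>C\<close> a complement of
  \<open>W \<inter> J\<close> in \<open>J\<close>. Imposing orthogonality to \<open>C\<close> on
  \<open>W\<close> costs at most \<open>dim C\<close> dimensions and leaves a space
  \<open>W0\<close>. It is orthogonal to all of \<open>J\<close>, as the null vectors in
  \<open>W \<inter> J\<close> are orthogonal to \<open>W\<close> already. Adding the isotropic space
  \<open>C\<close> to \<open>W0\<close> restores the lost dimensions and keeps the form nonpositive,
  now within the complement of \<open>J\<close>.
\<close>

lemma max_nonpos_dim_isotropic_complement:
  fixes H :: "'v::real_vector set"
  assumes Q: "sym_bilinear_on H Q" and H: "subspace H" and J: "findim J" "J \<subseteq> H"
    and iso: "\<And>x y. x \<in> J \<Longrightarrow> y \<in> J \<Longrightarrow> Q x y = 0"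
    and n: "max_nonpos_dim {w \<in> H. \<forall>j\<in>J. Q w j = 0} Q n"
  shows "max_nonpos_dim H Q n"
  unfolding max_nonpos_dim_def
proof (intro conjI allI impI)
  show "\<exists>W. findim W \<and> W \<subseteq> H \<and> nonpos_on W Q \<and> dim W = n"
    using n unfolding max_nonpos_dim_def by blast
next
  fix W assume W: "findim W" "W \<subseteq> H" "nonpos_on W Q"
  have sW: "subspace W" and sJ: "subspace J" using W J by (simp_all add: findim_subspace)
  have sWJ: "subspace (W \<inter> J)" using sW sJ by (rule real_vector.subspace_inter)
  obtain C where C: "findim C" "C \<subseteq> J" "(W \<inter> J) \<inter> C \<subseteq> {0}"
      "dim (W \<inter> J) + dim C = dim J" "span ((W \<inter> J) \<union> C) = J"
    using findim_complement[OF J(1) sWJ Int_lower2] .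
  obtain T where T: "finite T" "independent T" "span T = C" "card T = dim C"
    using findim_basis[OF C(1)] by blast
  have TC: "T \<subseteq> C" using T(3) real_vector.span_superset[of T] by auto
  have TH: "T \<subseteq> H" using TC C(2) J(2) by auto
  define W0 where "W0 = {w \<in> W. \<forall>t\<in>T. Q w t = 0}"
  have le: "dim W \<le> dim W0 + dim C"
    using dim_le_kernel[OF Q H W(1,2) T(1) TH] T(4) unfolding W0_def by simp
  have W0J: "Q w j = 0" if w: "w \<in> W0" and j: "j \<in> J" for w j
  proof -
    have wW: "w \<in> W" "w \<in> H" using w W(2) unfolding W0_def by auto
    have "j \<in> span ((W \<inter> J) \<union> C)" using j C(5) by simp
    then obtain a c where ac: "a \<in> W \<inter> J" "c \<in> C" "j = a + c"
      by (rule span_Un_E[OF sWJ findim_subspace[OF C(1)]])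
    have mem: "a \<in> H" "c \<in> H" using ac C(2) J(2) by auto
    obtain r where r: "c = (\<Sum>b\<in>T. r b *\<^sub>R b)" using span_finite_sum[OF T(1)] ac(2) T(3) by blast
    have "Q w c = (\<Sum>b\<in>T. r b * Q w b)"
      unfolding r using sym_bilinear_sum(2)[OF Q H T(1), of "\<lambda>b. b"] TH wW(2) by blast
    also have "\<dots> = 0" using w unfolding W0_def by simp
    finally have "Q w c = 0" .
    moreover have "Q a w = 0"
      using nonpos_null_orthogonal[OF sym_bilinear_on_subset[OF Q W(2)] sW W(3)] ac(1) iso wW(1) by blast
    then have "Q w a = 0" using sym_bilinear_onD(1)[OF Q wW(2) mem(1)] by simp
    ultimately show ?thesis
      using sym_bilinear_right(1)[OF Q H mem wW(2)] ac(3) by simp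
  qed
  have sW0: "subspace W0"
    unfolding real_vector.subspace_def W0_def
    using sW W(2) TH sym_bilinear_right(3)[OF Q H] sym_bilinear_onD(2,3)[OF Q]
    by (auto simp: real_vector.subspace_0 real_vector.subspace_add real_vector.subspace_scale subset_iff)
  have fW0: "findim W0" using findim_subset[OF W(1) sW0] unfolding W0_def by auto
  define W' where "W' = span (W0 \<union> C)"
  have W'eq: "W' = {a + b |a b. a \<in> W0 \<and> b \<in> C}"
    unfolding W'_def using sW0 findim_subspace[OF C(1)] by (rule span_Un_subspaces)
  have "W0 \<inter> C \<subseteq> {0}" using C(2,3) unfolding W0_def by auto
  then have dW': "dim W' = dim W0 + dim C" unfolding W'_def by (rule dim_direct_sum[OF fW0 C(1)])
  have "W' \<subseteq> {w \<in> H. \<forall>j\<in>J. Q w j = 0} \<and> nonpos_on W' Q"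
  proof -
    have "Q x x \<le> 0 \<and> x \<in> H \<and> (\<forall>j\<in>J. Q x j = 0)" if x: "x \<in> W'" for x
    proof -
      obtain a b where ab: "x = a + b" "a \<in> W0" "b \<in> C" using x W'eq by blast
      have m: "a \<in> H" "b \<in> H" "a \<in> W" "b \<in> J" using ab W(2) C(2) J(2) unfolding W0_def by auto
      have "Q x x = Q a a + 2 * Q a b + Q b b"
        unfolding ab(1) by (rule sym_bilinear_add_sq[OF Q H m(1,2)])
      also have "\<dots> = Q a a" using W0J[OF ab(2) m(4)] iso[OF m(4,4)] by simp
      also have "\<dots> \<le> 0" using W(3) m(3) unfolding nonpos_on_def by blast
      finally have 1: "Q x x \<le> 0" .
      have 2: "x \<in> H" unfolding ab(1) using H m(1,2) by (simp add: real_vector.subspace_add)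
      have "Q x j = 0" if j: "j \<in> J" for j
        using sym_bilinear_onD(2)[OF Q m(1,2), of j] W0J[OF ab(2) j] iso[OF m(4) j] j J(2) ab(1) by auto
      then show ?thesis using 1 2 by blast
    qed
    then show ?thesis unfolding nonpos_on_def by blast
  qed
  moreover have "findim W'" unfolding W'_def using fW0 C(1) by (rule findim_span_Un)
  ultimately have "dim W' \<le> n" using max_nonpos_dimD[OF n] by blast
  then show "dim W \<le> n" using le dW' by simp
qed

lemma max_nonpos_dim_image:
  fixes u :: "'v::real_vector \<Rightarrow> 'w::real_vector"
  assumes U: "subspace U" and add: "\<And>x y. x \<in> U \<Longrightarrow> y \<in> U \<Longrightarrow> u (x + y) = u x + u y"
    and scale: "\<And>c x. x \<in> U \<Longrightarrow> u (c *\<^sub>R x) = c *\<^sub>R u x"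
    and inj: "\<And>x. x \<in> U \<Longrightarrow> u x = 0 \<Longrightarrow> x = 0"
    and \<tau>: "\<And>x. x \<in> U \<Longrightarrow> \<tau> x x = Q (u x) (u x)"
    and n: "max_nonpos_dim U \<tau> n"
  shows "max_nonpos_dim (u ` U) Q n"
  unfolding max_nonpos_dim_def
proof (intro conjI allI impI)
  obtain W where W: "findim W" "W \<subseteq> U" "nonpos_on W \<tau>" "dim W = n"
    using n unfolding max_nonpos_dim_def by blast
  have "findim (u ` W)" "dim (u ` W) = dim W"
    by (rule dim_linear_image[OF W(1)]; use add scale inj W(2) in blast)+
  moreover have "nonpos_on (u ` W) Q" using W(2,3) \<tau> unfolding nonpos_on_def by force
  ultimately show "\<exists>W. findim W \<and> W \<subseteq> u ` U \<and> nonpos_on W Q \<and> dim W = n"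
    using W by (intro exI[of _ "u ` W"]) auto
next
  fix W assume W: "findim W" "W \<subseteq> u ` U" "nonpos_on W Q"
  have sW: "subspace W" using W by (simp add: findim_subspace)
  have u0: "u 0 = 0" using scale[of 0 0] U by (simp add: real_vector.subspace_0)
  define W' where "W' = {x \<in> U. u x \<in> W}"
  have W'U: "W' \<subseteq> U" unfolding W'_def by blast
  have sW': "subspace W'"
    unfolding real_vector.subspace_def W'_def using U sW add scale u0
    by (auto simp: real_vector.subspace_0 real_vector.subspace_add real_vector.subspace_scale)
  have img: "u ` W' = W" using W(2) unfolding W'_def by auto
  have "findim W'" "dim (u ` W') = dim W'"
    by (rule findim_injective_preimage[OF sW' _ _ _ W(1)]; use add scale inj img W'U in blast)+
  moreover have "nonpos_on W' \<tau>" using W(3) \<tau> unfolding nonpos_on_def W'_def by simp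
  ultimately show "dim W \<le> n" using max_nonpos_dimD[OF n _ W'U] img by simp
qed

lemma max_nonpos_dim_sum:
  fixes Hs :: "'k \<Rightarrow> 'v::real_vector set"
  assumes Q: "sym_bilinear_on H Q" and H: "subspace H" and K: "finite K"
    and Hs: "\<And>k. k \<in> K \<Longrightarrow> subspace (Hs k)" "\<And>k. k \<in> K \<Longrightarrow> Hs k \<subseteq> H"
    and orth: "\<And>j k x y. j \<in> K \<Longrightarrow> k \<in> K \<Longrightarrow> j \<noteq> k \<Longrightarrow> x \<in> Hs j \<Longrightarrow> y \<in> Hs k \<Longrightarrow> Q x y = 0"
    and int: "\<And>F k. F \<subseteq> K \<Longrightarrow> k \<in> K \<Longrightarrow> k \<notin> F \<Longrightarrow> Hs k \<inter> span (\<Union>j\<in>F. Hs j) \<subseteq> {0}"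
    and n: "\<And>k. k \<in> K \<Longrightarrow> max_nonpos_dim (Hs k) Q (n k)"
  shows "max_nonpos_dim (span (\<Union>k\<in>K. Hs k)) Q (\<Sum>k\<in>K. n k)"
proof -
  have "max_nonpos_dim (span (\<Union>k\<in>F. Hs k)) Q (\<Sum>k\<in>F. n k)" if "finite F" "F \<subseteq> K" for F
    using that
  proof (induction F rule: finite_induct)
    case empty
    have "Q 0 0 = 0" using sym_bilinear_right(3)[OF Q H, of 0] H by (simp add: real_vector.subspace_0)
    then have "findim {0::'v}" "nonpos_on {0} Q"
      using findim_span[of "{}::'v set"] by (auto simp: nonpos_on_def)
    moreover have "dim W = 0" if "W \<subseteq> {0}" for W :: "'v set"
      using that dim_pos_nonzero[of W] by blast
    ultimately show ?case unfolding max_nonpos_dim_def by auto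
  next
    case (insert k F)
    let ?S = "span (\<Union>j\<in>F. Hs j)"
    have k: "k \<in> K" and F: "F \<subseteq> K" using insert.prems by auto
    have SH: "?S \<subseteq> H" using Hs(2) F by (intro real_vector.span_minimal[OF _ H]) auto
    have o: "Q x y = 0" if x: "x \<in> Hs k" and y: "y \<in> ?S" for x y
    proof -
      have xH: "x \<in> H" using x Hs(2)[OF k] by blast
      have "subspace {y \<in> H. Q x y = 0}"
        unfolding real_vector.subspace_def
        using H xH sym_bilinear_right[OF Q H]
        by (auto simp: real_vector.subspace_0 real_vector.subspace_add real_vector.subspace_scale)
      then have "?S \<subseteq> {y \<in> H. Q x y = 0}"
      proof (rule real_vector.span_minimal[rotated], intro UN_least subsetI)
        fix j z assume "j \<in> F" "z \<in> Hs j"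
        then show "z \<in> {y \<in> H. Q x y = 0}" using orth[OF k _ _ x] F Hs(2) insert.hyps by blast
      qed
      then show ?thesis using y by blast
    qed
    have "max_nonpos_dim (span (Hs k \<union> ?S)) Q (n k + (\<Sum>j\<in>F. n j))"
    proof (rule max_nonpos_dim_orthogonal_sum[OF Q H Hs(1)[OF k] Hs(2)[OF k]])
      show "Hs k \<inter> ?S \<subseteq> {0}" using int[OF F k insert.hyps(2)] .
    qed (use SH o n[OF k] insert in \<open>auto intro: real_vector.subspace_span\<close>)
    moreover have "span (Hs k \<union> ?S) = span (\<Union>j\<in>insert k F. Hs j)"
      using span_Un_spans[of "Hs k" "\<Union>j\<in>F. Hs j"] real_vector.span_eq_iff[THEN iffD2, OF Hs(1)[OF k]]
      by simp
    ultimately show ?case using insert.hyps by simp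
  qed
  then show ?thesis using K by blast
qed

text \<open>
  The variational description of index plus nullity for a form \<open>a\<close> with eigenspaces
  \<open>J l\<close> relative to a positive form \<open>p\<close>. The assumptions
  \<open>bounded\<close> and \<open>crossing\<close> take the place of compactness; they are to be
  supplied by the crossing argument.
\<close>

locale spectral_form =
  fixes H :: "'v::real_vector set" and a p :: "'v \<Rightarrow> 'v \<Rightarrow> real" and J :: "real \<Rightarrow> 'v set" and M :: nat
  assumes H: "subspace H" and a: "sym_bilinear_on H a" and p: "sym_bilinear_on H p"
    and p_pos: "\<And>x. x \<in> H \<Longrightarrow> x \<noteq> 0 \<Longrightarrow> 0 < p x x"
    and J: "\<And>l. subspace (J l)" "\<And>l. J l \<subseteq> H"
    and J_eigen: "\<And>l x y. x \<in> J l \<Longrightarrow> y \<in> H \<Longrightarrow> a x y = l * p x y"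
    and bounded: "\<And>W. findim W \<Longrightarrow> W \<subseteq> H \<Longrightarrow> nonpos_on W a \<Longrightarrow> dim W \<le> M"
    and crossing: "\<And>W. findim W \<Longrightarrow> W \<subseteq> H \<Longrightarrow> nonpos_on W a \<Longrightarrow>
      \<exists>F. finite F \<and> F \<subseteq> {..0} \<and> dim W \<le> (\<Sum>l\<in>F. dim (J l))"
begin

definition E :: "real set \<Rightarrow> 'v set"
  where "E S = span (\<Union>l\<in>S. J l)"

lemma E_subset: "E S \<subseteq> H"
  unfolding E_def using J(2) by (intro real_vector.span_minimal[OF _ H]) auto

lemma subspace_E: "subspace (E S)"
  unfolding E_def by (rule real_vector.subspace_span)

lemma E_mono: "S \<subseteq> T \<Longrightarrow> E S \<subseteq> E T"
  unfolding E_def by (intro real_vector.span_mono) auto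

lemma E_singleton: "E {l} = J l"
  unfolding E_def using J(1)[of l] by (simp add: real_vector.span_eq_iff)

lemma E_Un: "E (S \<union> T) = span (E S \<union> E T)"
  unfolding E_def span_Un_spans by (simp add: UN_Un)

text \<open>
  The scalars \<open>1\<close> give the sum the form to which bilinearity applies.
\<close>

lemma E_sum:
  assumes "x \<in> E S"
  shows "\<exists>F f. finite F \<and> F \<subseteq> S \<and> (\<forall>l\<in>F. f l \<in> J l) \<and> x = (\<Sum>l\<in>F. 1 *\<^sub>R f l)"
  using assms unfolding E_def
proof (induction rule: real_vector.span_induct_alt)
  case base
  show ?case by (intro exI[of _ "{}"]) simp
next
  case (step c x y)
  then obtain l F f where l: "l \<in> S" "x \<in> J l"
    and F: "finite F" "F \<subseteq> S" "\<forall>l\<in>F. f l \<in> J l" "y = (\<Sum>l\<in>F. 1 *\<^sub>R f l)" by auto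
  define g where "g = f(l := c *\<^sub>R x + (if l \<in> F then f l else 0))"
  have "\<forall>k\<in>insert l F. g k \<in> J k"
    using F(3) l J(1) unfolding g_def
    by (auto simp: real_vector.subspace_add real_vector.subspace_scale)
  moreover have "c *\<^sub>R x + y = (\<Sum>k\<in>insert l F. 1 *\<^sub>R g k)"
  proof -
    have "(\<Sum>k\<in>F - {l}. g k) = (\<Sum>k\<in>F - {l}. f k)" by (rule sum.cong) (auto simp: g_def)
    moreover have "(\<Sum>k\<in>insert l F. g k) = g l + (\<Sum>k\<in>F - {l}. g k)"
      using F(1) by (metis sum.insert_remove)
    moreover have "(\<Sum>k\<in>F. f k) = (if l \<in> F then f l else 0) + (\<Sum>k\<in>F - {l}. f k)"
      using F(1) by (simp add: sum.remove)
    ultimately show ?thesis using F(4) by (simp add: g_def)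
  qed
  ultimately show ?case using F(1,2) l(1) by (intro exI[of _ "insert l F"] exI[of _ g]) auto
qed

lemma J_orthogonal:
  assumes "x \<in> J l" "y \<in> J m" "l \<noteq> m"
  shows "p x y = 0"
proof -
  have m: "x \<in> H" "y \<in> H" using assms J(2) by auto
  have "l * p x y = a x y" using J_eigen[OF assms(1) m(2)] by simp
  also have "\<dots> = a y x" using sym_bilinear_onD(1)[OF a] m by blast
  also have "\<dots> = m * p y x" using J_eigen[OF assms(2) m(1)] .
  also have "p y x = p x y" using sym_bilinear_onD(1)[OF p] m by blast
  finally show ?thesis using assms(3) by simp
qed

lemma E_orthogonal:
  assumes "x \<in> E S" "y \<in> E T" "S \<inter> T = {}"
  shows "p x y = 0"
proof -
  obtain F f where F: "finite F" "F \<subseteq> S" "\<forall>l\<in>F. f l \<in> J l" "x = (\<Sum>l\<in>F. 1 *\<^sub>R f l)"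
    using E_sum[OF assms(1)] by blast
  obtain G g where G: "finite G" "G \<subseteq> T" "\<forall>l\<in>G. g l \<in> J l" "y = (\<Sum>l\<in>G. 1 *\<^sub>R g l)"
    using E_sum[OF assms(2)] by blast
  have y: "y \<in> H" using assms(2) E_subset by blast
  have f: "f l \<in> H" if "l \<in> F" for l using F(3) J(2) that by blast
  have g: "g l \<in> H" if "l \<in> G" for l using G(3) J(2) that by blast
  have "p x y = (\<Sum>l\<in>F. 1 * p (f l) y)"
    unfolding F(4) by (rule sym_bilinear_sum(1)[OF p H F(1) f y])
  also have "\<dots> = (\<Sum>l\<in>F. 1 * (\<Sum>k\<in>G. 1 * p (f l) (g k)))"
    unfolding G(4) by (intro sum.cong refl arg_cong2[of _ _ _ _ "(*)"] sym_bilinear_sum(2)[OF p H G(1) g f])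
  also have "\<dots> = 0"
    using F(2,3) G(2,3) assms(3) by (simp, intro sum.neutral ballI) (auto intro!: sum.neutral J_orthogonal)
  finally show ?thesis .
qed

lemma E_disjoint:
  assumes "S \<inter> T = {}"
  shows "E S \<inter> E T \<subseteq> {0}"
proof
  fix x assume "x \<in> E S \<inter> E T"
  then have "p x x = 0" "x \<in> H" using E_orthogonal[of x S x T] assms E_subset[of S] by auto
  then show "x \<in> {0}" using p_pos[of x] by auto
qed

lemma E_nonpos:
  assumes "S \<subseteq> {..0}"
  shows "nonpos_on (E S) a"
  unfolding nonpos_on_def
proof
  fix x assume xE: "x \<in> E S"
  obtain F f where F: "finite F" "F \<subseteq> S" "\<forall>l\<in>F. f l \<in> J l" "x = (\<Sum>l\<in>F. 1 *\<^sub>R f l)"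
    using E_sum[OF xE] by blast
  have x: "x \<in> H" using xE E_subset[of S] by (rule rev_subsetD)
  have f: "f l \<in> H" if "l \<in> F" for l using F(3) J(2) that by blast
  have "a x x = (\<Sum>l\<in>F. 1 * a (f l) x)"
    by (subst F(4), rule sym_bilinear_sum(1)[OF a H F(1) f x])
  also have "\<dots> \<le> 0"
  proof (rule sum_nonpos)
    fix l assume l: "l \<in> F"
    have "p (f l) x = (\<Sum>k\<in>F. 1 * p (f l) (f k))"
      unfolding F(4) by (rule sym_bilinear_sum(2)[OF p H F(1) f f[OF l]])
    also have "\<dots> = (\<Sum>k\<in>F. if k = l then p (f l) (f l) else 0)"
      using F(3) l by (intro sum.cong) (auto intro: J_orthogonal)
    also have "\<dots> = p (f l) (f l)" using F(1) l by simp
    finally have "p (f l) x = p (f l) (f l)" .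
    moreover have "p (f l) (f l) \<ge> 0"
      using p_pos[OF f[OF l]] sym_bilinear_right(3)[OF p H, of 0] H
      by (cases "f l = 0") (auto simp: real_vector.subspace_0)
    moreover have "l \<le> 0" using l F(2) assms by auto
    ultimately show "1 * a (f l) x \<le> 0"
      using J_eigen[of "f l" l x] F(3) l x by (simp add: mult_nonpos_nonneg)
  qed
  finally show "a x x \<le> 0" .
qed

text \<open>
  Independent vectors in \<open>E S\<close> span nonpositive subspaces, so there are at most
  \<open>M\<close> of them.
\<close>

lemma findim_E:
  assumes "S \<subseteq> {..0}"
  shows "findim (E S)"
proof -
  obtain B where B: "B \<subseteq> E S" "independent B" "E S \<subseteq> span B"
    using real_vector.maximal_independent_subset[of "E S"] by blast
  have card: "card A \<le> M" if "A \<subseteq> B" "finite A" for A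
  proof -
    have i: "independent A" using real_vector.independent_mono[OF B(2) that(1)] .
    have s: "span A \<subseteq> E S" using that(1) B(1) by (intro real_vector.span_minimal[OF _ subspace_E]) auto
    then have "nonpos_on (span A) a" using E_nonpos[OF assms] unfolding nonpos_on_def by blast
    then have "dim (span A) \<le> M"
      using s E_subset by (intro bounded findim_span that(2)) auto
    then show ?thesis using real_vector.dim_span_eq_card_independent[OF i] by simp
  qed
  have "finite B"
  proof (rule ccontr)
    assume "infinite B"
    then obtain A where "A \<subseteq> B" "finite A" "card A = Suc M"
      using infinite_arbitrarily_large by blast
    then show False using card[of A] by simp
  qed
  then show ?thesis unfolding findim_def using B(3) subspace_E by blast
qed

lemma dim_E_Un:
  assumes "S \<subseteq> {..0}" "T \<subseteq> {..0}" "S \<inter> T = {}"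
  shows "dim (E (S \<union> T)) = dim (E S) + dim (E T)"
  unfolding E_Un by (rule dim_direct_sum[OF findim_E findim_E E_disjoint]) fact+

lemma dim_E_finite:
  assumes "finite F" "F \<subseteq> {..0}"
  shows "dim (E F) = (\<Sum>l\<in>F. dim (J l))"
  using assms
proof (induction F rule: finite_induct)
  case empty
  have "dim (E {}) \<le> card ({}::'v set)" unfolding E_def by (rule real_vector.dim_le_card) auto
  then show ?case by simp
next
  case (insert l F)
  then have "dim (E ({l} \<union> F)) = dim (E {l}) + dim (E F)" by (intro dim_E_Un) auto
  then show ?case using insert by (simp add: E_singleton)
qed

text \<open>
  The span of all eigenspaces with \<open>l \<le> 0\<close> is nonpositive, and by
  \<open>crossing\<close> any other nonpositive subspace is no larger than the span of finitely many
  of them.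
\<close>

theorem max_nonpos_dim_eigenspaces:
  "max_nonpos_dim H a (dim (E {..<0}) + dim (J 0))"
proof -
  have *: "dim (E {..<0}) + dim (J 0) = dim (E {..0})"
  proof -
    have "{..<0} \<union> {0} = {..0::real}" by auto
    moreover have "dim (E ({..<0} \<union> {0})) = dim (E {..<0}) + dim (E {0})" by (rule dim_E_Un) auto
    ultimately show ?thesis using E_singleton[of 0] by simp
  qed
  show ?thesis unfolding * max_nonpos_dim_def
  proof (intro conjI allI impI)
    show "\<exists>W. findim W \<and> W \<subseteq> H \<and> nonpos_on W a \<and> dim W = dim (E {..0})"
      using findim_E[of "{..0}"] E_subset[of "{..0}"] E_nonpos[of "{..0}"] by auto
    fix W assume W: "findim W" "W \<subseteq> H" "nonpos_on W a"
    obtain F where F: "finite F" "F \<subseteq> {..0}" "dim W \<le> (\<Sum>l\<in>F. dim (J l))"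
      using crossing[OF W] by blast
    then have "dim W \<le> dim (E F)" using dim_E_finite by simp
    also have "\<dots> \<le> dim (E {..0})"
      using findim_dim_mono[OF findim_E subspace_E] E_mono F(2) by blast
    finally show "dim W \<le> dim (E {..0})" .
  qed
qed

text \<open>
  Distinct negative eigenvalues contribute independent dimensions to a finite-dimensional space, so
  there are finitely many of them and the sum is over a finite set.
\<close>

lemma dim_E_neg:
  defines "N \<equiv> {l. l < 0 \<and> (\<exists>x\<in>J l. x \<noteq> 0)}"
  shows "dim (E {..<0}) = (\<Sum>l\<in>N. dim (J l))"
proof -
  have N: "N \<subseteq> {..<0}" "N \<subseteq> {..0}" unfolding N_def by auto
  have card: "card F \<le> dim (E {..<0})" if F: "F \<subseteq> N" "finite F" for F
  proof -
    have F0: "F \<subseteq> {..0}" using F N by blast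
    have "1 \<le> dim (J l)" if l: "l \<in> F" for l
    proof (rule ccontr)
      assume "\<not> 1 \<le> dim (J l)"
      have f: "findim (J l)" using findim_E[of "{l}"] E_singleton[of l] F0 l by auto
      obtain B where B: "finite B" "independent B" "span B = J l" "card B = dim (J l)"
        using findim_basis[OF f] .
      have "card B = 0" using B(4) \<open>\<not> 1 \<le> dim (J l)\<close> by linarith
      then have "B = {}" using B(1) by simp
      then have "J l = {0}" using B(3) by simp
      then show False using l F(1) unfolding N_def by auto
    qed
    then have "(\<Sum>l\<in>F. 1) \<le> (\<Sum>l\<in>F. dim (J l))" by (intro sum_mono) auto
    then have "card F \<le> dim (E F)" using dim_E_finite[OF F(2) F0] by simp
    also have "\<dots> \<le> dim (E {..<0})"
    proof (rule findim_dim_mono[OF findim_E subspace_E E_mono])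
      show "F \<subseteq> {..<0}" using F N by blast
    qed auto
    finally show ?thesis .
  qed
  have fin: "finite N"
  proof (rule ccontr)
    assume inf: "infinite N"
    obtain F where "finite F" "card F = Suc (dim (E {..<0}))" "F \<subseteq> N"
      using infinite_arbitrarily_large[OF inf, of "Suc (dim (E {..<0}))"] by blast
    then show False using card[of F] by simp
  qed
  have "E N = E {..<0}"
  proof
    show "E N \<subseteq> E {..<0}" using N(1) by (rule E_mono)
    have "J l \<subseteq> E N" if "l < 0" for l
    proof (cases "l \<in> N")
      case True
      then show ?thesis using E_mono[of "{l}" N] E_singleton by auto
    next
      case False
      then have "J l \<subseteq> {0}" using that unfolding N_def by auto
      then show ?thesis using subspace_E[of N] real_vector.subspace_0 by blast
    qed
    then have "(\<Union>l\<in>{..<0}. J l) \<subseteq> E N" by auto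
    then show "E {..<0} \<subseteq> E N"
      unfolding E_def[of "{..<0}"] by (rule real_vector.span_minimal[OF _ subspace_E])
  qed
  then show ?thesis using dim_E_finite[OF fin N(2)] by simp
qed

end

section \<open>Smooth functions on the unit interval\<close>

text \<open>
  Differentiability of order \<open>n\<close> on \<open>[0,1]\<close>, with no continuity required
  of the last derivative. All orders together amount to \<open>smooth01\<close>, and products and
  solutions of equations are handled by induction on \<open>n\<close>.
\<close>

primrec Ck :: "nat \<Rightarrow> (real \<Rightarrow> real) \<Rightarrow> bool" where
  "Ck 0 f \<longleftrightarrow> True"
| "Ck (Suc n) f \<longleftrightarrow>
    (\<exists>g. (\<forall>t\<in>{0..1}. (f has_real_derivative g t) (at t within {0..1})) \<and> Ck n g)"

lemma deriv01_eq:
  assumes "(f has_real_derivative D) (at t within {0..1})" "t \<in> {0..1}"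
  shows "deriv01 f t = D"
  using assms vector_derivative_within_closed_interval[of 0 1 t f D]
  by (simp add: has_real_derivative_iff_has_vector_derivative)

lemma deriv01_cong:
  fixes f g :: "real \<Rightarrow> 'a::real_normed_vector"
  assumes "\<And>s. s \<in> {0..1} \<Longrightarrow> f s = g s" "t \<in> {0..1}"
  shows "deriv01 f t = deriv01 g t"
proof -
  have "(f has_vector_derivative D) (at t within {0..1}) \<longleftrightarrow> (g has_vector_derivative D) (at t within {0..1})" for D
    using has_derivative_transform[of t "{0..1}" g f "\<lambda>x. x *\<^sub>R D"]
      has_derivative_transform[of t "{0..1}" f g "\<lambda>x. x *\<^sub>R D"] assms
    unfolding has_vector_derivative_def by auto
  then show ?thesis unfolding vector_derivative_def by simp
qed

lemma deriv01_zero: "t \<in> {0..1} \<Longrightarrow> deriv01 (\<lambda>s. 0 :: real) t = 0"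
  by (rule deriv01_eq[OF DERIV_const])

lemma has_derivative_cong01:
  assumes "(f has_real_derivative D) (at t within {a..b})" "t \<in> {a..b}" "\<And>s. s \<in> {a..b} \<Longrightarrow> g s = f s"
  shows "(g has_real_derivative D) (at t within {a..b})"
  using has_derivative_transform[of t "{a..b}" g f "(*) D"] assms
  unfolding has_field_derivative_def by simp

lemma Ck_cong:
  assumes "\<And>t. t \<in> {0..1} \<Longrightarrow> g t = f t" "Ck n f"
  shows "Ck n g"
proof (cases n)
  case (Suc m)
  then obtain h where h: "\<forall>t\<in>{0..1}. (f has_real_derivative h t) (at t within {0..1})" "Ck m h"
    using assms(2) by auto
  have "\<forall>t\<in>{0..1}. (g has_real_derivative h t) (at t within {0..1})"
    using h(1) assms(1) has_derivative_cong01 by blast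
  then show ?thesis using Suc h(2) by auto
qed simp

lemma Ck_SucD: "Ck (Suc n) f \<Longrightarrow> Ck n f"
proof (induction n arbitrary: f)
  case (Suc n)
  then obtain h where h: "\<forall>t\<in>{0..1}. (f has_real_derivative h t) (at t within {0..1})" "Ck (Suc n) h"
    by (auto simp only: Ck.simps)
  then have "Ck n h" using Suc.IH by blast
  then show ?case using h(1) by (auto simp only: Ck.simps)
qed simp

lemma Ck_add: "Ck n f \<Longrightarrow> Ck n g \<Longrightarrow> Ck n (\<lambda>t. f t + g t)"
proof (induction n arbitrary: f g)
  case (Suc n)
  then obtain f' g' where "\<forall>t\<in>{0..1}. (f has_real_derivative f' t) (at t within {0..1})" "Ck n f'"
    "\<forall>t\<in>{0..1}. (g has_real_derivative g' t) (at t within {0..1})" "Ck n g'" by auto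
  then show ?case using Suc.IH[of f' g']
    by (auto intro!: exI[of _ "\<lambda>t. f' t + g' t"] derivative_intros)
qed simp

lemma Ck_mult: "Ck n f \<Longrightarrow> Ck n g \<Longrightarrow> Ck n (\<lambda>t. f t * g t)"
proof (induction n arbitrary: f g)
  case (Suc n)
  then obtain f' g' where d: "\<forall>t\<in>{0..1}. (f has_real_derivative f' t) (at t within {0..1})" "Ck n f'"
    "\<forall>t\<in>{0..1}. (g has_real_derivative g' t) (at t within {0..1})" "Ck n g'" by auto
  have "Ck n (\<lambda>t. f t * g' t + f' t * g t)"
    using Suc.IH[of f g'] Suc.IH[of f' g] d Ck_SucD[OF Suc.prems(1)] Ck_SucD[OF Suc.prems(2)]
    by (intro Ck_add) auto
  moreover have "\<forall>t\<in>{0..1}. ((\<lambda>t. f t * g t) has_real_derivative f t * g' t + f' t * g t) (at t within {0..1})"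
    using d by (auto intro!: derivative_eq_intros)
  ultimately show ?case by (auto intro!: exI[of _ "\<lambda>t. f t * g' t + f' t * g t"])
qed simp

lemma Ck_const: "Ck n (\<lambda>t. c)"
proof (induction n arbitrary: c)
  case (Suc n)
  then show ?case by (auto intro!: exI[of _ "\<lambda>t. 0"] derivative_eq_intros)
qed simp

lemma smooth01_iff_Ck: "smooth01 f \<longleftrightarrow> (\<forall>n. Ck n f)"
proof
  assume "smooth01 f"
  then obtain D where D: "D 0 = f"
    "\<And>k t. t \<in> {0..1} \<Longrightarrow> (D k has_real_derivative D (Suc k) t) (at t within {0..1})"
    unfolding smooth01_def has_real_derivative_iff_has_vector_derivative by blast
  have "Ck n (D k)" for n k
  proof (induction n arbitrary: k)
    case (Suc n)
    then show ?case unfolding Ck.simps using D(2) by (intro exI[of _ "D (Suc k)"]) blast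
  qed simp
  then show "\<forall>n. Ck n f" using D(1) by auto
next
  assume f: "\<forall>n. Ck n f"
  define D where "D k = (deriv01 ^^ k) f" for k
  have D: "Ck n (D k)" for n k
  proof (induction k arbitrary: n)
    case 0
    then show ?case using f by (simp add: D_def)
  next
    case (Suc k)
    obtain g where g: "\<forall>t\<in>{0..1}. (D k has_real_derivative g t) (at t within {0..1})" "Ck n g"
      using Suc.IH[of "Suc n"] by auto
    have "D (Suc k) t = g t" if "t \<in> {0..1}" for t
      using deriv01_eq[of "D k" "g t" t] g(1) that by (simp add: D_def)
    then show ?case using Ck_cong g(2) by blast
  qed
  have "(D k has_real_derivative D (Suc k) t) (at t within {0..1})" if t: "t \<in> {0..1}" for k t
  proof -
    obtain g where g: "\<forall>t\<in>{0..1}. (D k has_real_derivative g t) (at t within {0..1})"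
      using D[of "Suc 0" k] by auto
    then have "D (Suc k) t = g t" using deriv01_eq[of "D k" "g t" t] t by (simp add: D_def)
    then show ?thesis using g t by simp
  qed
  moreover have "D 0 = f" by (simp add: D_def)
  ultimately show "smooth01 f"
    unfolding smooth01_def has_real_derivative_iff_has_vector_derivative by blast
qed

lemma smooth01_cong:
  fixes f g :: "real \<Rightarrow> real"
  shows "smooth01 f \<Longrightarrow> (\<And>t. t \<in> {0..1} \<Longrightarrow> g t = f t) \<Longrightarrow> smooth01 g"
  unfolding smooth01_iff_Ck using Ck_cong[of g f] by simp

lemma smooth01_add:
  fixes f g :: "real \<Rightarrow> real"
  shows "smooth01 f \<Longrightarrow> smooth01 g \<Longrightarrow> smooth01 (\<lambda>t. f t + g t)"
  unfolding smooth01_iff_Ck using Ck_add[of _ f g] by simp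

lemma smooth01_cmult:
  fixes f :: "real \<Rightarrow> real"
  shows "smooth01 f \<Longrightarrow> smooth01 (\<lambda>t. c * f t)"
  unfolding smooth01_iff_Ck using Ck_mult[OF Ck_const[of _ c], of _ f] by simp

lemma smooth01_const: "smooth01 (\<lambda>t. c :: real)"
  unfolding smooth01_iff_Ck using Ck_const by simp

lemma smooth01_deriv:
  fixes f :: "real \<Rightarrow> real"
  assumes "smooth01 f"
  shows "\<And>t. t \<in> {0..1} \<Longrightarrow> (f has_real_derivative deriv01 f t) (at t within {0..1})"
    and "smooth01 (deriv01 f)"
proof -
  obtain D where D: "D 0 = f"
    "\<And>k t. t \<in> {0..1} \<Longrightarrow> (D k has_real_derivative D (Suc k) t) (at t within {0..1})"
    using assms unfolding smooth01_def has_real_derivative_iff_has_vector_derivative by blast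
  have eq: "deriv01 f t = D 1 t" if "t \<in> {0..1}" for t
    using deriv01_eq[OF D(2)[OF that, of 0] that] D(1) by simp
  show "(f has_real_derivative deriv01 f t) (at t within {0..1})" if "t \<in> {0..1}" for t
    using D(2)[OF that, of 0] eq[OF that] D(1) by simp
  have "smooth01 (D 1)"
    unfolding smooth01_def has_real_derivative_iff_has_vector_derivative[symmetric]
    using D(2) by (intro exI[of _ "\<lambda>k. D (Suc k)"]) auto
  then show "smooth01 (deriv01 f)" using smooth01_cong[of "D 1" "deriv01 f"] eq by simp
qed

lemma has_real_derivative_continuous_on:
  assumes "\<And>t. t \<in> S \<Longrightarrow> (f has_real_derivative f' t) (at t within S)"
  shows "continuous_on S f"
  unfolding continuous_on_eq_continuous_within using DERIV_continuous[OF assms] by blast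

lemma smooth01_continuous:
  fixes f :: "real \<Rightarrow> real"
  shows "smooth01 f \<Longrightarrow> continuous_on {0..1} f"
  using has_real_derivative_continuous_on[OF smooth01_deriv(1)] by blast

section \<open>Linear second-order equations\<close>

text \<open>
  The equation \<open>u'' = q u\<close> as a first-order system for \<open>u\<close> and its
  derivative \<open>u'\<close>.
\<close>

definition solves :: "(real \<Rightarrow> real) \<Rightarrow> (real \<Rightarrow> real) \<Rightarrow> (real \<Rightarrow> real) \<Rightarrow> bool"
  where "solves q u u' \<longleftrightarrow> (\<forall>t\<in>{0..1}.
    (u has_real_derivative u' t) (at t within {0..1}) \<and>
    (u' has_real_derivative q t * u t) (at t within {0..1}))"

lemma solves_linear:
  assumes "solves q u u'" "solves q v v'"
  shows "solves q (\<lambda>t. x * u t + y * v t) (\<lambda>t. x * u' t + y * v' t)"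
  using assms unfolding solves_def
  by (auto intro!: derivative_eq_intros simp: algebra_simps)

text \<open>
  Regularity of order \<open>n\<close> for \<open>u\<close> and \<open>u'\<close> gives regularity
  of order \<open>n\<close> for \<open>q u\<close>, the derivative of \<open>u'\<close>, and so
  order \<open>n + 1\<close> for both.
\<close>

lemma solves_smooth:
  assumes q: "smooth01 q" and u: "solves q u u'"
  shows "smooth01 u" "smooth01 u'"
proof -
  have "Ck n u \<and> Ck n u'" for n
  proof (induction n)
    case (Suc n)
    then have "Ck n (\<lambda>t. q t * u t)" using q Ck_mult unfolding smooth01_iff_Ck by blast
    then show ?case using Suc u unfolding solves_def by auto
  qed simp
  then show "smooth01 u" "smooth01 u'" unfolding smooth01_iff_Ck by auto
qed

lemma ftc_real:
  fixes f f' :: "real \<Rightarrow> real"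
  assumes "a \<le> b" "\<And>t. t \<in> {a..b} \<Longrightarrow> (f has_real_derivative f' t) (at t within {a..b})"
  shows "(f' has_integral (f b - f a)) {a..b}"
  using assms fundamental_theorem_of_calculus[of a b f f']
  by (simp add: has_real_derivative_iff_has_vector_derivative)

lemma deriv_nonneg_mono:
  fixes f f' :: "real \<Rightarrow> real"
  assumes "a \<le> b" "\<And>t. t \<in> {a..b} \<Longrightarrow> (f has_real_derivative f' t) (at t within {a..b})"
    and "\<And>t. t \<in> {a..b} \<Longrightarrow> 0 \<le> f' t"
  shows "f a \<le> f b"
  using has_integral_nonneg[OF ftc_real[OF assms(1,2)] assms(3)] by simp

text \<open>
  The function \<open>e = u\<^sup>2 + u'\<^sup>2\<close> satisfies
  \<open>\<bar>e'\<bar> \<le> K e\<close>, so multiplication by \<open>exp (- K t)\<close> makes it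
  decreasing, and multiplication by \<open>exp (K t)\<close> increasing. The first is used to the
  right of \<open>t0\<close>, the second to the left.
\<close>

lemma solves_unique:
  assumes q: "continuous_on {0..1} q" and u: "solves q u u'"
    and t0: "t0 \<in> {0..1}" "u t0 = 0" "u' t0 = 0" and t: "t \<in> {0..1}"
  shows "u t = 0" "u' t = 0"
proof -
  obtain M where M: "\<And>t. t \<in> {0..1} \<Longrightarrow> \<bar>q t\<bar> \<le> M"
  proof -
    have "bounded (q ` {0..1})" using compact_continuous_image[OF q] compact_imp_bounded by blast
    then obtain B where "\<forall>x\<in>q ` {0..1}. norm x \<le> B" unfolding bounded_iff by blast
    then show ?thesis using that[of B] by simp
  qed
  define K where "K = 1 + M"
  define e where "e t = (u t)\<^sup>2 + (u' t)\<^sup>2" for t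
  define e' where "e' t = (1 + q t) * (2 * (u t * u' t))" for t
  have e: "(e has_real_derivative e' s) (at s within {0..1})" if "s \<in> {0..1}" for s
    unfolding e_def e'_def using u that unfolding solves_def
    by (auto intro!: derivative_eq_intros simp: algebra_simps)
  have bd: "\<bar>e' s\<bar> \<le> K * e s" if "s \<in> {0..1}" for s
  proof -
    have "\<bar>e' s\<bar> = \<bar>1 + q s\<bar> * \<bar>2 * (u s * u' s)\<bar>" by (simp add: e'_def abs_mult)
    also have "\<dots> \<le> K * e s"
    proof (rule mult_mono)
      show "\<bar>1 + q s\<bar> \<le> K" using M[OF that] unfolding K_def by linarith
      have "0 \<le> (\<bar>u s\<bar> - \<bar>u' s\<bar>)\<^sup>2" by simp
      then show "\<bar>2 * (u s * u' s)\<bar> \<le> e s" unfolding e_def by (simp add: power2_diff abs_mult)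
      show "0 \<le> K" using M[OF that] unfolding K_def by linarith
    qed simp
    finally show ?thesis .
  qed
  have e0: "e t0 = 0" using t0 by (simp add: e_def)
  have "e t \<le> 0"
  proof (cases "t0 \<le> t")
    case True
    have sub: "{t0..t} \<subseteq> {0..1}" using t0 t by auto
    have "- (e t0 * exp (- K * t0)) \<le> - (e t * exp (- K * t))"
    proof (rule deriv_nonneg_mono[OF True, where f = "\<lambda>s. - (e s * exp (- K * s))"])
      show "((\<lambda>t. - (e t * exp (- K * t))) has_real_derivative (K * e s - e' s) * exp (- K * s)) (at s within {t0..t})"
        if "s \<in> {t0..t}" for s
        using DERIV_subset[OF e sub] sub that
        by (auto intro!: derivative_eq_intros simp: algebra_simps)
      show "0 \<le> (K * e s - e' s) * exp (- K * s)" if "s \<in> {t0..t}" for s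
        using bd[of s] sub that by (intro mult_nonneg_nonneg) auto
    qed
    then have "e t * exp (- K * t) \<le> 0" using e0 by simp
    then show ?thesis by (simp add: mult_le_0_iff)
  next
    case False
    have sub: "{t..t0} \<subseteq> {0..1}" using t0 t by auto
    have "e t * exp (K * t) \<le> e t0 * exp (K * t0)"
    proof (rule deriv_nonneg_mono[where f = "\<lambda>s. e s * exp (K * s)"])
      show "((\<lambda>t. e t * exp (K * t)) has_real_derivative (K * e s + e' s) * exp (K * s)) (at s within {t..t0})"
        if "s \<in> {t..t0}" for s
        using DERIV_subset[OF e sub] sub that
        by (auto intro!: derivative_eq_intros simp: algebra_simps)
      show "0 \<le> (K * e s + e' s) * exp (K * s)" if "s \<in> {t..t0}" for s
        using bd[of s] sub that by (intro mult_nonneg_nonneg) auto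
    qed (use False in simp)
    then show ?thesis using e0 by (simp add: mult_le_0_iff)
  qed
  then have "e t = 0" unfolding e_def by (smt (verit) zero_le_power2)
  then show "u t = 0" "u' t = 0" unfolding e_def by (simp_all add: sum_power2_eq_zero_iff)
qed

text \<open>
  Picard iteration, written as a series: the \<open>n\<close>-th terms \<open>u n\<close> and
  \<open>v n\<close> arise by integrating \<open>n\<close> times from the initial values and are
  bounded by \<open>C * (M * t) ^ n / fact n\<close>. So the series may be differentiated termwise,
  which shifts the index by one and yields the equation.
\<close>

lemma solves_exists:
  assumes q: "continuous_on {0..1} q"
  obtains u u' where "solves q u u'" "u 0 = \<alpha>" "u' 0 = \<beta>"
proof -
  obtain M where M: "\<And>t. t \<in> {0..1} \<Longrightarrow> \<bar>q t\<bar> \<le> M" "M \<ge> 1"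
  proof -
    have "bounded (q ` {0..1})" using compact_continuous_image[OF q] compact_imp_bounded by blast
    then obtain B where "\<forall>x\<in>q ` {0..1}. norm x \<le> B" unfolding bounded_iff by blast
    then have "\<bar>q t\<bar> \<le> max 1 B" if "t \<in> {0..1}" for t
      using that by (simp add: le_max_iff_disj)
    then show ?thesis using that[of "max 1 B"] by simp
  qed
  define w where "w = rec_nat (\<lambda>t::real. (\<alpha>, \<beta>))
    (\<lambda>n f t. (integral {0..t} (\<lambda>s. snd (f s)), integral {0..t} (\<lambda>s. q s * fst (f s))))"
  define u where "u n t = fst (w n t)" for n t
  define v where "v n t = snd (w n t)" for n t
  have u0: "u 0 t = \<alpha>" and v0: "v 0 t = \<beta>" for t by (simp_all add: u_def v_def w_def)
  have uS: "u (Suc n) t = integral {0..t} (v n)" and vS: "v (Suc n) t = integral {0..t} (\<lambda>s. q s * u n s)" for n t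
    by (simp_all add: u_def[abs_def] v_def[abs_def] w_def)
  have cont: "continuous_on {0..1} (u n) \<and> continuous_on {0..1} (v n)" for n
  proof (induction n)
    case 0
    have "u 0 = (\<lambda>t. \<alpha>)" "v 0 = (\<lambda>t. \<beta>)" using u0 v0 by auto
    then show ?case by simp
  next
    case (Suc n)
    have "v n integrable_on {0..1}" "(\<lambda>s. q s * u n s) integrable_on {0..1}"
      using Suc q by (auto intro!: integrable_continuous_real continuous_intros)
    then have "continuous_on {0..1} (\<lambda>t. integral {0..t} (v n))"
      "continuous_on {0..1} (\<lambda>t. integral {0..t} (\<lambda>s. q s * u n s))"
      by (auto intro: indefinite_integral_continuous_1)
    moreover have "u (Suc n) = (\<lambda>t. integral {0..t} (v n))" "v (Suc n) = (\<lambda>t. integral {0..t} (\<lambda>s. q s * u n s))"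
      using uS vS by auto
    ultimately show ?case by simp
  qed
  have du: "(u (Suc n) has_real_derivative v n t) (at t within {0..1})" if "t \<in> {0..1}" for n t
    using integral_has_vector_derivative[of 0 1 "v n" t] cont that uS
    by (simp add: has_real_derivative_iff_has_vector_derivative cong: has_vector_derivative_cong_ev)
       (metis (no_types, lifting) ext)
  have dv: "(v (Suc n) has_real_derivative q t * u n t) (at t within {0..1})" if "t \<in> {0..1}" for n t
  proof -
    have "continuous_on {0..1} (\<lambda>s. q s * u n s)" using cont q by (intro continuous_intros) auto
    then have "((\<lambda>t. integral {0..t} (\<lambda>s. q s * u n s)) has_real_derivative q t * u n t) (at t within {0..1})"
      using integral_has_vector_derivative[of 0 1 "\<lambda>s. q s * u n s" t] that
      by (simp add: has_real_derivative_iff_has_vector_derivative)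
    moreover have "v (Suc n) = (\<lambda>t. integral {0..t} (\<lambda>s. q s * u n s))" using vS by auto
    ultimately show ?thesis by simp
  qed
  define C where "C = \<bar>\<alpha>\<bar> + \<bar>\<beta>\<bar>"
  have C: "C \<ge> 0" by (simp add: C_def)
  have bd: "\<forall>t\<in>{0..1}. \<bar>u n t\<bar> \<le> C * (M * t) ^ n / fact n \<and> \<bar>v n t\<bar> \<le> C * (M * t) ^ n / fact n" for n
  proof (induction n)
    case 0
    then show ?case by (simp add: u0 v0 C_def)
  next
    case (Suc n)
    show ?case
    proof
      fix t :: real assume t: "t \<in> {0..1}"
      have hi: "((\<lambda>s. M * (C * (M * s) ^ n / fact n)) has_integral C * (M * t) ^ Suc n / fact (Suc n)) {0..t}"
      proof -
        have "((\<lambda>s. M * (C * (M * s) ^ n / fact n)) has_integral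
          C * (M * t) ^ Suc n / fact (Suc n) - C * (M * 0) ^ Suc n / fact (Suc n)) {0..t}"
        proof (rule ftc_real)
          fix s :: real
          have "((\<lambda>s. C * (M * s) ^ Suc n / fact (Suc n)) has_real_derivative
            C * (real (Suc n) * (M * s) ^ n * M) / fact (Suc n)) (at s within {0..t})"
            by (auto intro!: derivative_eq_intros simp del: fact_Suc power_Suc)
          moreover have "C * (real (Suc n) * (M * s) ^ n * M) / fact (Suc n) = M * (C * (M * s) ^ n / fact n)"
            by (simp add: field_simps del: of_nat_Suc)
          ultimately show "((\<lambda>s. C * (M * s) ^ Suc n / fact (Suc n)) has_real_derivative
            M * (C * (M * s) ^ n / fact n)) (at s within {0..t})" by (simp only:)
        qed (use t in simp)
        then show ?thesis by simp
      qed
      have est: "\<bar>integral {0..t} f\<bar> \<le> C * (M * t) ^ Suc n / fact (Suc n)"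
        if f: "continuous_on {0..1} f" "\<And>s. s \<in> {0..1} \<Longrightarrow> \<bar>f s\<bar> \<le> M * (C * (M * s) ^ n / fact n)" for f
      proof -
        have fi: "f integrable_on {0..t}"
          using f(1) t by (intro integrable_continuous_real continuous_on_subset[OF f(1)]) auto
        have "norm (integral {0..t} f) \<le> integral {0..t} (\<lambda>s. M * (C * (M * s) ^ n / fact n))"
          using fi hi f(2) t by (intro integral_norm_bound_integral) auto
        then show ?thesis unfolding integral_unique[OF hi] real_norm_def .
      qed
      have "\<bar>v n s\<bar> \<le> M * (C * (M * s) ^ n / fact n)" if "s \<in> {0..1}" for s
      proof -
        have "0 \<le> C * (M * s) ^ n / fact n" using C M that by auto
        then have "C * (M * s) ^ n / fact n \<le> M * (C * (M * s) ^ n / fact n)"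
          using mult_right_mono[OF M(2), of "C * (M * s) ^ n / fact n"] by (simp only: mult_1)
        moreover have "\<bar>v n s\<bar> \<le> C * (M * s) ^ n / fact n" using bspec[OF Suc that] ..
        ultimately show ?thesis by linarith
      qed
      moreover have "\<bar>q s * u n s\<bar> \<le> M * (C * (M * s) ^ n / fact n)" if "s \<in> {0..1}" for s
        unfolding abs_mult
      proof (rule mult_mono)
        show "\<bar>u n s\<bar> \<le> C * (M * s) ^ n / fact n" using bspec[OF Suc that] ..
      qed (use M that in auto)
      moreover have "continuous_on {0..1} (\<lambda>s. q s * u n s)" using cont q by (intro continuous_intros) auto
      ultimately show "\<bar>u (Suc n) t\<bar> \<le> C * (M * t) ^ Suc n / fact (Suc n) \<and>
          \<bar>v (Suc n) t\<bar> \<le> C * (M * t) ^ Suc n / fact (Suc n)"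
        unfolding uS vS using est cont by blast
    qed
  qed
  have bd': "\<bar>u n t\<bar> \<le> C * (M ^ n / fact n)" "\<bar>v n t\<bar> \<le> C * (M ^ n / fact n)" if "t \<in> {0..1}" for n t
  proof -
    have "(M * t) ^ n \<le> M ^ n" using that M(2) by (intro power_mono) (auto simp: mult_left_le)
    then have "C * (M * t) ^ n / fact n \<le> C * (M ^ n / fact n)"
      using C by (simp add: divide_right_mono mult_left_mono)
    then show "\<bar>u n t\<bar> \<le> C * (M ^ n / fact n)" "\<bar>v n t\<bar> \<le> C * (M ^ n / fact n)"
      using bd that by (meson order_trans)+
  qed
  have summ: "summable (\<lambda>n. C * (M ^ n / fact n))"
    using summable_exp[of M] by (intro summable_mult) (simp add: field_simps)
  have su: "summable (\<lambda>n. u n t)" and sv: "summable (\<lambda>n. v n t)" if "t \<in> {0..1}" for t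
    using bd'[OF that] by (auto intro!: summable_comparison_test'[OF summ, of 0])
  define U where "U t = (\<Sum>n. u n t)" for t
  define V where "V t = (\<Sum>n. v n t)" for t
  have series: "((\<lambda>t. \<Sum>n. f n t) has_real_derivative (\<Sum>n. g n t)) (at t within {0..1})"
    if t: "t \<in> {0..1}" and d: "\<And>n t. t \<in> {0..1} \<Longrightarrow> (f (Suc n) has_real_derivative g n t) (at t within {0..1})"
      and c: "\<And>t. f 0 t = c0" and s: "\<And>t. t \<in> {0..1} \<Longrightarrow> summable (\<lambda>n. f n t)"
      and b: "\<And>n t. t \<in> {0..1} \<Longrightarrow> \<bar>g n t\<bar> \<le> M * (C * (M ^ n / fact n))" for f g t c0
  proof -
    \<comment> \<open>the zeroth term of the series is constant, so the derivatives are those of the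
      other terms, shifted by one\<close>
    define f' where "f' n = (case n of 0 \<Rightarrow> (\<lambda>t. 0) | Suc k \<Rightarrow> g k)" for n
    define B where "B n = (case n of 0 \<Rightarrow> 0 | Suc k \<Rightarrow> M * (C * (M ^ k / fact k)))" for n
    have "summable (\<lambda>n. B (Suc n))" unfolding B_def using summable_mult[OF summ, of M] by simp
    then have sB: "summable B" by (simp add: summable_Suc_iff)
    have der: "(f n has_real_derivative f' n x) (at x within {0..1})" if "x \<in> {0..1}" for n x
    proof (cases n)
      case 0
      have "f 0 = (\<lambda>t. c0)" using c by auto
      then show ?thesis using 0 by (simp add: f'_def)
    next
      case (Suc k)
      then show ?thesis using d[OF that] by (simp add: f'_def)
    qed
    have "uniform_limit {0..1} (\<lambda>n x. \<Sum>i<n. f' i x) (\<lambda>x. \<Sum>i. f' i x) sequentially"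
    proof (rule Weierstrass_m_test[OF _ sB])
      show "norm (f' n x) \<le> B n" if "x \<in> {0..1}" for n x
        using b[OF that] by (cases n) (auto simp: f'_def B_def)
    qed
    then have "\<exists>G. \<forall>x\<in>{0..1}. (\<lambda>n. f n x) sums G x \<and> (G has_real_derivative (\<Sum>i. f' i x)) (at x within {0..1})"
      using has_field_derivative_series[of "{0..1::real}" f f' "\<lambda>x. \<Sum>i. f' i x" t] der t s[OF t]
      by (simp only: convex_real_interval simp_thms)
    then obtain G where G: "\<And>x. x \<in> {0..1} \<Longrightarrow> (\<lambda>n. f n x) sums G x"
      "(G has_real_derivative (\<Sum>i. f' i t)) (at t within {0..1})" using t by blast
    have "((\<lambda>t. \<Sum>n. f n t) has_real_derivative (\<Sum>i. f' i t)) (at t within {0..1})"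
      using has_derivative_cong01[OF G(2) t] G(1) sums_unique by metis
    moreover have "(\<Sum>i. f' i t) = (\<Sum>n. g n t)"
    proof -
      have "summable (\<lambda>n. f' n t)"
        using b[OF t] by (intro summable_comparison_test'[OF sB, of 0]) (auto simp: f'_def B_def split: nat.split)
      then show ?thesis using suminf_split_head[of "\<lambda>n. f' n t"] by (simp add: f'_def)
    qed
    ultimately show ?thesis by simp
  qed
  have pos: "0 \<le> C * (M ^ n / fact n)" for n using C M by simp
  have "solves q U V"
    unfolding solves_def
  proof (intro ballI conjI)
    fix t :: real assume t: "t \<in> {0..1}"
    show "(U has_real_derivative V t) (at t within {0..1})"
      unfolding U_def V_def
    proof (rule series[OF t du u0 su])
      show "\<bar>v n t\<bar> \<le> M * (C * (M ^ n / fact n))" if "t \<in> {0..1}" for n t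
        using bd'(2)[OF that, of n] mult_right_mono[OF M(2) pos[of n]] by linarith
    qed
    have "((\<lambda>t. \<Sum>n. v n t) has_real_derivative (\<Sum>n. q t * u n t)) (at t within {0..1})"
    proof (rule series[OF t dv v0 sv])
      show "\<bar>q t * u n t\<bar> \<le> M * (C * (M ^ n / fact n))" if "t \<in> {0..1}" for n t
        unfolding abs_mult using bd'(1)[OF that, of n] M(1)[OF that] M(2) by (intro mult_mono) auto
    qed
    then show "(V has_real_derivative q t * U t) (at t within {0..1})"
      unfolding U_def V_def using suminf_mult[OF su[OF t], of "q t"] by simp
  qed
  moreover have "U 0 = \<alpha>" "V 0 = \<beta>"
  proof -
    have "u (Suc n) 0 = 0" "v (Suc n) 0 = 0" for n by (simp_all add: uS vS)
    then show "U 0 = \<alpha>" "V 0 = \<beta>"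
      unfolding U_def V_def using suminf_split_head[OF su, of 0] suminf_split_head[OF sv, of 0] u0 v0 by auto
  qed
  ultimately show ?thesis using that by blast
qed

section \<open>Short intervals\<close>

lemma green_has_integral:
  fixes u' u'' v v' :: "real \<Rightarrow> real"
  assumes "a \<le> b"
    and "\<And>t. t \<in> {a..b} \<Longrightarrow> (u' has_real_derivative u'' t) (at t within {a..b})"
    and "\<And>t. t \<in> {a..b} \<Longrightarrow> (v has_real_derivative v' t) (at t within {a..b})"
  shows "((\<lambda>t. u' t * v' t + u'' t * v t) has_integral u' b * v b - u' a * v a) {a..b}"
  using assms by (intro ftc_real) (auto intro!: derivative_eq_intros)

text \<open>
  The derivative of \<open>\<theta> w\<^sup>2\<close> with
  \<open>\<theta> t = - \<alpha> (t - a)\<close> integrates to zero, as \<open>\<theta>\<close>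
  vanishes at \<open>a\<close> and \<open>w\<close> at \<open>b\<close>. Subtracting it from the
  integrand completes the square: what remains is
  \<open>(w' - \<theta> w)\<^sup>2 + (\<alpha> - \<theta>\<^sup>2 - q) w\<^sup>2\<close>. For an
  interval of length \<open>h\<close> the choice \<open>\<alpha> = 1 / (2 h\<^sup>2)\<close> gives
  \<open>\<theta>\<^sup>2 \<le> \<alpha> / 2\<close>, and the hypothesis on \<open>q\<close> says
  \<open>q < \<alpha> / 2\<close>.
\<close>

lemma dirichlet_positive:
  fixes w w' q :: "real \<Rightarrow> real"
  assumes ab: "a < b" and w: "\<And>t. t \<in> {a..b} \<Longrightarrow> (w has_real_derivative w' t) (at t within {a..b})"
    and w': "continuous_on {a..b} w'" and q: "continuous_on {a..b} q"
    and small: "\<And>t. t \<in> {a..b} \<Longrightarrow> q t * (4 * (b - a)\<^sup>2) < 1" and wb: "w b = 0"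
  shows "0 \<le> integral {a..b} (\<lambda>t. (w' t)\<^sup>2 - q t * (w t)\<^sup>2)"
    and "integral {a..b} (\<lambda>t. (w' t)\<^sup>2 - q t * (w t)\<^sup>2) = 0 \<Longrightarrow> t \<in> {a..b} \<Longrightarrow> w t = 0"
proof -
  define h where "h = b - a"
  have h: "h > 0" using ab by (simp add: h_def)
  define \<alpha> where "\<alpha> = 1 / (2 * h\<^sup>2)"
  have \<alpha>: "\<alpha> > 0" using h by (simp add: \<alpha>_def)
  define \<theta> where "\<theta> t = - \<alpha> * (t - a)" for t
  define F where "F t = (w' t - \<theta> t * w t)\<^sup>2 + (\<alpha> - (\<theta> t)\<^sup>2 - q t) * (w t)\<^sup>2" for t
  have cw: "continuous_on {a..b} w" using w by (rule has_real_derivative_continuous_on)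
  have cF: "continuous_on {a..b} F"
    unfolding F_def \<theta>_def using cw w' q by (intro continuous_intros) auto
  have coef: "\<alpha> - (\<theta> t)\<^sup>2 - q t > 0" if t: "t \<in> {a..b}" for t
  proof -
    have "(t - a)\<^sup>2 \<le> h\<^sup>2" using t by (intro power_mono) (auto simp: h_def)
    then have "\<alpha>\<^sup>2 * (t - a)\<^sup>2 \<le> \<alpha>\<^sup>2 * h\<^sup>2" by (intro mult_left_mono) auto
    also have "\<alpha>\<^sup>2 * h\<^sup>2 = \<alpha> / 2" using h by (simp add: \<alpha>_def power2_eq_square field_simps)
    finally have "(\<theta> t)\<^sup>2 \<le> \<alpha> / 2" by (simp add: \<theta>_def power_mult_distrib)
    moreover have "q t < \<alpha> / 2"
      using small[OF t] h unfolding h_def[symmetric] by (simp add: \<alpha>_def field_simps)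
    ultimately show ?thesis by simp
  qed
  have F0: "F t \<ge> 0" if "t \<in> {a..b}" for t
    unfolding F_def using coef[OF that] by (intro add_nonneg_nonneg mult_nonneg_nonneg) auto
  have "((\<lambda>t. 2 * w t * w' t * \<theta> t - \<alpha> * (w t)\<^sup>2) has_integral (w b)\<^sup>2 * \<theta> b - (w a)\<^sup>2 * \<theta> a) {a..b}"
    using ab w by (intro ftc_real) (auto intro!: derivative_eq_intros simp: \<theta>_def)
  then have G: "((\<lambda>t. 2 * w t * w' t * \<theta> t - \<alpha> * (w t)\<^sup>2) has_integral 0) {a..b}"
    using wb by (simp add: \<theta>_def)
  have "F integrable_on {a..b}" using cF by (rule integrable_continuous_real)
  then have "((\<lambda>t. F t + (2 * w t * w' t * \<theta> t - \<alpha> * (w t)\<^sup>2)) has_integral integral {a..b} F + 0) {a..b}"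
    using G by (intro has_integral_add) auto
  moreover have "F t + (2 * w t * w' t * \<theta> t - \<alpha> * (w t)\<^sup>2) = (w' t)\<^sup>2 - q t * (w t)\<^sup>2" for t
    by (simp add: F_def power2_eq_square algebra_simps)
  ultimately have eq: "integral {a..b} (\<lambda>t. (w' t)\<^sup>2 - q t * (w t)\<^sup>2) = integral {a..b} F"
    by (simp add: integral_unique)
  show "0 \<le> integral {a..b} (\<lambda>t. (w' t)\<^sup>2 - q t * (w t)\<^sup>2)"
    unfolding eq using F0 by (intro integral_nonneg integrable_continuous_real cF) auto
  assume "integral {a..b} (\<lambda>t. (w' t)\<^sup>2 - q t * (w t)\<^sup>2) = 0" and t: "t \<in> {a..b}"
  then have "F t = 0" using integral_eq_0_iff[OF cF ab F0] eq by auto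
  moreover have "(w' t - \<theta> t * w t)\<^sup>2 \<ge> 0" "(\<alpha> - (\<theta> t)\<^sup>2 - q t) * (w t)\<^sup>2 \<ge> 0"
    using coef[OF t] by (auto intro!: mult_nonneg_nonneg)
  ultimately have "(\<alpha> - (\<theta> t)\<^sup>2 - q t) * (w t)\<^sup>2 = 0" unfolding F_def by linarith
  then show "w t = 0" using coef[OF t] by simp
qed

lemma solves_subinterval:
  assumes "solves q u u'" "{a..b} \<subseteq> {0..1}" "t \<in> {a..b}"
  shows "(u has_real_derivative u' t) (at t within {a..b})"
    and "(u' has_real_derivative q t * u t) (at t within {a..b})"
  using assms DERIV_subset[OF _ assms(2)] unfolding solves_def by blast+

text \<open>
  By Green's formula the form vanishes at \<open>u\<close>, so \<open>u = 0\<close> on the short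
  interval; then \<open>u\<close> has zero initial values at \<open>a\<close> and vanishes on all of
  \<open>[0,1]\<close>.
\<close>

lemma solves_zero_at_ends:
  assumes q: "continuous_on {0..1} q" and u: "solves q u u'" and ab: "a < b" "{a..b} \<subseteq> {0..1}"
    and small: "\<And>t. t \<in> {a..b} \<Longrightarrow> - q t * (4 * (b - a)\<^sup>2) < 1" and z: "u a = 0" "u b = 0"
    and t: "t \<in> {0..1}"
  shows "u t = 0" "u' t = 0"
proof -
  note du = solves_subinterval[OF u ab(2)]
  have cq: "continuous_on {a..b} (\<lambda>t. - q t)"
    using continuous_on_subset[OF q ab(2)] by (rule continuous_on_minus)
  have cu': "continuous_on {a..b} u'" using du(2) by (rule has_real_derivative_continuous_on)
  have "((\<lambda>t. u' t * u' t + q t * u t * u t) has_integral u' b * u b - u' a * u a) {a..b}"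
    using ab(1) du by (intro green_has_integral) auto
  then have "integral {a..b} (\<lambda>t. (u' t)\<^sup>2 - - q t * (u t)\<^sup>2) = 0"
    using z by (simp add: integral_unique power2_eq_square mult.assoc)
  then have uz: "u s = 0" if "s \<in> {a..b}" for s
    using dirichlet_positive(2)[OF ab(1) du(1) cu' cq small z(2)] that by blast
  have "((\<lambda>s. 0) has_real_derivative u' a) (at a within {a..b})"
    using has_derivative_cong01[OF du(1)] uz ab(1) by auto
  moreover have "((\<lambda>s. 0) has_real_derivative 0) (at a within {a..b})" by simp
  ultimately have "u' a = 0"
    using vector_derivative_unique_within_closed_interval[of a b a "\<lambda>s. 0" "u' a" 0] ab(1)
    by (simp add: has_real_derivative_iff_has_vector_derivative)
  moreover have "a \<in> {0..1}" using ab by auto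
  ultimately show "u t = 0" "u' t = 0" using solves_unique[OF q u _ z(1) _ t] by auto
qed

text \<open>
  The values at \<open>a\<close> and \<open>b\<close> of the solutions depend linearly on two
  parameters, injectively by \<open>solves_zero_at_ends\<close>; Cramer's rule gives the solution.
\<close>

lemma solves_boundary_values:
  assumes q: "continuous_on {0..1} q" and ab: "a < b" "{a..b} \<subseteq> {0..1}"
    and small: "\<And>t. t \<in> {a..b} \<Longrightarrow> - q t * (4 * (b - a)\<^sup>2) < 1"
  obtains u u' where "solves q u u'" "u a = x" "u b = y"
proof -
  obtain f f' where f: "solves q f f'" "f 0 = 1" "f' 0 = 0" using solves_exists[OF q] .
  obtain g g' where g: "solves q g g'" "g 0 = 0" "g' 0 = 1" using solves_exists[OF q] .
  define \<Delta> where "\<Delta> = f a * g b - g a * f b"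
  have triv: "r = 0 \<and> s = 0" if "r * f a + s * g a = 0" "r * f b + s * g b = 0" for r s
  proof -
    have "solves q (\<lambda>t. r * f t + s * g t) (\<lambda>t. r * f' t + s * g' t)" by (rule solves_linear[OF f(1) g(1)])
    from solves_zero_at_ends[OF q this ab small that, of 0] show ?thesis using f g by auto
  qed
  have \<Delta>: "\<Delta> \<noteq> 0"
  proof
    assume "\<Delta> = 0"
    then have "g b = 0 \<and> - f b = 0" "g a = 0 \<and> - f a = 0"
      by (intro triv; simp add: \<Delta>_def algebra_simps)+
    then show False using triv[of 1 0] by simp
  qed
  define r where "r = (x * g b - y * g a) / \<Delta>"
  define s where "s = (f a * y - f b * x) / \<Delta>"
  have "r * f a + s * g a = x" "r * f b + s * g b = y"
    unfolding r_def s_def using \<Delta> by (simp_all add: field_simps) (simp_all add: \<Delta>_def algebra_simps)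
  then show ?thesis using that[OF solves_linear[OF f(1) g(1), of r s]] by blast
qed

lemma solves_wronskian:
  assumes "solves q u u'" "solves q v v'"
  shows "u 1 * v' 1 - u' 1 * v 1 = u 0 * v' 0 - u' 0 * v 0"
proof -
  define w where "w t = u t * v' t - u' t * v t" for t
  have "((\<lambda>t::real. 0) has_integral w 1 - w 0) {0..1}"
  proof (rule ftc_real)
    fix t :: real assume "t \<in> {0..1}"
    then show "(w has_real_derivative 0) (at t within {0..1})"
      using assms unfolding solves_def w_def by (auto intro!: derivative_eq_intros)
  qed simp
  then have "w 1 - w 0 = 0"
    using has_integral_unique[OF _ has_integral_0] by blast
  then show ?thesis by (simp add: w_def)
qed

text \<open>
  The boundary data of the solutions form a plane in \<open>\<real>\<^sup>4\<close> which is its own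
  annihilator for the Wronskian pairing. The solution \<open>u\<close> with the right data at
  \<open>0\<close> has defects \<open>X\<close> and \<open>Z\<close> at \<open>1\<close> which
  satisfy \<open>X * v' 1 = Z * v 1\<close> for every solution \<open>v\<close>. Taking for
  \<open>v\<close> two solutions with Wronskian \<open>1\<close> shows \<open>X = Z = 0\<close>.
\<close>

lemma solves_lagrangian:
  assumes q: "continuous_on {0..1} q"
    and orth: "\<And>v v'. solves q v v' \<Longrightarrow> x0 * v 0 + x1 * v 1 - y0 * v' 0 + y1 * v' 1 = 0"
  obtains u u' where "solves q u u'" "u 0 = y0" "u 1 = y1" "u' 0 = x0" "u' 1 = - x1"
proof -
  obtain u u' where u: "solves q u u'" "u 0 = y0" "u' 0 = x0" using solves_exists[OF q] .
  obtain f f' where f: "solves q f f'" "f 0 = 1" "f' 0 = 0" using solves_exists[OF q] .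
  obtain g g' where g: "solves q g g'" "g 0 = 0" "g' 0 = 1" using solves_exists[OF q] .
  have W: "f 1 * g' 1 - f' 1 * g 1 = 1" using solves_wronskian[OF f(1) g(1)] f g by simp
  define X where "X = u 1 - y1"
  define Z where "Z = u' 1 + x1"
  have *: "X * v' 1 = Z * v 1" if v: "solves q v v'" for v v'
    using orth[OF v] solves_wronskian[OF u(1) v] u by (simp add: X_def Z_def algebra_simps)
  note XZ = *[OF f(1)] *[OF g(1)]
  have "X = X * (f 1 * g' 1 - f' 1 * g 1)" using W by simp
  also have "\<dots> = (X * g' 1) * f 1 - (X * f' 1) * g 1" by (simp add: algebra_simps)
  also have "\<dots> = 0" using XZ by simp
  finally have X: "X = 0" .
  have "Z = Z * (f 1 * g' 1 - f' 1 * g 1)" using W by simp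
  also have "\<dots> = (Z * f 1) * g' 1 - (Z * g 1) * f' 1" by (simp add: algebra_simps)
  also have "\<dots> = 0" using XZ[symmetric] by simp
  finally have "Z = 0" .
  then show ?thesis using that[OF u(1)] u X by (simp add: X_def Z_def)
qed

section \<open>Quantum graphs\<close>

text \<open>
  Edges are parametrised over \<open>[0,1]\<close> with constant speed \<open>c i\<close>, so arc
  length is \<open>c i * t\<close>. Functions vanish off the graph, as in \<open>C_inf\<close>. The
  operators below are written in the parameter \<open>t\<close>: \<open>dt\<close> is the exterior
  derivative with respect to arc length, \<open>energy\<close> the form
  \<open>\<integral> (\<nabla>u \<nabla>v - d u v) ds\<close>, \<open>mass\<close> the
  \<open>L\<^sup>2\<close> product, and \<open>eigen_eq\<close> the equation
  \<open>- (\<Delta> + d) u = l u\<close>.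
\<close>

definition Cs :: "'i set \<Rightarrow> ('i \<Rightarrow> real \<Rightarrow> real) set"
  where "Cs I = {\<phi>. (\<forall>i\<in>I. smooth01 (\<phi> i)) \<and> (\<forall>i t. \<not> (i \<in> I \<and> t \<in> {0..1}) \<longrightarrow> \<phi> i t = 0)}"

definition bd :: "'i set \<Rightarrow> ('i \<Rightarrow> real \<Rightarrow> real) \<Rightarrow> 'i \<times> real \<Rightarrow> real"
  where "bd I \<phi> = (\<lambda>(i, t). if i \<in> I \<and> t \<in> {0, 1} then \<phi> i t else 0)"

definition dt :: "'i set \<Rightarrow> ('i \<Rightarrow> real) \<Rightarrow> ('i \<Rightarrow> real \<Rightarrow> real) \<Rightarrow> 'i \<times> real \<Rightarrow> real"
  where "dt I c \<phi> = (\<lambda>(i, t). if i \<in> I \<and> t \<in> {0, 1} then ext_sign t * (deriv01 (\<phi> i) t / c i) else 0)"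

definition ipe :: "'i set \<Rightarrow> ('i \<times> real \<Rightarrow> real) \<Rightarrow> ('i \<times> real \<Rightarrow> real) \<Rightarrow> real"
  where "ipe I x y = (\<Sum>e\<in>I \<times> {0, 1}. x e * y e)"

definition energy :: "'i set \<Rightarrow> ('i \<Rightarrow> real) \<Rightarrow> ('i \<Rightarrow> real \<Rightarrow> real) \<Rightarrow> ('i \<Rightarrow> real \<Rightarrow> real) \<Rightarrow> ('i \<Rightarrow> real \<Rightarrow> real) \<Rightarrow> real"
  where "energy I c d u v = (\<Sum>i\<in>I. integral {0..1}
    (\<lambda>t. deriv01 (u i) t * deriv01 (v i) t / c i - c i * d i t * u i t * v i t))"

definition mass :: "'i set \<Rightarrow> ('i \<Rightarrow> real) \<Rightarrow> ('i \<Rightarrow> real \<Rightarrow> real) \<Rightarrow> ('i \<Rightarrow> real \<Rightarrow> real) \<Rightarrow> real"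
  where "mass I c u v = (\<Sum>i\<in>I. integral {0..1} (\<lambda>t. c i * u i t * v i t))"

definition eigen_eq :: "'i set \<Rightarrow> ('i \<Rightarrow> real) \<Rightarrow> ('i \<Rightarrow> real \<Rightarrow> real) \<Rightarrow> real \<Rightarrow> ('i \<Rightarrow> real \<Rightarrow> real) \<Rightarrow> bool"
  where "eigen_eq I c d l u \<longleftrightarrow>
    (\<forall>i\<in>I. \<forall>t\<in>{0..1}. deriv01 (deriv01 (u i)) t = - (c i)\<^sup>2 * (d i t + l) * u i t)"

lemma CsD:
  assumes "u \<in> Cs I"
  shows "\<And>i. i \<in> I \<Longrightarrow> smooth01 (u i)" "\<And>i t. \<not> (i \<in> I \<and> t \<in> {0..1}) \<Longrightarrow> u i t = 0"
  using assms unfolding Cs_def by auto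

lemma Cs_deriv:
  assumes "u \<in> Cs I" "i \<in> I"
  shows "\<And>t. t \<in> {0..1} \<Longrightarrow> (u i has_real_derivative deriv01 (u i) t) (at t within {0..1})"
    and "\<And>t. t \<in> {0..1} \<Longrightarrow> (deriv01 (u i) has_real_derivative deriv01 (deriv01 (u i)) t) (at t within {0..1})"
    and "continuous_on {0..1} (u i)" "continuous_on {0..1} (deriv01 (u i))"
proof -
  note s = CsD(1)[OF assms]
  show "\<And>t. t \<in> {0..1} \<Longrightarrow> (u i has_real_derivative deriv01 (u i) t) (at t within {0..1})"
    by (rule smooth01_deriv(1)[OF s])
  show "\<And>t. t \<in> {0..1} \<Longrightarrow> (deriv01 (u i) has_real_derivative deriv01 (deriv01 (u i)) t) (at t within {0..1})"
    by (rule smooth01_deriv(1)[OF smooth01_deriv(2)[OF s]])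
  show "continuous_on {0..1} (u i)" "continuous_on {0..1} (deriv01 (u i))"
    by (rule smooth01_continuous[OF s] smooth01_continuous[OF smooth01_deriv(2)[OF s]])+
qed

lemma add_tuple: "(u + v) i = (\<lambda>t. u i t + v i t)"
  by (simp add: plus_fun_def)

lemma scale_tuple: "(k *\<^sub>R u) i = (\<lambda>t. k * (u i t :: real))"
  by (simp add: scaleR_fun_def)

lemma deriv01_add:
  assumes "u \<in> Cs I" "v \<in> Cs I" "i \<in> I" "t \<in> {0..1}"
  shows "deriv01 ((u + v) i) t = deriv01 (u i) t + deriv01 (v i) t"
  unfolding add_tuple
  by (rule deriv01_eq[OF DERIV_add[OF Cs_deriv(1)[OF assms(1,3,4)] Cs_deriv(1)[OF assms(2,3,4)]] assms(4)])

lemma deriv01_scale: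
  assumes "u \<in> Cs I" "i \<in> I" "t \<in> {0..1}"
  shows "deriv01 ((k *\<^sub>R u) i) t = k * deriv01 (u i) t"
  unfolding scale_tuple
  by (rule deriv01_eq[OF DERIV_cmult[OF Cs_deriv(1)[OF assms]] assms(3)])

lemma subspace_Cs: "subspace (Cs I)"
  unfolding real_vector.subspace_def
proof (intro conjI ballI allI)
  show "0 \<in> Cs I" unfolding Cs_def using smooth01_const[of 0] by (auto simp: zero_fun_def)
  show "u + v \<in> Cs I" if "u \<in> Cs I" "v \<in> Cs I" for u v
  proof -
    have "smooth01 ((u + v) i)" if "i \<in> I" for i
      unfolding add_tuple
      by (rule smooth01_add[OF CsD(1)[OF \<open>u \<in> Cs I\<close> that] CsD(1)[OF \<open>v \<in> Cs I\<close> that]])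
    moreover have "(u + v) i t = 0" if "\<not> (i \<in> I \<and> t \<in> {0..1})" for i t
      using CsD(2)[OF \<open>u \<in> Cs I\<close> that] CsD(2)[OF \<open>v \<in> Cs I\<close> that] by simp
    ultimately show ?thesis unfolding Cs_def by blast
  qed
  show "k *\<^sub>R u \<in> Cs I" if "u \<in> Cs I" for k u
  proof -
    have "smooth01 ((k *\<^sub>R u) i)" if "i \<in> I" for i
      unfolding scale_tuple by (rule smooth01_cmult[OF CsD(1)[OF \<open>u \<in> Cs I\<close> that]])
    moreover have "(k *\<^sub>R u) i t = 0" if "\<not> (i \<in> I \<and> t \<in> {0..1})" for i t
      using CsD(2)[OF \<open>u \<in> Cs I\<close> that] by (simp add: scaleR_fun_def)
    ultimately show ?thesis unfolding Cs_def by blast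
  qed
qed

lemma deriv01_deriv01_add:
  assumes "u \<in> Cs I" "v \<in> Cs I" "i \<in> I" "t \<in> {0..1}"
  shows "deriv01 (deriv01 ((u + v) i)) t = deriv01 (deriv01 (u i)) t + deriv01 (deriv01 (v i)) t"
proof (rule deriv01_eq[OF _ assms(4)])
  have "((\<lambda>t. deriv01 (u i) t + deriv01 (v i) t) has_real_derivative
      deriv01 (deriv01 (u i)) t + deriv01 (deriv01 (v i)) t) (at t within {0..1})"
    by (rule DERIV_add[OF Cs_deriv(2)[OF assms(1,3,4)] Cs_deriv(2)[OF assms(2,3,4)]])
  then show "(deriv01 ((u + v) i) has_real_derivative
      deriv01 (deriv01 (u i)) t + deriv01 (deriv01 (v i)) t) (at t within {0..1})"
    by (rule has_derivative_cong01[OF _ assms(4) deriv01_add[OF assms(1-3)]])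
qed

lemma deriv01_deriv01_scale:
  assumes "u \<in> Cs I" "i \<in> I" "t \<in> {0..1}"
  shows "deriv01 (deriv01 ((k *\<^sub>R u) i)) t = k * deriv01 (deriv01 (u i)) t"
proof (rule deriv01_eq[OF _ assms(3)])
  have "((\<lambda>t. k * deriv01 (u i) t) has_real_derivative k * deriv01 (deriv01 (u i)) t) (at t within {0..1})"
    by (rule DERIV_cmult[OF Cs_deriv(2)[OF assms]])
  then show "(deriv01 ((k *\<^sub>R u) i) has_real_derivative k * deriv01 (deriv01 (u i)) t) (at t within {0..1})"
    by (rule has_derivative_cong01[OF _ assms(3) deriv01_scale[OF assms(1,2)]])
qed

lemma eigen_eq_add:
  assumes "u \<in> Cs I" "v \<in> Cs I" "eigen_eq I c d l u" "eigen_eq I c d l v"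
  shows "eigen_eq I c d l (u + v)"
  using assms(3,4) deriv01_deriv01_add[OF assms(1,2)] unfolding eigen_eq_def
  by (auto simp: algebra_simps)

lemma eigen_eq_scale:
  assumes "u \<in> Cs I" "eigen_eq I c d l u"
  shows "eigen_eq I c d l (k *\<^sub>R u)"
  using assms(2) deriv01_deriv01_scale[OF assms(1)] unfolding eigen_eq_def
  by (auto simp: scaleR_fun_def)

lemma bd_linear: "bd I (u + v) = bd I u + bd I v" "bd I (k *\<^sub>R u) = k *\<^sub>R bd I u"
  by (auto simp: bd_def fun_eq_iff scaleR_fun_def)

lemma bd_zero: "bd I 0 = 0"
  by (auto simp: bd_def fun_eq_iff)

lemma dt_on: "i \<in> I \<Longrightarrow> t \<in> {0, 1} \<Longrightarrow> dt I c u (i, t) = ext_sign t * (deriv01 (u i) t / c i)"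
  by (simp add: dt_def)

lemma dt_off: "\<not> (i \<in> I \<and> t \<in> {0, 1}) \<Longrightarrow> dt I c u (i, t) = 0"
  by (auto simp: dt_def)

lemma dt_add:
  assumes "u \<in> Cs I" "v \<in> Cs I"
  shows "dt I c (u + v) = dt I c u + dt I c v"
proof
  fix e :: "'a \<times> real"
  obtain i t where e: "e = (i, t)" by (cases e)
  show "dt I c (u + v) e = (dt I c u + dt I c v) e"
  proof (cases "i \<in> I \<and> t \<in> {0, 1}")
    case True
    then have "deriv01 ((u + v) i) t = deriv01 (u i) t + deriv01 (v i) t"
      by (intro deriv01_add[OF assms]) auto
    then show ?thesis using True by (simp add: e dt_on add_divide_distrib distrib_left del: plus_fun_apply)
      (simp add: plus_fun_def dt_on add_divide_distrib distrib_left)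
  qed (simp add: e dt_off)
qed

lemma dt_scale:
  assumes "u \<in> Cs I"
  shows "dt I c (k *\<^sub>R u) = k *\<^sub>R dt I c u"
proof
  fix e :: "'a \<times> real"
  obtain i t where e: "e = (i, t)" by (cases e)
  show "dt I c (k *\<^sub>R u) e = (k *\<^sub>R dt I c u) e"
  proof (cases "i \<in> I \<and> t \<in> {0, 1}")
    case True
    then have "deriv01 ((k *\<^sub>R u) i) t = k * deriv01 (u i) t"
      by (intro deriv01_scale[OF assms]) auto
    then show ?thesis using True by (simp add: e dt_on) (simp add: scaleR_fun_def dt_on)
  qed (simp add: e dt_off, simp add: scaleR_fun_def dt_off)
qed

lemma ipe_linear:
  "ipe I (x + y) z = ipe I x z + ipe I y z" "ipe I (k *\<^sub>R x) z = k * ipe I x z"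
  "ipe I x y = ipe I y x"
  by (simp_all add: ipe_def scaleR_fun_def sum.distrib algebra_simps sum_distrib_left)

lemma ipe_linear_right:
  "ipe I z (x + y) = ipe I z x + ipe I z y" "ipe I z (k *\<^sub>R x) = k * ipe I z x"
  by (simp_all add: ipe_def scaleR_fun_def sum.distrib algebra_simps sum_distrib_left)

lemma ipe_zero: "ipe I 0 z = 0" "ipe I z 0 = 0"
  by (simp_all add: ipe_def)

lemma sum_ends: "finite I \<Longrightarrow> (\<Sum>e\<in>I \<times> {0, 1::real}. f e) = (\<Sum>i\<in>I. f (i, 0) + f (i, 1))"
  using sum.cartesian_product[of "\<lambda>i t. f (i, t)" "{0, 1::real}" I] by simp

definition supp_ends :: "'i set \<Rightarrow> ('i \<times> real \<Rightarrow> real) set"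
  where "supp_ends I = {x. \<forall>e. e \<notin> I \<times> {0, 1} \<longrightarrow> x e = 0}"

lemma bd_supp: "bd I u \<in> supp_ends I"
  by (auto simp: supp_ends_def bd_def)

lemma dt_supp: "dt I c u \<in> supp_ends I"
  by (auto simp: supp_ends_def dt_def)

lemma subspace_supp: "subspace {x :: 'e \<Rightarrow> real. \<forall>e. e \<notin> A \<longrightarrow> x e = 0}"
  unfolding real_vector.subspace_def by (auto simp: scaleR_fun_def)

lemma sum_fun_apply: "(\<Sum>a\<in>A. f a) x = (\<Sum>a\<in>A. f a x :: real)"
  by (induction A rule: infinite_finite_induct) auto

lemma findim_supp:
  assumes "finite A"
  shows "findim {x :: 'e \<Rightarrow> real. \<forall>e. e \<notin> A \<longrightarrow> x e = 0}"
  unfolding findim_def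
proof (intro conjI exI subsetI)
  let ?\<delta> = "\<lambda>a e. if e = a then 1 else 0 :: real"
  show "subspace {x :: 'e \<Rightarrow> real. \<forall>e. e \<notin> A \<longrightarrow> x e = 0}" by (rule subspace_supp)
  show "finite (?\<delta> ` A)" using assms by simp
  fix x :: "'e \<Rightarrow> real" assume x: "x \<in> {x. \<forall>e. e \<notin> A \<longrightarrow> x e = 0}"
  have "x = (\<Sum>a\<in>A. x a *\<^sub>R ?\<delta> a)"
  proof
    fix e
    have "(\<Sum>a\<in>A. x a *\<^sub>R ?\<delta> a) e = (\<Sum>a\<in>A. if a = e then x a else 0)"
      unfolding sum_fun_apply by (rule sum.cong) (auto simp: scaleR_fun_def)
    also have "\<dots> = x e" using assms x by simp
    finally show "x e = (\<Sum>a\<in>A. x a *\<^sub>R ?\<delta> a) e" by simp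
  qed
  moreover have "(\<Sum>a\<in>A. x a *\<^sub>R ?\<delta> a) \<in> span (?\<delta> ` A)"
    by (intro real_vector.span_sum real_vector.span_scale real_vector.span_base) auto
  ultimately show "x \<in> span (?\<delta> ` A)" by simp
qed

lemma ipe_pos:
  assumes "finite I" "x \<in> supp_ends I" "x \<noteq> 0"
  shows "ipe I x x > 0"
proof -
  obtain e where e: "x e \<noteq> 0" using assms(3) by (auto simp: fun_eq_iff)
  then have "e \<in> I \<times> {0, 1}" using assms(2) unfolding supp_ends_def by blast
  then show ?thesis unfolding ipe_def using e assms(1)
    by (intro sum_pos2[of _ e]) (auto simp: zero_less_mult_iff)
qed

lemma ipe_nonneg: "ipe I x x \<ge> 0"
  unfolding ipe_def by (intro sum_nonneg) simp

lemma subspace_supp_ends: "subspace (supp_ends I)"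
  unfolding supp_ends_def by (rule subspace_supp)

lemma findim_supp_ends: "finite I \<Longrightarrow> findim (supp_ends I)"
  unfolding supp_ends_def by (rule findim_supp) simp

lemma sym_bilinear_ipe: "sym_bilinear_on U (ipe I)"
  by (rule sym_bilinear_onI) (rule ipe_linear)+

text \<open>
  A vertex condition is a subspace \<open>V\<close> of boundary values: functions are required to
  have values in \<open>V\<close>, and the natural condition that goes with it is that normal
  derivatives are orthogonal to \<open>V\<close>. For a network, \<open>V\<close> is
  \<open>V1\<close> of the interior endpoints; its elements vanish at the other ends, which is the
  Dirichlet condition there.
\<close>

locale quantum_graph =
  fixes I :: "'i set" and c :: "'i \<Rightarrow> real" and d :: "'i \<Rightarrow> real \<Rightarrow> real"
    and V :: "('i \<times> real \<Rightarrow> real) set"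
  assumes I: "finite I" and c: "\<And>i. i \<in> I \<Longrightarrow> c i > 0"
    and d: "\<And>i. i \<in> I \<Longrightarrow> smooth01 (d i)"
    and V: "subspace V" "V \<subseteq> supp_ends I"
begin

definition H :: "('i \<Rightarrow> real \<Rightarrow> real) set"
  where "H = {u \<in> Cs I. bd I u \<in> V}"

definition J :: "real \<Rightarrow> ('i \<Rightarrow> real \<Rightarrow> real) set"
  where "J l = {u \<in> H. (\<forall>v\<in>V. ipe I (dt I c u) v = 0) \<and> eigen_eq I c d l u}"

lemma d_cont: "i \<in> I \<Longrightarrow> continuous_on {0..1} (d i)"
  using d smooth01_continuous by blast

lemma H_Cs: "H \<subseteq> Cs I"
  unfolding H_def by blast

lemma J_H: "J l \<subseteq> H"
  unfolding J_def by blast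

lemma subspace_H: "subspace H"
  unfolding real_vector.subspace_def H_def
  using subspace_Cs[of I] V(1)
  by (auto simp: bd_linear real_vector.subspace_add real_vector.subspace_scale real_vector.subspace_0 bd_zero)

lemma subspace_J: "subspace (J l)"
  unfolding real_vector.subspace_def
proof (intro conjI ballI allI)
  have "0 \<in> H" using subspace_H by (simp add: real_vector.subspace_0)
  moreover have "eigen_eq I c d l (0 *\<^sub>R 0)" "dt I c (0 *\<^sub>R 0) = 0 *\<^sub>R dt I c 0"
  proof -
    have 0: "0 \<in> Cs I" by (rule real_vector.subspace_0[OF subspace_Cs])
    show "dt I c (0 *\<^sub>R 0) = 0 *\<^sub>R dt I c 0" by (rule dt_scale[OF 0])
    have "deriv01 (deriv01 ((0 *\<^sub>R 0 :: 'i \<Rightarrow> real \<Rightarrow> real) i)) t = 0" if "i \<in> I" "t \<in> {0..1}" for i t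
      using deriv01_deriv01_scale[OF 0 that, of 0] by simp
    then show "eigen_eq I c d l (0 *\<^sub>R 0)" unfolding eigen_eq_def by (simp add: scaleR_fun_def)
  qed
  ultimately show "0 \<in> J l" unfolding J_def by (simp add: ipe_zero)
  show "u + v \<in> J l" if "u \<in> J l" "v \<in> J l" for u v
  proof -
    have "u \<in> H" "v \<in> H" "u \<in> Cs I" "v \<in> Cs I" using that unfolding J_def H_def by auto
    then show ?thesis using that subspace_H unfolding J_def
      by (auto simp: real_vector.subspace_add dt_add ipe_linear(1,2) intro: eigen_eq_add)
  qed
  show "k *\<^sub>R u \<in> J l" if "u \<in> J l" for k u
  proof -
    have "u \<in> H" "u \<in> Cs I" using that unfolding J_def H_def by auto
    then show ?thesis using that subspace_H unfolding J_def
      by (auto simp: real_vector.subspace_scale dt_scale ipe_linear(1,2) intro: eigen_eq_scale)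
  qed
qed

lemma energy_cont:
  assumes "u \<in> Cs I" "v \<in> Cs I" "i \<in> I"
  shows "continuous_on {0..1} (\<lambda>t. deriv01 (u i) t * deriv01 (v i) t / c i - c i * d i t * u i t * v i t)"
  using Cs_deriv[OF assms(1,3)] Cs_deriv[OF assms(2,3)] d_cont[OF assms(3)] c[OF assms(3)]
  by (intro continuous_intros) auto

lemma energy_sym_bilinear: "sym_bilinear_on (Cs I) (energy I c d)"
proof (rule sym_bilinear_onI)
  show "energy I c d u v = energy I c d v u" for u v by (simp add: energy_def mult_ac)
  fix u v w assume u: "u \<in> Cs I" and w: "w \<in> Cs I"
  {
    assume v: "v \<in> Cs I"
    show "energy I c d (u + v) w = energy I c d u w + energy I c d v w"
      unfolding energy_def sum.distrib[symmetric]
    proof (rule sum.cong[OF refl])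
      fix i assume i: "i \<in> I"
      have "integral {0..1} (\<lambda>t. deriv01 ((u + v) i) t * deriv01 (w i) t / c i - c i * d i t * (u + v) i t * w i t) =
        integral {0..1} (\<lambda>t. (deriv01 (u i) t * deriv01 (w i) t / c i - c i * d i t * u i t * w i t) +
          (deriv01 (v i) t * deriv01 (w i) t / c i - c i * d i t * v i t * w i t))"
        using deriv01_add[OF u v i] by (intro integral_cong) (simp add: algebra_simps add_divide_distrib)
      also have "\<dots> = integral {0..1} (\<lambda>t. deriv01 (u i) t * deriv01 (w i) t / c i - c i * d i t * u i t * w i t) +
          integral {0..1} (\<lambda>t. deriv01 (v i) t * deriv01 (w i) t / c i - c i * d i t * v i t * w i t)"
        using energy_cont[OF u w i] energy_cont[OF v w i]
        by (intro integral_add integrable_continuous_real)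
      finally show "integral {0..1} (\<lambda>t. deriv01 ((u + v) i) t * deriv01 (w i) t / c i - c i * d i t * (u + v) i t * w i t) = \<dots>" .
    qed
  }
  show "energy I c d (k *\<^sub>R u) w = k * energy I c d u w" for k
    unfolding energy_def sum_distrib_left
  proof (rule sum.cong[OF refl])
    fix i assume i: "i \<in> I"
    have "integral {0..1} (\<lambda>t. deriv01 ((k *\<^sub>R u) i) t * deriv01 (w i) t / c i - c i * d i t * (k *\<^sub>R u) i t * w i t) =
      integral {0..1} (\<lambda>t. k * (deriv01 (u i) t * deriv01 (w i) t / c i - c i * d i t * u i t * w i t))"
      using deriv01_scale[OF u i] by (intro integral_cong) (simp add: scaleR_fun_def algebra_simps)
    then show "integral {0..1} (\<lambda>t. deriv01 ((k *\<^sub>R u) i) t * deriv01 (w i) t / c i - c i * d i t * (k *\<^sub>R u) i t * w i t) =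
      k * integral {0..1} (\<lambda>t. deriv01 (u i) t * deriv01 (w i) t / c i - c i * d i t * u i t * w i t)"
      by simp
  qed
qed

lemma mass_cont:
  assumes "u \<in> Cs I" "v \<in> Cs I" "i \<in> I"
  shows "continuous_on {0..1} (\<lambda>t. c i * u i t * v i t)"
  using Cs_deriv[OF assms(1,3)] Cs_deriv[OF assms(2,3)] by (intro continuous_intros) auto

lemma mass_sym_bilinear: "sym_bilinear_on (Cs I) (mass I c)"
proof (rule sym_bilinear_onI)
  show "mass I c u v = mass I c v u" for u v by (simp add: mass_def mult_ac)
  fix u v w assume u: "u \<in> Cs I" and w: "w \<in> Cs I"
  {
    assume v: "v \<in> Cs I"
    show "mass I c (u + v) w = mass I c u w + mass I c v w"
      unfolding mass_def sum.distrib[symmetric]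
    proof (rule sum.cong[OF refl])
      fix i assume i: "i \<in> I"
      have "integral {0..1} (\<lambda>t. c i * u i t * w i t + c i * v i t * w i t) =
          integral {0..1} (\<lambda>t. c i * u i t * w i t) + integral {0..1} (\<lambda>t. c i * v i t * w i t)"
        using mass_cont[OF u w i] mass_cont[OF v w i]
        by (intro integral_add integrable_continuous_real)
      then show "integral {0..1} (\<lambda>t. c i * (u + v) i t * w i t) =
          integral {0..1} (\<lambda>t. c i * u i t * w i t) + integral {0..1} (\<lambda>t. c i * v i t * w i t)"
        by (simp add: algebra_simps)
    qed
  }
  show "mass I c (k *\<^sub>R u) w = k * mass I c u w" for k
    unfolding mass_def sum_distrib_left by (rule sum.cong[OF refl]) (simp add: scaleR_fun_def mult_ac)
qed

lemma mass_pos: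
  assumes u: "u \<in> Cs I" "u \<noteq> 0"
  shows "mass I c u u > 0"
proof -
  obtain i t where it: "u i t \<noteq> 0" using u(2) by (auto simp: fun_eq_iff)
  then have i: "i \<in> I" and t: "t \<in> {0..1}" using CsD(2)[OF u(1)] by blast+
  have nn: "0 \<le> integral {0..1} (\<lambda>t. c k * u k t * u k t)" if "k \<in> I" for k
    using c[OF that] by (intro integral_nonneg integrable_continuous_real mass_cont u(1) that)
      (simp add: mult.assoc)
  have "integral {0..1} (\<lambda>t. c i * u i t * u i t) \<noteq> 0"
    using integral_eq_0_iff[OF mass_cont[OF u(1) u(1) i]] c[OF i] it t
    by (auto simp: mult.assoc dest!: bspec[of _ _ t])
  then have "0 < integral {0..1} (\<lambda>t. c i * u i t * u i t)" using nn[OF i] by linarith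
  then show ?thesis unfolding mass_def using I i nn by (intro sum_pos2[of I i]) auto
qed

lemma green:
  assumes u: "u \<in> Cs I" and v: "v \<in> Cs I" and eq: "eigen_eq I c d l u"
  shows "energy I c d u v = ipe I (dt I c u) (bd I v) + l * mass I c u v"
proof -
  have "integral {0..1} (\<lambda>t. deriv01 (u i) t * deriv01 (v i) t / c i - c i * d i t * u i t * v i t) =
      dt I c u (i, 0) * bd I v (i, 0) + dt I c u (i, 1) * bd I v (i, 1) +
      l * integral {0..1} (\<lambda>t. c i * u i t * v i t)" if i: "i \<in> I" for i
  proof -
    have ci: "c i \<noteq> 0" using c[OF i] by simp
    have "((\<lambda>t. deriv01 (u i) t * deriv01 (v i) t + deriv01 (deriv01 (u i)) t * v i t) has_integral
        deriv01 (u i) 1 * v i 1 - deriv01 (u i) 0 * v i 0) {0..1}"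
      using Cs_deriv[OF u i] Cs_deriv[OF v i] by (intro green_has_integral) auto
    from has_integral_mult_right[OF this, of "1 / c i"]
    have 1: "((\<lambda>t. 1 / c i * (deriv01 (u i) t * deriv01 (v i) t + deriv01 (deriv01 (u i)) t * v i t)) has_integral
        1 / c i * (deriv01 (u i) 1 * v i 1 - deriv01 (u i) 0 * v i 0)) {0..1}" .
    have "(\<lambda>t. c i * u i t * v i t) integrable_on {0..1}"
      using mass_cont[OF u v i] by (rule integrable_continuous_real)
    from has_integral_mult_right[OF integrable_integral[OF this], of l]
    have 2: "((\<lambda>t. l * (c i * u i t * v i t)) has_integral l * integral {0..1} (\<lambda>t. c i * u i t * v i t)) {0..1}" .
    have "integral {0..1} (\<lambda>t. deriv01 (u i) t * deriv01 (v i) t / c i - c i * d i t * u i t * v i t) =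
      integral {0..1} (\<lambda>t. 1 / c i * (deriv01 (u i) t * deriv01 (v i) t + deriv01 (deriv01 (u i)) t * v i t) +
        l * (c i * u i t * v i t))"
    proof (rule integral_cong)
      fix t :: real assume t: "t \<in> {0..1}"
      have "deriv01 (deriv01 (u i)) t = - (c i)\<^sup>2 * (d i t + l) * u i t"
        using eq i t unfolding eigen_eq_def by blast
      then show "deriv01 (u i) t * deriv01 (v i) t / c i - c i * d i t * u i t * v i t =
        1 / c i * (deriv01 (u i) t * deriv01 (v i) t + deriv01 (deriv01 (u i)) t * v i t) + l * (c i * u i t * v i t)"
        using ci by (simp only:) (simp add: field_simps power2_eq_square)
    qed
    also have "\<dots> = 1 / c i * (deriv01 (u i) 1 * v i 1 - deriv01 (u i) 0 * v i 0) +
        l * integral {0..1} (\<lambda>t. c i * u i t * v i t)"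
      using has_integral_add[OF 1 2] by (rule integral_unique)
    finally show ?thesis using i ci by (simp add: dt_def bd_def ext_sign_def field_simps)
  qed
  then have "energy I c d u v = (\<Sum>i\<in>I. (dt I c u (i, 0) * bd I v (i, 0) + dt I c u (i, 1) * bd I v (i, 1)) +
      l * integral {0..1} (\<lambda>t. c i * u i t * v i t))"
    unfolding energy_def by (intro sum.cong) auto
  then show ?thesis unfolding ipe_def mass_def sum_ends[OF I] by (simp add: sum.distrib sum_distrib_left)
qed

lemma J_weak:
  assumes "u \<in> J l" "v \<in> H"
  shows "energy I c d u v = l * mass I c u v"
  using green[of u v l] assms unfolding J_def H_def by auto

text \<open>
  Restores the normalisation of \<open>Cs\<close> for a family of solutions that are defined on all
  of \<open>\<real>\<close>.
\<close>

definition glue :: "('i \<Rightarrow> real \<Rightarrow> real) \<Rightarrow> 'i \<Rightarrow> real \<Rightarrow> real"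
  where "glue f = (\<lambda>i t. if i \<in> I \<and> t \<in> {0..1} then f i t else 0)"

lemma q_smooth: "i \<in> I \<Longrightarrow> smooth01 (\<lambda>t. - (c i)\<^sup>2 * (d i t + l))"
  by (rule smooth01_cmult[OF smooth01_add[OF d smooth01_const]])

lemma glue_solution:
  assumes f: "\<And>i. i \<in> I \<Longrightarrow> solves (\<lambda>t. - (c i)\<^sup>2 * (d i t + l)) (f i) (f' i)"
  shows "glue f \<in> Cs I" "eigen_eq I c d l (glue f)"
    "\<And>i t. i \<in> I \<Longrightarrow> t \<in> {0..1} \<Longrightarrow> glue f i t = f i t \<and> deriv01 (glue f i) t = f' i t"
proof -
  have val: "glue f i t = f i t" if "i \<in> I" "t \<in> {0..1}" for i t using that by (simp add: glue_def)
  have der: "(glue f i has_real_derivative f' i t) (at t within {0..1})" if "i \<in> I" "t \<in> {0..1}" for i t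
  proof (rule has_derivative_cong01[OF _ that(2) val[OF that(1)]])
    show "(f i has_real_derivative f' i t) (at t within {0..1})"
      using f[OF that(1)] that(2) unfolding solves_def by blast
  qed
  have d1: "deriv01 (glue f i) t = f' i t" if "i \<in> I" "t \<in> {0..1}" for i t
    using deriv01_eq[OF der[OF that] that(2)] .
  show "\<And>i t. i \<in> I \<Longrightarrow> t \<in> {0..1} \<Longrightarrow> glue f i t = f i t \<and> deriv01 (glue f i) t = f' i t"
    using val d1 by blast
  have "smooth01 (glue f i)" if "i \<in> I" for i
    by (rule smooth01_cong[OF solves_smooth(1)[OF q_smooth[OF that] f[OF that]] val[OF that]])
  then show "glue f \<in> Cs I" unfolding Cs_def by (simp add: glue_def)
  have "deriv01 (deriv01 (glue f i)) t = - (c i)\<^sup>2 * (d i t + l) * glue f i t" if i: "i \<in> I" and t: "t \<in> {0..1}" for i t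
  proof (rule deriv01_eq[OF _ t])
    have "(f' i has_real_derivative - (c i)\<^sup>2 * (d i t + l) * f i t) (at t within {0..1})"
      using f[OF i] t unfolding solves_def by blast
    then show "(deriv01 (glue f i) has_real_derivative - (c i)\<^sup>2 * (d i t + l) * glue f i t) (at t within {0..1})"
      unfolding val[OF i t] by (rule has_derivative_cong01[OF _ t d1[OF i]])
  qed
  then show "eigen_eq I c d l (glue f)" unfolding eigen_eq_def by blast
qed

text \<open>
  Testing with solutions supported on a single edge reduces this to \<open>solves_lagrangian\<close>
  on that edge.
\<close>

lemma lagrangian:
  assumes x: "x \<in> supp_ends I" and y: "y \<in> supp_ends I"
    and orth: "\<And>u. u \<in> Cs I \<Longrightarrow> eigen_eq I c d l u \<Longrightarrow> ipe I x (bd I u) + ipe I y (dt I c u) = 0"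
  obtains u where "u \<in> Cs I" "eigen_eq I c d l u" "bd I u = y" "dt I c u = - x"
proof -
  let ?q = "\<lambda>i t. - (c i)\<^sup>2 * (d i t + l)"
  have ex: "\<exists>u u'. solves (?q i) u u' \<and> u 0 = y (i, 0) \<and> u 1 = y (i, 1) \<and>
      u' 0 = c i * x (i, 0) \<and> u' 1 = - (c i * x (i, 1))" if i: "i \<in> I" for i
  proof -
    have ci: "c i \<noteq> 0" using c[OF i] by simp
    have orth': "c i * x (i, 0) * v 0 + c i * x (i, 1) * v 1 - y (i, 0) * v' 0 + y (i, 1) * v' 1 = 0"
      if v: "solves (?q i) v v'" for v v'
    proof -
      have "solves (?q k) (\<lambda>t. 0 * v t + 0 * v t) (\<lambda>t. 0 * v t + 0 * v t)" for k
        by (simp add: solves_def)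
      then have f: "solves (?q k) ((if k = i then v else (\<lambda>t. 0))) ((if k = i then v' else (\<lambda>t. 0)))" for k
        using v by (simp add: solves_def)
      note g = glue_solution[where f = "\<lambda>k. if k = i then v else (\<lambda>t. 0)" and f' = "\<lambda>k. if k = i then v' else (\<lambda>t. 0)", OF f]
      let ?w = "glue (\<lambda>k. if k = i then v else (\<lambda>t. 0))"
      have "ipe I x (bd I ?w) = (\<Sum>k\<in>I. if k = i then x (i, 0) * v 0 + x (i, 1) * v 1 else 0)"
        unfolding ipe_def sum_ends[OF I] by (rule sum.cong) (auto simp: bd_def g(3))
      then have 1: "ipe I x (bd I ?w) = x (i, 0) * v 0 + x (i, 1) * v 1" using I i by simp
      have "ipe I y (dt I c ?w) = (\<Sum>k\<in>I. if k = i then - y (i, 0) * v' 0 / c i + y (i, 1) * v' 1 / c i else 0)"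
        unfolding ipe_def sum_ends[OF I] by (rule sum.cong) (auto simp: dt_def g(3) ext_sign_def)
      then have 2: "ipe I y (dt I c ?w) = - y (i, 0) * v' 0 / c i + y (i, 1) * v' 1 / c i" using I i by simp
      have "x (i, 0) * v 0 + x (i, 1) * v 1 + (- y (i, 0) * v' 0 / c i + y (i, 1) * v' 1 / c i) = 0"
        using orth[OF g(1,2)] 1 2 by simp
      then have "c i * (x (i, 0) * v 0 + x (i, 1) * v 1 + (- y (i, 0) * v' 0 / c i + y (i, 1) * v' 1 / c i)) = 0" by simp
      moreover have "c i * (x (i, 0) * v 0 + x (i, 1) * v 1 + (- y (i, 0) * v' 0 / c i + y (i, 1) * v' 1 / c i)) =
        c i * x (i, 0) * v 0 + c i * x (i, 1) * v 1 - y (i, 0) * v' 0 + y (i, 1) * v' 1"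
        using ci by (simp add: algebra_simps)
      ultimately show ?thesis by metis
    qed
    obtain u u' where "solves (?q i) u u'" "u 0 = y (i, 0)" "u 1 = y (i, 1)"
        "u' 0 = c i * x (i, 0)" "u' 1 = - (c i * x (i, 1))"
      by (rule solves_lagrangian[OF smooth01_continuous[OF q_smooth[OF i]] orth'])
    then show ?thesis by (intro exI[of _ u] exI[of _ u']) simp
  qed
  obtain f f' where f: "\<And>i. i \<in> I \<Longrightarrow> solves (?q i) (f i) (f' i)"
    "\<And>i. i \<in> I \<Longrightarrow> f i 0 = y (i, 0)" "\<And>i. i \<in> I \<Longrightarrow> f i 1 = y (i, 1)"
    "\<And>i. i \<in> I \<Longrightarrow> f' i 0 = c i * x (i, 0)" "\<And>i. i \<in> I \<Longrightarrow> f' i 1 = - (c i * x (i, 1))"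
  proof -
    have "\<forall>i\<in>I. \<exists>p. solves (?q i) (fst p) (snd p) \<and> fst p 0 = y (i, 0) \<and> fst p 1 = y (i, 1) \<and>
        snd p 0 = c i * x (i, 0) \<and> snd p 1 = - (c i * x (i, 1))"
      using ex by simp
    then obtain p where "\<forall>i\<in>I. solves (?q i) (fst (p i)) (snd (p i)) \<and> fst (p i) 0 = y (i, 0) \<and>
        fst (p i) 1 = y (i, 1) \<and> snd (p i) 0 = c i * x (i, 0) \<and> snd (p i) 1 = - (c i * x (i, 1))"
      unfolding bchoice_iff by blast
    then show ?thesis using that[of "\<lambda>i. fst (p i)" "\<lambda>i. snd (p i)"] by simp
  qed
  note g = glue_solution[OF f(1)]
  have "bd I (glue f) = y"
  proof
    fix e :: "'i \<times> real"
    show "bd I (glue f) e = y e"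
      using y by (cases e) (auto simp: bd_def supp_ends_def g(3) f(2,3))
  qed
  moreover have c0: "c i \<noteq> 0" if "i \<in> I" for i using c[OF that] by simp
  have "dt I c (glue f) = - x"
  proof
    fix e :: "'i \<times> real"
    show "dt I c (glue f) e = (- x) e"
      using x c0 by (cases e) (auto simp: dt_def supp_ends_def g(3) f(4,5) ext_sign_def)
  qed
  ultimately show ?thesis using that g(1,2) by blast
qed

text \<open>
  In the space \<open>U\<close> of pairs of values and normal derivatives, let \<open>Y\<close> be
  the sum of the data of solutions and of \<open>V \<times> V\<^sup>\<bottom>\<close>. The boundary
  value problem is solvable iff \<open>(g, 0) \<in> Y\<close>. A pair
  \<open>(\<alpha>, \<beta>)\<close> orthogonal to \<open>Y\<close> has
  \<open>\<alpha> \<bottom> V\<close> and \<open>\<beta> \<in> V\<close>, and it annihilates the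
  data of solutions, so \<open>(\<beta>, - \<alpha>)\<close> are the data of a solution
  \<open>w\<close>, which lies in \<open>J 0\<close>. The hypothesis on \<open>g\<close> then makes
  \<open>(\<alpha>, \<beta>)\<close> orthogonal to \<open>(g, 0)\<close>. Applied to the component
  of \<open>(g, 0)\<close> orthogonal to \<open>Y\<close>, this shows that the component vanishes.
\<close>

theorem fredholm:
  assumes g: "g \<in> supp_ends I" and orth: "\<And>u. u \<in> J 0 \<Longrightarrow> ipe I g (dt I c u) = 0"
  obtains u where "u \<in> Cs I" "eigen_eq I c d 0 u" "bd I u - g \<in> V"
    "\<And>v. v \<in> V \<Longrightarrow> ipe I (dt I c u) v = 0"
proof -
  let ?S = "supp_ends I"
  define U where "U = ?S \<times> ?S"
  define B where "B p q = ipe I (fst p) (fst q) + ipe I (snd p) (snd q)"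
    for p q :: "('i \<times> real \<Rightarrow> real) \<times> ('i \<times> real \<Rightarrow> real)"
  define Vp where "Vp = {z \<in> ?S. \<forall>v\<in>V. ipe I z v = 0}"
  define Y where "Y = {(bd I u + v, dt I c u + z) | u v z. u \<in> Cs I \<and> eigen_eq I c d 0 u \<and> v \<in> V \<and> z \<in> Vp}"
  have sS: "subspace ?S" by (rule subspace_supp_ends)
  have sVp: "subspace Vp"
    using sS unfolding Vp_def real_vector.subspace_def by (auto simp: ipe_linear(1,2) ipe_zero)
  have sU: "subspace U"
    using sS unfolding U_def real_vector.subspace_def by (auto simp: zero_prod_def)
  have fU: "findim U"
    unfolding findim_def
  proof (intro conjI sU)
    have fS: "findim ?S" using I by (rule findim_supp_ends)
    have "findim ((\<lambda>x. (x, 0)) ` ?S)" "findim ((\<lambda>x. (0, x)) ` ?S)"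
      by (rule dim_linear_image(1)[OF fS]; simp add: zero_prod_def)+
    then have "findim (span ((\<lambda>x. (x, 0)) ` ?S \<union> (\<lambda>x. (0, x)) ` ?S))" by (rule findim_span_Un)
    then obtain T where T: "finite T" "span ((\<lambda>x. (x, 0)) ` ?S \<union> (\<lambda>x. (0, x)) ` ?S) \<subseteq> span T"
      unfolding findim_def by blast
    have "U \<subseteq> span ((\<lambda>x. (x, 0)) ` ?S \<union> (\<lambda>x. (0, x)) ` ?S)"
    proof
      fix p assume p: "p \<in> U"
      have "(fst p, 0) + (0, snd p) \<in> span ((\<lambda>x. (x, 0)) ` ?S \<union> (\<lambda>x. (0, x)) ` ?S)"
        using p unfolding U_def by (intro real_vector.span_add real_vector.span_base) auto
      then show "p \<in> span ((\<lambda>x. (x, 0)) ` ?S \<union> (\<lambda>x. (0, x)) ` ?S)" by simp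
    qed
    then show "\<exists>T. finite T \<and> U \<subseteq> span T" using T by blast
  qed
  have sB: "sym_bilinear_on U B"
    by (rule sym_bilinear_onI) (auto simp: B_def ipe_linear(1,2) algebra_simps ipe_linear(3)[of I])
  have posB: "B p p > 0" if "p \<in> U" "p \<noteq> 0" for p
  proof -
    have m: "fst p \<in> ?S" "snd p \<in> ?S" using that(1) by (auto simp: U_def)
    have "fst p \<noteq> 0 \<or> snd p \<noteq> 0" using that(2) by (auto simp: prod_eq_iff)
    then show ?thesis
      using ipe_pos[OF I m(1)] ipe_pos[OF I m(2)] ipe_nonneg[of I "fst p"] ipe_nonneg[of I "snd p"]
      unfolding B_def by fastforce
  qed
  have VS: "v \<in> ?S" if "v \<in> V" for v using that V(2) by blast
  have YU: "Y \<subseteq> U"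
    unfolding Y_def U_def using VS sS bd_supp dt_supp
    by (auto simp: Vp_def intro!: real_vector.subspace_add[OF sS])
  have YI: "(bd I u + v, dt I c u + z) \<in> Y" if "u \<in> Cs I" "eigen_eq I c d 0 u" "v \<in> V" "z \<in> Vp" for u v z
    using that unfolding Y_def by blast
  have sJ: "0 \<in> J 0" using subspace_J by (rule real_vector.subspace_0)
  then have z0: "0 \<in> Cs I" "eigen_eq I c d 0 0" unfolding J_def H_def by auto
  have d0: "dt I c 0 = 0" using dt_scale[OF z0(1), of c 0] by simp
  have "subspace Y"
    unfolding real_vector.subspace_def
  proof (intro conjI ballI allI)
    show "0 \<in> Y"
      using YI[OF z0 real_vector.subspace_0[OF V(1)] real_vector.subspace_0[OF sVp]] d0
      by (simp add: bd_zero zero_prod_def)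
    fix p q assume "p \<in> Y" "q \<in> Y"
    then obtain u v z u' v' z' where *: "p = (bd I u + v, dt I c u + z)" "q = (bd I u' + v', dt I c u' + z')"
      "u \<in> Cs I" "eigen_eq I c d 0 u" "v \<in> V" "z \<in> Vp" "u' \<in> Cs I" "eigen_eq I c d 0 u'" "v' \<in> V" "z' \<in> Vp"
      unfolding Y_def by blast
    have "(bd I (u + u') + (v + v'), dt I c (u + u') + (z + z')) \<in> Y"
      using * subspace_Cs[of I] V(1) sVp
      by (intro YI) (auto intro: eigen_eq_add simp: real_vector.subspace_add)
    then show "p + q \<in> Y" using * by (simp add: bd_linear dt_add algebra_simps)
  next
    fix k p assume "p \<in> Y"
    then obtain u v z where *: "p = (bd I u + v, dt I c u + z)"
      "u \<in> Cs I" "eigen_eq I c d 0 u" "v \<in> V" "z \<in> Vp"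
      unfolding Y_def by blast
    have "(bd I (k *\<^sub>R u) + k *\<^sub>R v, dt I c (k *\<^sub>R u) + k *\<^sub>R z) \<in> Y"
      using * subspace_Cs[of I] V(1) sVp
      by (intro YI) (auto intro: eigen_eq_scale simp: real_vector.subspace_scale)
    then show "k *\<^sub>R p \<in> Y" using * by (simp add: bd_linear dt_scale scaleR_add_right)
  qed
  then have fY: "findim Y" using fU YU findim_subset by blast
  have gU: "(g, 0) \<in> U" using g sS unfolding U_def by (simp add: real_vector.subspace_0)
  obtain y where y: "y \<in> Y" "\<And>z. z \<in> Y \<Longrightarrow> B ((g, 0) - y) z = 0"
    using orthogonal_projection[OF fY YU sU sB posB[OF subsetD[OF YU]] gU] by blast
  obtain \<alpha> \<beta> where ab: "(g, 0) - y = (\<alpha>, \<beta>)" by (cases "(g, 0) - y")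
  have "(g, 0) - y \<in> U" using gU y(1) YU sU real_vector.subspace_diff by blast
  then have abS: "\<alpha> \<in> ?S" "\<beta> \<in> ?S" unfolding ab U_def by auto
  have orthY: "ipe I \<alpha> (bd I u + v) + ipe I \<beta> (dt I c u + z) = 0"
    if "u \<in> Cs I" "eigen_eq I c d 0 u" "v \<in> V" "z \<in> Vp" for u v z
    using y(2)[OF YI[OF that]] unfolding ab B_def by simp
  have V0: "0 \<in> V" "0 \<in> Vp" using V(1) sVp by (simp_all add: real_vector.subspace_0)
  have \<alpha>V: "ipe I \<alpha> v = 0" if "v \<in> V" for v
    using orthY[OF z0 that V0(2)] by (simp add: bd_zero d0 ipe_zero)
  have \<beta>Vp: "ipe I \<beta> z = 0" if "z \<in> Vp" for z
    using orthY[OF z0 V0(1) that] by (simp add: bd_zero d0 ipe_zero)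
  have \<beta>: "\<beta> \<in> V"
  proof -
    have fV: "findim V" using findim_subset[OF findim_supp_ends[OF I] V] .
    obtain v where v: "v \<in> V" "\<And>z. z \<in> V \<Longrightarrow> ipe I (\<beta> - v) z = 0"
      using orthogonal_projection[OF fV V(2) sS sym_bilinear_ipe ipe_pos[OF I VS] abS(2)] by blast
    have mS: "\<beta> - v \<in> ?S" using abS(2) VS[OF v(1)] sS by (simp add: real_vector.subspace_diff)
    then have "\<beta> - v \<in> Vp" unfolding Vp_def using v(2) by blast
    then have "ipe I (\<beta> - v) \<beta> = 0" using \<beta>Vp[of "\<beta> - v"] ipe_linear(3)[of I] by simp
    moreover have "ipe I (\<beta> - v) v = 0" using v by blast
    moreover have "ipe I (\<beta> - v) (\<beta> - v) + ipe I (\<beta> - v) v = ipe I (\<beta> - v) \<beta>"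
      using ipe_linear_right(1)[of I "\<beta> - v" "\<beta> - v" v] by simp
    ultimately have "\<beta> - v = 0" using ipe_pos[OF I mS] by force
    then show ?thesis using v(1) by simp
  qed
  have lag: "ipe I \<alpha> (bd I u) + ipe I \<beta> (dt I c u) = 0" if "u \<in> Cs I" "eigen_eq I c d 0 u" for u
    using orthY[OF that V0] by simp
  obtain w where w: "w \<in> Cs I" "eigen_eq I c d 0 w" "bd I w = \<beta>" "dt I c w = - \<alpha>"
    by (rule lagrangian[OF abS lag])
  have neg: "ipe I (- x) y = - ipe I x y" for x y
    using ipe_linear(2)[of I "-1" x y] by simp
  have "w \<in> J 0" unfolding J_def H_def using w \<beta> \<alpha>V by (simp add: neg)
  then have "ipe I g (- \<alpha>) = 0" using orth w(4) by metis
  then have "ipe I \<alpha> g = 0" using ipe_linear(3)[of I g] neg[of \<alpha> g] by simp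
  then have "B (\<alpha>, \<beta>) (g, 0) = 0" by (simp add: B_def ipe_zero)
  moreover have "B (\<alpha>, \<beta>) y = 0" using y ab by metis
  moreover have "B (\<alpha>, \<beta>) ((\<alpha>, \<beta>) + y) = B (\<alpha>, \<beta>) (\<alpha>, \<beta>) + B (\<alpha>, \<beta>) y"
    by (simp add: B_def ipe_linear_right)
  moreover have "(\<alpha>, \<beta>) + y = (g, 0)" using ab by (metis diff_add_cancel)
  ultimately have "B (\<alpha>, \<beta>) (\<alpha>, \<beta>) = 0" by simp
  moreover have "(\<alpha>, \<beta>) \<in> U" using abS by (simp add: U_def)
  ultimately have "(\<alpha>, \<beta>) = 0" using posB[of "(\<alpha>, \<beta>)"] by (metis less_irrefl)
  then have "(g, 0) = y" using ab by simp
  then obtain u v z where u: "u \<in> Cs I" "eigen_eq I c d 0 u" "v \<in> V" "z \<in> Vp"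
    and eq: "g = bd I u + v" "0 = dt I c u + z"
    using y(1) unfolding Y_def by auto
  have "bd I u - g = - v" using eq(1) by simp
  moreover have "- v \<in> V" using V(1) u(3) by (simp add: real_vector.subspace_neg)
  moreover have "dt I c u = - z" using eq(2) by (metis add_eq_0_iff2)
  then have "ipe I (dt I c u) v' = 0" if "v' \<in> V" for v'
    using u(4) that unfolding Vp_def by (simp add: neg)
  ultimately show ?thesis using that[OF u(1,2)] by simp
qed

end

section \<open>Nodal reduction\<close>

text \<open>
  Each edge is divided into \<open>m\<close> pieces. The assumption \<open>fine\<close> is the
  hypothesis of \<open>dirichlet_positive\<close> on pieces of length \<open>1 / m\<close>, for all
  spectral parameters up to \<open>1\<close>: the parameters of interest are
  \<open>l \<le> 0\<close>, but continuity at \<open>0\<close> is obtained from concavity on an open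
  interval containing it.
\<close>

locale subdivided_graph = quantum_graph +
  fixes m :: nat
  assumes m: "m > 0"
    and fine: "\<And>i t. i \<in> I \<Longrightarrow> t \<in> {0..1} \<Longrightarrow> 4 * ((c i)\<^sup>2 * (d i t + 1)) < (real m)\<^sup>2"
begin

definition \<tau> :: "nat \<Rightarrow> real"
  where "\<tau> j = real j / real m"

lemma \<tau>_simps: "\<tau> 0 = 0" "\<tau> m = 1" "\<tau> j < \<tau> (Suc j)" "\<tau> (Suc j) - \<tau> j = 1 / real m"
  using m by (simp_all add: \<tau>_def field_simps)

lemma \<tau>_range: "j \<le> m \<Longrightarrow> \<tau> j \<in> {0..1}"
  using m by (simp add: \<tau>_def)

lemma \<tau>_sub: "j < m \<Longrightarrow> {\<tau> j..\<tau> (Suc j)} \<subseteq> {0..1}"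
  using \<tau>_range[of j] \<tau>_range[of "Suc j"] by auto

definition q :: "real \<Rightarrow> 'a \<Rightarrow> real \<Rightarrow> real"
  where "q l i t = - (c i)\<^sup>2 * (d i t + l)"

lemma q_cont: "i \<in> I \<Longrightarrow> continuous_on {0..1} (q l i)"
  unfolding q_def using smooth01_continuous[OF q_smooth] by simp

lemma q_small:
  assumes "i \<in> I" "l \<le> 1" "t \<in> {0..1}"
  shows "- q l i t * (4 * (\<tau> (Suc j) - \<tau> j)\<^sup>2) < 1"
proof -
  have "4 * ((c i)\<^sup>2 * (d i t + l)) \<le> 4 * ((c i)\<^sup>2 * (d i t + 1))"
    using assms(2) by (intro mult_left_mono) auto
  also have "\<dots> < (real m)\<^sup>2" using fine[OF assms(1,3)] .
  finally show ?thesis using m by (simp add: q_def \<tau>_simps power_divide field_simps)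
qed

text \<open>
  A solution on the whole edge with given values at the two ends of a piece. The solution
  \<open>P\<close> is combined from those with values \<open>1, 0\<close> and \<open>0, 1\<close>,
  so that it is linear in the node values by definition.
\<close>

definition hat :: "real \<Rightarrow> 'a \<Rightarrow> nat \<Rightarrow> real \<Rightarrow> real \<Rightarrow> (real \<Rightarrow> real) \<times> (real \<Rightarrow> real)"
  where "hat l i j x y = (SOME p. solves (q l i) (fst p) (snd p) \<and> fst p (\<tau> j) = x \<and> fst p (\<tau> (Suc j)) = y)"

definition P :: "real \<Rightarrow> 'a \<Rightarrow> nat \<Rightarrow> real \<Rightarrow> real \<Rightarrow> real \<Rightarrow> real"
  where "P l i j x y t = x * fst (hat l i j 1 0) t + y * fst (hat l i j 0 1) t"

definition P' :: "real \<Rightarrow> 'a \<Rightarrow> nat \<Rightarrow> real \<Rightarrow> real \<Rightarrow> real \<Rightarrow> real"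
  where "P' l i j x y t = x * snd (hat l i j 1 0) t + y * snd (hat l i j 0 1) t"

lemma P_solves:
  assumes i: "i \<in> I" and j: "j < m" and l: "l \<le> 1"
  shows "solves (q l i) (P l i j x y) (P' l i j x y)" "P l i j x y (\<tau> j) = x" "P l i j x y (\<tau> (Suc j)) = y"
proof -
  have hat: "solves (q l i) (fst (hat l i j x y)) (snd (hat l i j x y)) \<and>
      fst (hat l i j x y) (\<tau> j) = x \<and> fst (hat l i j x y) (\<tau> (Suc j)) = y" for x y
    unfolding hat_def
  proof (rule someI_ex)
    have small: "- q l i t * (4 * (\<tau> (Suc j) - \<tau> j)\<^sup>2) < 1" if "t \<in> {\<tau> j..\<tau> (Suc j)}" for t
      using q_small[OF i l] \<tau>_sub[OF j] that by blast
    obtain u u' where "solves (q l i) u u'" "u (\<tau> j) = x" "u (\<tau> (Suc j)) = y"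
      by (rule solves_boundary_values[OF q_cont[OF i] \<tau>_simps(3) \<tau>_sub[OF j] small])
    then show "\<exists>p. solves (q l i) (fst p) (snd p) \<and> fst p (\<tau> j) = x \<and> fst p (\<tau> (Suc j)) = y"
      by (intro exI[of _ "(u, u')"]) simp
  qed
  show "solves (q l i) (P l i j x y) (P' l i j x y)"
    unfolding P_def[abs_def] P'_def[abs_def] using hat by (intro solves_linear) auto
  show "P l i j x y (\<tau> j) = x" "P l i j x y (\<tau> (Suc j)) = y"
    unfolding P_def using hat by simp_all
qed

lemma P_deriv:
  assumes "i \<in> I" "j < m" "l \<le> 1" "t \<in> {\<tau> j..\<tau> (Suc j)}"
  shows "(P l i j x y has_real_derivative P' l i j x y t) (at t within {\<tau> j..\<tau> (Suc j)})"
    and "(P' l i j x y has_real_derivative q l i t * P l i j x y t) (at t within {\<tau> j..\<tau> (Suc j)})"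
  using solves_subinterval[OF P_solves(1)[OF assms(1-3)] \<tau>_sub[OF assms(2)] assms(4)] by auto

text \<open>
  The integrand has the shape of \<open>dirichlet_positive\<close> for the potential
  \<open>- q\<close>. By Green's formula \<open>E\<close> is the corresponding bilinear form at two
  solutions, in terms of their node values.
\<close>

definition piece :: "real \<Rightarrow> 'a \<Rightarrow> nat \<Rightarrow> (real \<Rightarrow> real) \<Rightarrow> (real \<Rightarrow> real) \<Rightarrow> real"
  where "piece l i j f f' = integral {\<tau> j..\<tau> (Suc j)} (\<lambda>t. (f' t)\<^sup>2 - - q l i t * (f t)\<^sup>2)"

definition E :: "real \<Rightarrow> 'a \<Rightarrow> nat \<Rightarrow> real \<Rightarrow> real \<Rightarrow> real \<Rightarrow> real \<Rightarrow> real"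
  where "E l i j x y x2 y2 = P' l i j x y (\<tau> (Suc j)) * y2 - P' l i j x y (\<tau> j) * x2"

lemma q_cont_piece: "i \<in> I \<Longrightarrow> j < m \<Longrightarrow> continuous_on {\<tau> j..\<tau> (Suc j)} (q k i)"
  using continuous_on_subset[OF q_cont \<tau>_sub] .

context
  fixes i :: 'a and j :: nat and l :: real
  assumes i: "i \<in> I" and j: "j < m" and l: "l \<le> 1"
begin

abbreviation (input) "S \<equiv> {\<tau> j..\<tau> (Suc j)}"

lemma E_green:
  assumes g: "\<And>t. t \<in> S \<Longrightarrow> (g has_real_derivative g' t) (at t within S)"
    and e: "g (\<tau> j) = x2" "g (\<tau> (Suc j)) = y2"
  shows "((\<lambda>t. P' l i j x y t * g' t + q l i t * P l i j x y t * g t) has_integral E l i j x y x2 y2) S"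
  unfolding E_def e[symmetric]
  using \<tau>_simps(3)[of j] P_deriv(2)[OF i j l] g by (intro green_has_integral) auto

lemma piece_nonneg:
  assumes g: "\<And>t. t \<in> S \<Longrightarrow> (g has_real_derivative g' t) (at t within S)"
    and g': "continuous_on S g'" and e: "g (\<tau> (Suc j)) = 0"
  shows "0 \<le> piece l i j g g'" "piece l i j g g' = 0 \<Longrightarrow> t \<in> S \<Longrightarrow> g t = 0"
proof -
  have cq: "continuous_on S (\<lambda>t. - q l i t)" using q_cont_piece[OF i j] by (rule continuous_on_minus)
  have small: "- q l i t * (4 * (\<tau> (Suc j) - \<tau> j)\<^sup>2) < 1" if "t \<in> S" for t
    using q_small[OF i l] \<tau>_sub[OF j] that by blast
  show "0 \<le> piece l i j g g'"
    unfolding piece_def by (rule dirichlet_positive(1)[OF \<tau>_simps(3) g g' cq small e])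
  show "piece l i j g g' = 0 \<Longrightarrow> t \<in> S \<Longrightarrow> g t = 0"
    unfolding piece_def by (rule dirichlet_positive(2)[OF \<tau>_simps(3) g g' cq small e])
qed

lemma piece_P: "piece l i j (P l i j x y) (P' l i j x y) = E l i j x y x y"
  using E_green[OF P_deriv(1)[OF i j l] P_solves(2,3)[OF i j l], of x y]
  unfolding piece_def by (simp add: power2_eq_square mult.assoc integral_unique)

text \<open>
  The difference to the solution with the same node values vanishes at both ends. So the mixed term
  is zero and the difference contributes a nonnegative amount.
\<close>

lemma piece_min:
  assumes g: "\<And>t. t \<in> S \<Longrightarrow> (g has_real_derivative g' t) (at t within S)"
    and g': "continuous_on S g'" and e: "g (\<tau> j) = x" "g (\<tau> (Suc j)) = y"
  shows "E l i j x y x y \<le> piece l i j g g'"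
proof -
  let ?P = "P l i j x y" and ?P' = "P' l i j x y"
  define w where "w t = g t - ?P t" for t
  define w' where "w' t = g' t - ?P' t" for t
  have dw: "(w has_real_derivative w' t) (at t within S)" if "t \<in> S" for t
    unfolding w_def w'_def using g[OF that] P_deriv(1)[OF i j l that] by (rule DERIV_diff)
  have cP': "continuous_on S ?P'" using P_deriv(2)[OF i j l] by (rule has_real_derivative_continuous_on)
  have cP: "continuous_on S ?P" using P_deriv(1)[OF i j l] by (rule has_real_derivative_continuous_on)
  have cw: "continuous_on S w" using dw by (rule has_real_derivative_continuous_on)
  have cw': "continuous_on S w'" unfolding w'_def using g' cP' by (rule continuous_on_diff)
  have z: "w (\<tau> j) = 0" "w (\<tau> (Suc j)) = 0" using e P_solves(2,3)[OF i j l] by (simp_all add: w_def)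
  have 1: "((\<lambda>t. (?P' t)\<^sup>2 - - q l i t * (?P t)\<^sup>2) has_integral E l i j x y x y) S"
    unfolding piece_P[symmetric] piece_def using cP cP' q_cont_piece[OF i j]
    by (intro integrable_integral integrable_continuous_real continuous_intros)
  have 2: "((\<lambda>t. 2 * (?P' t * w' t + q l i t * ?P t * w t)) has_integral 2 * E l i j x y 0 0) S"
    by (rule has_integral_mult_right[OF E_green[OF dw z]])
  have 3: "((\<lambda>t. (w' t)\<^sup>2 - - q l i t * (w t)\<^sup>2) has_integral piece l i j w w') S"
    unfolding piece_def using cw cw' q_cont_piece[OF i j]
    by (intro integrable_integral integrable_continuous_real continuous_intros)
  have "((\<lambda>t. ((?P' t)\<^sup>2 - - q l i t * (?P t)\<^sup>2) + 2 * (?P' t * w' t + q l i t * ?P t * w t) +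
      ((w' t)\<^sup>2 - - q l i t * (w t)\<^sup>2)) has_integral E l i j x y x y + 2 * E l i j x y 0 0 + piece l i j w w') S"
    by (intro has_integral_add 1 2 3)
  moreover have "((?P' t)\<^sup>2 - - q l i t * (?P t)\<^sup>2) + 2 * (?P' t * w' t + q l i t * ?P t * w t) +
      ((w' t)\<^sup>2 - - q l i t * (w t)\<^sup>2) = (g' t)\<^sup>2 - - q l i t * (g t)\<^sup>2" for t
    by (simp add: w_def w'_def power2_eq_square algebra_simps)
  ultimately have "piece l i j g g' = E l i j x y x y + 2 * E l i j x y 0 0 + piece l i j w w'"
    unfolding piece_def[of l i j g g'] by (simp add: integral_unique)
  moreover have "E l i j x y 0 0 = 0" by (simp add: E_def)
  ultimately show ?thesis using piece_nonneg(1)[OF dw cw' z(2)] by simp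
qed

lemma E_sym: "E l i j x y x2 y2 = E l i j x2 y2 x y"
proof -
  have a: "((\<lambda>t. P' l i j x y t * P' l i j x2 y2 t + q l i t * P l i j x y t * P l i j x2 y2 t) has_integral E l i j x y x2 y2) S"
    by (rule E_green[OF P_deriv(1)[OF i j l] P_solves(2,3)[OF i j l]])
  have b: "((\<lambda>t. P' l i j x2 y2 t * P' l i j x y t + q l i t * P l i j x2 y2 t * P l i j x y t) has_integral E l i j x2 y2 x y) S"
    by (rule E_green[OF P_deriv(1)[OF i j l] P_solves(2,3)[OF i j l]])
  have eq: "(\<lambda>t. P' l i j x2 y2 t * P' l i j x y t + q l i t * P l i j x2 y2 t * P l i j x y t) =
      (\<lambda>t. P' l i j x y t * P' l i j x2 y2 t + q l i t * P l i j x y t * P l i j x2 y2 t)"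
    by (auto simp: mult_ac)
  show ?thesis by (rule has_integral_unique[OF a b[unfolded eq]])
qed

end

lemma E_linear:
  "E l i j (x + x') (y + y') x2 y2 = E l i j x y x2 y2 + E l i j x' y' x2 y2"
  "E l i j (k * x) (k * y) x2 y2 = k * E l i j x y x2 y2"
  by (simp_all add: E_def P'_def algebra_simps)

text \<open>
  \<open>E l\<close> is the minimum of \<open>piece l\<close>, which is affine in \<open>l\<close>.
  In the proof the solution at the intermediate parameter serves as competitor at both ends.
\<close>

lemma E_concave:
  assumes i: "i \<in> I" and j: "j < m"
  shows "convex_on {..<1} (\<lambda>l. - E l i j x y x y)"
proof (rule convex_onI)
  fix s a b :: real assume s: "0 < s" "s < 1" and ab: "a \<in> {..<1}" "b \<in> {..<1}"
  define l where "l = (1 - s) *\<^sub>R a + s *\<^sub>R b"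
  have "(1 - s) * a + s * b < (1 - s) * 1 + s * 1"
    using s ab by (intro add_strict_mono mult_strict_left_mono) auto
  then have l: "l \<le> 1" by (simp add: l_def)
  let ?P = "P l i j x y" and ?P' = "P' l i j x y"
  have cP': "continuous_on {\<tau> j..\<tau> (Suc j)} ?P'"
    using P_deriv(2)[OF i j l] by (rule has_real_derivative_continuous_on)
  have cP: "continuous_on {\<tau> j..\<tau> (Suc j)} ?P"
    using P_deriv(1)[OF i j l] by (rule has_real_derivative_continuous_on)
  have int: "(\<lambda>t. (?P' t)\<^sup>2 - - q k i t * (?P t)\<^sup>2) integrable_on {\<tau> j..\<tau> (Suc j)}" for k
    using cP cP' q_cont_piece[OF i j] by (intro integrable_continuous_real continuous_intros)
  have le: "E k i j x y x y \<le> piece k i j ?P ?P'" if "k < 1" for k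
    using piece_min[OF i j _ P_deriv(1)[OF i j l] cP' P_solves(2,3)[OF i j l]] that by simp
  have "E l i j x y x y = piece l i j ?P ?P'" using piece_P[OF i j l] by simp
  also have "\<dots> = integral {\<tau> j..\<tau> (Suc j)} (\<lambda>t. (1 - s) * ((?P' t)\<^sup>2 - - q a i t * (?P t)\<^sup>2) +
      s * ((?P' t)\<^sup>2 - - q b i t * (?P t)\<^sup>2))"
    unfolding piece_def by (rule integral_cong) (simp add: q_def l_def algebra_simps)
  also have "\<dots> = (1 - s) * piece a i j ?P ?P' + s * piece b i j ?P ?P'"
    unfolding piece_def using int
    by (subst integral_add) (auto intro: integrable_on_mult_right)
  also have "\<dots> \<ge> (1 - s) * E a i j x y x y + s * E b i j x y x y"
    using s ab le by (intro add_mono mult_left_mono) auto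
  finally show "- E ((1 - s) *\<^sub>R a + s *\<^sub>R b) i j x y x y \<le> (1 - s) * - E a i j x y x y + s * - E b i j x y x y"
    by (simp add: l_def)
qed simp

text \<open>
  A concave function is continuous on an open interval; polarisation extends this to the bilinear
  form.
\<close>

lemma E_continuous:
  assumes i: "i \<in> I" and j: "j < m"
  shows "continuous_on {..0} (\<lambda>l. E l i j x y x2 y2)"
proof -
  have c: "continuous_on {..0} (\<lambda>l. E l i j x y x y)" for x y
  proof -
    have "continuous_on {..<1} (\<lambda>l. - E l i j x y x y)"
      using E_concave[OF i j] by (intro convex_on_continuous) auto
    from continuous_on_minus[OF this] have "continuous_on {..<1} (\<lambda>l. E l i j x y x y)" by simp
    then show ?thesis by (rule continuous_on_subset) auto
  qed
  have cont: "continuous_on {..0} (\<lambda>l. (E l i j (x + x2) (y + y2) (x + x2) (y + y2) - E l i j x y x y - E l i j x2 y2 x2 y2) / 2)"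
    by (intro continuous_intros c) simp
  have eq: "(E l i j (x + x2) (y + y2) (x + x2) (y + y2) - E l i j x y x y - E l i j x2 y2 x2 y2) / 2 = E l i j x y x2 y2"
    if "l \<in> {..0}" for l
  proof -
    have l: "l \<le> 1" using that by simp
    have "E l i j (x + x2) (y + y2) (x + x2) (y + y2) = E l i j x y (x + x2) (y + y2) + E l i j x2 y2 (x + x2) (y + y2)"
      by (rule E_linear)
    also have "\<dots> = E l i j (x + x2) (y + y2) x y + E l i j (x + x2) (y + y2) x2 y2"
      using E_sym[OF i j l] by metis
    also have "\<dots> = E l i j x y x y + E l i j x2 y2 x y + E l i j x y x2 y2 + E l i j x2 y2 x2 y2"
      by (simp add: E_linear)
    also have "E l i j x2 y2 x y = E l i j x y x2 y2" by (rule E_sym[OF i j l])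
    finally show ?thesis by simp
  qed
  show ?thesis by (rule continuous_on_cong[THEN iffD1, OF refl eq cont])
qed

text \<open>
  The finite-dimensional model: \<open>F\<close> consists of the node values satisfying the vertex
  condition, where \<open>outer\<close> turns the values at the first and the last node of an edge
  into boundary data. \<open>R\<close> restricts a function to the nodes, and \<open>Q l\<close> is
  the form left after minimising over functions with given node values. The factor
  \<open>1 / c i\<close> is the one in \<open>energy\<close>, where
  \<open>deriv01 (u i) t * deriv01 (v i) t\<close> is divided by \<open>c i\<close>.
\<close>

definition outer :: "('a \<times> nat \<Rightarrow> real) \<Rightarrow> 'a \<times> real \<Rightarrow> real"
  where "outer x = (\<lambda>(i, t). if i \<in> I \<and> t \<in> {0, 1} then x (i, if t = 0 then 0 else m) else 0)"

definition F :: "('a \<times> nat \<Rightarrow> real) set"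
  where "F = {x. (\<forall>e. e \<notin> I \<times> {..m} \<longrightarrow> x e = 0) \<and> outer x \<in> V}"

definition Q :: "real \<Rightarrow> ('a \<times> nat \<Rightarrow> real) \<Rightarrow> ('a \<times> nat \<Rightarrow> real) \<Rightarrow> real"
  where "Q l x y = (\<Sum>i\<in>I. \<Sum>j<m. E l i j (x (i, j)) (x (i, Suc j)) (y (i, j)) (y (i, Suc j)) / c i)"

definition R :: "('a \<Rightarrow> real \<Rightarrow> real) \<Rightarrow> 'a \<times> nat \<Rightarrow> real"
  where "R u = (\<lambda>(i, j). if i \<in> I \<and> j \<le> m then u i (\<tau> j) else 0)"

lemma R_linear: "R (u + v) = R u + R v" "R (k *\<^sub>R u) = k *\<^sub>R R u"
  by (auto simp: R_def fun_eq_iff scaleR_fun_def)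

lemma R_on: "i \<in> I \<Longrightarrow> j \<le> m \<Longrightarrow> R u (i, j) = u i (\<tau> j)"
  by (simp add: R_def)

lemma outer_linear: "outer (x + y) = outer x + outer y" "outer (k *\<^sub>R x) = k *\<^sub>R outer x" "outer 0 = 0"
  by (auto simp: outer_def fun_eq_iff scaleR_fun_def)

lemma findim_F: "findim F"
proof (rule findim_subset[OF findim_supp[of "I \<times> {..m}"]])
  show "subspace F"
    unfolding real_vector.subspace_def
  proof (intro conjI ballI allI)
    show "0 \<in> F" using V(1) by (simp add: F_def outer_linear real_vector.subspace_0)
    show "x + y \<in> F" if "x \<in> F" "y \<in> F" for x y
      using that V(1) by (simp add: F_def outer_linear real_vector.subspace_add)
    show "k *\<^sub>R x \<in> F" if "x \<in> F" for k x
    proof -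
      have "outer (k *\<^sub>R x) \<in> V"
        using that V(1) unfolding outer_linear F_def by (simp add: real_vector.subspace_scale)
      moreover have "(k *\<^sub>R x) e = 0" if "e \<notin> I \<times> {..m}" for e
      proof -
        have "x e = 0" using \<open>x \<in> F\<close> that unfolding F_def by blast
        then show ?thesis by (simp add: scaleR_fun_def)
      qed
      ultimately show ?thesis unfolding F_def by blast
    qed
  qed
qed (use I in \<open>auto simp: F_def\<close>)

lemma outer_R: "outer (R u) = bd I u"
  using \<tau>_simps(1,2) by (auto simp: outer_def bd_def R_def fun_eq_iff)

lemma R_F:
  assumes "u \<in> H"
  shows "R u \<in> F"
proof -
  have "\<forall>e. e \<notin> I \<times> {..m} \<longrightarrow> R u e = 0" by (auto simp: R_def)
  then show ?thesis using assms unfolding F_def H_def by (simp add: outer_R)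
qed

lemma Q_sym_bilinear:
  assumes l: "l \<le> 1"
  shows "sym_bilinear_on U (Q l)"
proof (rule sym_bilinear_onI)
  show "Q l x y = Q l y x" for x y
    unfolding Q_def using E_sym[OF _ _ l]
    by (intro sum.cong refl arg_cong2[of _ _ _ _ "(/)"]) auto
  show "Q l (x + y) z = Q l x z + Q l y z" for x y z
    unfolding Q_def by (simp add: E_linear add_divide_distrib sum.distrib)
  show "Q l (k *\<^sub>R x) z = k * Q l x z" for k x z
    unfolding Q_def by (simp add: E_linear scaleR_fun_def sum_distrib_left)
qed

lemma Q_continuous: "continuous_on {..0} (\<lambda>l. Q l x y)"
  unfolding Q_def divide_inverse
  by (intro continuous_on_sum continuous_on_mult_right E_continuous) auto

text \<open>
  For \<open>l\<close> below all values of \<open>- d\<close> the potential \<open>q\<close> is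
  positive, so the integrand is a sum of squares which vanishes only for the zero solution.
\<close>

lemma Q_pos:
  obtains L where "\<And>l x. l \<le> L \<Longrightarrow> x \<in> F \<Longrightarrow> x \<noteq> 0 \<Longrightarrow> Q l x x > 0"
proof -
  \<comment> \<open>an upper bound of \<open>d\<close>, read off from \<open>fine\<close>\<close>
  define D where "D = (\<Sum>i\<in>I. (real m)\<^sup>2 / (4 * (c i)\<^sup>2))"
  have D0: "D \<ge> 0" unfolding D_def by (intro sum_nonneg) simp
  have D: "d i t < D" if i: "i \<in> I" and t: "t \<in> {0..1}" for i t
  proof -
    have "4 * ((c i)\<^sup>2 * (d i t + 1)) < (real m)\<^sup>2" using fine[OF i t] .
    then have "d i t + 1 < (real m)\<^sup>2 / (4 * (c i)\<^sup>2)"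
      using c[OF i] by (simp add: field_simps)
    also have "\<dots> \<le> D" unfolding D_def using I i by (intro member_le_sum) auto
    finally show ?thesis by simp
  qed
  have "Q l x x > 0" if l: "l \<le> - D" and x: "x \<in> F" "x \<noteq> 0" for l x
  proof -
    have l1: "l \<le> 1" using l D0 by simp
    have neg: "q l i t > 0" if i: "i \<in> I" and t: "t \<in> {0..1}" for i t
    proof -
      have "d i t + l < 0" using D[OF i t] l by simp
      then show ?thesis using c[OF i] unfolding q_def by (simp add: mult_pos_neg)
    qed
    have EE: "0 \<le> E l i j a b a b \<and> (E l i j a b a b = 0 \<longrightarrow> a = 0 \<and> b = 0)" if i: "i \<in> I" and j: "j < m" for i j a b
    proof -
      let ?S = "{\<tau> j..\<tau> (Suc j)}"
      have cP': "continuous_on ?S (P' l i j a b)"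
        using P_deriv(2)[OF i j l1] by (rule has_real_derivative_continuous_on)
      have cP: "continuous_on ?S (P l i j a b)"
        using P_deriv(1)[OF i j l1] by (rule has_real_derivative_continuous_on)
      define f where "f t = (P' l i j a b t)\<^sup>2 - - q l i t * (P l i j a b t)\<^sup>2" for t
      have cf: "continuous_on ?S f"
        unfolding f_def using cP cP' q_cont_piece[OF i j] by (intro continuous_intros)
      have q: "q l i t > 0" if "t \<in> ?S" for t using neg[OF i] \<tau>_sub[OF j] that by blast
      have f0: "f t \<ge> 0" if "t \<in> ?S" for t
        unfolding f_def using q[OF that] by simp
      have EI: "E l i j a b a b = integral ?S f"
        using piece_P[OF i j l1] unfolding piece_def f_def by simp
      have "0 \<le> integral ?S f" using f0 by (intro integral_nonneg integrable_continuous_real cf) auto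
      moreover have "a = 0 \<and> b = 0" if z: "integral ?S f = 0"
      proof -
        have "\<forall>t\<in>?S. f t = 0" using integral_eq_0_iff[OF cf \<tau>_simps(3) f0] z by simp
        then have "P l i j a b t = 0" if "t \<in> ?S" for t
          using q[OF that] that unfolding f_def by (smt (verit) mult_pos_pos zero_le_power2 zero_less_power2 mult_minus_left)
        then have "P l i j a b (\<tau> j) = 0" "P l i j a b (\<tau> (Suc j)) = 0" using \<tau>_simps(3)[of j] by auto
        then show ?thesis using P_solves(2,3)[OF i j l1] by simp
      qed
      ultimately show ?thesis using EI by simp
    qed
    obtain e where e: "x e \<noteq> 0" using x(2) by (auto simp: fun_eq_iff)
    obtain i k where ik: "e = (i, k)" "i \<in> I" "k \<le> m" using x(1) e unfolding F_def by (cases e) auto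
    obtain j where j: "j < m" "k = j \<or> k = Suc j"
    proof (cases "k < m")
      case True
      then show ?thesis using that by blast
    next
      case False
      then show ?thesis using that[of "m - 1"] ik(3) m by auto
    qed
    define G where "G i j = E l i j (x (i, j)) (x (i, Suc j)) (x (i, j)) (x (i, Suc j)) / c i" for i j
    have G0: "G i j \<ge> 0" if "i \<in> I" "j < m" for i j
      unfolding G_def using EE[OF that, of "x (i, j)" "x (i, Suc j)"] c[OF that(1)] by simp
    have "E l i j (x (i, j)) (x (i, Suc j)) (x (i, j)) (x (i, Suc j)) \<noteq> 0"
      using EE[OF ik(2) j(1), of "x (i, j)" "x (i, Suc j)"] j(2) e ik(1) by auto
    then have "G i j \<noteq> 0" unfolding G_def using c[OF ik(2)] by simp
    then have "G i j > 0" using G0[OF ik(2) j(1)] by simp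
    then have "(\<Sum>j<m. G i j) > 0" using j(1) G0[OF ik(2)] by (intro sum_pos2[of _ j]) auto
    then have "(\<Sum>i\<in>I. \<Sum>j<m. G i j) > 0"
      using I ik(2) G0 by (intro sum_pos2[of I i]) (auto intro: sum_nonneg)
    then show ?thesis unfolding Q_def G_def .
  qed
  then show ?thesis by (rule that)
qed

lemma energy_pieces:
  assumes u: "u \<in> Cs I"
  shows "energy I c d u u = (\<Sum>i\<in>I. \<Sum>j<m. piece 0 i j (u i) (deriv01 (u i)) / c i)"
  unfolding energy_def
proof (rule sum.cong[OF refl])
  fix i assume i: "i \<in> I"
  define f where "f t = deriv01 (u i) t * deriv01 (u i) t / c i - c i * d i t * u i t * u i t" for t
  have cf: "continuous_on {0..1} f" unfolding f_def using energy_cont[OF u u i] .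
  have "integral {0..\<tau> k} f = (\<Sum>j<k. integral {\<tau> j..\<tau> (Suc j)} f)" if "k \<le> m" for k
    using that
  proof (induction k)
    case 0
    then show ?case by (simp add: \<tau>_simps(1))
  next
    case (Suc k)
    have "f integrable_on {0..\<tau> (Suc k)}"
      using continuous_on_subset[OF cf, of "{0..\<tau> (Suc k)}"] \<tau>_range[OF Suc.prems]
      by (intro integrable_continuous_real) auto
    moreover have "0 \<le> \<tau> k" "\<tau> k \<le> \<tau> (Suc k)" using \<tau>_simps(3)[of k] by (auto simp: \<tau>_def)
    ultimately have "integral {0..\<tau> k} f + integral {\<tau> k..\<tau> (Suc k)} f = integral {0..\<tau> (Suc k)} f"
      by (intro Henstock_Kurzweil_Integration.integral_combine)
    then show ?case using Suc by simp
  qed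
  from this[OF order_refl] have "integral {0..1} f = (\<Sum>j<m. integral {\<tau> j..\<tau> (Suc j)} f)"
    by (simp add: \<tau>_simps(2))
  also have "\<dots> = (\<Sum>j<m. piece 0 i j (u i) (deriv01 (u i)) / c i)"
  proof (rule sum.cong[OF refl])
    fix j
    have ci: "c i \<noteq> 0" using c[OF i] by simp
    have "f t = ((deriv01 (u i) t)\<^sup>2 - - q 0 i t * (u i t)\<^sup>2) / c i" for t
      using ci by (simp add: f_def q_def power2_eq_square field_simps)
    then have "f = (\<lambda>t. ((deriv01 (u i) t)\<^sup>2 - - q 0 i t * (u i t)\<^sup>2) / c i)" by (rule ext)
    then show "integral {\<tau> j..\<tau> (Suc j)} f = piece 0 i j (u i) (deriv01 (u i)) / c i"
      unfolding piece_def by (simp only: integral_divide)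
  qed
  finally show "integral {0..1} (\<lambda>t. deriv01 (u i) t * deriv01 (u i) t / c i - c i * d i t * u i t * u i t) =
    (\<Sum>j<m. piece 0 i j (u i) (deriv01 (u i)) / c i)" unfolding f_def .
qed

lemma Cs_piece:
  assumes u: "u \<in> Cs I" and i: "i \<in> I" and j: "j < m"
  shows "\<And>t. t \<in> {\<tau> j..\<tau> (Suc j)} \<Longrightarrow> (u i has_real_derivative deriv01 (u i) t) (at t within {\<tau> j..\<tau> (Suc j)})"
    and "continuous_on {\<tau> j..\<tau> (Suc j)} (deriv01 (u i))"
proof -
  show "(u i has_real_derivative deriv01 (u i) t) (at t within {\<tau> j..\<tau> (Suc j)})" if "t \<in> {\<tau> j..\<tau> (Suc j)}" for t
    using DERIV_subset[OF Cs_deriv(1)[OF u i] \<tau>_sub[OF j]] \<tau>_sub[OF j] that by blast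
  show "continuous_on {\<tau> j..\<tau> (Suc j)} (deriv01 (u i))"
    using continuous_on_subset[OF Cs_deriv(4)[OF u i] \<tau>_sub[OF j]] .
qed

lemma Q_le_energy:
  assumes u: "u \<in> Cs I"
  shows "Q 0 (R u) (R u) \<le> energy I c d u u"
  unfolding Q_def energy_pieces[OF u]
proof (intro sum_mono divide_right_mono)
  fix i j assume i: "i \<in> I" and j: "j \<in> {..<m}"
  then have jm: "j < m" by simp
  show "E 0 i j (R u (i, j)) (R u (i, Suc j)) (R u (i, j)) (R u (i, Suc j)) \<le> piece 0 i j (u i) (deriv01 (u i))"
    by (rule piece_min[OF i jm _ Cs_piece[OF u i jm]]) (use i jm in \<open>auto simp: R_on\<close>)
  show "0 \<le> c i" using c[OF i] by simp
qed

lemma energy_pos: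
  assumes u: "u \<in> Cs I" and R: "R u = 0" and le: "energy I c d u u \<le> 0"
  shows "u = 0"
proof -
  have z: "u i (\<tau> j) = 0" if "i \<in> I" "j \<le> m" for i j
    using R R_on[OF that, of u] by (simp add: fun_eq_iff)
  have p: "0 \<le> piece 0 i j (u i) (deriv01 (u i)) / c i" if "i \<in> I" "j < m" for i j
    using piece_nonneg(1)[OF that _ Cs_piece[OF u that]] z[OF that(1), of "Suc j"] that c[OF that(1)] by simp
  have sums: "(\<Sum>i\<in>I. \<Sum>j<m. piece 0 i j (u i) (deriv01 (u i)) / c i) = 0"
    using le p unfolding energy_pieces[OF u] by (intro antisym sum_nonneg) auto
  have p0: "piece 0 i j (u i) (deriv01 (u i)) = 0" if i: "i \<in> I" and j: "j < m" for i j
  proof -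
    have "(\<Sum>j<m. piece 0 i j (u i) (deriv01 (u i)) / c i) = 0"
      using sums p I i by (subst (asm) sum_nonneg_eq_0_iff) (auto intro: sum_nonneg)
    then have "piece 0 i j (u i) (deriv01 (u i)) / c i = 0"
      using p[OF i] j by (subst (asm) sum_nonneg_eq_0_iff) auto
    then show ?thesis using c[OF i] by simp
  qed
  have "u i t = 0" if i: "i \<in> I" and t: "t \<in> {0..1}" for i t
  proof -
    obtain j where j: "j < m" "t \<in> {\<tau> j..\<tau> (Suc j)}"
    proof (cases "t = 1")
      case True
      then show ?thesis using that[of "m - 1"] m \<tau>_simps(2) \<tau>_simps(3)[of "m - 1"] by auto
    next
      case False
      define j where "j = nat \<lfloor>t * m\<rfloor>"
      have "t * m < m" using False t m by simp
      then have jm: "j < m" using t by (simp add: j_def nat_less_iff floor_less_iff)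
      have j1: "real j \<le> t * m" "t * m < real j + 1" using t by (simp_all add: j_def)
      then have "\<tau> j \<le> t" "t \<le> \<tau> (Suc j)" using m by (simp_all add: \<tau>_def field_simps)
      then show ?thesis using that jm by auto
    qed
    show ?thesis
      using piece_nonneg(2)[OF i j(1) _ Cs_piece[OF u i j(1)] _ p0[OF i j(1)] j(2)] z[OF i, of "Suc j"] j(1) by simp
  qed
  then have "u i t = 0" for i t using CsD(2)[OF u] by blast
  then show ?thesis by (auto simp: fun_eq_iff)
qed

text \<open>
  Testing with the node value \<open>1\<close> at one inner node shows that the derivatives of the
  adjacent solutions match there, so these solutions coincide and the edge carries a single one. For
  a test vector with values at the outer nodes only, the sum over the pieces telescopes, and
  vanishing of \<open>Q\<close> is the natural vertex condition.
\<close>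

lemma radical_eigenfunction:
  assumes x: "x \<in> radical F (Q l)" and l: "l \<le> 1"
  obtains u where "u \<in> J l" "R u = x"
proof -
  have xF: "x \<in> F" and xQ: "\<And>y. y \<in> F \<Longrightarrow> Q l x y = 0" using x unfolding radical_def by auto
  let ?P = "\<lambda>i j. P l i j (x (i, j)) (x (i, Suc j))"
  let ?P' = "\<lambda>i j. P' l i j (x (i, j)) (x (i, Suc j))"
  have match: "?P' i j (\<tau> (Suc j)) = ?P' i (Suc j) (\<tau> (Suc j))" if i: "i \<in> I" and j: "Suc j < m" for i j
  proof -
    define y where "y e = (if e = (i, Suc j) then 1 else 0 :: real)" for e
    have "outer y = 0" using j by (auto simp: outer_def y_def fun_eq_iff)
    then have yF: "y \<in> F" using V(1) i j by (auto simp: F_def y_def real_vector.subspace_0)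
    have "Q l x y = (\<Sum>i'\<in>I. \<Sum>j'<m. (if i' = i then (if j' = j then ?P' i j (\<tau> (Suc j)) / c i else 0) -
        (if j' = Suc j then ?P' i (Suc j) (\<tau> (Suc j)) / c i else 0) else 0))"
      unfolding Q_def E_def by (intro sum.cong refl) (auto simp: y_def)
    also have "\<dots> = (\<Sum>i'\<in>I. if i' = i then (\<Sum>j'<m. (if j' = j then ?P' i j (\<tau> (Suc j)) / c i else 0) -
        (if j' = Suc j then ?P' i (Suc j) (\<tau> (Suc j)) / c i else 0)) else 0)"
      by (intro sum.cong refl) auto
    also have "\<dots> = ?P' i j (\<tau> (Suc j)) / c i - ?P' i (Suc j) (\<tau> (Suc j)) / c i"
      using I i j by (simp add: sum_subtractf)
    finally show ?thesis using xQ[OF yF] c[OF i] by (simp add: field_simps)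
  qed
  have agree: "?P i j t = ?P i 0 t \<and> ?P' i j t = ?P' i 0 t" if i: "i \<in> I" and j: "j < m" and t: "t \<in> {0..1}" for i j t
    using j
  proof (induction j)
    case (Suc j)
    then have jm: "j < m" by simp
    note s1 = P_solves[OF i jm l, of "x (i, j)" "x (i, Suc j)"]
    note s2 = P_solves[OF i Suc.prems l, of "x (i, Suc j)" "x (i, Suc (Suc j))"]
    have s: "solves (q l i) (\<lambda>t. 1 * ?P i j t + (- 1) * ?P i (Suc j) t) (\<lambda>t. 1 * ?P' i j t + (- 1) * ?P' i (Suc j) t)"
      by (rule solves_linear[OF s1(1) s2(1)])
    have "\<tau> (Suc j) \<in> {0..1}" using \<tau>_range Suc.prems by simp
    from solves_unique[OF q_cont[OF i] s this _ _ t]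
    have "?P i j t = ?P i (Suc j) t" "?P' i j t = ?P' i (Suc j) t"
      using s1(3) s2(2) match[OF i Suc.prems] by simp_all
    then show ?case using Suc.IH[OF jm] by simp
  qed simp
  have f: "solves (\<lambda>t. - (c i)\<^sup>2 * (d i t + l)) (?P i 0) (?P' i 0)" if "i \<in> I" for i
    using P_solves(1)[OF that m l] unfolding q_def[abs_def] .
  define u where "u = glue (\<lambda>i. ?P i 0)"
  have g1: "u \<in> Cs I" "eigen_eq I c d l u"
    unfolding u_def by (rule glue_solution[where f = "\<lambda>i. ?P i 0" and f' = "\<lambda>i. ?P' i 0", OF f]; assumption)+
  have g: "u i t = ?P i 0 t \<and> deriv01 (u i) t = ?P' i 0 t" if "i \<in> I" "t \<in> {0..1}" for i t
    unfolding u_def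
    by (rule glue_solution(3)[where f = "\<lambda>i. ?P i 0" and f' = "\<lambda>i. ?P' i 0", OF f that]; assumption)
  have val: "u i (\<tau> j) = x (i, j)" if i: "i \<in> I" and j: "j \<le> m" for i j
  proof (cases "j < m")
    case True
    have "u i (\<tau> j) = ?P i j (\<tau> j)"
      using g[OF i \<tau>_range[OF j]] agree[OF i True \<tau>_range[OF j]] by simp
    then show ?thesis using P_solves(2)[OF i True l] by simp
  next
    case False
    then obtain k where k: "j = Suc k" "k < m" using j m by (cases j) auto
    have "u i (\<tau> j) = ?P i k (\<tau> j)"
      using g[OF i \<tau>_range[OF j]] agree[OF i k(2) \<tau>_range[OF j]] by simp
    then show ?thesis using P_solves(3)[OF i k(2) l] k(1) by simp
  qed
  have Ru: "R u = x"
  proof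
    fix e :: "'a \<times> nat"
    show "R u e = x e" using val xF by (cases e) (auto simp: R_def F_def)
  qed
  have "bd I u \<in> V" using xF Ru outer_R[of u] unfolding F_def by auto
  moreover have "ipe I (dt I c u) v = 0" if v: "v \<in> V" for v
  proof -
    define y where "y = (\<lambda>(i, j). if i \<in> I \<and> j = 0 then v (i, 0) else if i \<in> I \<and> j = m then v (i, 1) else 0 :: real)"
    have vS: "v \<in> supp_ends I" using v V(2) by blast
    have "outer y = v"
    proof
      fix e :: "'a \<times> real"
      show "outer y e = v e" using vS m by (cases e) (auto simp: outer_def y_def supp_ends_def)
    qed
    then have yF: "y \<in> F" using v m by (auto simp: F_def y_def)
    have "Q l x y = (\<Sum>i\<in>I. dt I c u (i, 0) * v (i, 0) + dt I c u (i, 1) * v (i, 1))"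
      unfolding Q_def
    proof (rule sum.cong[OF refl])
      fix i assume i: "i \<in> I"
      have "(\<Sum>j<m. E l i j (x (i, j)) (x (i, Suc j)) (y (i, j)) (y (i, Suc j)) / c i) =
        (\<Sum>j<m. ?P' i 0 (\<tau> (Suc j)) * y (i, Suc j) / c i - ?P' i 0 (\<tau> j) * y (i, j) / c i)"
      proof (rule sum.cong[OF refl])
        fix j assume "j \<in> {..<m}"
        then have j: "j < m" "j \<le> m" "Suc j \<le> m" by auto
        show "E l i j (x (i, j)) (x (i, Suc j)) (y (i, j)) (y (i, Suc j)) / c i =
          ?P' i 0 (\<tau> (Suc j)) * y (i, Suc j) / c i - ?P' i 0 (\<tau> j) * y (i, j) / c i"
          unfolding E_def using agree[OF i j(1) \<tau>_range[OF j(2)]] agree[OF i j(1) \<tau>_range[OF j(3)]]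
          by (simp add: diff_divide_distrib)
      qed
      also have "\<dots> = ?P' i 0 (\<tau> m) * y (i, m) / c i - ?P' i 0 (\<tau> 0) * y (i, 0) / c i"
        by (rule sum_lessThan_telescope)
      also have "\<dots> = dt I c u (i, 0) * v (i, 0) + dt I c u (i, 1) * v (i, 1)"
        using i m g[OF i, of 0] g[OF i, of 1] by (simp add: y_def \<tau>_simps(1,2) dt_def ext_sign_def)
      finally show "(\<Sum>j<m. E l i j (x (i, j)) (x (i, Suc j)) (y (i, j)) (y (i, Suc j)) / c i) =
        dt I c u (i, 0) * v (i, 0) + dt I c u (i, 1) * v (i, 1)" .
    qed
    also have "\<dots> = ipe I (dt I c u) v" unfolding ipe_def sum_ends[OF I] ..
    finally show ?thesis using xQ[OF yF] by simp
  qed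
  ultimately have "u \<in> J l" unfolding J_def H_def using g1 by blast
  then show ?thesis using that Ru by blast
qed

text \<open>
  A function in \<open>W\<close> with zero node values has nonnegative energy on every piece and
  nonpositive total energy, so it is zero; hence \<open>R\<close> is injective on \<open>W\<close>.
\<close>

lemma R_findim:
  assumes "subspace W" "W \<subseteq> H" "nonpos_on W (energy I c d)"
  shows "findim W" "subspace (R ` W)" "dim (R ` W) = dim W" "R ` W \<subseteq> F"
proof -
  have inj: "u = 0" if "u \<in> W" "R u = 0" for u
  proof (rule energy_pos[OF _ that(2)])
    show "u \<in> Cs I" using that(1) assms(2) H_Cs by blast
    show "energy I c d u u \<le> 0" using that(1) assms(3) unfolding nonpos_on_def by blast
  qed
  show RF: "R ` W \<subseteq> F" using R_F assms(2) by blast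
  show "findim W" "subspace (R ` W)" "dim (R ` W) = dim W"
    by (rule findim_injective_preimage[OF assms(1) R_linear inj findim_F RF]; assumption)+
qed

text \<open>
  For a nonpositive subspace \<open>W\<close>, the form \<open>Q 0\<close> is nonpositive on
  \<open>R ` W\<close> because \<open>Q 0\<close> is the minimal energy for given node values. The
  crossing argument in the finite-dimensional space \<open>F\<close> then bounds the dimension by
  those of the radicals, which consist of node values of eigenfunctions.
\<close>

theorem spectral: "spectral_form H (energy I c d) (mass I c) J (dim F)"
proof
  show "subspace H" by (rule subspace_H)
  show "sym_bilinear_on H (energy I c d)" by (rule sym_bilinear_on_subset[OF energy_sym_bilinear H_Cs])
  show "sym_bilinear_on H (mass I c)" by (rule sym_bilinear_on_subset[OF mass_sym_bilinear H_Cs])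
  show "0 < mass I c x x" if "x \<in> H" "x \<noteq> 0" for x using mass_pos[OF subsetD[OF H_Cs that(1)] that(2)] .
  show "subspace (J l)" for l by (rule subspace_J)
  show "J l \<subseteq> H" for l by (rule J_H)
  show "energy I c d x y = l * mass I c x y" if "x \<in> J l" "y \<in> H" for l x y using J_weak[OF that] .
  fix W assume W: "findim W" "W \<subseteq> H" "nonpos_on W (energy I c d)"
  note RW = R_findim[OF findim_subspace[OF W(1)] W(2,3)]
  show "dim W \<le> dim F" using findim_dim_mono[OF findim_F RW(2,4)] RW(3) by simp
  obtain L where L: "\<And>l x. l \<le> L \<Longrightarrow> x \<in> F \<Longrightarrow> x \<noteq> 0 \<Longrightarrow> Q l x x > 0" using Q_pos by blast
  have Qs: "sym_bilinear_on F (Q l)" if "l \<le> 0" for l using that by (intro Q_sym_bilinear) simp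
  have RWn: "nonpos_on (R ` W) (Q 0)"
    unfolding nonpos_on_def
  proof
    fix x assume "x \<in> R ` W"
    then obtain u where u: "u \<in> W" "x = R u" by blast
    have "Q 0 x x \<le> energy I c d u u" unfolding u(2) using u(1) W(2) H_Cs by (intro Q_le_energy) auto
    also have "\<dots> \<le> 0" using u(1) W(3) unfolding nonpos_on_def by blast
    finally show "Q 0 x x \<le> 0" .
  qed
  have "\<exists>T. finite T \<and> T \<subseteq> {..0} \<and> dim (R ` W) \<le> (\<Sum>l\<in>T. dim (radical F (Q l)))"
    by (rule nonpos_dim_le_radical_dims[OF findim_F Qs Q_continuous L order_refl RW(2,4) RWn])
  then obtain T where T: "finite T" "T \<subseteq> {..0}" "dim W \<le> (\<Sum>l\<in>T. dim (radical F (Q l)))"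
    using RW(3) by auto
  have "dim (radical F (Q l)) \<le> dim (J l)" if "l \<in> T" for l
  proof -
    have l0: "l \<le> 0" using that T(2) by auto
    have "nonpos_on (J l) (energy I c d)"
      unfolding nonpos_on_def
    proof
      fix u assume u: "u \<in> J l"
      then have uH: "u \<in> H" using J_H by blast
      have "mass I c u u \<ge> 0"
        using mass_pos[OF subsetD[OF H_Cs uH]] by (cases "u = 0") (auto simp: mass_def)
      then show "energy I c d u u \<le> 0" using J_weak[OF u uH] l0 by (simp add: mult_nonpos_nonneg)
    qed
    note RJ = R_findim[OF subspace_J J_H this]
    have "radical F (Q l) \<subseteq> R ` J l"
    proof
      fix x assume x: "x \<in> radical F (Q l)"
      have "l \<le> 1" using l0 by simp
      then obtain u where "u \<in> J l" "R u = x" by (rule radical_eigenfunction[OF x])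
      then show "x \<in> R ` J l" by blast
    qed
    then have "dim (radical F (Q l)) \<le> dim (R ` J l)"
      using findim_dim_mono[OF findim_subset[OF findim_F RJ(2,4)] subspace_radical[OF Qs[OF l0] findim_subspace[OF findim_F]]]
      by blast
    then show ?thesis using RJ(3) by simp
  qed
  then have "dim W \<le> (\<Sum>l\<in>T. dim (J l))" using T(3) by (meson order_trans sum_mono)
  then show "\<exists>T. finite T \<and> T \<subseteq> {..0} \<and> dim W \<le> (\<Sum>l\<in>T. dim (J l))" using T by blast
qed

end

context quantum_graph
begin

lemma subdivision_exists: "\<exists>m. subdivided_graph I c d V m"
proof -
  have ex: "\<exists>B. \<forall>t\<in>{0..1}. 4 * ((c i)\<^sup>2 * (d i t + 1)) \<le> B" if i: "i \<in> I" for i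
  proof -
    have "continuous_on {0..1} (\<lambda>t. 4 * ((c i)\<^sup>2 * (d i t + 1)))"
      using d_cont[OF i] by (intro continuous_intros)
    then have "bounded ((\<lambda>t. 4 * ((c i)\<^sup>2 * (d i t + 1))) ` {0..1})"
      using compact_continuous_image compact_imp_bounded by blast
    then obtain B where "\<forall>x\<in>(\<lambda>t. 4 * ((c i)\<^sup>2 * (d i t + 1))) ` {0..1}. norm x \<le> B" unfolding bounded_iff by blast
    then have "\<forall>t\<in>{0..1}. 4 * ((c i)\<^sup>2 * (d i t + 1)) \<le> B" by force
    then show ?thesis ..
  qed
  have "\<forall>i\<in>I. \<exists>B. \<forall>t\<in>{0..1}. 4 * ((c i)\<^sup>2 * (d i t + 1)) \<le> B" using ex by (rule ballI)
  from bchoice[OF this] obtain B where B: "\<forall>i\<in>I. \<forall>t\<in>{0..1}. 4 * ((c i)\<^sup>2 * (d i t + 1)) \<le> B i" ..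
  obtain m :: nat where m: "real m > 1 + (\<Sum>i\<in>I. \<bar>B i\<bar>)" using reals_Archimedean2 by blast
  have S0: "(\<Sum>i\<in>I. \<bar>B i\<bar>) \<ge> 0" by (intro sum_nonneg) simp
  have "4 * ((c i)\<^sup>2 * (d i t + 1)) < (real m)\<^sup>2" if i: "i \<in> I" and t: "t \<in> {0..1}" for i t
  proof -
    have "4 * ((c i)\<^sup>2 * (d i t + 1)) \<le> B i" using B i t by blast
    also have "\<dots> \<le> (\<Sum>i\<in>I. \<bar>B i\<bar>)" using I i member_le_sum[of i I "\<lambda>i. \<bar>B i\<bar>"] by force
    also have "\<dots> < real m" using m by simp
    also have "\<dots> \<le> (real m)\<^sup>2"
    proof -
      have "1 \<le> real m" using m S0 by linarith
      then show ?thesis by (simp add: self_le_power)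
    qed
    finally show ?thesis .
  qed
  moreover have "m > 0" using m S0 by (cases m) auto
  ultimately have "subdivided_graph I c d V m"
    by (intro subdivided_graph.intro quantum_graph_axioms subdivided_graph_axioms.intro)
  then show ?thesis ..
qed

theorem index_max_nonpos_dim:
  "max_nonpos_dim H (energy I c d) (dim (span (\<Union>l\<in>{..<0}. J l)) + dim (J 0))"
proof -
  obtain m where "subdivided_graph I c d V m" using subdivision_exists by blast
  then interpret subdivided_graph I c d V m .
  interpret sp: spectral_form H "energy I c d" "mass I c" J "dim F" by (rule spectral)
  show ?thesis using sp.max_nonpos_dim_eigenspaces unfolding sp.E_def .
qed

lemma findim_J: "l \<le> 0 \<Longrightarrow> findim (J l)"
proof -
  assume l: "l \<le> 0"
  obtain m where "subdivided_graph I c d V m" using subdivision_exists by blast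
  then interpret subdivided_graph I c d V m .
  interpret sp: spectral_form H "energy I c d" "mass I c" J "dim F" by (rule spectral)
  show "findim (J l)" using sp.findim_E[of "{l}"] l by (simp add: sp.E_singleton)
qed

end

section \<open>Self-adjoint maps\<close>

text \<open>
  The crossing argument applies to the forms \<open>p (T x) y - l * p x y\<close>, whose radicals
  are the eigenspaces. For very negative \<open>l\<close> they are positive: with
  \<open>s = - 1 / l\<close>, such a form is a positive multiple of
  \<open>p x y + s * p (T x) y\<close>, which is positive for \<open>s = 0\<close> and so for all
  small \<open>s\<close>.
\<close>

lemma self_adjoint_index:
  fixes U :: "'v::real_vector set"
  assumes U: "findim U" and p: "sym_bilinear_on U p" and pos: "\<And>x. x \<in> U \<Longrightarrow> x \<noteq> 0 \<Longrightarrow> 0 < p x x"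
    and T: "\<And>x. x \<in> U \<Longrightarrow> T x \<in> U" and adj: "\<And>x y. x \<in> U \<Longrightarrow> y \<in> U \<Longrightarrow> p (T x) y = p x (T y)"
  shows "max_nonpos_dim U (\<lambda>x y. p (T x) y) (map_Ind U T + map_Nul U T)"
proof -
  let ?a = "\<lambda>x y. p (T x) y"
  have sU: "subspace U" using U by (rule findim_subspace)
  note pl = sym_bilinear_onD[OF p] and pr = sym_bilinear_right[OF p sU]
  have a: "sym_bilinear_on U ?a"
  proof (rule sym_bilinear_onI)
    show "p (T x) y = p (T y) x" if "x \<in> U" "y \<in> U" for x y
      using adj[OF that] pl(1)[OF that(1) T[OF that(2)]] by simp
    show "p (T (x + y)) z = p (T x) z + p (T y) z" if "x \<in> U" "y \<in> U" "z \<in> U" for x y z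
      using adj that T pl(2) sU by (simp add: real_vector.subspace_add)
    show "p (T (k *\<^sub>R x)) z = k * p (T x) z" if "x \<in> U" "z \<in> U" for k x z
      using adj that T pl(3) sU by (simp add: real_vector.subspace_scale)
  qed
  have eig: "x \<in> eigenspace_on U T l \<longleftrightarrow> x \<in> U \<and> (\<forall>y\<in>U. ?a x y = l * p x y)" for x l
  proof
    assume "x \<in> eigenspace_on U T l"
    then show "x \<in> U \<and> (\<forall>y\<in>U. ?a x y = l * p x y)"
      unfolding eigenspace_on_def using pl(3) by auto
  next
    assume x: "x \<in> U \<and> (\<forall>y\<in>U. ?a x y = l * p x y)"
    define z where "z = T x + (- l) *\<^sub>R x"
    have m: "(- l) *\<^sub>R x \<in> U" "T x \<in> U" using x T sU by (auto simp: real_vector.subspace_scale simp del: scaleR_minus_left)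
    then have zU: "z \<in> U" unfolding z_def using sU by (simp add: real_vector.subspace_add del: scaleR_minus_left)
    have "p z z = p (T x) z + p ((- l) *\<^sub>R x) z"
      using pl(2)[OF m(2,1) zU] unfolding z_def .
    also have "\<dots> = p (T x) z + (- l) * p x z" using pl(3)[of x z "- l"] x zU by simp
    also have "\<dots> = 0" using x zU by simp
    finally have "z = 0" using pos[OF zU] by force
    then show "x \<in> eigenspace_on U T l" using x unfolding z_def eigenspace_on_def by simp
  qed
  have sub: "subspace (eigenspace_on U T l)" for l
  proof -
    have eigs: "eigenspace_on U T l = {x \<in> U. \<forall>y\<in>U. ?a x y = l * p x y}" using eig by blast
    show ?thesis
    unfolding real_vector.subspace_def eigs
    using sU sym_bilinear_onD(2,3)[OF a] sym_bilinear_right(3)[OF a sU] pl(2,3) pr(3)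
    by (auto simp: real_vector.subspace_0 real_vector.subspace_add real_vector.subspace_scale algebra_simps)
  qed
  let ?Q = "\<lambda>l x y. ?a x y - l * p x y"
  have Q: "sym_bilinear_on U (?Q l)" for l
  proof (rule sym_bilinear_onI)
    show "?Q l x y = ?Q l y x" if "x \<in> U" "y \<in> U" for x y
      using sym_bilinear_onD(1)[OF a that] pl(1)[OF that] by simp
    show "?Q l (x + y) z = ?Q l x z + ?Q l y z" if "x \<in> U" "y \<in> U" "z \<in> U" for x y z
      using sym_bilinear_onD(2)[OF a that] pl(2)[OF that] by (simp add: algebra_simps)
    show "?Q l (k *\<^sub>R x) z = k * ?Q l x z" if "x \<in> U" "z \<in> U" for k x z
      using sym_bilinear_onD(3)[OF a that] pl(3)[OF that] by (simp add: algebra_simps)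
  qed
  obtain L where L: "L < 0" "\<And>l x. l \<le> L \<Longrightarrow> x \<in> U \<Longrightarrow> x \<noteq> 0 \<Longrightarrow> ?Q l x x > 0"
  proof -
    obtain B where B: "finite B" "independent B" "span B = U"
      and orth: "\<And>x y. x \<in> B \<Longrightarrow> y \<in> B \<Longrightarrow> x \<noteq> y \<Longrightarrow> p x y = 0"
      using orthogonal_basis[OF U p] by blast
    have BU: "B \<subseteq> U" using B(3) real_vector.span_superset[of B] by auto
    have B0: "0 \<notin> B" using B(2) real_vector.dependent_zero by blast
    let ?G = "\<lambda>s x y. p x y + s * ?a x y"
    have "\<exists>e>0. \<forall>s\<in>UNIV. \<bar>s - 0\<bar> < e \<longrightarrow> (\<forall>x\<in>span B. x \<noteq> 0 \<longrightarrow> ?G s x x > 0)"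
    proof (rule pos_def_open[where Q = ?G, OF sU _ B(1) BU])
      show "sym_bilinear_on U (?G s)" for s
      proof (rule sym_bilinear_onI)
        show "?G s x y = ?G s y x" if "x \<in> U" "y \<in> U" for x y
          using sym_bilinear_onD(1)[OF a that] pl(1)[OF that] by simp
        show "?G s (x + y) z = ?G s x z + ?G s y z" if "x \<in> U" "y \<in> U" "z \<in> U" for x y z
          using sym_bilinear_onD(2)[OF a that] pl(2)[OF that] by (simp add: algebra_simps)
        show "?G s (k *\<^sub>R x) z = k * ?G s x z" if "x \<in> U" "z \<in> U" for k x z
          using sym_bilinear_onD(3)[OF a that] pl(3)[OF that] by (simp add: algebra_simps)
      qed
      show "?G 0 x y = 0" if "x \<in> B" "y \<in> B" "x \<noteq> y" for x y using orth[OF that] by simp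
      show "?G 0 b b > 0" if "b \<in> B" for b
      proof -
        have "b \<in> U" "b \<noteq> 0" using that BU B0 by auto
        then show ?thesis using pos by simp
      qed
      show "continuous_on UNIV (\<lambda>s. ?G s x y)" for x y by (intro continuous_intros)
    qed simp
    then obtain e where e0: "e > 0 \<and> (\<forall>s\<in>UNIV. \<bar>s - 0\<bar> < e \<longrightarrow> (\<forall>x\<in>span B. x \<noteq> 0 \<longrightarrow> ?G s x x > 0))" ..
    have e: "e > 0" using e0 ..
    have e2: "?G s x x > 0" if "\<bar>s\<bar> < e" "x \<in> U" "x \<noteq> 0" for s x
      using conjunct2[OF e0, rule_format, of s x] that B(3) by simp
    have "?Q l x x > 0" if l: "l \<le> - (2 / e)" and x: "x \<in> U" "x \<noteq> 0" for l x
    proof -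
      define k where "k = - l"
      have k: "2 / e \<le> k" "0 < 2 / e" using l e by (simp_all add: k_def)
      then have k0: "k > 0" by linarith
      have "2 \<le> k * e" using k(1) e by (simp add: field_simps)
      then have "1 / k < e" using k0 by (simp add: field_simps)
      then have "\<bar>1 / k\<bar> < e" using k0 by simp
      from e2[OF this x] have "k * (p x x + 1 / k * p (T x) x) > 0" using k0 by simp
      moreover have "k * (p x x + 1 / k * p (T x) x) = p (T x) x - l * p x x"
        using k0 by (simp add: k_def field_simps)
      ultimately show ?thesis by simp
    qed
    moreover have "- (2 / e) < 0" using e by simp
    ultimately show ?thesis using that by blast
  qed
  interpret spectral_form U ?a p "eigenspace_on U T" "dim U"
  proof
    show "subspace U" by (rule sU)
    show "sym_bilinear_on U ?a" by (rule a)
    show "sym_bilinear_on U p" by (rule p)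
    show "0 < p x x" if "x \<in> U" "x \<noteq> 0" for x using pos[OF that] .
    show "subspace (eigenspace_on U T l)" for l by (rule sub)
    show "eigenspace_on U T l \<subseteq> U" for l unfolding eigenspace_on_def by blast
    show "p (T x) y = l * p x y" if "x \<in> eigenspace_on U T l" "y \<in> U" for l x y using that eig by blast
    fix W assume W: "findim W" "W \<subseteq> U" "nonpos_on W ?a"
    note sW = findim_subspace[OF W(1)]
    show "dim W \<le> dim U" using findim_dim_mono[OF U sW W(2)] .
    have W0: "nonpos_on W (?Q 0)" using W(3) by simp
    have "\<exists>F. finite F \<and> F \<subseteq> {..0} \<and> dim W \<le> (\<Sum>l\<in>F. dim (radical U (?Q l)))"
      by (rule nonpos_dim_le_radical_dims[where Q = ?Q, OF U Q _ L(2) order_refl sW W(2) W0])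
         (auto intro!: continuous_intros)
    moreover have "radical U (?Q l) = eigenspace_on U T l" for l
      unfolding radical_def using eig[of _ l] by auto
    ultimately show "\<exists>F. finite F \<and> F \<subseteq> {..0} \<and> dim W \<le> (\<Sum>l\<in>F. dim (eigenspace_on U T l))" by simp
  qed
  have "dim (E {..<0}) = map_Ind U T" unfolding map_Ind_def using dim_E_neg by simp
  moreover have "dim (eigenspace_on U T 0) = map_Nul U T"
    unfolding map_Nul_def eigenspace_on_def by simp
  ultimately show ?thesis using max_nonpos_dim_eigenspaces by simp
qed

section \<open>Networks as quantum graphs\<close>

locale network_graph =
  fixes M :: "'i network" and c :: "'i \<Rightarrow> real" and d :: "'i \<Rightarrow> real \<Rightarrow> real"
  assumes M: "is_network M"
    and speed: "\<And>i t. i \<in> idx M \<Longrightarrow> t \<in> {0..1} \<Longrightarrow> norm (deriv01 (crv M i) t) = c i"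
    and c_pos: "\<And>i. i \<in> idx M \<Longrightarrow> c i > 0"
    and d_smooth: "\<And>i. i \<in> idx M \<Longrightarrow> smooth01 (d i)"
begin

lemma finite_idx: "finite (idx M)"
  using M unfolding is_network_def by simp

lemma finite_ends: "finite (ends M)"
  using finite_idx unfolding ends_def by simp

lemma endpoints: "intp M \<inter> bdp M = {}" "intp M \<union> bdp M = endpt M ` ends M"
  using M unfolding is_network_def by simp_all

lemma finite_intp: "finite (intp M)"
  using endpoints(2) finite_ends by (metis finite_Un finite_imageI)

end

lemma ends_at_sub: "ends_at M A \<subseteq> ends M"
  unfolding ends_at_def by auto

lemma restr_linear: "restr M A (x + y) = restr M A x + restr M A y" "restr M A (k *\<^sub>R x) = k *\<^sub>R restr M A x"
  "restr M A 0 = 0"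
  by (auto simp: restr_def fun_eq_iff scaleR_fun_def)

lemma restr_diff: "restr M A (x - y) = restr M A x - restr M A y"
  by (auto simp: restr_def fun_eq_iff)

lemma restr_Vsp: "restr M A x \<in> Vsp M A"
  by (auto simp: restr_def Vsp_def)

lemma restr_id: "x \<in> Vsp M A \<Longrightarrow> restr M A x = x"
  unfolding restr_def Vsp_def by (auto simp: fun_eq_iff)

lemma restr_restr: "restr M A (restr M B x) = restr M (A \<inter> B) x"
  by (auto simp: restr_def ends_at_def fun_eq_iff)

lemma subspace_Vsp: "subspace (Vsp M A)"
  unfolding Vsp_def by (rule subspace_supp)

lemma Vsp_mono: "A \<subseteq> B \<Longrightarrow> Vsp M A \<subseteq> Vsp M B"
  unfolding Vsp_def ends_at_def by blast

lemma ip_linear: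
  "ip M (x + y) z = ip M x z + ip M y z" "ip M (k *\<^sub>R x) z = k * ip M x z" "ip M x y = ip M y x"
  by (simp_all add: ip_def scaleR_fun_def sum.distrib algebra_simps sum_distrib_left)

lemma ip_ipe: "ip M = ipe (idx M)"
  by (simp add: ip_def ipe_def ends_def fun_eq_iff)

lemma ip_restr: "ip M (restr M A x) y = ip M x (restr M A y)"
  unfolding ip_def restr_def by (rule sum.cong) auto

lemma subspace_V1_at: "subspace (V1_at M p)"
  unfolding real_vector.subspace_def
proof (intro conjI ballI allI)
  have 0: "restr M {p} (\<lambda>(i, t). 0 \<bullet> nrm M i t) = 0" by (auto simp: restr_def fun_eq_iff)
  show "0 \<in> V1_at M p" unfolding V1_at_def
    by (rule CollectI, rule exI[of _ 0]) (use 0 in simp)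
  fix x y assume "x \<in> V1_at M p" "y \<in> V1_at M p"
  then obtain X Y where *: "x = restr M {p} (\<lambda>(i, t). X \<bullet> nrm M i t)" "X \<bullet> p = 0"
    "y = restr M {p} (\<lambda>(i, t). Y \<bullet> nrm M i t)" "Y \<bullet> p = 0" unfolding V1_at_def by blast
  have "x + y = restr M {p} (\<lambda>(i, t). (X + Y) \<bullet> nrm M i t)"
    unfolding * by (auto simp: restr_def fun_eq_iff inner_add_left)
  moreover have "(X + Y) \<bullet> p = 0" using * by (simp add: inner_add_left)
  ultimately show "x + y \<in> V1_at M p" unfolding V1_at_def by blast
next
  fix k x assume "x \<in> V1_at M p"
  then obtain X where *: "x = restr M {p} (\<lambda>(i, t). X \<bullet> nrm M i t)" "X \<bullet> p = 0" unfolding V1_at_def by blast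
  have "k *\<^sub>R x = restr M {p} (\<lambda>(i, t). (k *\<^sub>R X) \<bullet> nrm M i t)"
    unfolding * by (auto simp: restr_def fun_eq_iff scaleR_fun_def)
  moreover have "(k *\<^sub>R X) \<bullet> p = 0" using * by simp
  ultimately show "k *\<^sub>R x \<in> V1_at M p" unfolding V1_at_def by blast
qed

lemma V1_at_Vsp: "V1_at M p \<subseteq> Vsp M {p}"
  unfolding V1_at_def using restr_Vsp by blast

lemma subspace_V1: "subspace (V1 M A)"
  unfolding real_vector.subspace_def V1_def
  using subspace_Vsp[of M A] subspace_V1_at[of M]
  by (auto simp: restr_linear real_vector.subspace_0 real_vector.subspace_add real_vector.subspace_scale)

lemma V1_Vsp: "V1 M A \<subseteq> Vsp M A"
  unfolding V1_def by blast

lemma restr_single_zero: "x \<in> Vsp M A \<Longrightarrow> p \<notin> A \<Longrightarrow> restr M {p} x = 0"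
  unfolding restr_def Vsp_def ends_at_def by (auto simp: fun_eq_iff)

lemma V1_mono:
  assumes "A \<subseteq> B"
  shows "V1 M A \<subseteq> V1 M B"
proof
  fix x assume x: "x \<in> V1 M A"
  have "restr M {p} x \<in> V1_at M p" for p
    using x restr_single_zero[of x M A p] subspace_V1_at[of M p] unfolding V1_def
    by (cases "p \<in> A") (auto simp: real_vector.subspace_0)
  then show "x \<in> V1 M B" using x Vsp_mono[OF assms, of M] unfolding V1_def by blast
qed

lemma restr_V1:
  assumes "x \<in> V1 M B" "A \<subseteq> B"
  shows "restr M A x \<in> V1 M A"
proof -
  have "restr M {p} (restr M A x) = restr M {p} x" if "p \<in> A" for p
    using that restr_restr[of M "{p}" A x] by (simp add: insert_absorb)
  then show ?thesis using assms restr_Vsp[of M A x] unfolding V1_def by auto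
qed

lemma V1_at_V1: "p \<in> A \<Longrightarrow> V1_at M p \<subseteq> V1 M A"
proof
  fix x assume p: "p \<in> A" and x: "x \<in> V1_at M p"
  have xV: "x \<in> Vsp M {p}" using x V1_at_Vsp by blast
  then have "x \<in> V1 M {p}" unfolding V1_def using x restr_id[OF xV] by simp
  then show "x \<in> V1 M A" using V1_mono[of "{p}" A M] p by blast
qed

text \<open>
  \<open>V1\<close> and \<open>V2\<close> are defined point by point. Since ends at distinct points
  are distinct, the inner product is the sum of the inner products at the points, and orthogonality
  can be tested globally.
\<close>

lemma V2_iff:
  assumes fin: "finite (ends M)" "finite A" and x: "x \<in> Vsp M A"
  shows "x \<in> V2 M A \<longleftrightarrow> (\<forall>v\<in>V1 M A. ip M x v = 0)"
proof
  assume x2: "x \<in> V2 M A"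
  show "\<forall>v\<in>V1 M A. ip M x v = 0"
  proof
    fix v assume v: "v \<in> V1 M A"
    have fa: "finite (ends_at M A)" using fin(1) ends_at_sub finite_subset by blast
    have "ip M x v = (\<Sum>e\<in>ends_at M A. x e * v e)"
      unfolding ip_def using x fin(1) ends_at_sub[of M A]
      by (intro sum.mono_neutral_right) (auto simp: Vsp_def)
    also have "\<dots> = (\<Sum>p\<in>A. \<Sum>e\<in>{e \<in> ends_at M A. endpt M e = p}. x e * v e)"
      by (rule sum.group[symmetric, OF fa fin(2)]) (auto simp: ends_at_def)
    also have "\<dots> = (\<Sum>p\<in>A. ip M (restr M {p} x) (restr M {p} v))"
    proof (rule sum.cong[OF refl])
      fix p assume "p \<in> A"
      then have "{e \<in> ends_at M A. endpt M e = p} = ends_at M {p}" unfolding ends_at_def by auto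
      moreover have "(\<Sum>e\<in>ends_at M {p}. x e * v e) = ip M (restr M {p} x) (restr M {p} v)"
        unfolding ip_def using fin(1) ends_at_sub[of M "{p}"]
        by (intro sum.mono_neutral_cong_left) (auto simp: restr_def)
      ultimately show "(\<Sum>e\<in>{e \<in> ends_at M A. endpt M e = p}. x e * v e) = ip M (restr M {p} x) (restr M {p} v)" by simp
    qed
    also have "\<dots> = 0"
    proof (rule sum.neutral, rule ballI)
      fix p assume p: "p \<in> A"
      have "restr M {p} x \<in> V2_at M p" "restr M {p} v \<in> V1_at M p"
        using p x2 v unfolding V2_def V1_def by auto
      then have "ip M (restr M {p} v) (restr M {p} x) = 0" unfolding V2_at_def perp_in_def by blast
      then show "ip M (restr M {p} x) (restr M {p} v) = 0" by (simp add: ip_linear(3)[of M "restr M {p} x"])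
    qed
    finally show "ip M x v = 0" .
  qed
next
  assume orth: "\<forall>v\<in>V1 M A. ip M x v = 0"
  have "restr M {p} x \<in> V2_at M p" if p: "p \<in> A" for p
    unfolding V2_at_def perp_in_def
  proof (intro CollectI conjI ballI)
    show "restr M {p} x \<in> Vsp M {p}" by (rule restr_Vsp)
    fix w assume w: "w \<in> V1_at M p"
    have "w \<in> V1 M A" using V1_at_V1[OF p] w by blast
    then have "ip M x w = 0" using orth by blast
    moreover have "restr M {p} w = w" using restr_id w V1_at_Vsp by blast
    ultimately show "ip M w (restr M {p} x) = 0"
      using ip_restr[of M "{p}" x w] ip_linear(3)[of M w "restr M {p} x"] by simp
  qed
  then show "x \<in> V2 M A" using x unfolding V2_def by blast
qed

context network_graph
begin

sublocale quantum_graph "idx M" c d "V1 M (intp M)"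
proof
  show "V1 M (intp M) \<subseteq> supp_ends (idx M)"
    using V1_Vsp[of M "intp M"] unfolding Vsp_def supp_ends_def ends_at_def ends_def by blast
qed (use finite_idx c_pos d_smooth subspace_V1 in auto)

lemma C_inf_Cs: "C_inf M = Cs (idx M)"
  unfolding C_inf_def Cs_def ..

lemma in_ends: "(i, t) \<in> ends M \<longleftrightarrow> i \<in> idx M \<and> t \<in> {0, 1}"
  unfolding ends_def by auto

lemma bdval_bd: "bdval M A u = restr M A (bd (idx M) u)"
  unfolding bdval_def restr_def bd_def ends_at_def by (auto simp: fun_eq_iff in_ends)

lemma dtau_dt: "dtau M A u = restr M A (dt (idx M) c u)"
proof
  fix e :: "'i \<times> real"
  obtain i t where e: "e = (i, t)" by (cases e)
  show "dtau M A u e = restr M A (dt (idx M) c u) e"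
  proof (cases "e \<in> ends_at M A")
    case True
    then have "i \<in> idx M" "t \<in> {0, 1}" unfolding ends_at_def e by (auto simp: in_ends)
    then show ?thesis using speed[of i t] True by (auto simp: dtau_def restr_def e dt_def ds_deriv_def)
  qed (simp add: dtau_def restr_def)
qed

lemma ends_split: "ends M = ends_at M (intp M) \<union> ends_at M (bdp M)"
  using endpoints(2) unfolding ends_at_def by auto

lemma ends_disjoint: "A \<inter> B = {} \<Longrightarrow> ends_at M A \<inter> ends_at M B = {}"
  unfolding ends_at_def by auto

lemma supp_zero: "x \<in> supp_ends (idx M) \<Longrightarrow> e \<notin> ends M \<Longrightarrow> x e = 0"
  unfolding supp_ends_def ends_def by blast

text \<open>
  Boundary data in \<open>V1\<close> of the interior endpoints vanish at the other ends, so the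
  single condition contains the Dirichlet condition.
\<close>

lemma C01_H: "C01_inf M = H"
proof (rule set_eqI)
  fix u
  have "bdval M (intp M) u \<in> V1 M (intp M) \<and> bdval M (bdp M) u = 0 \<longleftrightarrow> bd (idx M) u \<in> V1 M (intp M)" (is "?l \<longleftrightarrow> ?r")
  proof
    assume ?l
    have "bd (idx M) u e = bdval M (intp M) u e" for e
    proof (cases "e \<in> ends_at M (intp M)")
      case True
      then show ?thesis by (simp add: bdval_bd restr_def)
    next
      case False
      have "bd (idx M) u e = 0"
      proof (cases "e \<in> ends_at M (bdp M)")
        case True
        have "bdval M (bdp M) u e = 0" using \<open>?l\<close> by simp
        then show ?thesis using True by (simp add: bdval_bd restr_def)
      next
        case False
        then have "e \<notin> ends M" using ends_split \<open>e \<notin> ends_at M (intp M)\<close> by blast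
        then show ?thesis using supp_zero[OF bd_supp] by blast
      qed
      then show ?thesis using False by (simp add: bdval_bd restr_def)
    qed
    then have "bd (idx M) u = bdval M (intp M) u" by (rule ext)
    then show ?r using \<open>?l\<close> by simp
  next
    assume ?r
    then have v: "bd (idx M) u \<in> Vsp M (intp M)" using V1_Vsp by blast
    have "bdval M (intp M) u = bd (idx M) u" unfolding bdval_bd by (rule restr_id[OF v])
    moreover have "bdval M (bdp M) u = 0"
      unfolding bdval_bd restr_def using v ends_disjoint[OF endpoints(1)]
      by (auto simp: Vsp_def fun_eq_iff)
    ultimately show ?l using \<open>?r\<close> by simp
  qed
  then show "u \<in> C01_inf M \<longleftrightarrow> u \<in> H"
    unfolding C01_inf_def C1_inf_def H_def C_inf_Cs by auto
qed

lemma compatible_iff: "compatible M u \<longleftrightarrow> (\<forall>v\<in>V1 M (intp M). ipe (idx M) (dt (idx M) c u) v = 0)"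
proof -
  have "ip M (restr M (intp M) (dt (idx M) c u)) v = ipe (idx M) (dt (idx M) c u) v" if "v \<in> V1 M (intp M)" for v
    unfolding ip_restr using restr_id[OF subsetD[OF V1_Vsp that]] by (simp add: ip_ipe)
  then show ?thesis
    unfolding compatible_def dtau_dt using V2_iff[OF finite_ends finite_intp restr_Vsp] by simp
qed

lemma Lop_eq:
  assumes u: "u \<in> Cs (idx M)" and i: "i \<in> idx M" and t: "t \<in> {0..1}"
  shows "Lop d M u i t = deriv01 (deriv01 (u i)) t / (c i)\<^sup>2 + d i t * u i t"
proof -
  have "((\<lambda>s. deriv01 (u i) s / c i) has_real_derivative deriv01 (deriv01 (u i)) t / c i) (at t within {0..1})"
    by (rule DERIV_cdivide[OF Cs_deriv(2)[OF u i t]])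
  then have "(ds_deriv M i (u i) has_real_derivative deriv01 (deriv01 (u i)) t / c i) (at t within {0..1})"
    by (rule has_derivative_cong01[OF _ t]) (simp add: ds_deriv_def speed[OF i])
  then have "deriv01 (ds_deriv M i (u i)) t = deriv01 (deriv01 (u i)) t / c i"
    by (rule deriv01_eq[OF _ t])
  then show ?thesis unfolding Lop_def ds_deriv_def[of M i "ds_deriv M i (u i)"]
    using speed[OF i t] by (simp add: power2_eq_square)
qed

lemma eigen_eq_iff:
  assumes u: "u \<in> Cs (idx M)"
  shows "eigen_eq (idx M) c d l u \<longleftrightarrow> (\<forall>i\<in>idx M. \<forall>t\<in>{0..1}. - Lop d M u i t = l * u i t)"
proof -
  have "deriv01 (deriv01 (u i)) t = - (c i)\<^sup>2 * (d i t + l) * u i t \<longleftrightarrow> - Lop d M u i t = l * u i t"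
    if "i \<in> idx M" "t \<in> {0..1}" for i t
  proof -
    have "(c i)\<^sup>2 \<noteq> 0" using c_pos[OF that(1)] by simp
    then show ?thesis unfolding Lop_eq[OF u that] by (auto simp: field_simps)
  qed
  then show ?thesis unfolding eigen_eq_def by blast
qed

lemma Jsp_J: "Jsp d M l = J l"
  unfolding Jsp_def J_def C01_H using eigen_eq_iff compatible_iff H_Cs by blast

lemma index_network: "max_nonpos_dim (C01_inf M) (energy (idx M) c d) (Ind d M + Nul d M)"
  using index_max_nonpos_dim unfolding C01_H Ind_def Nul_def J_neg_def Jsp_J by simp

lemma L2_mass: "L2_ip M u v = mass (idx M) c u v"
  unfolding L2_ip_def mass_def
proof (rule sum.cong[OF refl])
  fix i assume i: "i \<in> idx M"
  show "integral {0..1} (\<lambda>t. u i t * v i t * norm (deriv01 (crv M i) t)) = integral {0..1} (\<lambda>t. c i * u i t * v i t)"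
    by (rule integral_cong) (simp add: speed[OF i])
qed

end

section \<open>Solutions with prescribed boundary values\<close>

text \<open>
  \<open>A\<close> is the set of boundary endpoints at which values are to be prescribed. For a part
  of a partition these are the points where it is cut out of the larger network.
\<close>

locale network_cut = network_graph M c d
  for M :: "'i network" and c :: "'i \<Rightarrow> real" and d :: "'i \<Rightarrow> real \<Rightarrow> real" +
  fixes A :: "(real^3) set"
  assumes A: "A \<subseteq> bdp M"
begin

abbreviation (input) "VM \<equiv> V1 M (intp M)"

lemma A_intp: "A \<inter> intp M = {}"
  using A endpoints(1) by blast

lemma restr_A_intp: "x \<in> Vsp M (intp M) \<Longrightarrow> restr M A x = 0"
  using ends_disjoint[OF A_intp] unfolding restr_def Vsp_def by (auto simp: fun_eq_iff)

lemma restr_intp_A: "x \<in> Vsp M A \<Longrightarrow> restr M (intp M) x = 0"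
  using ends_disjoint[OF A_intp] unfolding restr_def Vsp_def by (auto simp: fun_eq_iff)

text \<open>
  The three conditions on boundary values say together that the boundary data of \<open>u\<close>
  differ from \<open>g\<close> by an element of \<open>V1\<close> of the interior endpoints. This is
  the form in which \<open>fredholm\<close> provides solutions.
\<close>

lemma is_L_ext_iff:
  assumes g: "g \<in> Vsp M A"
  shows "is_L_ext d M A g u \<longleftrightarrow>
    u \<in> Cs (idx M) \<and> eigen_eq (idx M) c d 0 u \<and> bd (idx M) u - g \<in> VM \<and>
    (\<forall>v\<in>VM. ipe (idx M) (dt (idx M) c u) v = 0) \<and>
    (\<forall>v\<in>I0 d M A. mass (idx M) c u v = 0) \<and> dtau M A u \<in> DJ_perp d M A"
proof -
  have "restr M (intp M) (bd (idx M) u) \<in> VM \<and> restr M A (bd (idx M) u) = g \<and>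
      restr M (bdp M - A) (bd (idx M) u) = 0 \<longleftrightarrow> bd (idx M) u - g \<in> VM" (is "?l \<longleftrightarrow> ?r")
  proof
    assume l: ?l
    have "(bd (idx M) u - g) e = restr M (intp M) (bd (idx M) u) e" for e
    proof -
      consider "e \<in> ends_at M (intp M)" | "e \<in> ends_at M A" | "e \<in> ends_at M (bdp M - A)" | "e \<notin> ends M"
        using ends_split unfolding ends_at_def by blast
      then show ?thesis
      proof cases
        case 1
        then have "e \<notin> ends_at M A" using ends_disjoint[OF A_intp] by blast
        then have "g e = 0" using g unfolding Vsp_def by blast
        then show ?thesis using 1 by (simp add: restr_def)
      next
        case 2
        then have "e \<notin> ends_at M (intp M)" using ends_disjoint[OF A_intp] by blast
        moreover have "restr M A (bd (idx M) u) e = g e" using l by simp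
        then have "bd (idx M) u e = g e" using 2 by (simp add: restr_def)
        ultimately show ?thesis by (simp add: restr_def)
      next
        case 3
        then have ni: "e \<notin> ends_at M (intp M)" "e \<notin> ends_at M A"
          using endpoints(1) unfolding ends_at_def by auto
        have "restr M (bdp M - A) (bd (idx M) u) e = 0" using l by simp
        then have "bd (idx M) u e = 0" using 3 by (simp add: restr_def)
        moreover have "g e = 0" using g ni(2) unfolding Vsp_def by blast
        ultimately show ?thesis using ni(1) by (simp add: restr_def)
      next
        case 4
        then have "e \<notin> ends_at M (intp M)" "e \<notin> ends_at M A" using ends_at_sub by blast+
        then have "g e = 0" using g unfolding Vsp_def by blast
        then show ?thesis using supp_zero[OF bd_supp 4] \<open>e \<notin> ends_at M (intp M)\<close> by (simp add: restr_def)
      qed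
    qed
    then have "bd (idx M) u - g = restr M (intp M) (bd (idx M) u)" by (rule ext)
    then show ?r using l by simp
  next
    assume r: ?r
    define x where "x = bd (idx M) u - g"
    have xV: "x \<in> Vsp M (intp M)" using r V1_Vsp unfolding x_def by blast
    have b: "bd (idx M) u = x + g" unfolding x_def by simp
    have "restr M (intp M) (bd (idx M) u) = x"
      unfolding b restr_linear using restr_id[OF xV] restr_intp_A[OF g] by simp
    moreover have "restr M A (bd (idx M) u) = g"
      unfolding b restr_linear using restr_id[OF g] restr_A_intp[OF xV] by simp
    moreover have "restr M (bdp M - A) (bd (idx M) u) = 0"
    proof
      fix e
      show "restr M (bdp M - A) (bd (idx M) u) e = 0 e"
      proof (cases "e \<in> ends_at M (bdp M - A)")
        case True
        then have "e \<notin> ends_at M (intp M)" "e \<notin> ends_at M A"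
          using endpoints(1) unfolding ends_at_def by auto
        then have "x e = 0" "g e = 0" using xV g unfolding Vsp_def by blast+
        then show ?thesis unfolding b by (simp add: restr_def)
      qed (simp add: restr_def)
    qed
    ultimately show ?l using r unfolding x_def by simp
  qed
  moreover have "eigen_eq (idx M) c d 0 u \<longleftrightarrow> (\<forall>i\<in>idx M. \<forall>t\<in>{0..1}. Lop d M u i t = 0)" if "u \<in> Cs (idx M)"
    using eigen_eq_iff[OF that, of 0] by simp
  ultimately show ?thesis
    unfolding is_L_ext_def C1_inf_def C_inf_Cs bdval_bd compatible_iff L2_mass by auto
qed

lemma J0_eq: "Jsp d M 0 = J 0"
  by (rule Jsp_J)

lemma dtau_add: "u \<in> Cs (idx M) \<Longrightarrow> v \<in> Cs (idx M) \<Longrightarrow> dtau M A (u + v) = dtau M A u + dtau M A v"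
  unfolding dtau_dt by (simp add: dt_add restr_linear)

lemma dtau_scale: "u \<in> Cs (idx M) \<Longrightarrow> dtau M A (k *\<^sub>R u) = k *\<^sub>R dtau M A u"
  unfolding dtau_dt by (simp add: dt_scale restr_linear)

lemma J_Cs: "J l \<subseteq> Cs (idx M)"
  using J_H H_Cs by blast

lemma DJ_perpD:
  assumes "y \<in> DJ_perp d M A" "j \<in> J 0"
  shows "ip M (dtau M A j) y = 0"
  using assms unfolding DJ_perp_def perp_in_def D_tau_J_def J0_eq by blast

lemma DJ_perpI:
  assumes "y \<in> Vsp M A" "\<And>j. j \<in> J 0 \<Longrightarrow> ip M (dtau M A j) y = 0"
  shows "y \<in> DJ_perp d M A"
  using assms unfolding DJ_perp_def perp_in_def D_tau_J_def J0_eq by blast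

lemma subspace_DJ_perp: "subspace (DJ_perp d M A)"
  unfolding real_vector.subspace_def DJ_perp_def perp_in_def
  using subspace_Vsp[of M A]
  by (auto simp: ip_ipe ipe_linear_right ipe_zero real_vector.subspace_0 real_vector.subspace_add real_vector.subspace_scale)

lemma DJ_perp_Vsp: "DJ_perp d M A \<subseteq> Vsp M A"
  unfolding DJ_perp_def perp_in_def by blast

text \<open>
  The difference \<open>z\<close> of two \<open>L\<close>-extensions lies in \<open>J 0\<close>, and
  its normal derivative lies both in the space of normal derivatives of \<open>J 0\<close> and in
  the complement. So \<open>z\<close> lies in \<open>I0\<close>, to which it is also orthogonal.
\<close>

lemma L_ext_unique:
  assumes g: "g \<in> Vsp M A" and u: "is_L_ext d M A g u" and w: "is_L_ext d M A g w"
  shows "u = w"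
proof -
  note u' = u[unfolded is_L_ext_iff[OF g]] and w' = w[unfolded is_L_ext_iff[OF g]]
  define z where "z = u + (-1) *\<^sub>R w"
  have wC: "(-1) *\<^sub>R w \<in> Cs (idx M)" using w' subspace_Cs[of "idx M"] real_vector.subspace_scale by blast
  have uC: "u \<in> Cs (idx M)" using u' by blast
  have zC: "z \<in> Cs (idx M)" unfolding z_def using uC wC subspace_Cs[of "idx M"] real_vector.subspace_add by blast
  have ez: "eigen_eq (idx M) c d 0 z"
    unfolding z_def using u' w' wC by (intro eigen_eq_add eigen_eq_scale) auto
  have "bd (idx M) z = (bd (idx M) u - g) - (bd (idx M) w - g)"
    unfolding z_def bd_linear by simp
  also have "\<dots> \<in> VM" by (rule real_vector.subspace_diff[OF subspace_V1]) (use u' w' in blast)+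
  finally have bz: "bd (idx M) z \<in> VM" .
  have "dt (idx M) c z = dt (idx M) c u + (-1) *\<^sub>R dt (idx M) c w"
    unfolding z_def using dt_add[OF uC wC] dt_scale[of w "idx M" c "-1"] w' by simp
  then have "\<forall>v\<in>VM. ipe (idx M) (dt (idx M) c z) v = 0"
    using u' w' by (simp only: ipe_linear(1,2)) simp
  then have zJ: "z \<in> J 0" unfolding J_def H_def using zC ez bz by blast
  have dz: "dtau M A z = dtau M A u + (-1) *\<^sub>R dtau M A w"
    unfolding z_def using dtau_add[OF uC wC] dtau_scale[of w "-1"] w' by simp
  have "dtau M A z \<in> DJ_perp d M A"
    unfolding dz using u' w' subspace_DJ_perp
    by (intro real_vector.subspace_add real_vector.subspace_scale) auto
  then have "ip M (dtau M A z) (dtau M A z) = 0" using DJ_perpD zJ by blast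
  moreover have "dtau M A z \<in> supp_ends (idx M)"
    using restr_Vsp[of M A "dt (idx M) c z"] unfolding dtau_dt Vsp_def supp_ends_def ends_at_def ends_def by blast
  ultimately have "dtau M A z = 0" using ipe_pos[OF finite_idx, of "dtau M A z"] by (force simp: ip_ipe)
  then have zI: "z \<in> I0 d M A" unfolding I0_def J0_eq using zJ by blast
  have "mass (idx M) c z z = mass (idx M) c u z + mass (idx M) c ((-1) *\<^sub>R w) z"
    using sym_bilinear_onD(2)[OF mass_sym_bilinear uC wC zC] unfolding z_def .
  also have "mass (idx M) c ((-1) *\<^sub>R w) z = - mass (idx M) c w z"
    using sym_bilinear_onD(3)[OF mass_sym_bilinear _ zC, of w "-1"] w' by simp
  finally have "mass (idx M) c z z = 0" using u' w' zI by simp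
  then have "z = 0" using mass_pos[OF zC] by force
  then show ?thesis unfolding z_def by simp
qed

text \<open>
  A solution given by \<open>fredholm\<close> may be changed by elements of \<open>J 0\<close>. A
  first change projects its normal derivative to the complement of the normal derivatives of
  \<open>J 0\<close>; a second one, by an element of \<open>I0\<close>, keeps the normal derivative
  and makes the function orthogonal to \<open>I0\<close>.
\<close>

lemma L_ext_exists:
  assumes g: "g \<in> DJ_perp d M A"
  shows "\<exists>u. is_L_ext d M A g u"
proof -
  have gV: "g \<in> Vsp M A" using g DJ_perp_Vsp by blast
  have gS: "g \<in> supp_ends (idx M)"
    using gV unfolding Vsp_def supp_ends_def ends_at_def ends_def by blast
  have "ipe (idx M) g (dt (idx M) c j) = 0" if "j \<in> J 0" for j
  proof -
    have "ip M (dtau M A j) g = 0" using DJ_perpD[OF g that] .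
    then have "ip M (dt (idx M) c j) g = 0" unfolding dtau_dt ip_restr restr_id[OF gV] .
    then show ?thesis using ip_linear(3)[of M g] by (simp add: ip_ipe)
  qed
  from fredholm[OF gS this] obtain u where u: "u \<in> Cs (idx M)" "eigen_eq (idx M) c d 0 u"
    "bd (idx M) u - g \<in> VM" "\<And>v. v \<in> VM \<Longrightarrow> ipe (idx M) (dt (idx M) c u) v = 0" by blast
  have sub: "u' + (-1) *\<^sub>R j \<in> Cs (idx M) \<and> eigen_eq (idx M) c d 0 (u' + (-1) *\<^sub>R j) \<and>
      bd (idx M) (u' + (-1) *\<^sub>R j) - g \<in> VM \<and> (\<forall>v\<in>VM. ipe (idx M) (dt (idx M) c (u' + (-1) *\<^sub>R j)) v = 0)"
    if u': "u' \<in> Cs (idx M)" "eigen_eq (idx M) c d 0 u'" "bd (idx M) u' - g \<in> VM"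
      "\<And>v. v \<in> VM \<Longrightarrow> ipe (idx M) (dt (idx M) c u') v = 0" and j: "j \<in> J 0" for u' j
  proof -
    have mj: "(-1) *\<^sub>R j \<in> J 0" using j subspace_J real_vector.subspace_scale by blast
    then have mC: "(-1) *\<^sub>R j \<in> Cs (idx M)" using J_Cs by blast
    have e: "eigen_eq (idx M) c d 0 ((-1) *\<^sub>R j)" and b: "bd (idx M) ((-1) *\<^sub>R j) \<in> VM"
      and t: "\<And>v. v \<in> VM \<Longrightarrow> ipe (idx M) (dt (idx M) c ((-1) *\<^sub>R j)) v = 0"
      using mj unfolding J_def H_def by blast+
    have "bd (idx M) (u' + (-1) *\<^sub>R j) - g = (bd (idx M) u' - g) + bd (idx M) ((-1) *\<^sub>R j)"
      unfolding bd_linear(1) by simp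
    also have "\<dots> \<in> VM" using u'(3) b subspace_V1 by (intro real_vector.subspace_add)
    finally have "bd (idx M) (u' + (-1) *\<^sub>R j) - g \<in> VM" .
    moreover have "ipe (idx M) (dt (idx M) c (u' + (-1) *\<^sub>R j)) v = 0" if "v \<in> VM" for v
      unfolding dt_add[OF u'(1) mC] ipe_linear(1) using u'(4)[OF that] t[OF that] by simp
    ultimately show ?thesis
      using eigen_eq_add[OF u'(1) mC u'(2) e] real_vector.subspace_add[OF subspace_Cs u'(1) mC] by blast
  qed
  have fJ: "findim (J 0)" by (rule findim_J) simp
  have sV: "Vsp M A \<subseteq> supp_ends (idx M)"
    unfolding Vsp_def supp_ends_def ends_at_def ends_def by blast
  have fD: "findim (dtau M A ` J 0)"
  proof (rule findim_subset[OF findim_supp_ends[OF finite_idx]])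
    show "dtau M A ` J 0 \<subseteq> supp_ends (idx M)" using restr_Vsp sV unfolding dtau_dt by blast
    show "subspace (dtau M A ` J 0)"
      unfolding real_vector.subspace_def
    proof (intro conjI ballI allI)
      have 0: "0 \<in> J 0" using subspace_J by (rule real_vector.subspace_0)
      have "dtau M A 0 = 0" using dtau_scale[OF subsetD[OF J_Cs 0], of 0] by simp
      then show "0 \<in> dtau M A ` J 0" using 0 by (metis imageI)
      fix x y assume "x \<in> dtau M A ` J 0" "y \<in> dtau M A ` J 0"
      then obtain a b where ab: "a \<in> J 0" "b \<in> J 0" "x = dtau M A a" "y = dtau M A b" by blast
      then have "x + y = dtau M A (a + b)" using dtau_add[OF subsetD[OF J_Cs ab(1)] subsetD[OF J_Cs ab(2)]] by simp
      then show "x + y \<in> dtau M A ` J 0" using real_vector.subspace_add[OF subspace_J ab(1,2)] by blast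
    next
      fix k x assume "x \<in> dtau M A ` J 0"
      then obtain a where ab: "a \<in> J 0" "x = dtau M A a" by blast
      then have "k *\<^sub>R x = dtau M A (k *\<^sub>R a)" using dtau_scale[OF subsetD[OF J_Cs ab(1)]] by simp
      then show "k *\<^sub>R x \<in> dtau M A ` J 0" using real_vector.subspace_scale[OF subspace_J ab(1)] by blast
    qed
  qed
  have dS: "dtau M A w \<in> supp_ends (idx M)" for w using restr_Vsp sV unfolding dtau_dt by blast
  \<comment> \<open>the first change, projecting the normal derivative\<close>
  have "\<exists>y\<in>dtau M A ` J 0. \<forall>z\<in>dtau M A ` J 0. ipe (idx M) (dtau M A u - y) z = 0"
    by (rule orthogonal_projection[OF fD _ subspace_supp_ends sym_bilinear_ipe ipe_pos[OF finite_idx] dS])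
       (use dS in auto)
  then obtain j where j: "j \<in> J 0" "\<And>z. z \<in> J 0 \<Longrightarrow> ipe (idx M) (dtau M A u - dtau M A j) (dtau M A z) = 0" by blast
  define u1 where "u1 = u + (-1) *\<^sub>R j"
  note u1 = sub[OF u j(1), folded u1_def]
  have jC: "j \<in> Cs (idx M)" "(-1) *\<^sub>R j \<in> Cs (idx M)"
    using j(1) J_Cs real_vector.subspace_scale[OF subspace_Cs] by blast+
  have "dtau M A u1 = dtau M A u - dtau M A j"
    unfolding u1_def dtau_add[OF u(1) jC(2)] dtau_scale[OF jC(1)] by simp
  then have d1: "ip M (dtau M A z) (dtau M A u1) = 0" if "z \<in> J 0" for z
    using j(2)[OF that] ip_linear(3)[of M "dtau M A z" "dtau M A u1"] by (simp add: ip_ipe)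
  have I0: "I0 d M A \<subseteq> J 0" "subspace (I0 d M A)"
  proof -
    show IJ: "I0 d M A \<subseteq> J 0" unfolding I0_def J0_eq by blast
    show "subspace (I0 d M A)"
      unfolding real_vector.subspace_def
    proof (intro conjI ballI allI)
      have 0: "0 \<in> J 0" using subspace_J by (rule real_vector.subspace_0)
      have "dtau M A 0 = 0" using dtau_scale[OF subsetD[OF J_Cs 0], of 0] by simp
      then show "0 \<in> I0 d M A" using 0 unfolding I0_def J0_eq by blast
      fix x y assume xy: "x \<in> I0 d M A" "y \<in> I0 d M A"
      then have m: "x \<in> J 0" "y \<in> J 0" using IJ by auto
      have "dtau M A (x + y) = 0"
        using dtau_add[OF subsetD[OF J_Cs m(1)] subsetD[OF J_Cs m(2)]] xy unfolding I0_def by simp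
      then show "x + y \<in> I0 d M A" using real_vector.subspace_add[OF subspace_J m] unfolding I0_def J0_eq by blast
    next
      fix k x assume x: "x \<in> I0 d M A"
      then have m: "x \<in> J 0" using IJ by auto
      have "dtau M A (k *\<^sub>R x) = 0" using dtau_scale[OF subsetD[OF J_Cs m]] x unfolding I0_def by simp
      then show "k *\<^sub>R x \<in> I0 d M A" using real_vector.subspace_scale[OF subspace_J m] unfolding I0_def J0_eq by blast
    qed
  qed
  \<comment> \<open>the second change, by an element of \<open>I0\<close>\<close>
  have "\<exists>y\<in>I0 d M A. \<forall>z\<in>I0 d M A. mass (idx M) c (u1 - y) z = 0"
  proof (rule orthogonal_projection[OF findim_subset[OF fJ I0(2,1)] _ subspace_Cs mass_sym_bilinear mass_pos])
    show "I0 d M A \<subseteq> Cs (idx M)" using I0(1) J_Cs by blast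
    then show "\<And>y. y \<in> I0 d M A \<Longrightarrow> y \<in> Cs (idx M)" by blast
  qed (use u1 in auto)
  then obtain y where y: "y \<in> I0 d M A" "\<And>z. z \<in> I0 d M A \<Longrightarrow> mass (idx M) c (u1 - y) z = 0" by blast
  define u2 where "u2 = u1 + (-1) *\<^sub>R y"
  have yJ: "y \<in> J 0" using y(1) I0(1) by blast
  have yC: "y \<in> Cs (idx M)" "(-1) *\<^sub>R y \<in> Cs (idx M)"
    using yJ J_Cs real_vector.subspace_scale[OF subspace_Cs] by blast+
  have u2: "u2 \<in> Cs (idx M) \<and> eigen_eq (idx M) c d 0 u2 \<and> bd (idx M) u2 - g \<in> VM \<and>
      (\<forall>v\<in>VM. ipe (idx M) (dt (idx M) c u2) v = 0)"
    unfolding u2_def by (rule sub) (use u1 yJ in auto)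
  have u1C: "u1 \<in> Cs (idx M)" using u1 by blast
  have "dtau M A u2 = dtau M A u1"
    unfolding u2_def dtau_add[OF u1C yC(2)] dtau_scale[OF yC(1)] using y(1) unfolding I0_def by simp
  then have "dtau M A u2 \<in> DJ_perp d M A"
    using d1 restr_Vsp[of M A] by (intro DJ_perpI) (auto simp: dtau_dt)
  moreover have "mass (idx M) c u2 z = 0" if "z \<in> I0 d M A" for z
    using y(2)[OF that] unfolding u2_def by simp
  ultimately show ?thesis using u2 unfolding is_L_ext_iff[OF gV] by blast
qed

lemma L_ext:
  assumes "g \<in> DJ_perp d M A"
  shows "is_L_ext d M A g (L_ext d M A g)"
proof -
  obtain u where u: "is_L_ext d M A g u" using L_ext_exists[OF assms] by blast
  have "w = u" if "is_L_ext d M A g w" for w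
    by (rule L_ext_unique[OF subsetD[OF DJ_perp_Vsp assms] that u])
  then show ?thesis unfolding L_ext_def by (rule theI[of "is_L_ext d M A g", OF u])
qed

lemma L_ext_props:
  assumes "g \<in> DJ_perp d M A"
  shows "L_ext d M A g \<in> Cs (idx M)" "eigen_eq (idx M) c d 0 (L_ext d M A g)"
    "bd (idx M) (L_ext d M A g) - g \<in> VM"
    "\<And>v. v \<in> VM \<Longrightarrow> ipe (idx M) (dt (idx M) c (L_ext d M A g)) v = 0"
  using L_ext[OF assms] unfolding is_L_ext_iff[OF subsetD[OF DJ_perp_Vsp assms]] by blast+

lemma L_ext_add:
  assumes g: "g \<in> DJ_perp d M A" and h: "h \<in> DJ_perp d M A"
  shows "L_ext d M A (g + h) = L_ext d M A g + L_ext d M A h"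
proof -
  have gh: "g + h \<in> DJ_perp d M A" using real_vector.subspace_add[OF subspace_DJ_perp g h] .
  let ?u = "L_ext d M A g" and ?w = "L_ext d M A h"
  note V = subsetD[OF DJ_perp_Vsp]
  note u = L_ext[OF g, unfolded is_L_ext_iff[OF V[OF g]]] and w = L_ext[OF h, unfolded is_L_ext_iff[OF V[OF h]]]
  have uC: "?u \<in> Cs (idx M)" and wC: "?w \<in> Cs (idx M)" using u w by blast+
  have "is_L_ext d M A (g + h) (?u + ?w)"
    unfolding is_L_ext_iff[OF V[OF gh]]
  proof (intro conjI ballI)
    show "?u + ?w \<in> Cs (idx M)" using real_vector.subspace_add[OF subspace_Cs uC wC] .
    show "eigen_eq (idx M) c d 0 (?u + ?w)" using u w by (intro eigen_eq_add) auto
    have "bd (idx M) (?u + ?w) - (g + h) = (bd (idx M) ?u - g) + (bd (idx M) ?w - h)"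
      unfolding bd_linear by simp
    also have "\<dots> \<in> VM" using u w subspace_V1 by (intro real_vector.subspace_add) auto
    finally show "bd (idx M) (?u + ?w) - (g + h) \<in> VM" .
    show "ipe (idx M) (dt (idx M) c (?u + ?w)) v = 0" if "v \<in> VM" for v
      unfolding dt_add[OF uC wC] ipe_linear(1) using u w that by simp
    show "mass (idx M) c (?u + ?w) v = 0" if "v \<in> I0 d M A" for v
    proof -
      have "v \<in> Cs (idx M)" using that J_Cs unfolding I0_def J0_eq by blast
      then show ?thesis using sym_bilinear_onD(2)[OF mass_sym_bilinear uC wC] u w that by simp
    qed
    show "dtau M A (?u + ?w) \<in> DJ_perp d M A"
      unfolding dtau_add[OF uC wC] using u w subspace_DJ_perp by (intro real_vector.subspace_add) auto
  qed
  then show ?thesis using L_ext_unique[OF V[OF gh] L_ext[OF gh]] by blast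
qed

lemma L_ext_scale:
  assumes g: "g \<in> DJ_perp d M A"
  shows "L_ext d M A (k *\<^sub>R g) = k *\<^sub>R L_ext d M A g"
proof -
  have kg: "k *\<^sub>R g \<in> DJ_perp d M A" using real_vector.subspace_scale[OF subspace_DJ_perp g] .
  let ?u = "L_ext d M A g"
  note V = subsetD[OF DJ_perp_Vsp]
  note u = L_ext[OF g, unfolded is_L_ext_iff[OF V[OF g]]]
  have uC: "?u \<in> Cs (idx M)" using u by blast
  have "is_L_ext d M A (k *\<^sub>R g) (k *\<^sub>R ?u)"
    unfolding is_L_ext_iff[OF V[OF kg]]
  proof (intro conjI ballI)
    show "k *\<^sub>R ?u \<in> Cs (idx M)" using real_vector.subspace_scale[OF subspace_Cs uC] .
    show "eigen_eq (idx M) c d 0 (k *\<^sub>R ?u)" using u by (intro eigen_eq_scale) auto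
    have "bd (idx M) (k *\<^sub>R ?u) - k *\<^sub>R g = k *\<^sub>R (bd (idx M) ?u - g)"
      unfolding bd_linear by (simp add: scaleR_diff_right)
    also have "\<dots> \<in> VM" using u subspace_V1 by (intro real_vector.subspace_scale) auto
    finally show "bd (idx M) (k *\<^sub>R ?u) - k *\<^sub>R g \<in> VM" .
    show "ipe (idx M) (dt (idx M) c (k *\<^sub>R ?u)) v = 0" if "v \<in> VM" for v
      unfolding dt_scale[OF uC] ipe_linear(2) using u that by simp
    show "mass (idx M) c (k *\<^sub>R ?u) v = 0" if "v \<in> I0 d M A" for v
    proof -
      have "v \<in> Cs (idx M)" using that J_Cs unfolding I0_def J0_eq by blast
      then show ?thesis using sym_bilinear_onD(3)[OF mass_sym_bilinear uC] u that by simp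
    qed
    show "dtau M A (k *\<^sub>R ?u) \<in> DJ_perp d M A"
      unfolding dtau_scale[OF uC] using u subspace_DJ_perp by (intro real_vector.subspace_scale) auto
  qed
  then show ?thesis using L_ext_unique[OF V[OF kg] L_ext[OF kg]] by blast
qed

end

section \<open>Partitions\<close>

context
  fixes I I' :: "'i set" and u :: "'i \<Rightarrow> real \<Rightarrow> real"
  assumes sub: "I' \<subseteq> I" and u: "u \<in> Cs I'"
begin

lemma Cs_off: "i \<notin> I' \<Longrightarrow> u i = (\<lambda>t. 0)"
  using CsD(2)[OF u] by auto

lemma Cs_extend: "u \<in> Cs I"
proof -
  have "smooth01 (u i)" if "i \<in> I" for i
    using CsD(1)[OF u, of i] Cs_off[of i] smooth01_const[of 0] by (cases "i \<in> I'") auto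
  moreover have "u i t = 0" if "\<not> (i \<in> I \<and> t \<in> {0..1})" for i t
    using CsD(2)[OF u, of i t] that sub by blast
  ultimately show ?thesis unfolding Cs_def by blast
qed

lemma bd_extend: "bd I u = bd I' u"
  using sub Cs_off by (auto simp: bd_def fun_eq_iff)

lemma dt_extend: "dt I c u = dt I' c u"
proof
  fix e :: "'i \<times> real"
  obtain i t where e: "e = (i, t)" by (cases e)
  show "dt I c u e = dt I' c u e"
  proof (cases "i \<in> I' \<or> t \<notin> {0, 1}")
    case True
    then show ?thesis using sub by (auto simp: e dt_def)
  next
    case False
    then have "deriv01 (u i) t = 0" using Cs_off[of i] deriv01_zero[of t] by auto
    then show ?thesis using False by (simp add: e dt_def)
  qed
qed

lemma eigen_eq_extend: "eigen_eq I' c d l u \<Longrightarrow> eigen_eq I c d l u"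
  unfolding eigen_eq_def
proof (intro ballI)
  fix i t assume *: "\<forall>i\<in>I'. \<forall>t\<in>{0..1}. deriv01 (deriv01 (u i)) t = - (c i)\<^sup>2 * (d i t + l) * u i t"
    and t: "t \<in> {0..1::real}"
  show "deriv01 (deriv01 (u i)) t = - (c i)\<^sup>2 * (d i t + l) * u i t"
  proof (cases "i \<in> I'")
    case False
    then have "deriv01 (deriv01 (u i)) t = deriv01 (\<lambda>s. 0) t"
      using t by (intro deriv01_cong) (auto simp: Cs_off deriv01_zero)
    then show ?thesis using deriv01_zero[OF t] Cs_off[OF False] by simp
  qed (use * t in blast)
qed

lemma energy_extend:
  assumes "finite I"
  shows "energy I c d u v = energy I' c d u v"
  unfolding energy_def
proof (rule sum.mono_neutral_right[OF assms sub], rule ballI)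
  fix i assume i: "i \<in> I - I'"
  have "integral {0..1} (\<lambda>t. deriv01 (u i) t * deriv01 (v i) t / c i - c i * d i t * u i t * v i t) =
    integral {0..1} (\<lambda>t::real. 0 :: real)"
    using i by (intro integral_cong) (simp add: Cs_off deriv01_zero)
  then show "integral {0..1} (\<lambda>t. deriv01 (u i) t * deriv01 (v i) t / c i - c i * d i t * u i t * v i t) = 0" by simp
qed

end

lemma energy_disjoint:
  assumes "u \<in> Cs I" "v \<in> Cs I'" "I \<inter> I' = {}"
  shows "energy I c d u v = 0"
  unfolding energy_def
proof (rule sum.neutral, rule ballI)
  fix i assume "i \<in> I"
  then have "i \<notin> I'" using assms(3) by blast
  then have v: "v i = (\<lambda>t. 0)" using CsD(2)[OF assms(2)] by auto
  have "integral {0..1} (\<lambda>t. deriv01 (u i) t * deriv01 (v i) t / c i - c i * d i t * u i t * v i t) =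
    integral {0..1} (\<lambda>t::real. 0 :: real)"
    by (intro integral_cong) (simp add: v deriv01_zero)
  then show "integral {0..1} (\<lambda>t. deriv01 (u i) t * deriv01 (v i) t / c i - c i * d i t * u i t * v i t) = 0" by simp
qed

text \<open>
  The data of a partition. On functions supported on one part, the energy and the boundary data do
  not depend on whether they are computed in the part or in the whole network, so all spaces are
  realised inside the function space of the whole network.
\<close>

locale network_partition =
  fixes N :: "'i network" and Ns :: "nat \<Rightarrow> 'i network" and l :: nat
    and Po Pb :: "(real^3) set" and Qt Qb :: "nat \<Rightarrow> (real^3) set"
    and d :: "'i \<Rightarrow> real \<Rightarrow> real"
  assumes net: "is_network N" and d_C_inf: "d \<in> C_inf N"
    and part: "is_partition N l Ns Po Pb Qt Qb"
begin

abbreviation "K \<equiv> {1..l}"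

definition c :: "'i \<Rightarrow> real"
  where "c i = norm (deriv01 (crv N i) 0)"

lemma partD:
  shows "\<And>k. k \<in> K \<Longrightarrow> is_network (Ns k)"
    and "idx N = (\<Union>k\<in>K. idx (Ns k))"
    and "\<And>j k. j \<in> K \<Longrightarrow> k \<in> K \<Longrightarrow> j \<noteq> k \<Longrightarrow> idx (Ns j) \<inter> idx (Ns k) = {}"
    and "\<And>k i t. k \<in> K \<Longrightarrow> i \<in> idx (Ns k) \<Longrightarrow> t \<in> {0..1} \<Longrightarrow> crv (Ns k) i t = crv N i t"
    and "\<And>k i t. k \<in> K \<Longrightarrow> i \<in> idx (Ns k) \<Longrightarrow> t \<in> {0..1} \<Longrightarrow> nrm (Ns k) i t = nrm N i t"
    and "intp N = Po \<union> Pb" "Po \<inter> Pb = {}"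
    and "\<And>k. k \<in> K \<Longrightarrow> bdp (Ns k) = Qt k \<union> Qb k"
    and "Po = (\<Union>k\<in>K. intp (Ns k))"
    and "\<And>j k. j \<in> K \<Longrightarrow> k \<in> K \<Longrightarrow> j \<noteq> k \<Longrightarrow> intp (Ns j) \<inter> intp (Ns k) = {}"
    and "Pb = (\<Union>k\<in>K. Qt k)" "bdp N = (\<Union>k\<in>K. Qb k)"
proof -
  note p = part[unfolded is_partition_def disjoint_family_on_def]
  have q: "\<forall>k\<in>K. is_network (Ns k)"
    "\<forall>j\<in>K. \<forall>k\<in>K. j \<noteq> k \<longrightarrow> idx (Ns j) \<inter> idx (Ns k) = {}"
    "\<forall>k\<in>K. \<forall>i\<in>idx (Ns k). \<forall>t\<in>{0..1}. crv (Ns k) i t = crv N i t \<and> nrm (Ns k) i t = nrm N i t"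
    "\<forall>k\<in>K. bdp (Ns k) = Qt k \<union> Qb k \<and> Qt k \<inter> Qb k = {}"
    "\<forall>j\<in>K. \<forall>k\<in>K. j \<noteq> k \<longrightarrow> intp (Ns j) \<inter> intp (Ns k) = {}"
    using p by - (elim conjE; assumption)+
  show "idx N = (\<Union>k\<in>K. idx (Ns k))" "intp N = Po \<union> Pb" "Po \<inter> Pb = {}"
    "Po = (\<Union>k\<in>K. intp (Ns k))" "Pb = (\<Union>k\<in>K. Qt k)" "bdp N = (\<Union>k\<in>K. Qb k)"
    using p by - (elim conjE; assumption)+
  show "is_network (Ns k)" if "k \<in> K" for k using q(1) that by blast
  show "idx (Ns j) \<inter> idx (Ns k) = {}" if "j \<in> K" "k \<in> K" "j \<noteq> k" for j k using q(2) that by blast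
  show "crv (Ns k) i t = crv N i t" if "k \<in> K" "i \<in> idx (Ns k)" "t \<in> {0..1}" for k i t
    using q(3) that by blast
  show "nrm (Ns k) i t = nrm N i t" if "k \<in> K" "i \<in> idx (Ns k)" "t \<in> {0..1}" for k i t
    using q(3) that by blast
  show "bdp (Ns k) = Qt k \<union> Qb k" if "k \<in> K" for k using q(4) that by blast
  show "intp (Ns j) \<inter> intp (Ns k) = {}" if "j \<in> K" "k \<in> K" "j \<noteq> k" for j k using q(5) that by blast
qed

lemma speed_N:
  assumes "i \<in> idx N"
  shows "t \<in> {0..1} \<Longrightarrow> norm (deriv01 (crv N i) t) = c i" "c i > 0"
proof -
  have cv: "is_curve (crv N i)" using net assms unfolding is_network_def by simp
  then obtain k where "\<forall>t\<in>{0..1}. norm (deriv01 (crv N i) t) = k" unfolding is_curve_def by blast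
  then have k: "norm (deriv01 (crv N i) t) = k" if "t \<in> {0..1}" for t using that by blast
  then have ck: "c i = k" unfolding c_def by simp
  then show "t \<in> {0..1} \<Longrightarrow> norm (deriv01 (crv N i) t) = c i" using k by simp
  have "\<forall>t\<in>{0..1}. deriv01 (crv N i) t \<noteq> 0" using cv unfolding is_curve_def by blast
  then have "deriv01 (crv N i) 0 \<noteq> 0" by simp
  then show "c i > 0" unfolding c_def by simp
qed

sublocale N: network_graph N c d
proof
  show "smooth01 (d i)" if "i \<in> idx N" for i using d_C_inf that unfolding C_inf_def by blast
qed (use net speed_N in auto)

lemma idx_sub: "k \<in> K \<Longrightarrow> idx (Ns k) \<subseteq> idx N"
  using partD(2) by blast

lemma cut: "k \<in> K \<Longrightarrow> network_cut (Ns k) c d (Qt k)"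
proof
  assume k: "k \<in> K"
  show "is_network (Ns k)" using partD(1)[OF k] .
  fix i assume i: "i \<in> idx (Ns k)"
  then have iN: "i \<in> idx N" using idx_sub[OF k] by blast
  show "norm (deriv01 (crv (Ns k) i) t) = c i" if "t \<in> {0..1}" for t
    using deriv01_cong[of "crv (Ns k) i" "crv N i" t] partD(4)[OF k i] speed_N(1)[OF iN that] that by simp
  show "c i > 0" using speed_N(2)[OF iN] .
  show "smooth01 (d i)" using d_C_inf iN unfolding C_inf_def by blast
qed (use partD(8) in auto)

lemma ends_sub: "k \<in> K \<Longrightarrow> ends (Ns k) \<subseteq> ends N"
  using idx_sub unfolding ends_def by auto

lemma ends_cover: "e \<in> ends N \<Longrightarrow> \<exists>k\<in>K. e \<in> ends (Ns k)"
  using partD(2) unfolding ends_def by auto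

lemma ends_unique: "e \<in> ends (Ns j) \<Longrightarrow> e \<in> ends (Ns k) \<Longrightarrow> j \<in> K \<Longrightarrow> k \<in> K \<Longrightarrow> j = k"
  using partD(3)[of j k] unfolding ends_def by auto

lemma endpt_eq: "k \<in> K \<Longrightarrow> e \<in> ends (Ns k) \<Longrightarrow> endpt (Ns k) e = endpt N e"
  using partD(4)[of k "fst e" "snd e"] unfolding ends_def endpt_def by auto

lemma endpt_cases:
  assumes "k \<in> K" "e \<in> ends (Ns k)"
  shows "endpt N e \<in> intp (Ns k) \<or> endpt N e \<in> Qt k \<or> endpt N e \<in> Qb k"
proof -
  interpret S: network_cut "Ns k" c d "Qt k" using cut[OF assms(1)] .
  have "endpt (Ns k) e \<in> intp (Ns k) \<union> bdp (Ns k)" using S.endpoints(2) assms(2) by blast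
  then show ?thesis using partD(8)[OF assms(1)] endpt_eq[OF assms] by auto
qed

text \<open>
  An interior endpoint of a part lies in \<open>Po\<close>, so it is neither a cut point nor a
  boundary endpoint of the network. All ends there belong to parts for which it is an interior
  endpoint, and there is only one such part.
\<close>

lemma ends_at_intp_point:
  assumes k: "k \<in> K" and p: "p \<in> intp (Ns k)"
  shows "ends_at (Ns k) {p} = ends_at N {p}"
proof
  show "ends_at (Ns k) {p} \<subseteq> ends_at N {p}"
    using ends_sub[OF k] endpt_eq[OF k] unfolding ends_at_def by auto
  show "ends_at N {p} \<subseteq> ends_at (Ns k) {p}"
  proof
    fix e assume "e \<in> ends_at N {p}"
    then have e: "e \<in> ends N" "endpt N e = p" unfolding ends_at_def by auto
    obtain j where j: "j \<in> K" "e \<in> ends (Ns j)" using ends_cover[OF e(1)] by blast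
    have pPo: "p \<in> Po" using partD(9) k p by blast
    have "p \<notin> Qt j" using pPo partD(7,11) j(1) by blast
    moreover have "p \<notin> Qb j" using pPo partD(6,12) j(1) N.endpoints(1) by blast
    ultimately have "p \<in> intp (Ns j)" using endpt_cases[OF j] e(2) by blast
    then have "j = k" using partD(10)[OF j(1) k] p by blast
    then show "e \<in> ends_at (Ns k) {p}" using j e(2) endpt_eq[OF j] unfolding ends_at_def by auto
  qed
qed

lemma ends_at_intp:
  assumes k: "k \<in> K"
  shows "ends_at (Ns k) (intp (Ns k)) = ends_at N (intp (Ns k))"
proof -
  have "ends_at M A = (\<Union>p\<in>A. ends_at M {p})" for M :: "'i network" and A unfolding ends_at_def by auto
  then show ?thesis using ends_at_intp_point[OF k] by (metis (no_types, lifting) SUP_cong)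
qed

lemma ends_at_Qt:
  assumes k: "k \<in> K"
  shows "ends_at (Ns k) (Qt k) = ends (Ns k) \<inter> ends_at N Pb"
proof
  show "ends_at (Ns k) (Qt k) \<subseteq> ends (Ns k) \<inter> ends_at N Pb"
    using ends_sub[OF k] endpt_eq[OF k] partD(11) k unfolding ends_at_def by auto
  show "ends (Ns k) \<inter> ends_at N Pb \<subseteq> ends_at (Ns k) (Qt k)"
  proof
    fix e assume "e \<in> ends (Ns k) \<inter> ends_at N Pb"
    then have e: "e \<in> ends (Ns k)" "endpt N e \<in> Pb" unfolding ends_at_def by auto
    have "endpt N e \<notin> intp (Ns k)" using partD(7,9) k e(2) by blast
    moreover have "endpt N e \<notin> Qb k" using partD(6,12) k e(2) N.endpoints(1) by blast
    ultimately show "e \<in> ends_at (Ns k) (Qt k)"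
      using endpt_cases[OF k e(1)] e(1) endpt_eq[OF k e(1)] unfolding ends_at_def by auto
  qed
qed

lemma V1_eq:
  assumes k: "k \<in> K"
  shows "V1 (Ns k) (intp (Ns k)) = V1 N (intp (Ns k))"
proof -
  have r: "restr (Ns k) {p} = restr N {p}" if "p \<in> intp (Ns k)" for p
    unfolding restr_def ends_at_intp_point[OF k that] ..
  have "V1_at (Ns k) p = V1_at N p" if p: "p \<in> intp (Ns k)" for p
  proof -
    have "restr N {p} (\<lambda>(i, t). X \<bullet> nrm (Ns k) i t) = restr N {p} (\<lambda>(i, t). X \<bullet> nrm N i t)" for X
    proof
      fix e :: "'i \<times> real"
      obtain i t where e: "e = (i, t)" by (cases e)
      show "restr N {p} (\<lambda>(i, t). X \<bullet> nrm (Ns k) i t) e = restr N {p} (\<lambda>(i, t). X \<bullet> nrm N i t) e"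
      proof (cases "e \<in> ends_at N {p}")
        case True
        then have "e \<in> ends (Ns k)" using ends_at_intp_point[OF k p] ends_at_sub by blast
        then have "i \<in> idx (Ns k)" "t \<in> {0..1}" unfolding e ends_def by auto
        then show ?thesis using partD(5)[OF k] by (simp add: restr_def e)
      qed (simp add: restr_def)
    qed
    then show ?thesis unfolding V1_at_def r[OF p] by simp
  qed
  moreover have "Vsp (Ns k) (intp (Ns k)) = Vsp N (intp (Ns k))"
    unfolding Vsp_def ends_at_intp[OF k] ..
  ultimately show ?thesis using r unfolding V1_def by auto
qed

lemma intp_Po: "k \<in> K \<Longrightarrow> intp (Ns k) \<subseteq> Po"
  using partD(9) by blast

lemma Po_intp: "Po \<subseteq> intp N" and Pb_intp: "Pb \<subseteq> intp N"
  using partD(6) by blast+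

lemma V1_sub: "k \<in> K \<Longrightarrow> V1 (Ns k) (intp (Ns k)) \<subseteq> V1 N Po"
  using V1_eq V1_mono intp_Po by metis

lemma Po_Pb_zero: "x \<in> Vsp N Po \<Longrightarrow> restr N Pb x = 0"
  using partD(7) unfolding restr_def Vsp_def ends_at_def by (auto simp: fun_eq_iff)

text \<open>
  In Green's formula only the ends of the part contribute. At its interior endpoints the natural
  vertex condition makes the contribution vanish, and at the boundary endpoints of the whole network
  the function \<open>w\<close> vanishes. The cut points remain.
\<close>

lemma pairing:
  assumes k: "k \<in> K" and u: "u \<in> Cs (idx (Ns k))" and eq: "eigen_eq (idx (Ns k)) c d 0 u"
    and orth: "\<And>v. v \<in> V1 (Ns k) (intp (Ns k)) \<Longrightarrow> ipe (idx (Ns k)) (dt (idx (Ns k)) c u) v = 0"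
    and w: "w \<in> N.H"
  shows "energy (idx N) c d u w = ip N (dtau (Ns k) (Qt k) u) (bd (idx N) w)"
proof -
  interpret S: network_cut "Ns k" c d "Qt k" using cut[OF k] .
  note sub = idx_sub[OF k]
  define \<delta> where "\<delta> = dt (idx (Ns k)) c u"
  define x where "x = bd (idx N) w"
  have wC: "w \<in> Cs (idx N)" and x: "x \<in> V1 N (intp N)" using w unfolding N.H_def x_def by auto
  have "energy (idx N) c d u w = ipe (idx N) (dt (idx N) c u) x"
    using N.green[OF Cs_extend[OF sub u] wC eigen_eq_extend[OF sub u eq]] unfolding x_def by simp
  also have "\<dots> = ip N \<delta> x" unfolding dt_extend[OF sub u] \<delta>_def ip_ipe ..
  also have "\<dots> = ip N \<delta> (restr N (intp (Ns k)) x) + ip N (restr (Ns k) (Qt k) \<delta>) x"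
    unfolding ip_def sum.distrib[symmetric]
  proof (rule sum.cong[OF refl])
    fix e
    consider "e \<in> ends (Ns k)" "endpt N e \<in> intp (Ns k)" | "e \<in> ends (Ns k)" "endpt N e \<in> Qt k"
      | "e \<in> ends (Ns k)" "endpt N e \<in> Qb k" | "e \<notin> ends (Ns k)"
      using endpt_cases[OF k, of e] by blast
    then show "\<delta> e * x e = \<delta> e * restr N (intp (Ns k)) x e + restr (Ns k) (Qt k) \<delta> e * x e"
    proof cases
      case 1
      then have "e \<in> ends_at (Ns k) (intp (Ns k))" unfolding ends_at_def using endpt_eq[OF k] by auto
      moreover then have "e \<notin> ends_at (Ns k) (Qt k)" using S.ends_disjoint[OF S.A_intp] by blast
      ultimately show ?thesis by (simp add: restr_def ends_at_intp[OF k])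
    next
      case 2
      then have "e \<in> ends_at (Ns k) (Qt k)" unfolding ends_at_def using endpt_eq[OF k] by auto
      moreover then have "e \<notin> ends_at (Ns k) (intp (Ns k))" using S.ends_disjoint[OF S.A_intp] by blast
      ultimately show ?thesis by (simp add: restr_def ends_at_intp[OF k, symmetric])
    next
      case 3
      then have "endpt N e \<in> bdp N" using partD(12) k by blast
      then have "e \<notin> ends_at N (intp N)" using N.endpoints(1) unfolding ends_at_def by blast
      then have "x e = 0" using x V1_Vsp unfolding Vsp_def by blast
      then show ?thesis by (simp add: restr_def)
    next
      case 4
      then have "\<delta> e = 0" unfolding \<delta>_def by (intro S.supp_zero dt_supp)
      then show ?thesis by (simp add: restr_def)
    qed
  qed
  also have "ip N \<delta> (restr N (intp (Ns k)) x) = 0"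
  proof -
    let ?v = "restr N (intp (Ns k)) x"
    have "?v \<in> V1 (Ns k) (intp (Ns k))"
      unfolding V1_eq[OF k] by (rule restr_V1[OF x]) (use intp_Po[OF k] Po_intp in blast)
    then have "ip (Ns k) \<delta> ?v = 0" unfolding \<delta>_def ip_ipe by (rule orth)
    moreover have "ip N \<delta> ?v = ip (Ns k) \<delta> ?v"
      unfolding ip_def using N.finite_ends ends_sub[OF k] S.supp_zero[OF dt_supp] unfolding \<delta>_def
      by (intro sum.mono_neutral_right) auto
    ultimately show ?thesis by simp
  qed
  finally show ?thesis unfolding S.dtau_dt \<delta>_def x_def by simp
qed

text \<open>
  On \<open>U\<close> the \<open>L\<close>-extensions of the components to the parts exist;
  \<open>ext\<close> combines them into one function on the network. Its boundary values at the cut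
  points are \<open>g\<close>, hence satisfy the vertex condition there, whereas its normal
  derivatives in general do not.
\<close>

abbreviation "U \<equiv> V1_bar d N l Ns Pb Qt"

lemma U_D:
  assumes "g \<in> U"
  shows "g \<in> V1 N Pb" "g \<in> Vsp N Pb" "\<And>k. k \<in> K \<Longrightarrow> restr (Ns k) (Qt k) g \<in> DJ_perp d (Ns k) (Qt k)"
  using assms unfolding V1_bar_def DJ_perp_sum_def by auto

lemma U_I:
  assumes "g \<in> V1 N Pb" "\<And>k. k \<in> K \<Longrightarrow> restr (Ns k) (Qt k) g \<in> DJ_perp d (Ns k) (Qt k)"
  shows "g \<in> U"
  using assms V1_Vsp unfolding V1_bar_def DJ_perp_sum_def by blast

lemma subspace_U: "subspace U"
proof -
  have s: "subspace (DJ_perp d (Ns k) (Qt k))" if "k \<in> K" for k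
    using network_cut.subspace_DJ_perp[OF cut[OF that]] .
  show ?thesis
    unfolding real_vector.subspace_def
  proof (intro conjI ballI allI)
    show "0 \<in> U" using s subspace_V1[of N Pb]
      by (intro U_I) (auto simp: restr_linear real_vector.subspace_0)
    show "x + y \<in> U" if "x \<in> U" "y \<in> U" for x y
      using s subspace_V1[of N Pb] U_D[OF that(1)] U_D[OF that(2)]
      by (intro U_I) (auto simp: restr_linear real_vector.subspace_add)
    show "a *\<^sub>R x \<in> U" if "x \<in> U" for a x
      using s subspace_V1[of N Pb] U_D[OF that]
      by (intro U_I) (auto simp: restr_linear real_vector.subspace_scale)
  qed
qed

lemma Vsp_supp: "Vsp N A \<subseteq> supp_ends (idx N)"
  unfolding Vsp_def supp_ends_def ends_at_def ends_def by blast

lemma U_supp: "U \<subseteq> supp_ends (idx N)"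
  using U_D(2) Vsp_supp by blast

lemma findim_U: "findim U"
  by (rule findim_subset[OF findim_supp_ends[OF N.finite_idx] subspace_U U_supp])

definition part_ext :: "nat \<Rightarrow> ('i \<times> real \<Rightarrow> real) \<Rightarrow> 'i \<Rightarrow> real \<Rightarrow> real"
  where "part_ext k g = L_ext d (Ns k) (Qt k) (restr (Ns k) (Qt k) g)"

definition ext :: "('i \<times> real \<Rightarrow> real) \<Rightarrow> 'i \<Rightarrow> real \<Rightarrow> real"
  where "ext g = (\<Sum>k\<in>K. part_ext k g)"

lemma ext_add: "g \<in> U \<Longrightarrow> h \<in> U \<Longrightarrow> ext (g + h) = ext g + ext h"
  unfolding ext_def sum.distrib[symmetric] part_ext_def
  using network_cut.L_ext_add[OF cut] U_D(3) by (intro sum.cong) (auto simp: restr_linear)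

lemma ext_scale: "g \<in> U \<Longrightarrow> ext (a *\<^sub>R g) = a *\<^sub>R ext g"
  unfolding ext_def scaleR_sum_right part_ext_def
  using network_cut.L_ext_scale[OF cut] U_D(3) by (intro sum.cong) (auto simp: restr_linear)

lemma part_ext_props:
  assumes "g \<in> U" "k \<in> K"
  shows "part_ext k g \<in> Cs (idx (Ns k))" "eigen_eq (idx (Ns k)) c d 0 (part_ext k g)"
    "bd (idx (Ns k)) (part_ext k g) - restr (Ns k) (Qt k) g \<in> V1 (Ns k) (intp (Ns k))"
    "\<And>v. v \<in> V1 (Ns k) (intp (Ns k)) \<Longrightarrow> ipe (idx (Ns k)) (dt (idx (Ns k)) c (part_ext k g)) v = 0"
  using network_cut.L_ext_props[OF cut[OF assms(2)] U_D(3)[OF assms]] unfolding part_ext_def by blast+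

lemma part_ext_Cs: "g \<in> U \<Longrightarrow> k \<in> K \<Longrightarrow> part_ext k g \<in> Cs (idx N)"
  using Cs_extend[OF idx_sub part_ext_props(1)] by blast

lemma ext_Cs: "g \<in> U \<Longrightarrow> ext g \<in> Cs (idx N)"
  unfolding ext_def using part_ext_Cs by (intro real_vector.subspace_sum[OF subspace_Cs])

lemma bd_sum: "bd I (\<Sum>k\<in>A. f k) = (\<Sum>k\<in>A. bd I (f k))"
  by (induction A rule: infinite_finite_induct)
     (simp_all only: sum.insert sum.infinite sum.empty bd_linear bd_zero simp_thms not_False_eq_True)

lemma Vsp_Pb_split:
  assumes "g \<in> Vsp N Pb"
  shows "(\<Sum>k\<in>K. restr (Ns k) (Qt k) g) = g"
proof
  fix e
  have "(\<Sum>k\<in>K. restr (Ns k) (Qt k) g e) = g e"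
  proof (cases "e \<in> ends_at N Pb")
    case True
    then obtain k where k: "k \<in> K" "e \<in> ends (Ns k)" using ends_cover ends_at_sub by blast
    have "restr (Ns j) (Qt j) g e = (if j = k then g e else 0)" if "j \<in> K" for j
    proof (cases "j = k")
      case True
      then show ?thesis using \<open>e \<in> ends_at N Pb\<close> k unfolding restr_def ends_at_Qt[OF that] by simp
    next
      case False
      then have "e \<notin> ends (Ns j)" using ends_unique[OF _ k(2) that k(1)] by blast
      then show ?thesis using False unfolding restr_def ends_at_Qt[OF that] by simp
    qed
    then have "(\<Sum>j\<in>K. restr (Ns j) (Qt j) g e) = (\<Sum>j\<in>K. if j = k then g e else 0)" by (intro sum.cong) auto
    then show ?thesis using k(1) by simp
  next
    case False
    then have g: "g e = 0" using assms unfolding Vsp_def by blast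
    then have "restr (Ns k) (Qt k) g e = 0" for k by (simp add: restr_def)
    then show ?thesis using g by simp
  qed
  then show "(\<Sum>k\<in>K. restr (Ns k) (Qt k) g) e = g e" by (simp add: sum_fun_apply)
qed

lemma bd_ext:
  assumes g: "g \<in> U"
  shows "bd (idx N) (ext g) - g \<in> V1 N Po"
proof -
  have "bd (idx N) (ext g) - g =
      (\<Sum>k\<in>K. bd (idx N) (part_ext k g)) - (\<Sum>k\<in>K. restr (Ns k) (Qt k) g)"
    unfolding ext_def bd_sum Vsp_Pb_split[OF U_D(2)[OF g]] ..
  also have "\<dots> = (\<Sum>k\<in>K. bd (idx N) (part_ext k g) - restr (Ns k) (Qt k) g)" by (rule sum_subtractf[symmetric])
  also have "\<dots> \<in> V1 N Po"
  proof (rule real_vector.subspace_sum[OF subspace_V1])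
    fix k assume k: "k \<in> K"
    show "bd (idx N) (part_ext k g) - restr (Ns k) (Qt k) g \<in> V1 N Po"
      using part_ext_props(3)[OF g k] V1_sub[OF k] bd_extend[OF idx_sub[OF k] part_ext_props(1)[OF g k]] by auto
  qed
  finally show ?thesis .
qed

lemma restr_bd_ext: "g \<in> U \<Longrightarrow> restr N Pb (bd (idx N) (ext g)) = g"
proof -
  assume g: "g \<in> U"
  have "bd (idx N) (ext g) - g \<in> Vsp N Po" using bd_ext[OF g] V1_Vsp by blast
  from Po_Pb_zero[OF this] show ?thesis
    unfolding restr_diff using restr_id[OF U_D(2)[OF g]] by simp
qed

lemma ext_H: "g \<in> U \<Longrightarrow> ext g \<in> N.H"
proof -
  assume g: "g \<in> U"
  have "bd (idx N) (ext g) - g \<in> V1 N (intp N)" using bd_ext[OF g] V1_mono[OF Po_intp] by blast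
  moreover have "g \<in> V1 N (intp N)" using U_D(1)[OF g] V1_mono[OF Pb_intp] by blast
  ultimately have "(bd (idx N) (ext g) - g) + g \<in> V1 N (intp N)"
    by (rule real_vector.subspace_add[OF subspace_V1])
  then show ?thesis using ext_Cs[OF g] unfolding N.H_def by simp
qed

lemma T_hat_eq: "T_hat d l Ns Qt g = (\<Sum>k\<in>K. dtau (Ns k) (Qt k) (part_ext k g))"
  unfolding T_hat_def DN_def part_ext_def ..

lemma dtau_Vsp: "k \<in> K \<Longrightarrow> dtau (Ns k) (Qt k) u \<in> Vsp N Pb"
proof -
  assume k: "k \<in> K"
  have "dtau (Ns k) (Qt k) u \<in> Vsp (Ns k) (Qt k)" unfolding dtau_def by (rule restr_Vsp)
  then show ?thesis using ends_at_Qt[OF k] unfolding Vsp_def by blast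
qed

lemma T_hat_Vsp: "T_hat d l Ns Qt g \<in> Vsp N Pb"
  unfolding T_hat_eq using dtau_Vsp by (intro real_vector.subspace_sum[OF subspace_Vsp])

lemma ip_sum: "ip N (\<Sum>k\<in>A. f k) x = (\<Sum>k\<in>A. ip N (f k) x)"
proof (induction A rule: infinite_finite_induct)
  case (insert a A)
  then show ?case by (simp only: sum.insert ip_linear(1) simp_thms not_False_eq_True)
qed (simp_all only: sum.infinite sum.empty ip_ipe ipe_zero simp_thms not_False_eq_True)

lemma energy_ext:
  assumes g: "g \<in> U" and w: "w \<in> N.H"
  shows "energy (idx N) c d (ext g) w = ip N (T_hat d l Ns Qt g) (bd (idx N) w)"
proof -
  have wC: "w \<in> Cs (idx N)" using w N.H_Cs by blast
  have "energy (idx N) c d (\<Sum>k\<in>K. 1 *\<^sub>R part_ext k g) w = (\<Sum>k\<in>K. 1 * energy (idx N) c d (part_ext k g) w)"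
    using sym_bilinear_sum(1)[OF N.energy_sym_bilinear subspace_Cs, of K "\<lambda>k. part_ext k g" w "\<lambda>k. 1"]
      part_ext_Cs[OF g] wC by blast
  then have "energy (idx N) c d (ext g) w = (\<Sum>k\<in>K. energy (idx N) c d (part_ext k g) w)" unfolding ext_def by simp
  also have "\<dots> = (\<Sum>k\<in>K. ip N (dtau (Ns k) (Qt k) (part_ext k g)) (bd (idx N) w))"
  proof (rule sum.cong[OF refl])
    fix k assume k: "k \<in> K"
    note e = part_ext_props[OF g k]
    show "energy (idx N) c d (part_ext k g) w = ip N (dtau (Ns k) (Qt k) (part_ext k g)) (bd (idx N) w)"
      by (rule pairing[OF k e(1,2,4) w])
  qed
  finally show ?thesis unfolding T_hat_eq ip_sum .
qed

lemma T_bar_props: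
  shows "T_bar d N l Ns Pb Qt g \<in> U"
    and "v \<in> U \<Longrightarrow> ip N (T_bar d N l Ns Pb Qt g) v = ip N (T_hat d l Ns Qt g) v"
proof -
  let ?x = "T_hat d l Ns Qt g"
  have xS: "?x \<in> supp_ends (idx N)" using T_hat_Vsp Vsp_supp by blast
  have "\<exists>y\<in>U. \<forall>z\<in>U. ipe (idx N) (?x - y) z = 0"
    by (rule orthogonal_projection[OF findim_U U_supp subspace_supp_ends sym_bilinear_ipe
        ipe_pos[OF N.finite_idx subsetD[OF U_supp]] xS])
  then obtain y where y: "y \<in> U" "\<And>z. z \<in> U \<Longrightarrow> ip N (?x - y) z = 0" unfolding ip_ipe by blast
  have diff: "ip N (a - b) z = ip N a z - ip N b z" for a b z
    unfolding ip_def by (simp add: algebra_simps sum_subtractf)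
  have "h = y" if h: "h \<in> U \<and> (\<forall>z\<in>U. ip N (?x - h) z = 0)" for h
  proof -
    have m: "y - h \<in> U" using y(1) h subspace_U real_vector.subspace_diff by blast
    have "ip N (y - h) (y - h) = 0"
      using y(2)[OF m] h m diff[of ?x y "y - h"] diff[of ?x h "y - h"] diff[of y h "y - h"] by simp
    then have "y - h = 0" using ipe_pos[OF N.finite_idx subsetD[OF U_supp m]] by (force simp: ip_ipe)
    then show ?thesis by simp
  qed
  then have eq: "T_bar d N l Ns Pb Qt g = y"
    unfolding T_bar_def orth_proj_def using y by (intro the_equality) auto
  show "T_bar d N l Ns Pb Qt g \<in> U" unfolding eq using y(1) .
  show "ip N (T_bar d N l Ns Pb Qt g) v = ip N ?x v" if "v \<in> U"
    unfolding eq using y(2)[OF that] diff[of ?x y v] by simp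
qed

text \<open>
  By \<open>pairing\<close> the energy of two extensions is the product of the normal derivatives
  \<open>T_hat g\<close> with the values \<open>h\<close> at the cut points; replacing
  \<open>T_hat g\<close> by its projection to \<open>U\<close> does not change the product with
  \<open>h \<in> U\<close>.
\<close>

lemma energy_ext_ext:
  assumes g: "g \<in> U" and h: "h \<in> U"
  shows "energy (idx N) c d (ext g) (ext h) = ip N (T_bar d N l Ns Pb Qt g) h"
proof -
  have "energy (idx N) c d (ext g) (ext h) = ip N (T_hat d l Ns Qt g) (bd (idx N) (ext h))"
    by (rule energy_ext[OF g ext_H[OF h]])
  also have "\<dots> = ip N (restr N Pb (T_hat d l Ns Qt g)) (bd (idx N) (ext h))"
    using restr_id[OF T_hat_Vsp] by simp
  also have "\<dots> = ip N (T_hat d l Ns Qt g) h" unfolding ip_restr restr_bd_ext[OF h] ..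
  finally show ?thesis using T_bar_props(2)[OF h] by simp
qed

lemma max_nonpos_dim_U:
  "max_nonpos_dim U (\<lambda>g h. ip N (T_bar d N l Ns Pb Qt g) h)
    (map_Ind U (T_bar d N l Ns Pb Qt) + map_Nul U (T_bar d N l Ns Pb Qt))"
proof (rule self_adjoint_index[OF findim_U])
  show "sym_bilinear_on U (ip N)" unfolding ip_ipe by (rule sym_bilinear_ipe)
  show "0 < ip N x x" if "x \<in> U" "x \<noteq> 0" for x
    unfolding ip_ipe using ipe_pos[OF N.finite_idx subsetD[OF U_supp that(1)] that(2)] .
  show "T_bar d N l Ns Pb Qt x \<in> U" for x by (rule T_bar_props(1))
  show "ip N (T_bar d N l Ns Pb Qt g) h = ip N g (T_bar d N l Ns Pb Qt h)" if "g \<in> U" "h \<in> U" for g h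
    using energy_ext_ext[OF that] energy_ext_ext[OF that(2,1)]
      sym_bilinear_onD(1)[OF N.energy_sym_bilinear ext_Cs[OF that(1)] ext_Cs[OF that(2)]]
      ip_linear(3)[of N g] by simp
qed

definition H0 :: "('i \<Rightarrow> real \<Rightarrow> real) set"
  where "H0 = span (\<Union>k\<in>K. C01_inf (Ns k))"

lemma C01_part:
  assumes k: "k \<in> K" and u: "u \<in> C01_inf (Ns k)"
  shows "u \<in> Cs (idx (Ns k))" "u \<in> N.H" "restr N Pb (bd (idx N) u) = 0"
proof -
  interpret S: network_cut "Ns k" c d "Qt k" using cut[OF k] .
  show uC: "u \<in> Cs (idx (Ns k))" using u S.H_Cs unfolding S.C01_H by blast
  have b: "bd (idx N) u \<in> V1 N Po"
    unfolding bd_extend[OF idx_sub[OF k] uC] using u V1_sub[OF k] unfolding S.C01_H S.H_def by blast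
  then show "u \<in> N.H"
    using Cs_extend[OF idx_sub[OF k] uC] V1_mono[OF Po_intp, of N] unfolding N.H_def by blast
  show "restr N Pb (bd (idx N) u) = 0" using b V1_Vsp by (intro Po_Pb_zero) blast
qed

lemma H0_sub: "H0 \<subseteq> N.H"
  unfolding H0_def using C01_part(2) by (intro real_vector.span_minimal[OF _ N.subspace_H]) blast

lemma H0_zero: "v \<in> H0 \<Longrightarrow> restr N Pb (bd (idx N) v) = 0"
proof -
  assume v: "v \<in> H0"
  have "subspace {v. restr N Pb (bd (idx N) v) = 0}"
    unfolding real_vector.subspace_def by (auto simp: bd_linear bd_zero restr_linear)
  then have "H0 \<subseteq> {v. restr N Pb (bd (idx N) v) = 0}"
    unfolding H0_def using C01_part(3) by (intro real_vector.span_minimal) blast+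
  then show ?thesis using v by blast
qed

lemma energy_N: "sym_bilinear_on N.H (energy (idx N) c d)"
  by (rule sym_bilinear_on_subset[OF N.energy_sym_bilinear N.H_Cs])

text \<open>
  Functions supported on different parts are orthogonal for the energy, so the contributions of the
  parts add.
\<close>

lemma max_nonpos_dim_H0:
  "max_nonpos_dim H0 (energy (idx N) c d) (\<Sum>k\<in>K. Ind d (Ns k) + Nul d (Ns k))"
  unfolding H0_def
proof (rule max_nonpos_dim_sum[OF energy_N N.subspace_H])
  show "finite K" by simp
  fix k assume k: "k \<in> K"
  interpret S: network_cut "Ns k" c d "Qt k" using cut[OF k] .
  show "subspace (C01_inf (Ns k))" unfolding S.C01_H by (rule S.subspace_H)
  show "C01_inf (Ns k) \<subseteq> N.H" using C01_part(2)[OF k] by blast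
  have "max_nonpos_dim (C01_inf (Ns k)) (energy (idx N) c d) n \<longleftrightarrow>
      max_nonpos_dim (C01_inf (Ns k)) (energy (idx (Ns k)) c d) n" for n
    using energy_extend[OF idx_sub[OF k] C01_part(1)[OF k] N.finite_idx]
    by (intro max_nonpos_dim_cong) auto
  then show "max_nonpos_dim (C01_inf (Ns k)) (energy (idx N) c d) (Ind d (Ns k) + Nul d (Ns k))"
    using S.index_network by simp
next
  fix j k u v assume *: "j \<in> K" "k \<in> K" "j \<noteq> k" "u \<in> C01_inf (Ns j)" "v \<in> C01_inf (Ns k)"
  show "energy (idx N) c d u v = 0"
    unfolding energy_extend[OF idx_sub[OF *(1)] C01_part(1)[OF *(1,4)] N.finite_idx]
    by (rule energy_disjoint[OF C01_part(1)[OF *(1,4)] C01_part(1)[OF *(2,5)] partD(3)[OF *(1-3)]])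
next
  fix F k assume F: "F \<subseteq> K" and k: "k \<in> K" "k \<notin> F"
  have "span (\<Union>j\<in>F. C01_inf (Ns j)) \<subseteq> {u. \<forall>i\<in>idx (Ns k). u i = 0}"
  proof (rule real_vector.span_minimal)
    show "subspace {u :: 'i \<Rightarrow> real \<Rightarrow> real. \<forall>i\<in>idx (Ns k). u i = 0}"
      unfolding real_vector.subspace_def by (auto simp: scaleR_fun_def fun_eq_iff)
    show "(\<Union>j\<in>F. C01_inf (Ns j)) \<subseteq> {u. \<forall>i\<in>idx (Ns k). u i = 0}"
    proof
      fix u assume "u \<in> (\<Union>j\<in>F. C01_inf (Ns j))"
      then obtain j where j: "j \<in> F" "u \<in> C01_inf (Ns j)" by blast
      have jK: "j \<in> K" "j \<noteq> k" using j F k by auto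
      have "u i = 0" if "i \<in> idx (Ns k)" for i
        using Cs_off[OF order_refl C01_part(1)[OF jK(1) j(2)], of i] partD(3)[OF jK(1) k(1) jK(2)] that
        by (auto simp: fun_eq_iff)
      then show "u \<in> {u. \<forall>i\<in>idx (Ns k). u i = 0}" by blast
    qed
  qed
  moreover have "u = 0" if "u \<in> C01_inf (Ns k)" "\<forall>i\<in>idx (Ns k). u i = 0" for u
  proof
    fix i
    show "u i = 0 i"
      using that(2) Cs_off[OF order_refl C01_part(1)[OF k(1) that(1)], of i]
      by (cases "i \<in> idx (Ns k)") (auto simp: fun_eq_iff)
  qed
  ultimately show "C01_inf (Ns k) \<inter> span (\<Union>j\<in>F. C01_inf (Ns j)) \<subseteq> {0}" by blast
qed

definition J0 :: "('i \<Rightarrow> real \<Rightarrow> real) set"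
  where "J0 = span (\<Union>k\<in>K. Jsp d (Ns k) 0)"

lemma J0_H0: "J0 \<subseteq> H0"
  unfolding J0_def H0_def Jsp_def by (intro real_vector.span_mono) blast

lemma findim_J0: "findim J0"
proof -
  have "findim (Jsp d (Ns k) 0)" if k: "k \<in> K" for k
  proof -
    interpret S: network_cut "Ns k" c d "Qt k" using cut[OF k] .
    show ?thesis unfolding S.J0_eq by (rule S.findim_J) simp
  qed
  then have "\<forall>k\<in>K. \<exists>S. finite S \<and> Jsp d (Ns k) 0 \<subseteq> span S" unfolding findim_def by blast
  from bchoice[OF this] obtain S where S: "\<forall>k\<in>K. finite (S k) \<and> Jsp d (Ns k) 0 \<subseteq> span (S k)" ..
  have "span (S k) \<subseteq> span (\<Union>k\<in>K. S k)" if "k \<in> K" for k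
    using that by (intro real_vector.span_mono) auto
  then have "(\<Union>k\<in>K. Jsp d (Ns k) 0) \<subseteq> span (\<Union>k\<in>K. S k)" using S by blast
  then have "J0 \<subseteq> span (\<Union>k\<in>K. S k)"
    unfolding J0_def by (rule real_vector.span_minimal[OF _ real_vector.subspace_span])
  moreover have "finite (\<Union>k\<in>K. S k)" using S by auto
  ultimately show ?thesis unfolding findim_def J0_def using real_vector.subspace_span by blast
qed

lemma J_pairing:
  assumes k: "k \<in> K" and j: "j \<in> Jsp d (Ns k) 0" and w: "w \<in> N.H"
  shows "energy (idx N) c d j w = ip N (dtau (Ns k) (Qt k) j) (bd (idx N) w)"
proof -
  interpret S: network_cut "Ns k" c d "Qt k" using cut[OF k] .
  have jJ: "j \<in> S.J 0" using j unfolding S.J0_eq .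
  show ?thesis
    by (rule pairing[OF k _ _ _ w]) (use jJ S.J_Cs in \<open>auto simp: S.J_def\<close>)
qed

lemma zero_pairing:
  assumes k: "k \<in> K" and w: "restr N Pb x = 0"
  shows "ip N (dtau (Ns k) (Qt k) u) x = 0"
proof -
  have "ip N (dtau (Ns k) (Qt k) u) x = ip N (restr N Pb (dtau (Ns k) (Qt k) u)) x"
    using restr_id[OF dtau_Vsp[OF k]] by simp
  also have "\<dots> = 0" unfolding ip_restr w by (simp add: ip_def)
  finally show ?thesis .
qed

lemma J0_orth:
  assumes w: "w \<in> N.H" and z: "\<And>k j. k \<in> K \<Longrightarrow> j \<in> Jsp d (Ns k) 0 \<Longrightarrow> energy (idx N) c d j w = 0"
    and j: "j \<in> J0"
  shows "energy (idx N) c d w j = 0"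
proof -
  have "subspace {j \<in> N.H. energy (idx N) c d w j = 0}"
    unfolding real_vector.subspace_def
    using N.subspace_H w sym_bilinear_right[OF energy_N N.subspace_H]
    by (auto simp: real_vector.subspace_0 real_vector.subspace_add real_vector.subspace_scale)
  moreover have "(\<Union>k\<in>K. Jsp d (Ns k) 0) \<subseteq> {j \<in> N.H. energy (idx N) c d w j = 0}"
  proof
    fix j assume "j \<in> (\<Union>k\<in>K. Jsp d (Ns k) 0)"
    then obtain k where k: "k \<in> K" "j \<in> Jsp d (Ns k) 0" by blast
    have jH: "j \<in> N.H" using k C01_part(2) unfolding Jsp_def by blast
    then show "j \<in> {j \<in> N.H. energy (idx N) c d w j = 0}"
      using z[OF k] sym_bilinear_onD(1)[OF energy_N w jH] by simp
  qed
  ultimately have "J0 \<subseteq> {j \<in> N.H. energy (idx N) c d w j = 0}"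
    unfolding J0_def by (intro real_vector.span_minimal)
  then show ?thesis using j by blast
qed

lemma H0_J0:
  assumes "v \<in> H0" "j \<in> J0"
  shows "energy (idx N) c d v j = 0"
proof (rule J0_orth[OF _ _ assms(2)])
  show v: "v \<in> N.H" using assms(1) H0_sub by blast
  fix k j assume "k \<in> K" "j \<in> Jsp d (Ns k) 0"
  then show "energy (idx N) c d j v = 0"
    using J_pairing[OF _ _ v] zero_pairing[OF _ H0_zero[OF assms(1)]] by simp
qed

lemma ext_H0:
  assumes g: "g \<in> U" and v: "v \<in> H0"
  shows "energy (idx N) c d (ext g) v = 0"
proof -
  have "energy (idx N) c d (ext g) v = (\<Sum>k\<in>K. ip N (dtau (Ns k) (Qt k) (part_ext k g)) (bd (idx N) v))"
    using energy_ext[OF g] v H0_sub unfolding T_hat_eq ip_sum by blast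
  also have "\<dots> = 0" using zero_pairing[OF _ H0_zero[OF v]] by (intro sum.neutral) blast
  finally show ?thesis .
qed

text \<open>
  A function vanishing at the cut points is the sum of its restrictions \<open>vk k\<close> to the
  parts, each of which satisfies the vertex conditions of its part and vanishes at the boundary
  endpoints of the part.
\<close>

lemma zero_at_cut_H0:
  assumes v: "v \<in> N.H" and z: "restr N Pb (bd (idx N) v) = 0"
  shows "v \<in> H0"
proof -
  define vk where "vk k = (\<lambda>i t. if i \<in> idx (Ns k) then v i t else 0)" for k
  have vC: "v \<in> Cs (idx N)" and vV: "bd (idx N) v \<in> V1 N (intp N)" using v unfolding N.H_def by auto
  have "vk k \<in> C01_inf (Ns k)" if k: "k \<in> K" for k
  proof -
    interpret S: network_cut "Ns k" c d "Qt k" using cut[OF k] .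
    have "smooth01 (vk k i)" if "i \<in> idx (Ns k)" for i
      using CsD(1)[OF vC, of i] that idx_sub[OF k] unfolding vk_def by auto
    moreover have "vk k i t = 0" if "\<not> (i \<in> idx (Ns k) \<and> t \<in> {0..1})" for i t
      using CsD(2)[OF vC, of i t] that unfolding vk_def by auto
    ultimately have C: "vk k \<in> Cs (idx (Ns k))" unfolding Cs_def by blast
    have "bd (idx (Ns k)) (vk k) e = restr N (intp (Ns k)) (bd (idx N) v) e" for e
    proof (cases "e \<in> ends (Ns k)")
      case False
      then have "e \<notin> ends_at N (intp (Ns k))" using ends_at_intp[OF k] ends_at_sub by blast
      then show ?thesis using S.supp_zero[OF bd_supp False] by (simp add: restr_def)
    next
      case True
      obtain i t where e: "e = (i, t)" by (cases e)
      have it: "i \<in> idx (Ns k)" "t \<in> {0, 1}" "i \<in> idx N" using True idx_sub[OF k] unfolding e ends_def by auto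
      have eq: "bd (idx (Ns k)) (vk k) e = bd (idx N) v e" using it by (simp add: e bd_def vk_def)
      consider "endpt N e \<in> intp (Ns k)" | "endpt N e \<in> Qt k" | "endpt N e \<in> Qb k"
        using endpt_cases[OF k True] by blast
      then show ?thesis
      proof cases
        case 1
        then have "e \<in> ends_at N (intp (Ns k))" using True ends_sub[OF k] unfolding ends_at_def by auto
        then show ?thesis using eq by (simp add: restr_def)
      next
        case 2
        then have "endpt N e \<in> Pb" using partD(11) k by blast
        then have p: "e \<in> ends_at N Pb" using True ends_sub[OF k] unfolding ends_at_def by auto
        have "restr N Pb (bd (idx N) v) e = 0" using z by simp
        then have "bd (idx N) v e = 0" using p by (simp add: restr_def)
        then show ?thesis using eq by (simp add: restr_def)
      next
        case 3
        then have "endpt N e \<in> bdp N" using partD(12) k by blast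
        then have "e \<notin> ends_at N (intp N)" using N.endpoints(1) unfolding ends_at_def by blast
        then have "bd (idx N) v e = 0" using vV V1_Vsp unfolding Vsp_def by blast
        then show ?thesis using eq by (simp add: restr_def)
      qed
    qed
    then have "bd (idx (Ns k)) (vk k) = restr N (intp (Ns k)) (bd (idx N) v)" by (rule ext)
    also have "\<dots> \<in> V1 (Ns k) (intp (Ns k))"
      unfolding V1_eq[OF k] by (rule restr_V1[OF vV]) (use intp_Po[OF k] Po_intp in blast)
    finally show ?thesis unfolding S.C01_H S.H_def using C by blast
  qed
  then have "(\<Sum>k\<in>K. vk k) \<in> H0"
    unfolding H0_def by (intro real_vector.span_sum real_vector.span_base) blast
  moreover have "(\<Sum>k\<in>K. vk k) = v"
  proof (intro ext)
    fix i t
    have "(\<Sum>k\<in>A. vk k) i t = (\<Sum>k\<in>A. vk k i t)" for A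
      by (induction A rule: infinite_finite_induct) auto
    then have "(\<Sum>k\<in>K. vk k) i t = (\<Sum>k\<in>K. vk k i t)" .
    also have "\<dots> = v i t"
    proof (cases "i \<in> idx N")
      case True
      then obtain k where k: "k \<in> K" "i \<in> idx (Ns k)" using partD(2) by blast
      have "vk j i t = (if j = k then v i t else 0)" if "j \<in> K" for j
        using k partD(3)[OF that k(1)] unfolding vk_def by auto
      then have "(\<Sum>j\<in>K. vk j i t) = (\<Sum>j\<in>K. if j = k then v i t else 0)" by (intro sum.cong) auto
      then show ?thesis using k(1) by simp
    next
      case False
      then have "vk k i t = 0" if "k \<in> K" for k using idx_sub[OF that] unfolding vk_def by auto
      then show ?thesis using CsD(2)[OF vC, of i t] False by simp
    qed
    finally show "(\<Sum>k\<in>K. vk k) i t = v i t" .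
  qed
  ultimately show ?thesis by simp
qed

lemma subspace_ext_U: "subspace (ext ` U)"
  unfolding real_vector.subspace_def
proof (intro conjI ballI allI)
  have 0: "0 \<in> U" using subspace_U by (rule real_vector.subspace_0)
  have "ext 0 = 0" using ext_scale[OF 0, of 0] by simp
  then show "0 \<in> ext ` U" using 0 by (metis imageI)
  fix x y assume "x \<in> ext ` U" "y \<in> ext ` U"
  then obtain g h where gh: "g \<in> U" "h \<in> U" "x = ext g" "y = ext h" by blast
  then have "x + y = ext (g + h)" using ext_add by simp
  then show "x + y \<in> ext ` U" using real_vector.subspace_add[OF subspace_U gh(1,2)] by blast
next
  fix a x assume "x \<in> ext ` U"
  then obtain g where g: "g \<in> U" "x = ext g" by blast
  then have "a *\<^sub>R x = ext (a *\<^sub>R g)" using ext_scale by simp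
  then show "a *\<^sub>R x \<in> ext ` U" using real_vector.subspace_scale[OF subspace_U g(1)] by blast
qed

lemma ext_0: "g \<in> U \<Longrightarrow> restr N Pb (bd (idx N) (ext g)) = 0 \<Longrightarrow> g = 0"
  using restr_bd_ext by simp

text \<open>
  By \<open>pairing\<close>, orthogonality of \<open>w\<close> to the kernel functions says that the
  values \<open>g\<close> of \<open>w\<close> at the cut points are orthogonal to all normal
  derivatives of kernel functions, that is, \<open>g \<in> U\<close>. Subtracting the extension of
  \<open>g\<close> leaves a function that vanishes at the cut points.
\<close>

lemma J0_perp: "{w \<in> N.H. \<forall>j\<in>J0. energy (idx N) c d w j = 0} = span (H0 \<union> ext ` U)"
proof
  show "{w \<in> N.H. \<forall>j\<in>J0. energy (idx N) c d w j = 0} \<subseteq> span (H0 \<union> ext ` U)"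
  proof
    fix w assume "w \<in> {w \<in> N.H. \<forall>j\<in>J0. energy (idx N) c d w j = 0}"
    then have w: "w \<in> N.H" "\<And>j. j \<in> J0 \<Longrightarrow> energy (idx N) c d w j = 0" by auto
    define x where "x = bd (idx N) w"
    define g where "g = restr N Pb x"
    have x: "x \<in> V1 N (intp N)" using w(1) unfolding N.H_def x_def by blast
    have gU: "g \<in> U"
    proof (rule U_I)
      show "g \<in> V1 N Pb" unfolding g_def by (rule restr_V1[OF x Pb_intp])
      fix k assume k: "k \<in> K"
      interpret S: network_cut "Ns k" c d "Qt k" using cut[OF k] .
      show "restr (Ns k) (Qt k) g \<in> DJ_perp d (Ns k) (Qt k)"
      proof (rule S.DJ_perpI[OF restr_Vsp])
        fix j assume "j \<in> S.J 0"
        then have j: "j \<in> Jsp d (Ns k) 0" unfolding S.J0_eq .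
        have jJ: "j \<in> J0" unfolding J0_def using j k by (intro real_vector.span_base) blast
        have jH: "j \<in> N.H" using jJ J0_H0 H0_sub by blast
        have "ip N (dtau (Ns k) (Qt k) j) x = 0"
          using J_pairing[OF k j w(1)] w(2)[OF jJ] sym_bilinear_onD(1)[OF energy_N w(1) jH] unfolding x_def by simp
        moreover have "ip (Ns k) (dtau (Ns k) (Qt k) j) (restr (Ns k) (Qt k) g) = ip N (dtau (Ns k) (Qt k) j) x"
          unfolding ip_def
        proof (rule sum.mono_neutral_cong_left[OF N.finite_ends ends_sub[OF k]])
          show "\<forall>e\<in>ends N - ends (Ns k). dtau (Ns k) (Qt k) j e * x e = 0"
            using ends_at_sub unfolding dtau_def restr_def by fastforce
          show "dtau (Ns k) (Qt k) j e * restr (Ns k) (Qt k) g e = dtau (Ns k) (Qt k) j e * x e" for e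
            using ends_at_Qt[OF k] unfolding dtau_def g_def by (auto simp: restr_def)
        qed
        ultimately show "ip (Ns k) (dtau (Ns k) (Qt k) j) (restr (Ns k) (Qt k) g) = 0" by simp
      qed
    qed
    have m: "(-1) *\<^sub>R ext g \<in> N.H" using ext_H[OF gU] N.subspace_H real_vector.subspace_scale by blast
    have "w + (-1) *\<^sub>R ext g \<in> H0"
    proof (rule zero_at_cut_H0)
      show "w + (-1) *\<^sub>R ext g \<in> N.H" using real_vector.subspace_add[OF N.subspace_H w(1) m] .
      have gx: "restr N Pb (bd (idx N) w) = g" unfolding g_def x_def ..
      have "restr N Pb (bd (idx N) (w + (-1) *\<^sub>R ext g)) = g + (-1) *\<^sub>R g"
        unfolding bd_linear restr_linear restr_bd_ext[OF gU] gx ..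
      then show "restr N Pb (bd (idx N) (w + (-1) *\<^sub>R ext g)) = 0" by simp
    qed
    then have "(w + (-1) *\<^sub>R ext g) + ext g \<in> span (H0 \<union> ext ` U)"
      using gU by (intro real_vector.span_add real_vector.span_base) auto
    then show "w \<in> span (H0 \<union> ext ` U)" by simp
  qed
  show "span (H0 \<union> ext ` U) \<subseteq> {w \<in> N.H. \<forall>j\<in>J0. energy (idx N) c d w j = 0}"
  proof (rule real_vector.span_minimal)
    show "H0 \<union> ext ` U \<subseteq> {w \<in> N.H. \<forall>j\<in>J0. energy (idx N) c d w j = 0}"
      using H0_sub H0_J0 ext_H ext_H0 J0_H0 by blast
    have "j \<in> N.H" if "j \<in> J0" for j using that J0_H0 H0_sub by blast
    then show "subspace {w \<in> N.H. \<forall>j\<in>J0. energy (idx N) c d w j = 0}"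
      unfolding real_vector.subspace_def
      using N.subspace_H sym_bilinear_right(3)[OF energy_N N.subspace_H] sym_bilinear_onD(2,3)[OF energy_N]
      by (auto simp: real_vector.subspace_0 real_vector.subspace_add real_vector.subspace_scale)
  qed
qed

text \<open>
  \<open>J0\<close> is isotropic, so it may be replaced by its complement, where the energy splits
  orthogonally into the energy of the parts and the form of \<open>T_bar\<close>.
\<close>

theorem index_formula:
  "Ind d N + Nul d N = (\<Sum>k\<in>K. Ind d (Ns k) + Nul d (Ns k)) +
    (map_Ind U (T_bar d N l Ns Pb Qt) + map_Nul U (T_bar d N l Ns Pb Qt))"
proof (rule max_nonpos_dim_unique)
  show "max_nonpos_dim N.H (energy (idx N) c d) (Ind d N + Nul d N)"
    by (rule N.index_network[unfolded N.C01_H])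
  have sH0: "subspace H0" unfolding H0_def by (rule real_vector.subspace_span)
  have inj: "g = 0" if "g \<in> U" "ext g = 0" for g
    using ext_0[OF that(1)] that(2) by (simp add: bd_zero restr_linear)
  have extU: "max_nonpos_dim (ext ` U) (energy (idx N) c d)
      (map_Ind U (T_bar d N l Ns Pb Qt) + map_Nul U (T_bar d N l Ns Pb Qt))"
  proof -
    have diag: "ip N (T_bar d N l Ns Pb Qt g) g = energy (idx N) c d (ext g) (ext g)" if "g \<in> U" for g
      using energy_ext_ext[OF that that] by simp
    show ?thesis
      by (rule max_nonpos_dim_image[where u = ext and \<tau> = "\<lambda>g h. ip N (T_bar d N l Ns Pb Qt g) h"
            and Q = "energy (idx N) c d", OF subspace_U ext_add ext_scale inj diag max_nonpos_dim_U])
  qed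
  have sub: "ext ` U \<subseteq> N.H" using ext_H by blast
  have orth: "energy (idx N) c d x y = 0" if "x \<in> H0" "y \<in> ext ` U" for x y
    using that ext_H0 sym_bilinear_onD(1)[OF energy_N] H0_sub sub by force
  have int: "H0 \<inter> ext ` U \<subseteq> {0}"
  proof
    fix x assume "x \<in> H0 \<inter> ext ` U"
    then obtain g where g: "g \<in> U" "x = ext g" "x \<in> H0" by blast
    then have "g = 0" using ext_0 H0_zero by blast
    then show "x \<in> {0}" using g(1,2) ext_scale[of g 0] by simp
  qed
  have "max_nonpos_dim {w \<in> N.H. \<forall>j\<in>J0. energy (idx N) c d w j = 0} (energy (idx N) c d)
    ((\<Sum>k\<in>K. Ind d (Ns k) + Nul d (Ns k)) +
      (map_Ind U (T_bar d N l Ns Pb Qt) + map_Nul U (T_bar d N l Ns Pb Qt)))"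
    unfolding J0_perp
    by (rule max_nonpos_dim_orthogonal_sum[OF energy_N N.subspace_H sH0 H0_sub subspace_ext_U sub orth int
        max_nonpos_dim_H0 extU])
  then show "max_nonpos_dim N.H (energy (idx N) c d)
    ((\<Sum>k\<in>K. Ind d (Ns k) + Nul d (Ns k)) +
      (map_Ind U (T_bar d N l Ns Pb Qt) + map_Nul U (T_bar d N l Ns Pb Qt)))"
  proof (rule max_nonpos_dim_isotropic_complement[OF energy_N N.subspace_H findim_J0, rotated 2])
    show "J0 \<subseteq> N.H" using J0_H0 H0_sub by blast
    show "energy (idx N) c d x y = 0" if "x \<in> J0" "y \<in> J0" for x y
      using H0_J0 that J0_H0 by blast
  qed
qed

end

theorem corollary4p11:
  fixes N :: "'i network" and Ns :: "nat \<Rightarrow> 'i network" and l :: nat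
    and Po Pb :: "(real^3) set" and Qt Qb :: "nat \<Rightarrow> (real^3) set"
    and d :: "'i \<Rightarrow> real \<Rightarrow> real"
  assumes "is_network N"
    and "d \<in> C_inf N"
    and "is_partition N l Ns Po Pb Qt Qb"
  shows "Ind d N + Nul d N =
    (\<Sum>i = 1..l. Ind d (Ns i) + Nul d (Ns i)) +
    map_Ind (V1_bar d N l Ns Pb Qt) (T_bar d N l Ns Pb Qt) +
    map_Nul (V1_bar d N l Ns Pb Qt) (T_bar d N l Ns Pb Qt)"
proof -
  interpret network_partition N Ns l Po Pb Qt Qb d using assms by unfold_locales
  show ?thesis using index_formula by simp
qed

end
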